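(* Let $\pi:Q\to M=Q/G$ be a right principal $G$-bundle equipped with a horizontal distribution $\mathrm{H}Q\subset \mathrm{T}Q$ (not necessarily $G$-invariant) and a smooth Lagrangian $L:\mathrm{T}Q\to\mathbb{R}$ (not necessarily $G$-invariant), i.e. a (non-invariant) Chaplygin system. With the notation of the context: (a) A nonholonomic extremal $\widetilde X(t)\in \mathrm{H}_{q(t)}Q$ is an unconstrained extremal if and only if $$\Big\langle \mathrm{H}L(\widetilde X(t))-\frac{\mathrm{d}}{\mathrm{d}t}\mathrm{F}L(\widetilde X(t)),\,b\Big\rangle+\Big\langle \mathrm{F}L(\widetilde X(t)),\mathcal{B}(q(t))(X(t),b)\Big\rangle=0$$ for every $t\in[t_0,t_1]$ and every $b\in\mathfrak{g}$. (b) A nonholonomic extremal $\widetilde X(t)\in \mathrm{H}_{q(t)}Q$ is a vakonomic extremal if and only if $$\int_I\big\langle \mathrm{H}L(\widetilde X(t)),b(t)\big\rangle\,\mathrm{d}t=\int_I\big\langle \mathrm{F}L(\widetilde X(t)),\mathcal{R}(q(t))(X(t),Y(t))\big\rangle\,\mathrm{d}t$$ for each pair of curves $\widetilde Y(t)\in \mathrm{H}_{q(t)}Q$ and $b(t)\in\mathfrak{g}$ vanishing at the end-points $t_0,t_1$ and related by $$\dot b(t)+\mathcal{B}(q(t))(X(t),b(t))+\mathcal{R}(q(t))(X(t),Y(t))=0 .$$ (c) Let $\widetilde X(t)\in \mathrm{H}_{q(t)}Q$ be a vakonomic extremal which is a solution of the unconstrained problem with the modified Lagrangian $\widetilde L(Z,t)=L(Z)-\langle\lambda(t),\omega(Z)\rangle$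 for some multiplier $\lambda:I\to\mathfrak{g}^*$. Then $\widetilde X(t)$ is a nonholonomic extremal if and only if $$\big\langle\lambda(t),\mathcal{R}(q(t))(X(t),Y)\big\rangle=0$$ for every $t\in[t_0,t_1]$ and every $Y\in \mathrm{T}_{\pi(q(t))}M$.
   Context: Everything is $C^\infty$; $I=[t_0,t_1]$ is a fixed interval. Variations. $\tau_Q:\mathrm{T}Q\to Q$ is the tangent bundle; $\kappa_Q:\mathrm{TT}Q\to\mathrm{TT}Q$ is the canonical flip, $(q^a,\dot q^b,q'^c,\dot q'^d)\mapsto(q^a,q'^b,\dot q^c,\dot q'^d)$ in induced coordinates. If $\gamma(t)\in\mathrm{T}Q$ is the tangent lift of a curve $q(t)\in Q$ and $\xi(t)\in\mathrm{T}_{q(t)}Q$ is a curve (generator), the standard admissible variation generated by $\xi$ is $\delta_{\xi}\gamma(t)=\kappa_Q(\mathrm{T}_t\xi(t))\in\mathrm{T}_{\gamma(t)}\mathrm{T}Q$, where $\mathrm{T}_t\xi(t)\in\mathrm{TT}Q$ is the tangent lift of the curve $\xi$. It has vanishing end-points if $\xi(t_0)=\xi(t_1)=0$. The variation of the action is $\langle \mathrm{d}S_L(\gamma),\delta\gamma\rangle=\int_I\langle \mathrm{d}L(\gamma(t)),\delta\gamma(t)\rangle\,\mathrm{d}t$ (for a time-dependent Lagrangian, differentiate in the $\mathrm{T}Q$ variable). Chaplygin system. $\mathrm{V}Q=\ker\pi_*$; a horizontal distribution is a smooth distribution with $\mathrm{T}_qQ=\mathrm{H}_qQ\oplus\mathrm{V}_qQ$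 for all $q$. A horizontal admissible path is a curve $\widetilde X(t)\in\mathrm{H}_{q(t)}Q$ which is the tangent lift of a curve $q(t)$. Such a path is: an unconstrained extremal (for a possibly time-dependent Lagrangian) if $\langle\mathrm{d}S_L(\widetilde X),\delta_\xi\widetilde X\rangle=0$ for all generators $\xi(t)\in\mathrm{T}_{q(t)}Q$ vanishing at the end-points; a nonholonomic extremal if this holds for all such $\xi$ with $\xi(t)\in\mathrm{H}_{q(t)}Q$; a vakonomic extremal if this holds for all such $\xi$ for which $\delta_{\xi}\widetilde X(t)\in\mathrm{T}_{\widetilde X(t)}\mathrm{H}Q$ for all $t$ (a vakonomic admissible variation). Notation. $\mathfrak g=\mathrm{T}_eG$ carries the left Lie algebra structure. For $a\in\mathfrak g$, $\widetilde a$ is the fundamental vector field on $Q$, with flow $q\mapsto q\cdot\exp(ta)$; this identifies $\mathrm{V}Q\approx Q\times\mathfrak g$. $\omega:\mathrm{T}Q\to\mathfrak g$ is the projection onto the $\mathfrak g$-part in $\mathrm{T}Q=\mathrm{H}Q\oplus_Q(Q\times\mathfrak g)$. For $X\in\mathrm{T}_xM$ and $q\in\pi^{-1}(x)$, $\widetilde X_q\in\mathrm{H}_qQ$ is the horizontal lift. For a path $\widetilde X(t)$, $X(t)=\pi_*\widetilde X(t)$, and similarly $Y(t)=\pi_*\widetilde Y(t)$. Maps (tensorial, so defined by extending $X,Y$ to vector fields on $M$): curvature $\mathcal R(q)(X,Y)=\omega([\widetilde X,\widetilde Y]-\widetilde{[X,Y]})(q)\in\mathfrak g$, and $\mathcal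 B(q)(X,a)=\omega([\widetilde X,\widetilde a])(q)\in\mathfrak g$. Derivatives of $L$: $\mathrm{F}L,\mathrm{H}L:\mathrm{H}Q\to\mathfrak g^*$, $\langle\mathrm{F}L(\widetilde X_q),b\rangle=\frac{\mathrm d}{\mathrm dt}\big|_0L(\widetilde X_q+t\,\widetilde b_q)$ and $\langle\mathrm{H}L(\widetilde X_q),b\rangle=\frac{\mathrm d}{\mathrm dt}\big|_0L(\widetilde X_{q\cdot\exp(tb)})$, where $\widetilde X_{q\cdot \exp(tb)}$ is the horizontal lift of the same $X$ to the point $q\cdot\exp(tb)$. *)

theory Defs
  imports "HOL-Analysis.Analysis" "HOL-Algebra.Group"
begin

section \<open>Smooth functions\<close>

text \<open>Derivatives are taken within the domain, so that on a nondegenerate interval they are one-sided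
  at the end-points; on open sets they are the usual ones.\<close>

fun Ck_on :: "nat \<Rightarrow> 'a::real_normed_vector set \<Rightarrow> ('a \<Rightarrow> 'b::real_normed_vector) \<Rightarrow> bool" where
  "Ck_on 0 S f \<longleftrightarrow> continuous_on S f"
| "Ck_on (Suc k) S f \<longleftrightarrow>
     (\<exists>f'. (\<forall>x\<in>S. (f has_derivative f' x) (at x within S)) \<and> (\<forall>v. Ck_on k S (\<lambda>x. f' x v)))"

definition smooth_on :: "'a::real_normed_vector set \<Rightarrow> ('a \<Rightarrow> 'b::real_normed_vector) \<Rightarrow> bool" where
  "smooth_on S f \<longleftrightarrow> (\<forall>k. Ck_on k S f)"


section \<open>Manifolds\<close>

text \<open>A chart is a domain together with a coordinate map. An atlas need not be maximal. The model
  space is any finite-dimensional real inner product space; unlike \<open>euclidean_space\<close> this allows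
  dimension zero.\<close>

type_synonym ('p, 'e) chart = "'p set \<times> ('p \<Rightarrow> 'e)"
type_synonym ('p, 'e) atlas = "('p, 'e) chart set"

definition pts :: "('p, 'e) atlas \<Rightarrow> 'p set" where
  "pts A = (\<Union>c\<in>A. fst c)"

definition charts_at :: "('p, 'e) atlas \<Rightarrow> 'p \<Rightarrow> ('p, 'e) chart set" where
  "charts_at A p = {c \<in> A. p \<in> fst c}"

definition chart_inv :: "('p, 'e) chart \<Rightarrow> 'e \<Rightarrow> 'p" where
  "chart_inv c = inv_into (fst c) (snd c)"

definition smooth_atlas :: "('p, 'e::real_inner) atlas \<Rightarrow> bool" where
  "smooth_atlas A \<longleftrightarrow>
     (\<forall>c\<in>A. inj_on (snd c) (fst c) \<and> open (snd c ` fst c)) \<and>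
     (\<forall>c\<in>A. \<forall>d\<in>A. open (snd c ` (fst c \<inter> fst d)) \<and>
        smooth_on (snd c ` (fst c \<inter> fst d)) (snd d \<circ> chart_inv c))"

definition manifold_topology :: "('p, 'e::real_inner) atlas \<Rightarrow> 'p topology" where
  "manifold_topology A = topology (\<lambda>W. W \<subseteq> pts A \<and> (\<forall>c\<in>A. open (snd c ` (W \<inter> fst c))))"

lemma openin_manifold_topology:
  assumes "smooth_atlas A"
  shows "openin (manifold_topology A) W \<longleftrightarrow> W \<subseteq> pts A \<and> (\<forall>c\<in>A. open (snd c ` (W \<inter> fst c)))"
proof -
  have "istopology (\<lambda>W. W \<subseteq> pts A \<and> (\<forall>c\<in>A. open (snd c ` (W \<inter> fst c))))"
    unfolding istopology_def
  proof (intro conjI allI impI)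
    fix S T
    assume S: "S \<subseteq> pts A \<and> (\<forall>c\<in>A. open (snd c ` (S \<inter> fst c)))"
      and T: "T \<subseteq> pts A \<and> (\<forall>c\<in>A. open (snd c ` (T \<inter> fst c)))"
    show "S \<inter> T \<subseteq> pts A" using S by blast
    show "\<forall>c\<in>A. open (snd c ` (S \<inter> T \<inter> fst c))"
    proof
      fix c assume c: "c \<in> A"
      then have "inj_on (snd c) (fst c)" using assms by (auto simp: smooth_atlas_def)
      then have "snd c ` (S \<inter> T \<inter> fst c) = snd c ` (S \<inter> fst c) \<inter> snd c ` (T \<inter> fst c)"
        by (auto simp: inj_on_def)
      then show "open (snd c ` (S \<inter> T \<inter> fst c))" using S T c by auto
    qed
  next
    fix K :: "'a set set"
    assume K: "\<forall>S\<in>K. S \<subseteq> pts A \<and> (\<forall>c\<in>A. open (snd c ` (S \<inter> fst c)))"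
    show "\<Union>K \<subseteq> pts A" using K by blast
    show "\<forall>c\<in>A. open (snd c ` (\<Union>K \<inter> fst c))"
    proof
      fix c assume c: "c \<in> A"
      have "snd c ` (\<Union>K \<inter> fst c) = (\<Union>S\<in>K. snd c ` (S \<inter> fst c))" by blast
      then show "open (snd c ` (\<Union>K \<inter> fst c))" using K c by auto
    qed
  qed
  then show ?thesis by (simp add: manifold_topology_def)
qed

definition manifold :: "('p, 'e::real_inner) atlas \<Rightarrow> bool" where
  "manifold A \<longleftrightarrow> smooth_atlas A \<and> (\<exists>B::'e set. finite B \<and> span B = UNIV) \<and>
     Hausdorff_space (manifold_topology A) \<and> second_countable (manifold_topology A)"

definition prod_atlas :: "('p, 'e) atlas \<Rightarrow> ('r, 'f) atlas \<Rightarrow> ('p \<times> 'r, 'e \<times> 'f) atlas" where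
  "prod_atlas A B = (\<lambda>(c, d). (fst c \<times> fst d, map_prod (snd c) (snd d))) ` (A \<times> B)"

definition restrict_atlas :: "('p, 'e) atlas \<Rightarrow> 'p set \<Rightarrow> ('p, 'e) atlas" where
  "restrict_atlas A W = (\<lambda>c. (fst c \<inter> W, snd c)) ` A"

definition real_atlas :: "(real, real) atlas" where
  "real_atlas = {(UNIV, id)}"

text \<open>The openness clause expresses continuity.\<close>

definition smooth_map ::
  "('p, 'e::real_inner) atlas \<Rightarrow> ('r, 'f::real_inner) atlas \<Rightarrow> ('p \<Rightarrow> 'r) \<Rightarrow> bool" where
  "smooth_map A B f \<longleftrightarrow> (\<forall>p\<in>pts A. f p \<in> pts B) \<and>
     (\<forall>c\<in>A. \<forall>d\<in>B. open (snd c ` {p \<in> fst c. f p \<in> fst d}) \<and>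
        smooth_on (snd c ` {p \<in> fst c. f p \<in> fst d}) (snd d \<circ> f \<circ> chart_inv c))"

definition diffeo ::
  "('p, 'e::real_inner) atlas \<Rightarrow> ('r, 'f::real_inner) atlas \<Rightarrow> ('p \<Rightarrow> 'r) \<Rightarrow> bool" where
  "diffeo A B f \<longleftrightarrow> bij_betw f (pts A) (pts B) \<and> smooth_map A B f \<and>
     smooth_map B A (inv_into (pts A) f)"


section \<open>Tangent bundles\<close>

text \<open>A tangent vector at \<open>p\<close> is the pair of \<open>p\<close> and the family of its coordinate vectors in all
  charts around \<open>p\<close> (padded by zero at the other charts), compatible under changes of charts. With
  the induced charts the tangent bundle is an atlas again, so the construction can be iterated.\<close>

type_synonym ('p, 'e) tvec = "'p \<times> (('p, 'e) chart \<Rightarrow> 'e)"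

definition tan_space :: "('p, 'e::real_inner) atlas \<Rightarrow> 'p \<Rightarrow> ('p, 'e) tvec set" where
  "tan_space A p = {Z. fst Z = p \<and> (\<forall>c. c \<notin> charts_at A p \<longrightarrow> snd Z c = 0) \<and>
     (\<forall>c\<in>charts_at A p. \<forall>d\<in>charts_at A p.
        snd Z d = frechet_derivative (snd d \<circ> chart_inv c) (at (snd c p)) (snd Z c))}"

definition tan_chart ::
  "('p, 'e::real_inner) atlas \<Rightarrow> ('p, 'e) chart \<Rightarrow> (('p, 'e) tvec, 'e \<times> 'e) chart" where
  "tan_chart A c = ((\<Union>p\<in>fst c. tan_space A p), (\<lambda>Z. (snd c (fst Z), snd Z c)))"

definition tan_atlas :: "('p, 'e::real_inner) atlas \<Rightarrow> (('p, 'e) tvec, 'e \<times> 'e) atlas" where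
  "tan_atlas A = tan_chart A ` A"

text \<open>Linear operations, meant for vectors with the same base point.\<close>

definition tzero :: "'p \<Rightarrow> ('p, 'e::real_vector) tvec" where
  "tzero p = (p, \<lambda>c. 0)"

definition tadd :: "('p, 'e::real_vector) tvec \<Rightarrow> ('p, 'e) tvec \<Rightarrow> ('p, 'e) tvec" where
  "tadd Z W = (fst Z, \<lambda>c. snd Z c + snd W c)"

definition tscale :: "real \<Rightarrow> ('p, 'e::real_vector) tvec \<Rightarrow> ('p, 'e) tvec" where
  "tscale r Z = (fst Z, \<lambda>c. r *\<^sub>R snd Z c)"

definition tdiff :: "('p, 'e::real_vector) tvec \<Rightarrow> ('p, 'e) tvec \<Rightarrow> ('p, 'e) tvec" where
  "tdiff Z W = tadd Z (tscale (-1) W)"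

definition tan_map :: "('p, 'e::real_inner) atlas \<Rightarrow> ('r, 'f::real_inner) atlas \<Rightarrow> ('p \<Rightarrow> 'r) \<Rightarrow>
    ('p, 'e) tvec \<Rightarrow> ('r, 'f) tvec" where
  "tan_map A B f Z = (let p = fst Z; c = (SOME c. c \<in> charts_at A p) in
     (f p, \<lambda>d. if d \<in> charts_at B (f p)
        then frechet_derivative (snd d \<circ> f \<circ> chart_inv c) (at (snd c p)) (snd Z c) else 0))"

definition differential :: "('p, 'e::real_inner) atlas \<Rightarrow> ('p \<Rightarrow> real) \<Rightarrow> ('p, 'e) tvec \<Rightarrow> real" where
  "differential A f Z = (let p = fst Z; c = (SOME c. c \<in> charts_at A p) in
     frechet_derivative (f \<circ> chart_inv c) (at (snd c p)) (snd Z c))"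

text \<open>In the coordinates that a chart of \<open>Q\<close> induces on the second tangent bundle, the flip exchanges
  the two middle entries.\<close>

definition canonical_flip :: "('p, 'e::real_inner) atlas \<Rightarrow>
    (('p, 'e) tvec, 'e \<times> 'e) tvec \<Rightarrow> (('p, 'e) tvec, 'e \<times> 'e) tvec" where
  "canonical_flip A W = (THE W'. W' \<in> pts (tan_atlas (tan_atlas A)) \<and>
     (\<forall>c\<in>charts_at A (fst (fst W)). let C = tan_chart (tan_atlas A) (tan_chart A c) in
        W' \<in> fst C \<and> snd C W' = (\<lambda>((x, v), (x', v')). ((x, x'), (v, v'))) (snd C W)))"

definition vector_field_on ::
  "('p, 'e::real_inner) atlas \<Rightarrow> 'p set \<Rightarrow> ('p \<Rightarrow> ('p, 'e) tvec) \<Rightarrow> bool" where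
  "vector_field_on A W X \<longleftrightarrow> (\<forall>p\<in>W. X p \<in> tan_space A p) \<and>
     smooth_map (restrict_atlas A W) (tan_atlas A) X"

abbreviation vector_field ::
  "('p, 'e::real_inner) atlas \<Rightarrow> ('p \<Rightarrow> ('p, 'e) tvec) \<Rightarrow> bool" where
  "vector_field A \<equiv> vector_field_on A (pts A)"

text \<open>The sign convention is \<open>[X,Y] f = X (Y f) - Y (X f)\<close>.\<close>

definition lie_bracket :: "('p, 'e::real_inner) atlas \<Rightarrow> ('p \<Rightarrow> ('p, 'e) tvec) \<Rightarrow>
    ('p \<Rightarrow> ('p, 'e) tvec) \<Rightarrow> 'p \<Rightarrow> ('p, 'e) tvec" where
  "lie_bracket A X Y p = (p, \<lambda>c. if c \<in> charts_at A p then
     (let Xc = (\<lambda>x. snd (X (chart_inv c x)) c); Yc = (\<lambda>x. snd (Y (chart_inv c x)) c); x = snd c p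
      in frechet_derivative Yc (at x) (Xc x) - frechet_derivative Xc (at x) (Yc x)) else 0)"


section \<open>Curves\<close>

definition smooth_curve :: "real set \<Rightarrow> ('p, 'e::real_inner) atlas \<Rightarrow> (real \<Rightarrow> 'p) \<Rightarrow> bool" where
  "smooth_curve I A \<gamma> \<longleftrightarrow> (\<forall>t\<in>I. \<gamma> t \<in> pts A) \<and>
     (\<forall>c\<in>A. openin (top_of_set I) {t \<in> I. \<gamma> t \<in> fst c} \<and>
        smooth_on {t \<in> I. \<gamma> t \<in> fst c} (snd c \<circ> \<gamma>))"

definition velocity ::
  "real set \<Rightarrow> ('p, 'e::real_inner) atlas \<Rightarrow> (real \<Rightarrow> 'p) \<Rightarrow> real \<Rightarrow> ('p, 'e) tvec" where
  "velocity I A \<gamma> t = (\<gamma> t, \<lambda>c. if c \<in> charts_at A (\<gamma> t)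
     then vector_derivative (snd c \<circ> \<gamma>) (at t within I) else 0)"

text \<open>The ordinary derivative of a curve that stays in a single tangent space.\<close>

definition fibre_derivative ::
  "real set \<Rightarrow> (real \<Rightarrow> ('p, 'e::real_inner) tvec) \<Rightarrow> real \<Rightarrow> ('p, 'e) tvec" where
  "fibre_derivative I b t = (fst (b t), \<lambda>c. vector_derivative (\<lambda>s. snd (b s) c) (at t within I))"

text \<open>Tangent space at \<open>p\<close> of a submanifold \<open>S\<close>, inside the tangent space of the ambient manifold.\<close>

definition sub_tan_space :: "('p, 'e::real_inner) atlas \<Rightarrow> 'p set \<Rightarrow> 'p \<Rightarrow> ('p, 'e) tvec set" where
  "sub_tan_space A S p = {velocity {-\<epsilon><..<\<epsilon>} A \<gamma> 0 | \<gamma> \<epsilon>. \<epsilon> > 0 \<and>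
     smooth_curve {-\<epsilon><..<\<epsilon>} A \<gamma> \<and> (\<forall>s\<in>{-\<epsilon><..<\<epsilon>}. \<gamma> s \<in> S) \<and> \<gamma> 0 = p}"


section \<open>Principal bundles with a horizontal distribution\<close>

record ('q, 'e, 'm, 'f, 'g, 'h) chaplygin =
  Qat :: "('q, 'e) atlas"
  Mat :: "('m, 'f) atlas"
  Gat :: "('g, 'h) atlas"
  grp :: "'g monoid"
  act :: "'q \<Rightarrow> 'g \<Rightarrow> 'q"
  proj :: "'q \<Rightarrow> 'm"
  hor :: "'q \<Rightarrow> ('q, 'e) tvec set"

definition lie_group :: "('g, 'h::real_inner) atlas \<Rightarrow> 'g monoid \<Rightarrow> bool" where
  "lie_group A G \<longleftrightarrow> manifold A \<and> group G \<and> carrier G = pts A \<and>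
     smooth_map (prod_atlas A A) A (\<lambda>(g, h). g \<otimes>\<^bsub>G\<^esub> h) \<and> smooth_map A A (\<lambda>g. inv\<^bsub>G\<^esub> g)"

definition principal_bundle ::
  "('q, 'e::real_inner, 'm, 'f::real_inner, 'g, 'h::real_inner) chaplygin \<Rightarrow> bool" where
  "principal_bundle S \<longleftrightarrow> manifold (Qat S) \<and> manifold (Mat S) \<and> lie_group (Gat S) (grp S) \<and>
     smooth_map (prod_atlas (Qat S) (Gat S)) (Qat S) (\<lambda>(q, g). act S q g) \<and>
     (\<forall>q\<in>pts (Qat S). act S q \<one>\<^bsub>grp S\<^esub> = q) \<and>
     (\<forall>q\<in>pts (Qat S). \<forall>g\<in>pts (Gat S). \<forall>h\<in>pts (Gat S).
        act S (act S q g) h = act S q (g \<otimes>\<^bsub>grp S\<^esub> h)) \<and>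
     smooth_map (Qat S) (Mat S) (proj S) \<and> proj S ` pts (Qat S) = pts (Mat S) \<and>
     (\<forall>x\<in>pts (Mat S). \<exists>U k. openin (manifold_topology (Mat S)) U \<and> x \<in> U \<and>
        diffeo (restrict_atlas (Qat S) {q \<in> pts (Qat S). proj S q \<in> U})
          (prod_atlas (restrict_atlas (Mat S) U) (Gat S)) (\<lambda>q. (proj S q, k q)) \<and>
        (\<forall>q\<in>pts (Qat S). \<forall>g\<in>pts (Gat S). proj S q \<in> U \<longrightarrow>
           proj S (act S q g) = proj S q \<and> k (act S q g) = k q \<otimes>\<^bsub>grp S\<^esub> g))"

definition proj_push :: "('q, 'e::real_inner, 'm, 'f::real_inner, 'g, 'h) chaplygin \<Rightarrow>
    ('q, 'e) tvec \<Rightarrow> ('m, 'f) tvec" where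
  "proj_push S = tan_map (Qat S) (Mat S) (proj S)"

definition vert ::
  "('q, 'e::real_inner, 'm, 'f::real_inner, 'g, 'h) chaplygin \<Rightarrow> 'q \<Rightarrow> ('q, 'e) tvec set" where
  "vert S q = {Z \<in> tan_space (Qat S) q. proj_push S Z = tzero (proj S q)}"

definition smooth_distribution ::
  "('p, 'e::real_inner) atlas \<Rightarrow> ('p \<Rightarrow> ('p, 'e) tvec set) \<Rightarrow> bool" where
  "smooth_distribution A D \<longleftrightarrow>
     (\<forall>q\<in>pts A. \<exists>W k (X :: nat \<Rightarrow> 'p \<Rightarrow> ('p, 'e) tvec). openin (manifold_topology A) W \<and> q \<in> W \<and>
        (\<forall>i<k. vector_field_on A W (X i)) \<and>
        (\<forall>p\<in>W. D p = {(p, \<lambda>c. \<Sum>i<k. r i *\<^sub>R snd (X i p) c) | r. True} \<and>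
          (\<forall>r. (\<forall>c. (\<Sum>i<k. r i *\<^sub>R snd (X i p) c) = 0) \<longrightarrow> (\<forall>i<k. r i = 0))))"

definition horizontal_distribution ::
  "('q, 'e::real_inner, 'm, 'f::real_inner, 'g, 'h) chaplygin \<Rightarrow> bool" where
  "horizontal_distribution S \<longleftrightarrow> smooth_distribution (Qat S) (hor S) \<and>
     (\<forall>q\<in>pts (Qat S). hor S q \<inter> vert S q = {tzero q} \<and>
        tan_space (Qat S) q = {tadd Y V | Y V. Y \<in> hor S q \<and> V \<in> vert S q})"

definition horizontal_bundle :: "('q, 'e, 'm, 'f, 'g, 'h) chaplygin \<Rightarrow> ('q, 'e) tvec set" where
  "horizontal_bundle S = (\<Union>q\<in>pts (Qat S). hor S q)"

text \<open>The Lie algebra as a vector space; its bracket is not needed here.\<close>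

definition lie_alg ::
  "('q, 'e, 'm, 'f, 'g, 'h::real_inner) chaplygin \<Rightarrow> ('g, 'h) tvec set" where
  "lie_alg S = tan_space (Gat S) \<one>\<^bsub>grp S\<^esub>"

definition one_parameter_subgroup ::
  "('q, 'e, 'm, 'f, 'g, 'h::real_inner) chaplygin \<Rightarrow> ('g, 'h) tvec \<Rightarrow> (real \<Rightarrow> 'g) \<Rightarrow> bool" where
  "one_parameter_subgroup S a c \<longleftrightarrow> smooth_curve UNIV (Gat S) c \<and>
     (\<forall>s t. c (s + t) = c s \<otimes>\<^bsub>grp S\<^esub> c t) \<and> velocity UNIV (Gat S) c 0 = a"

definition lie_exp ::
  "('q, 'e, 'm, 'f, 'g, 'h::real_inner) chaplygin \<Rightarrow> ('g, 'h) tvec \<Rightarrow> 'g" where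
  "lie_exp S a = (THE c. one_parameter_subgroup S a c) 1"

definition fundamental :: "('q, 'e::real_inner, 'm, 'f, 'g, 'h::real_inner) chaplygin \<Rightarrow>
    ('g, 'h) tvec \<Rightarrow> 'q \<Rightarrow> ('q, 'e) tvec" where
  "fundamental S a q = velocity UNIV (Qat S) (\<lambda>t. act S q (lie_exp S (tscale t a))) 0"

definition omega :: "('q, 'e::real_inner, 'm, 'f, 'g, 'h::real_inner) chaplygin \<Rightarrow>
    ('q, 'e) tvec \<Rightarrow> ('g, 'h) tvec" where
  "omega S Z = (THE a. a \<in> lie_alg S \<and> tdiff Z (fundamental S a (fst Z)) \<in> hor S (fst Z))"

definition hlift :: "('q, 'e::real_inner, 'm, 'f::real_inner, 'g, 'h) chaplygin \<Rightarrow>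
    ('m, 'f) tvec \<Rightarrow> 'q \<Rightarrow> ('q, 'e) tvec" where
  "hlift S X q = (THE Z. Z \<in> hor S q \<and> proj_push S Z = X)"

definition hlift_field :: "('q, 'e::real_inner, 'm, 'f::real_inner, 'g, 'h) chaplygin \<Rightarrow>
    ('m \<Rightarrow> ('m, 'f) tvec) \<Rightarrow> 'q \<Rightarrow> ('q, 'e) tvec" where
  "hlift_field S X q = hlift S (X (proj S q)) q"

text \<open>Both maps below are tensorial: the value is the one obtained from every choice of extensions.\<close>

definition curvature :: "('q, 'e::real_inner, 'm, 'f::real_inner, 'g, 'h::real_inner) chaplygin \<Rightarrow>
    'q \<Rightarrow> ('m, 'f) tvec \<Rightarrow> ('m, 'f) tvec \<Rightarrow> ('g, 'h) tvec" where
  "curvature S q X Y = (THE a. \<forall>X' Y'. vector_field (Mat S) X' \<and> vector_field (Mat S) Y' \<and>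
     X' (proj S q) = X \<and> Y' (proj S q) = Y \<longrightarrow>
     a = omega S (tdiff (lie_bracket (Qat S) (hlift_field S X') (hlift_field S Y') q)
                        (hlift_field S (lie_bracket (Mat S) X' Y') q)))"

definition bmap :: "('q, 'e::real_inner, 'm, 'f::real_inner, 'g, 'h::real_inner) chaplygin \<Rightarrow>
    'q \<Rightarrow> ('m, 'f) tvec \<Rightarrow> ('g, 'h) tvec \<Rightarrow> ('g, 'h) tvec" where
  "bmap S q X a = (THE a'. \<forall>X'. vector_field (Mat S) X' \<and> X' (proj S q) = X \<longrightarrow>
     a' = omega S (lie_bracket (Qat S) (hlift_field S X') (fundamental S a) q))"


section \<open>Lagrangians and extremals\<close>

text \<open>Elements of the dual of the Lie algebra are represented as real functions on tangent vectors
  of the group, of which only the values on \<open>lie_alg\<close> matter.\<close>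

definition smooth_lagrangian :: "('q, 'e::real_inner, 'm, 'f, 'g, 'h) chaplygin \<Rightarrow>
    (('q, 'e) tvec \<Rightarrow> real) \<Rightarrow> bool" where
  "smooth_lagrangian S L \<longleftrightarrow> smooth_map (tan_atlas (Qat S)) real_atlas L"

definition FL :: "('q, 'e::real_inner, 'm, 'f, 'g, 'h::real_inner) chaplygin \<Rightarrow>
    (('q, 'e) tvec \<Rightarrow> real) \<Rightarrow> ('q, 'e) tvec \<Rightarrow> ('g, 'h) tvec \<Rightarrow> real" where
  "FL S L Z b = deriv (\<lambda>t. L (tadd Z (tscale t (fundamental S b (fst Z))))) 0"

definition HL :: "('q, 'e::real_inner, 'm, 'f::real_inner, 'g, 'h::real_inner) chaplygin \<Rightarrow>
    (('q, 'e) tvec \<Rightarrow> real) \<Rightarrow> ('q, 'e) tvec \<Rightarrow> ('g, 'h) tvec \<Rightarrow> real" where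
  "HL S L Z b = deriv (\<lambda>t. L (hlift S (proj_push S Z) (act S (fst Z) (lie_exp S (tscale t b))))) 0"

definition smooth_dual_curve :: "('q, 'e, 'm, 'f, 'g, 'h::real_inner) chaplygin \<Rightarrow> real set \<Rightarrow>
    (real \<Rightarrow> ('g, 'h) tvec \<Rightarrow> real) \<Rightarrow> bool" where
  "smooth_dual_curve S I \<mu> \<longleftrightarrow>
     (\<forall>t\<in>I. \<forall>a\<in>lie_alg S. (\<forall>b\<in>lie_alg S. \<mu> t (tadd a b) = \<mu> t a + \<mu> t b) \<and>
        (\<forall>r. \<mu> t (tscale r a) = r * \<mu> t a)) \<and>
     (\<forall>a\<in>lie_alg S. smooth_on I (\<lambda>t. \<mu> t a))"

definition horizontal_path :: "('q, 'e::real_inner, 'm, 'f, 'g, 'h) chaplygin \<Rightarrow>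
    real \<Rightarrow> real \<Rightarrow> (real \<Rightarrow> ('q, 'e) tvec) \<Rightarrow> bool" where
  "horizontal_path S t0 t1 X \<longleftrightarrow> smooth_curve {t0..t1} (Qat S) (\<lambda>t. fst (X t)) \<and>
     (\<forall>t\<in>{t0..t1}. X t = velocity {t0..t1} (Qat S) (\<lambda>t. fst (X t)) t \<and> X t \<in> hor S (fst (X t)))"

definition generator :: "('q, 'e::real_inner, 'm, 'f, 'g, 'h) chaplygin \<Rightarrow> real \<Rightarrow> real \<Rightarrow>
    (real \<Rightarrow> ('q, 'e) tvec) \<Rightarrow> (real \<Rightarrow> ('q, 'e) tvec) \<Rightarrow> bool" where
  "generator S t0 t1 X \<xi> \<longleftrightarrow> smooth_curve {t0..t1} (tan_atlas (Qat S)) \<xi> \<and>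
     (\<forall>t\<in>{t0..t1}. \<xi> t \<in> tan_space (Qat S) (fst (X t))) \<and>
     \<xi> t0 = tzero (fst (X t0)) \<and> \<xi> t1 = tzero (fst (X t1))"

definition variation :: "('q, 'e::real_inner, 'm, 'f, 'g, 'h) chaplygin \<Rightarrow> real \<Rightarrow> real \<Rightarrow>
    (real \<Rightarrow> ('q, 'e) tvec) \<Rightarrow> real \<Rightarrow> (('q, 'e) tvec, 'e \<times> 'e) tvec" where
  "variation S t0 t1 \<xi> t =
     canonical_flip (Qat S) (velocity {t0..t1} (tan_atlas (Qat S)) \<xi> t)"

definition action_variation :: "('q, 'e::real_inner, 'm, 'f, 'g, 'h) chaplygin \<Rightarrow> real \<Rightarrow> real \<Rightarrow>
    (real \<Rightarrow> ('q, 'e) tvec \<Rightarrow> real) \<Rightarrow> (real \<Rightarrow> ('q, 'e) tvec) \<Rightarrow> real" where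
  "action_variation S t0 t1 L \<xi> =
     integral {t0..t1} (\<lambda>t. differential (tan_atlas (Qat S)) (L t) (variation S t0 t1 \<xi> t))"

definition unconstrained_extremal :: "('q, 'e::real_inner, 'm, 'f, 'g, 'h) chaplygin \<Rightarrow>
    real \<Rightarrow> real \<Rightarrow> (real \<Rightarrow> ('q, 'e) tvec \<Rightarrow> real) \<Rightarrow> (real \<Rightarrow> ('q, 'e) tvec) \<Rightarrow> bool" where
  "unconstrained_extremal S t0 t1 L X \<longleftrightarrow> horizontal_path S t0 t1 X \<and>
     (\<forall>\<xi>. generator S t0 t1 X \<xi> \<longrightarrow> action_variation S t0 t1 L \<xi> = 0)"

definition nonholonomic_extremal :: "('q, 'e::real_inner, 'm, 'f, 'g, 'h) chaplygin \<Rightarrow>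
    real \<Rightarrow> real \<Rightarrow> (real \<Rightarrow> ('q, 'e) tvec \<Rightarrow> real) \<Rightarrow> (real \<Rightarrow> ('q, 'e) tvec) \<Rightarrow> bool" where
  "nonholonomic_extremal S t0 t1 L X \<longleftrightarrow> horizontal_path S t0 t1 X \<and>
     (\<forall>\<xi>. generator S t0 t1 X \<xi> \<and> (\<forall>t\<in>{t0..t1}. \<xi> t \<in> hor S (fst (X t)))
        \<longrightarrow> action_variation S t0 t1 L \<xi> = 0)"

definition vakonomic_extremal :: "('q, 'e::real_inner, 'm, 'f, 'g, 'h) chaplygin \<Rightarrow>
    real \<Rightarrow> real \<Rightarrow> (real \<Rightarrow> ('q, 'e) tvec \<Rightarrow> real) \<Rightarrow> (real \<Rightarrow> ('q, 'e) tvec) \<Rightarrow> bool" where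
  "vakonomic_extremal S t0 t1 L X \<longleftrightarrow> horizontal_path S t0 t1 X \<and>
     (\<forall>\<xi>. generator S t0 t1 X \<xi> \<and>
        (\<forall>t\<in>{t0..t1}. variation S t0 t1 \<xi> t \<in>
           sub_tan_space (tan_atlas (Qat S)) (horizontal_bundle S) (X t))
        \<longrightarrow> action_variation S t0 t1 L \<xi> = 0)"

end

theory Submission
  imports Defs
begin

text \<open>Let \<open>\<xi> = Y + b\<close> be the decomposition of a generator into its horizontal and vertical parts. By
  Cartan's formula the connection form has the derivative \<open>b' + \<B>(X, b) + \<R>(X, Y)\<close> along the
  variation generated by \<open>\<xi>\<close>, so that the variation is vakonomic admissible iff this expression
  vanishes. The variation generated by a vertical \<open>b\<close> differs from the velocity of the horizontal lifts
  of \<open>X\<close> to \<open>q exp(r b)\<close> by the vertical vector belonging to \<open>b' + \<B>(X, b)\<close>; hence the variation of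
  the action along \<open>b\<close> is the integral of \<open>\<langle>HL, b\<rangle> + \<langle>FL, b' + \<B>(X, b)\<rangle>\<close>. For a nonholonomic
  extremal only the vertical part contributes to the variation of the action. Integration by parts and
  the fundamental lemma of the calculus of variations give (a), and inserting the constraint gives (b).
  In (c) the multiplier term of the modified action contributes the integral of \<open>\<langle>\<lambda>, \<R>(X, Y)\<rangle>\<close> for
  horizontal \<open>Y\<close>, and the fundamental lemma applies again.\<close>

section \<open>Calculus in finite-dimensional inner product spaces\<close>

text \<open>Two features of the encoding shape the proof. First, \<open>curvature\<close>,
  \<open>bmap\<close>, \<open>lie_exp\<close>, \<open>omega\<close> and \<open>hlift\<close> are
  definite descriptions, which have a known value only after existence and uniqueness are
  established. For \<open>lie_exp\<close> this takes an ODE theorem and a doubling argument; for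
  \<open>curvature\<close> and \<open>bmap\<close> a single tangent vector must be extended to a
  global field, which brings in bump functions and the Hausdorff axiom. Second, the distribution is
  smooth in the sense of local frames, whereas the computations need a smooth connection form; it is
  obtained from the smoothness of the inverse of a smooth family of linear maps. From then on the
  geometry is carried by four coordinate objects: \<open>fcoord\<close> (fundamental fields),
  \<open>wcoord\<close> (connection form), \<open>pcoord\<close> (projection) and
  \<open>hcoord\<close> (horizontal lift). Symmetry of second derivatives makes the flip and the
  bracket independent of the chart, and the bracket of a lift with a fundamental field vertical. The
  model spaces are inner product spaces with a finite spanning set, so compactness and completeness
  are derived from coordinates.\<close>

definition fin_dim :: "'a::real_inner itself \<Rightarrow> bool" where
  "fin_dim _ \<longleftrightarrow> (\<exists>B::'a set. finite B \<and> span B = UNIV)"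

text \<open>The vectors \<open>w b\<close> play the role of a dual basis. They are
  \<open>b /\<^sub>R (b \<bullet> b)\<close> for an orthogonal spanning set; a zero vector in the
  set does no harm, because then \<open>w b = 0\<close>.\<close>

lemma fin_dim_coords:
  assumes "fin_dim TYPE('a::real_inner)"
  obtains E w where "finite (E::'a set)" "\<And>x. x = (\<Sum>b\<in>E. (x \<bullet> w b) *\<^sub>R b)"
proof -
  obtain B :: "'a set" where "finite B" "span B = UNIV"
    using assms by (auto simp: fin_dim_def)
  then obtain C where C: "finite C" "span C = (UNIV :: 'a set)" "pairwise orthogonal C"
    using basis_orthogonal by metis
  have "x = (\<Sum>b\<in>C. (x \<bullet> (b /\<^sub>R (b \<bullet> b))) *\<^sub>R b)" for x
  proof -
    \<comment> \<open>The remainder \<open>y\<close> is orthogonal to \<open>C\<close>, hence to its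
      span, hence to itself.\<close>
    define y where "y = x - (\<Sum>b\<in>C. (x \<bullet> (b /\<^sub>R (b \<bullet> b))) *\<^sub>R b)"
    have "orthogonal y c" if c: "c \<in> C" for c
    proof -
      have "(\<Sum>b\<in>C. (x \<bullet> (b /\<^sub>R (b \<bullet> b))) *\<^sub>R b) \<bullet> c = (\<Sum>b\<in>C. (x \<bullet> (b /\<^sub>R (b \<bullet> b))) * (b \<bullet> c))"
        by (simp add: inner_sum_left)
      also have "\<dots> = (\<Sum>b\<in>C. if b = c then x \<bullet> c else 0)"
        using C(3) c by (intro sum.cong; cases "c = 0") (auto simp: pairwise_def orthogonal_def)
      also have "\<dots> = x \<bullet> c" using C(1) c by simp
      finally show ?thesis by (simp add: y_def orthogonal_def inner_diff_left)
    qed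
    then have "orthogonal y y" using orthogonal_to_span[of y C y] C(2) by auto
    then show ?thesis by (simp add: y_def orthogonal_def)
  qed
  with C(1) show ?thesis using that[of C "\<lambda>b. b /\<^sub>R (b \<bullet> b)"] by blast
qed

lemma fin_dim_real: "fin_dim TYPE(real)"
  unfolding fin_dim_def
proof (intro exI conjI)
  show "span {1::real} = UNIV"
  proof -
    have "x \<in> span {1::real}" for x :: real
      using span_scale[OF span_base[of 1 "{1::real}"], of x] by simp
    then show ?thesis by auto
  qed
qed simp

lemma fin_dim_prod:
  assumes "fin_dim TYPE('a::real_inner)" "fin_dim TYPE('b::real_inner)"
  shows "fin_dim TYPE('a \<times> 'b)"
proof -
  obtain B :: "'a set" and C :: "'b set"
    where B: "finite B" "span B = UNIV" and C: "finite C" "span C = UNIV"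
    using assms by (auto simp: fin_dim_def)
  let ?D = "(\<lambda>x. (x, 0)) ` B \<union> (\<lambda>y. (0, y)) ` C"
  have 1: "(x, 0) \<in> span ?D" for x :: 'a
  proof -
    have "(\<lambda>x. (x, 0::'b)) ` span B = span ((\<lambda>x. (x, 0)) ` B)"
      by (rule linear_span_image[symmetric]) (auto intro!: linearI)
    then show ?thesis using B(2) span_mono[of "(\<lambda>x. (x, 0)) ` B" ?D] by auto
  qed
  have 2: "(0, y) \<in> span ?D" for y :: 'b
  proof -
    have "(\<lambda>y. (0::'a, y)) ` span C = span ((\<lambda>y. (0, y)) ` C)"
      by (rule linear_span_image[symmetric]) (auto intro!: linearI)
    then show ?thesis using C(2) span_mono[of "(\<lambda>y. (0, y)) ` C" ?D] by auto
  qed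
  have "z \<in> span ?D" for z
    using span_add[OF 1[of "fst z"] 2[of "snd z"]] by simp
  then show ?thesis unfolding fin_dim_def using B C by (intro exI[of _ ?D]) auto
qed

lemma fin_dim_linear_sum:
  assumes "linear f" "\<And>x. x = (\<Sum>b\<in>E. (x \<bullet> w b) *\<^sub>R b)"
  shows "f x = (\<Sum>b\<in>E. (x \<bullet> w b) *\<^sub>R f b)"
  by (subst assms(2)[of x]) (simp add: linear_sum[OF assms(1)] linear_cmul[OF assms(1)])

text \<open>Expanding the argument writes \<open>f\<close> as a finite sum of bounded functionals
  \<open>x \<bullet> w b\<close> times fixed vectors.\<close>

lemma fin_dim_bounded_linear:
  fixes f :: "'a::real_inner \<Rightarrow> 'b::real_normed_vector"
  assumes "fin_dim TYPE('a)" "linear f"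
  shows "bounded_linear f"
proof -
  obtain E w where E: "finite (E::'a set)" "\<And>x. x = (\<Sum>b\<in>E. (x \<bullet> w b) *\<^sub>R b)"
    using fin_dim_coords[OF assms(1)] by metis
  have "f = (\<lambda>x. \<Sum>b\<in>E. (x \<bullet> w b) *\<^sub>R f b)"
    using fin_dim_linear_sum[OF assms(2) E(2)] by blast
  moreover have "bounded_linear (\<lambda>x. \<Sum>b\<in>E. (x \<bullet> w b) *\<^sub>R f b)"
    by (intro bounded_linear_sum bounded_linear_scaleR_const bounded_linear_inner_left)
  ultimately show ?thesis by simp
qed

text \<open>By induction on the spanning set, the combinations with coefficients in
  \<open>{-R..R}\<close> form a compact set, as the continuous image of a box. A ball is a closed
  subset of such a set.\<close>

lemma fin_dim_compact_cball:
  fixes x :: "'a::real_inner"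
  assumes "fin_dim TYPE('a)"
  shows "compact (cball x r)"
proof -
  obtain E w where E: "finite (E::'a set)" "\<And>x. x = (\<Sum>b\<in>E. (x \<bullet> w b) *\<^sub>R b)"
    using fin_dim_coords[OF assms] by metis
  define K where "K R F = {\<Sum>b\<in>F. c b *\<^sub>R b | c. \<forall>b\<in>F. \<bar>c b\<bar> \<le> R}" for R :: real and F :: "'a set"
  have cK: "compact (K R F)" if "finite F" for R F
    using that
  proof induction
    case empty
    then show ?case by (simp add: K_def)
  next
    case (insert a F)
    have "K R (insert a F) = (\<lambda>(r, y). r *\<^sub>R a + y) ` ({-R..R} \<times> K R F)"
    proof (intro equalityI subsetI)
      fix y assume "y \<in> K R (insert a F)"
      then obtain c where c: "y = (\<Sum>b\<in>insert a F. c b *\<^sub>R b)" "\<forall>b\<in>insert a F. \<bar>c b\<bar> \<le> R"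
        by (auto simp: K_def)
      then have "y = c a *\<^sub>R a + (\<Sum>b\<in>F. c b *\<^sub>R b)" using insert by simp
      moreover have "c a \<in> {-R..R}" "(\<Sum>b\<in>F. c b *\<^sub>R b) \<in> K R F"
        using c(2) by (auto simp: K_def abs_le_iff)
      ultimately show "y \<in> (\<lambda>(r, y). r *\<^sub>R a + y) ` ({-R..R} \<times> K R F)"
        by (auto intro!: image_eqI[of _ _ "(c a, \<Sum>b\<in>F. c b *\<^sub>R b)"])
    next
      fix y assume "y \<in> (\<lambda>(r, y). r *\<^sub>R a + y) ` ({-R..R} \<times> K R F)"
      then obtain r c where c: "y = r *\<^sub>R a + (\<Sum>b\<in>F. c b *\<^sub>R b)" "\<bar>r\<bar> \<le> R" "\<forall>b\<in>F. \<bar>c b\<bar> \<le> R"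
        by (auto simp: K_def)
      have "(\<Sum>b\<in>F. (c(a := r)) b *\<^sub>R b) = (\<Sum>b\<in>F. c b *\<^sub>R b)"
        using insert by (intro sum.cong) auto
      then have "y = (\<Sum>b\<in>insert a F. (c(a := r)) b *\<^sub>R b)"
        using c(1) insert by simp
      moreover have "\<forall>b\<in>insert a F. \<bar>(c(a := r)) b\<bar> \<le> R" using c by auto
      ultimately show "y \<in> K R (insert a F)" unfolding K_def by blast
    qed
    moreover have "continuous_on X (\<lambda>(r, y). r *\<^sub>R a + y)" for X :: "(real \<times> 'a) set"
      by (auto simp: case_prod_unfold intro!: continuous_intros)
    ultimately show ?case
      using insert by (auto intro!: compact_continuous_image compact_Times)
  qed
  \<comment> \<open>Cauchy-Schwarz bounds each coefficient by \<open>norm y * norm (w b)\<close>;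
    the sum over \<open>E\<close> gives one bound for all of them.\<close>
  define R where "R = (norm x + \<bar>r\<bar>) * (\<Sum>b\<in>E. norm (w b))"
  have "cball x r \<subseteq> K R E"
  proof
    fix y assume "y \<in> cball x r"
    then have "norm y \<le> norm x + \<bar>r\<bar>"
      using norm_triangle_ineq[of "y - x" x] by (auto simp: dist_norm norm_minus_commute)
    then have "\<bar>y \<bullet> w b\<bar> \<le> R" if "b \<in> E" for b
    proof -
      have "\<bar>y \<bullet> w b\<bar> \<le> norm y * norm (w b)" by (rule Cauchy_Schwarz_ineq2)
      also have "\<dots> \<le> R" unfolding R_def
        using \<open>norm y \<le> norm x + \<bar>r\<bar>\<close> E(1) that
        by (intro mult_mono member_le_sum) auto
      finally show ?thesis .
    qed
    then show "y \<in> K R E" unfolding K_def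
      by (intro CollectI exI[of _ "\<lambda>b. y \<bullet> w b"]) (use E(2)[of y] in auto)
  qed
  moreover have "closed (cball x r)" by simp
  ultimately show ?thesis using cK[OF E(1), of R]
    by (metis compact_Int_closed inf.absorb_iff2)
qed

subsection \<open>Sets on which derivatives are unique\<close>

text \<open>On every line through a point of \<open>S\<close> there are points of \<open>S\<close>
  arbitrarily close to it, on one side at least. The sign of \<open>d\<close> is left open so that
  the end-points of an interval qualify. The condition makes derivatives within \<open>S\<close>
  unique.\<close>

definition fat :: "'a::real_normed_vector set \<Rightarrow> bool" where
  "fat S \<longleftrightarrow> (\<forall>x\<in>S. \<forall>v. \<forall>e>0. \<exists>d. d \<noteq> 0 \<and> \<bar>d\<bar> < e \<and> x + d *\<^sub>R v \<in> S)"

lemma fat_Int_open: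
  assumes "fat S" "open V"
  shows "fat (S \<inter> V)"
  unfolding fat_def
proof (intro ballI allI impI)
  fix x v :: 'a and e :: real assume x: "x \<in> S \<inter> V" and e: "e > 0"
  obtain r where r: "r > 0" "ball x r \<subseteq> V"
    using assms(2) x open_contains_ball by (metis IntD2)
  have "min e (r / (norm v + 1)) > 0" using e r by (simp add: add_nonneg_pos)
  then obtain d where d: "d \<noteq> 0" "\<bar>d\<bar> < min e (r / (norm v + 1))" "x + d *\<^sub>R v \<in> S"
    using assms(1) x unfolding fat_def by blast
  have "\<bar>d\<bar> * norm v \<le> \<bar>d\<bar> * (norm v + 1)" by (intro mult_left_mono) auto
  also have "\<dots> < r" using d(2) by (simp add: pos_less_divide_eq add_nonneg_pos)
  finally have "x + d *\<^sub>R v \<in> ball x r" by (simp add: dist_norm)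
  then show "\<exists>d. d \<noteq> 0 \<and> \<bar>d\<bar> < e \<and> x + d *\<^sub>R v \<in> S \<inter> V" using d r by auto
qed

lemma fat_open: "open S \<Longrightarrow> fat S"
proof -
  have "fat (UNIV :: 'a::real_normed_vector set)"
    unfolding fat_def
  proof (intro ballI allI impI)
    show "\<exists>d. d \<noteq> 0 \<and> \<bar>d\<bar> < e \<and> x + d *\<^sub>R v \<in> UNIV" if "e > 0" for x v :: 'a and e :: real
      using that by (intro exI[of _ "e / 2"]) auto
  qed
  then show "open S \<Longrightarrow> fat (S :: 'a set)" using fat_Int_open by fastforce
qed

lemma fat_atLeastAtMost:
  assumes "t0 < (t1::real)"
  shows "fat {t0..t1}"
  unfolding fat_def
proof (intro ballI allI impI)
  fix x v :: real and e :: real assume x: "x \<in> {t0..t1}" and e: "e > 0"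
  \<comment> \<open>With this choice \<open>r * \<bar>v\<bar>\<close> is at most half the length of
    the interval, so that \<open>x + r * v\<close> and \<open>x - r * v\<close> cannot both leave
    it.\<close>
  define r where "r = min (e / 2) ((t1 - t0) / (2 * (\<bar>v\<bar> + 1)))"
  have r: "0 < r" "r < e" "r * \<bar>v\<bar> \<le> (t1 - t0) / 2"
  proof -
    show "0 < r" "r < e" using e assms by (auto simp: r_def)
    have "r * \<bar>v\<bar> \<le> ((t1 - t0) / (2 * (\<bar>v\<bar> + 1))) * (\<bar>v\<bar> + 1)"
      using assms e by (intro mult_mono) (auto simp: r_def)
    also have "\<dots> = (t1 - t0) / 2" by (simp add: field_simps)
    finally show "r * \<bar>v\<bar> \<le> (t1 - t0) / 2" .
  qed
  have rv: "r * v \<le> (t1 - t0) / 2" "- (r * v) \<le> (t1 - t0) / 2"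
    using r by (auto simp: abs_if split: if_splits) (smt (verit) mult_minus_right r(1) mult_nonneg_nonneg assms divide_pos_pos)+
  show "\<exists>d. d \<noteq> 0 \<and> \<bar>d\<bar> < e \<and> x + d *\<^sub>R v \<in> {t0..t1}"
  proof (cases "x + r * v \<in> {t0..t1}")
    case True
    then show ?thesis using r by (intro exI[of _ r]) auto
  next
    case False
    then have "x - r * v \<in> {t0..t1}" using x rv by (auto simp: field_simps)
    then show ?thesis using r by (intro exI[of _ "-r"]) auto
  qed
qed

text \<open>The difference \<open>D\<close> of the two derivatives is of smaller order than its
  argument, yet homogeneous. Testing it on the small multiples of \<open>v\<close> supplied by
  \<open>fat\<close> gives \<open>norm (D v) \<le> e * norm v\<close> for every positive
  \<open>e\<close>.\<close>

lemma fat_unique_derivative: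
  assumes "fat S" "x \<in> S"
    and D1: "(f has_derivative D1) (at x within S)" and D2: "(f has_derivative D2) (at x within S)"
  shows "D1 = D2"
proof
  fix v
  define D where "D h = D1 h - D2 h" for h
  have lin: "bounded_linear D"
    unfolding D_def using D1 D2 by (intro bounded_linear_sub) (auto dest: has_derivative_bounded_linear)
  have "((\<lambda>x. f x - f x) has_derivative D) (at x within S)"
    unfolding D_def by (rule has_derivative_diff[OF D1 D2])
  then have lim: "((\<lambda>y. norm (D (y - x)) / norm (y - x)) \<longlongrightarrow> 0) (at x within S)"
    by (simp add: has_derivative_iff_norm)
  have le: "norm (D v) \<le> e * norm v" if e: "e > 0" for e
  proof (cases "v = 0")
    case True
    then show ?thesis using bounded_linear.linear[OF lin] linear_0 by fastforce
  next
    case v: False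
    obtain r where r: "r > 0" "\<And>y. y \<in> S \<Longrightarrow> y \<noteq> x \<Longrightarrow> dist y x < r \<Longrightarrow> norm (D (y - x)) / norm (y - x) < e"
      using tendstoD[OF lim e] unfolding eventually_at by auto
    obtain d where d: "d \<noteq> 0" "\<bar>d\<bar> < r / norm v" "x + d *\<^sub>R v \<in> S"
      using assms(1,2) r(1) v unfolding fat_def by (metis divide_pos_pos zero_less_norm_iff)
    have "norm (D (d *\<^sub>R v)) / norm (d *\<^sub>R v) < e"
      using r(2)[OF d(3)] d v by (auto simp: dist_norm pos_less_divide_eq)
    moreover have "norm (D (d *\<^sub>R v)) = \<bar>d\<bar> * norm (D v)"
      using linear_cmul[OF bounded_linear.linear[OF lin]] by simp
    ultimately show ?thesis using d v by (simp add: field_simps)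
  qed
  have "norm (D v) \<le> 0"
  proof (rule field_le_epsilon)
    fix e :: real assume "e > 0"
    then have "norm (D v) \<le> e / (norm v + 1) * norm v" using le[of "e / (norm v + 1)"] by (simp add: add_nonneg_pos)
    also have "\<dots> \<le> e / (norm v + 1) * (norm v + 1)" using \<open>e > 0\<close> by (intro mult_left_mono) auto
    also have "\<dots> = e" using norm_ge_zero[of v] by (simp del: norm_ge_zero)
    finally show "norm (D v) \<le> 0 + e" by simp
  qed
  then show "D1 v = D2 v" by (simp add: D_def)
qed

subsection \<open>Functions of class \<open>C\<^sup>k\<close>\<close>

lemma Ck_mono: "Ck_on (Suc k) S f \<Longrightarrow> Ck_on k S f"
proof (induction k arbitrary: f)
  case 0
  then show ?case by (auto intro: has_derivative_continuous_on)
next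
  case (Suc k)
  then show ?case by (metis Ck_on.simps(2))
qed

lemma Ck_continuous: "Ck_on k S f \<Longrightarrow> continuous_on S f"
  by (cases k) (auto intro: has_derivative_continuous_on)

lemma Ck_subset: "Ck_on k S f \<Longrightarrow> T \<subseteq> S \<Longrightarrow> Ck_on k T f"
proof (induction k arbitrary: f)
  case 0
  then show ?case by (auto intro: continuous_on_subset)
next
  case (Suc k)
  then obtain f' where "\<forall>x\<in>S. (f has_derivative f' x) (at x within S)" "\<forall>v. Ck_on k S (\<lambda>x. f' x v)"
    by auto
  with Suc show ?case by (auto intro!: exI[of _ f'] intro: has_derivative_subset)
qed

lemma Ck_cong:
  assumes "\<And>x. x \<in> S \<Longrightarrow> f x = g x"
  shows "Ck_on k S f \<longleftrightarrow> Ck_on k S g"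
proof -
  have "Ck_on k S g" if f: "Ck_on k S f" and e: "\<And>x. x \<in> S \<Longrightarrow> f x = g x" for f g :: "'a \<Rightarrow> 'b"
  proof (cases k)
    case 0
    then show ?thesis using f continuous_on_cong[OF refl, of S f g] e by simp
  next
    case (Suc j)
    then obtain f' where f': "\<forall>x\<in>S. (f has_derivative f' x) (at x within S)" "\<forall>v. Ck_on j S (\<lambda>x. f' x v)"
      using f by (auto simp only: Ck_on.simps)
    have "(g has_derivative f' x) (at x within S)" if "x \<in> S" for x
      using has_derivative_transform[OF that, of g f "f' x"] e f'(1) that by auto
    with Suc f'(2) show ?thesis by auto
  qed
  from this[of f g] this[of g f] assms show ?thesis by auto
qed

lemma Ck_const: "Ck_on k S (\<lambda>x. c)"
proof (induction k arbitrary: c)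
  case (Suc k)
  have "\<forall>x\<in>S. ((\<lambda>x. c) has_derivative (\<lambda>_. 0)) (at x within S)" by simp
  then show ?case unfolding Ck_on.simps using Suc by (intro exI[of _ "\<lambda>_ _. 0"]) auto
qed simp

lemma Ck_bounded_linear: "bounded_linear f \<Longrightarrow> Ck_on k S f"
proof (cases k)
  case (Suc j)
  assume "bounded_linear f"
  then have "\<forall>x\<in>S. (f has_derivative f) (at x within S)" by (simp add: bounded_linear_imp_has_derivative)
  then show ?thesis unfolding Suc Ck_on.simps
    by (intro exI[of _ "\<lambda>_. f"] conjI) (auto intro: Ck_const)
qed (simp add: linear_continuous_on)

lemma Ck_add:
  "Ck_on k S f \<Longrightarrow> Ck_on k S g \<Longrightarrow> Ck_on k S (\<lambda>x. f x + g x)"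
proof (induction k arbitrary: f g)
  case 0
  then show ?case by (auto intro: continuous_intros)
next
  case (Suc k)
  obtain f' where f': "\<forall>x\<in>S. (f has_derivative f' x) (at x within S)" "\<forall>v. Ck_on k S (\<lambda>x. f' x v)"
    using Suc.prems(1) by (auto simp only: Ck_on.simps)
  obtain g' where g': "\<forall>x\<in>S. (g has_derivative g' x) (at x within S)" "\<forall>v. Ck_on k S (\<lambda>x. g' x v)"
    using Suc.prems(2) by (auto simp only: Ck_on.simps)
  show ?case unfolding Ck_on.simps
    by (intro exI[of _ "\<lambda>x v. f' x v + g' x v"] conjI ballI allI has_derivative_add Suc.IH)
       (use f' g' in auto)
qed

text \<open>The Leibniz rule involves \<open>f\<close> and \<open>g\<close> themselves next to their
  derivatives; by \<open>Ck_mono\<close> these are of class \<open>k\<close> too, so the induction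
  closes.\<close>

lemma Ck_bilinear:
  assumes "bounded_bilinear p"
  shows "Ck_on k S f \<Longrightarrow> Ck_on k S g \<Longrightarrow> Ck_on k S (\<lambda>x. p (f x) (g x))"
proof (induction k arbitrary: f g)
  case 0
  then show ?case using bounded_bilinear.continuous_on[OF assms] by auto
next
  case (Suc k)
  obtain f' where f': "\<forall>x\<in>S. (f has_derivative f' x) (at x within S)" "\<forall>v. Ck_on k S (\<lambda>x. f' x v)"
    using Suc.prems(1) by (auto simp only: Ck_on.simps)
  obtain g' where g': "\<forall>x\<in>S. (g has_derivative g' x) (at x within S)" "\<forall>v. Ck_on k S (\<lambda>x. g' x v)"
    using Suc.prems(2) by (auto simp only: Ck_on.simps)
  note fg = Ck_mono[OF Suc.prems(1)] Ck_mono[OF Suc.prems(2)]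
  show ?case unfolding Ck_on.simps
  proof (intro exI[of _ "\<lambda>x h. p (f x) (g' x h) + p (f' x h) (g x)"] conjI ballI allI)
    fix v
    show "Ck_on k S (\<lambda>x. p (f x) (g' x v) + p (f' x v) (g x))"
      using fg f'(2) g'(2) by (intro Ck_add Suc.IH) auto
  qed (use f' g' bounded_bilinear.FDERIV[OF assms] in blast)
qed

lemma Ck_sum:
  assumes "\<And>i. i \<in> F \<Longrightarrow> Ck_on k S (f i)"
  shows "Ck_on k S (\<lambda>x. \<Sum>i\<in>F. f i x)"
  using assms by (induction F rule: infinite_finite_induct) (auto intro: Ck_const Ck_add)

lemma Ck_compose_linear:
  assumes "bounded_linear h" "Ck_on k S f"
  shows "Ck_on k S (\<lambda>x. h (f x))"
  using assms(2)
proof (induction k arbitrary: f)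
  case 0
  then show ?case using assms(1)
    by (auto intro: bounded_linear.continuous_on)
next
  case (Suc k)
  obtain f' where f': "\<forall>x\<in>S. (f has_derivative f' x) (at x within S)" "\<forall>v. Ck_on k S (\<lambda>x. f' x v)"
    using Suc.prems(1) by (auto simp only: Ck_on.simps)
  show ?case unfolding Ck_on.simps
    by (intro exI[of _ "\<lambda>x v. h (f' x v)"] conjI ballI allI bounded_linear.has_derivative[OF assms(1)]
        Suc.IH) (use f' in auto)
qed

text \<open>In the chain rule the vector \<open>f' x v\<close> fed into \<open>g'\<close> moves with
  \<open>x\<close>, whereas \<open>Ck_on\<close> speaks of derivatives in fixed directions only.
  Expanding this vector in coordinates of the intermediate space reduces the claim to fixed
  directions.\<close>

lemma Ck_compose:
  fixes f :: "'a::real_normed_vector \<Rightarrow> 'b::real_inner" and g :: "'b \<Rightarrow> 'c::real_normed_vector"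
  assumes "fin_dim TYPE('b)"
  shows "Ck_on k S f \<Longrightarrow> Ck_on k U g \<Longrightarrow> f ` S \<subseteq> U \<Longrightarrow> Ck_on k S (\<lambda>x. g (f x))"
proof (induction k arbitrary: f g)
  case 0
  then show ?case by (auto intro: continuous_on_compose2)
next
  case (Suc k)
  obtain E w where E: "finite (E::'b set)" "\<And>x. x = (\<Sum>b\<in>E. (x \<bullet> w b) *\<^sub>R b)"
    using fin_dim_coords[OF assms] by metis
  obtain f' where f': "\<forall>x\<in>S. (f has_derivative f' x) (at x within S)" "\<forall>v. Ck_on k S (\<lambda>x. f' x v)"
    using Suc.prems(1) by (auto simp only: Ck_on.simps)
  obtain g' where g': "\<forall>x\<in>U. (g has_derivative g' x) (at x within U)" "\<forall>v. Ck_on k U (\<lambda>x. g' x v)"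
    using Suc.prems(2) by (auto simp only: Ck_on.simps)
  note fg = Ck_mono[OF Suc.prems(1)]
  show ?case unfolding Ck_on.simps
  proof (intro exI[of _ "\<lambda>x v. g' (f x) (f' x v)"] conjI ballI allI)
    show "((\<lambda>x. g (f x)) has_derivative (\<lambda>v. g' (f x) (f' x v))) (at x within S)" if "x \<in> S" for x
      using has_derivative_in_compose2[of U g g' f S x "f' x"] f' g' Suc.prems(3) that by auto
    fix v
    have "g' (f x) (f' x v) = (\<Sum>b\<in>E. (f' x v \<bullet> w b) *\<^sub>R g' (f x) b)" if "x \<in> S" for x
    proof -
      have "linear (g' (f x))"
        using g'(1) that Suc.prems(3) by (meson has_derivative_linear image_subset_iff)
      then show ?thesis using fin_dim_linear_sum[OF _ E(2)] by blast
    qed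
    moreover have "Ck_on k S (\<lambda>x. (\<Sum>b\<in>E. (f' x v \<bullet> w b) *\<^sub>R g' (f x) b))"
      by (intro Ck_sum Ck_bilinear[OF bounded_bilinear_scaleR] Ck_bilinear[OF bounded_bilinear_inner]
          Ck_const Suc.IH fg Suc.prems(3)) (use f' g' in auto)
    ultimately show "Ck_on k S (\<lambda>x. g' (f x) (f' x v))"
      by (subst Ck_cong) auto
  qed
qed

lemma has_derivative_at_within_Int_open:
  assumes "x \<in> V" "open V"
  shows "(f has_derivative D) (at x within S \<inter> V) \<longleftrightarrow> (f has_derivative D) (at x within S)"
proof -
  have "at x within S \<inter> V = at x within S"
    by (rule at_within_nhd[OF assms]) auto
  then show ?thesis by simp
qed

text \<open>The locally chosen derivative functions glue to a single one because derivatives within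
  a fat set are unique.\<close>

lemma Ck_local:
  assumes "fat S" "\<And>x. x \<in> S \<Longrightarrow> \<exists>V. open V \<and> x \<in> V \<and> Ck_on k (S \<inter> V) f"
  shows "Ck_on k S f"
  using assms(2)
proof (induction k arbitrary: f)
  case 0
  show ?case unfolding Ck_on.simps continuous_on_eq_continuous_within
  proof
    fix x assume x: "x \<in> S"
    obtain V where V: "open V" "x \<in> V" "continuous_on (S \<inter> V) f" using 0[OF x] by auto
    then have "continuous (at x within S \<inter> V) f" using x by (auto simp: continuous_on_eq_continuous_within)
    moreover have "at x within S \<inter> V = at x within S"
      by (rule at_within_nhd[OF V(2,1)]) auto
    ultimately show "continuous (at x within S) f" by simp
  qed
next
  case (Suc k)
  have "\<exists>D. (f has_derivative D) (at x within S)" if "x \<in> S" for x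
    using Suc.prems[OF that] that by (fastforce simp: has_derivative_at_within_Int_open)
  then obtain F where F: "\<And>x. x \<in> S \<Longrightarrow> (f has_derivative F x) (at x within S)" by metis
  have "Ck_on k S (\<lambda>x. F x v)" for v
  proof (rule Suc.IH)
    fix x assume x: "x \<in> S"
    obtain V f' where V: "open V" "x \<in> V" "\<forall>y\<in>S\<inter>V. (f has_derivative f' y) (at y within S \<inter> V)"
      "\<forall>v. Ck_on k (S \<inter> V) (\<lambda>x. f' x v)" using Suc.prems[OF x] by auto
    have "f' y = F y" if "y \<in> S \<inter> V" for y
      using fat_unique_derivative[OF assms(1), of y f] that V(1,3) F
      by (auto simp: has_derivative_at_within_Int_open)
    then have "Ck_on k (S \<inter> V) (\<lambda>x. F x v)"
      using V(4) Ck_cong[of "S \<inter> V" "\<lambda>x. f' x v" "\<lambda>x. F x v"] by auto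
    with V show "\<exists>V. open V \<and> x \<in> V \<and> Ck_on k (S \<inter> V) (\<lambda>x. F x v)" by blast
  qed
  then show ?case using F by auto
qed

subsection \<open>Smooth functions\<close>

lemma smooth_const: "smooth_on S (\<lambda>x. c)"
  by (simp add: smooth_on_def Ck_const)

lemma smooth_bounded_linear: "bounded_linear f \<Longrightarrow> smooth_on S f"
  by (simp add: smooth_on_def Ck_bounded_linear)

lemma smooth_ident: "smooth_on S (\<lambda>x. x)"
  by (rule smooth_bounded_linear) simp

lemma smooth_subset: "smooth_on S f \<Longrightarrow> T \<subseteq> S \<Longrightarrow> smooth_on T f"
  unfolding smooth_on_def using Ck_subset by blast

lemma smooth_cong: "(\<And>x. x \<in> S \<Longrightarrow> f x = g x) \<Longrightarrow> smooth_on S f \<longleftrightarrow> smooth_on S g"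
  unfolding smooth_on_def using Ck_cong by blast

lemma smooth_add: "smooth_on S f \<Longrightarrow> smooth_on S g \<Longrightarrow> smooth_on S (\<lambda>x. f x + g x)"
  unfolding smooth_on_def using Ck_add by blast

lemma smooth_sum: "(\<And>i. i \<in> F \<Longrightarrow> smooth_on S (f i)) \<Longrightarrow> smooth_on S (\<lambda>x. \<Sum>i\<in>F. f i x)"
  unfolding smooth_on_def using Ck_sum[of F] by blast

lemma smooth_bilinear:
  "bounded_bilinear p \<Longrightarrow> smooth_on S f \<Longrightarrow> smooth_on S g \<Longrightarrow> smooth_on S (\<lambda>x. p (f x) (g x))"
  unfolding smooth_on_def using Ck_bilinear by blast

lemmas smooth_scaleR = smooth_bilinear[OF bounded_bilinear_scaleR]
lemmas smooth_mult = smooth_bilinear[OF bounded_bilinear_mult]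
lemmas smooth_inner = smooth_bilinear[OF bounded_bilinear_inner]

lemma smooth_compose_linear: "bounded_linear h \<Longrightarrow> smooth_on S f \<Longrightarrow> smooth_on S (\<lambda>x. h (f x))"
  unfolding smooth_on_def using Ck_compose_linear by blast

lemma smooth_diff: "smooth_on S f \<Longrightarrow> smooth_on S g \<Longrightarrow> smooth_on S (\<lambda>x. f x - g x)"
  using smooth_add[of S f "\<lambda>x. - g x"] smooth_compose_linear[OF bounded_linear_minus[OF bounded_linear_ident]]
  by fastforce

lemma smooth_Pair:
  assumes "smooth_on S f" "smooth_on S g" shows "smooth_on S (\<lambda>x. (f x, g x))"
proof -
  have "smooth_on S (\<lambda>x. (f x, 0) + (0, g x))"
    using assms by (intro smooth_add smooth_compose_linear[of "\<lambda>x. (x, 0)"]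
        smooth_compose_linear[of "\<lambda>x. (0, x)"] bounded_linear_Pair bounded_linear_ident bounded_linear_zero)
  then show ?thesis by simp
qed

lemma smooth_fst: "smooth_on S f \<Longrightarrow> smooth_on S (\<lambda>x. fst (f x))"
  by (rule smooth_compose_linear[OF bounded_linear_fst])

lemma smooth_snd: "smooth_on S f \<Longrightarrow> smooth_on S (\<lambda>x. snd (f x))"
  by (rule smooth_compose_linear[OF bounded_linear_snd])

lemma smooth_compose:
  fixes f :: "'a::real_normed_vector \<Rightarrow> 'b::real_inner"
  shows "fin_dim TYPE('b) \<Longrightarrow> smooth_on U g \<Longrightarrow> smooth_on S f \<Longrightarrow> f ` S \<subseteq> U \<Longrightarrow> smooth_on S (\<lambda>x. g (f x))"
  unfolding smooth_on_def using Ck_compose by blast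

lemma smooth_local:
  assumes "fat S" "\<And>x. x \<in> S \<Longrightarrow> \<exists>V. open V \<and> x \<in> V \<and> smooth_on (S \<inter> V) f"
  shows "smooth_on S f"
  unfolding smooth_on_def using Ck_local[OF assms(1)] assms(2) unfolding smooth_on_def by metis

lemma smooth_continuous: "smooth_on S f \<Longrightarrow> continuous_on S f"
  unfolding smooth_on_def using Ck_continuous by blast

text \<open>For each order \<open>Ck_on\<close> provides some derivative of its own; by uniqueness
  they all agree with the given \<open>f'\<close>.\<close>

lemma smooth_derivative_within:
  assumes "smooth_on S f" "fat S" "\<And>x. x \<in> S \<Longrightarrow> (f has_derivative f' x) (at x within S)"
  shows "smooth_on S (\<lambda>x. f' x v)"
  unfolding smooth_on_def
proof
  fix k
  obtain g where g: "\<forall>x\<in>S. (f has_derivative g x) (at x within S)" "\<forall>v. Ck_on k S (\<lambda>x. g x v)"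
    using assms(1) unfolding smooth_on_def by (metis Ck_on.simps(2))
  have "g x = f' x" if "x \<in> S" for x
    using fat_unique_derivative[OF assms(2) that] g(1) assms(3) that by blast
  then show "Ck_on k S (\<lambda>x. f' x v)"
    using g(2) Ck_cong[of S "\<lambda>x. g x v" "\<lambda>x. f' x v"] by auto
qed

lemma smooth_has_derivative_within:
  assumes "smooth_on S f" "x \<in> S"
  obtains D where "(f has_derivative D) (at x within S)"
  using assms unfolding smooth_on_def by (metis Ck_on.simps(2))

abbreviation DD :: "('a::real_normed_vector \<Rightarrow> 'b::real_normed_vector) \<Rightarrow> 'a \<Rightarrow> 'a \<Rightarrow> 'b" where
  "DD f x \<equiv> frechet_derivative f (at x)"

lemma DD_eq: "(f has_derivative D) (at x) \<Longrightarrow> DD f x = D"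
  using frechet_derivative_at by metis

lemma smooth_has_derivative:
  assumes "smooth_on S f" "open S" "x \<in> S"
  shows "(f has_derivative DD f x) (at x)"
proof -
  obtain D where "(f has_derivative D) (at x within S)"
    using smooth_has_derivative_within[OF assms(1,3)] .
  then have "(f has_derivative D) (at x)" using assms(2,3) at_within_open by metis
  then show ?thesis using DD_eq by metis
qed

lemma smooth_DD:
  assumes "smooth_on S f" "open S"
  shows "smooth_on S (\<lambda>x. DD f x v)"
proof (rule smooth_derivative_within[OF assms(1) fat_open[OF assms(2)]])
  fix x assume "x \<in> S"
  then show "(f has_derivative DD f x) (at x within S)"
    using smooth_has_derivative[OF assms] has_derivative_at_withinI by blast
qed

lemma DD_cong:
  assumes "open S" "x \<in> S" "\<And>y. y \<in> S \<Longrightarrow> f y = g y"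
  shows "DD f x = DD g x"
proof -
  have "(f has_derivative D) (at x) \<longleftrightarrow> (g has_derivative D) (at x)" for D
    using has_derivative_transform_within_open[OF _ assms(1,2)] assms(3) by metis
  then show ?thesis by (simp add: frechet_derivative_def)
qed

lemma linear_DD: "smooth_on S f \<Longrightarrow> open S \<Longrightarrow> x \<in> S \<Longrightarrow> linear (DD f x)"
  using smooth_has_derivative has_derivative_linear by blast

text \<open>Families of linear maps are treated throughout as families that are smooth at each fixed
  argument. Coordinates then admit an argument that moves with the parameter.\<close>

lemma Ck_apply:
  fixes T :: "'a::real_normed_vector \<Rightarrow> 'b::real_inner \<Rightarrow> 'c::real_normed_vector"
  assumes "fin_dim TYPE('b)" "\<And>v. Ck_on k S (\<lambda>x. T x v)" "\<And>x. x \<in> S \<Longrightarrow> linear (T x)" "Ck_on k S u"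
  shows "Ck_on k S (\<lambda>x. T x (u x))"
proof -
  obtain E w where E: "finite (E::'b set)" "\<And>x. x = (\<Sum>b\<in>E. (x \<bullet> w b) *\<^sub>R b)"
    using fin_dim_coords[OF assms(1)] by metis
  have "Ck_on k S (\<lambda>x. (\<Sum>b\<in>E. (u x \<bullet> w b) *\<^sub>R T x b))"
    by (intro Ck_sum Ck_bilinear[OF bounded_bilinear_scaleR] Ck_bilinear[OF bounded_bilinear_inner]
        Ck_const assms)
  then show ?thesis
    by (rule Ck_cong[THEN iffD1, rotated]) (rule fin_dim_linear_sum[OF assms(3) E(2), symmetric])
qed

lemma smooth_apply:
  fixes T :: "'a::real_normed_vector \<Rightarrow> 'b::real_inner \<Rightarrow> 'c::real_normed_vector"
  assumes "fin_dim TYPE('b)" "\<And>v. smooth_on S (\<lambda>x. T x v)" "\<And>x. x \<in> S \<Longrightarrow> linear (T x)" "smooth_on S u"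
  shows "smooth_on S (\<lambda>x. T x (u x))"
  unfolding smooth_on_def
proof
  show "Ck_on k S (\<lambda>x. T x (u x))" for k
    by (rule Ck_apply[OF assms(1) _ assms(3)]) (use assms(2,4) in \<open>simp_all add: smooth_on_def\<close>)
qed

text \<open>The product rule for a family of linear maps applied to a moving argument;
  \<open>T' v\<close> is the derivative with the argument frozen at \<open>v\<close>.\<close>

lemma has_derivative_apply:
  fixes T :: "'a::real_normed_vector \<Rightarrow> 'b::real_inner \<Rightarrow> 'c::real_normed_vector"
  assumes "fin_dim TYPE('b)" "\<And>v. ((\<lambda>x. T x v) has_derivative T' v) (at x within S)"
    "\<And>x. x \<in> S \<Longrightarrow> linear (T x)" "(u has_derivative u') (at x within S)" "x \<in> S" "fat S"
  shows "((\<lambda>x. T x (u x)) has_derivative (\<lambda>h. T' (u x) h + T x (u' h))) (at x within S)"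
proof -
  obtain E w where E: "finite (E::'b set)" "\<And>x. x = (\<Sum>b\<in>E. (x \<bullet> w b) *\<^sub>R b)"
    using fin_dim_coords[OF assms(1)] by metis
  note s = fin_dim_linear_sum[OF assms(3) E(2)]
  have D: "((\<lambda>x. \<Sum>b\<in>E. (u x \<bullet> w b) *\<^sub>R T x b) has_derivative
      (\<lambda>h. \<Sum>b\<in>E. (u x \<bullet> w b) *\<^sub>R T' b h + (u' h \<bullet> w b) *\<^sub>R T x b)) (at x within S)"
    by (intro has_derivative_sum has_derivative_scaleR assms(2)
        bounded_linear.has_derivative[OF bounded_linear_inner_left assms(4)])
  have T': "T' (u x) = (\<lambda>h. \<Sum>b\<in>E. (u x \<bullet> w b) *\<^sub>R T' b h)"
  proof (rule fat_unique_derivative[OF assms(6,5,2)])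
    have "((\<lambda>y. \<Sum>b\<in>E. (u x \<bullet> w b) *\<^sub>R T y b) has_derivative (\<lambda>h. \<Sum>b\<in>E. (u x \<bullet> w b) *\<^sub>R T' b h)) (at x within S)"
      by (intro has_derivative_sum has_derivative_scaleR_right assms(2))
    then show "((\<lambda>y. T y (u x)) has_derivative (\<lambda>h. \<Sum>b\<in>E. (u x \<bullet> w b) *\<^sub>R T' b h)) (at x within S)"
      by (rule has_derivative_transform[OF assms(5), rotated]) (rule s)
  qed
  have "((\<lambda>x. T x (u x)) has_derivative (\<lambda>h. \<Sum>b\<in>E. (u x \<bullet> w b) *\<^sub>R T' b h + (u' h \<bullet> w b) *\<^sub>R T x b)) (at x within S)"
    by (rule has_derivative_transform[OF assms(5) _ D]) (rule s)
  moreover have "(\<lambda>h. \<Sum>b\<in>E. (u x \<bullet> w b) *\<^sub>R T' b h + (u' h \<bullet> w b) *\<^sub>R T x b) = (\<lambda>h. T' (u x) h + T x (u' h))"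
    unfolding T' by (rule ext) (simp add: sum.distrib flip: s[OF assms(5)])
  ultimately show ?thesis by simp
qed

subsection \<open>Symmetry of second derivatives\<close>

lemma DERIV_along_line:
  fixes g :: "'a::real_normed_vector \<Rightarrow> real"
  assumes "smooth_on S g" "open S" "y + s *\<^sub>R u \<in> S"
  shows "((\<lambda>s. g (y + s *\<^sub>R u)) has_real_derivative DD g (y + s *\<^sub>R u) u) (at s)"
proof -
  have g: "(g has_derivative DD g (y + s *\<^sub>R u)) (at (y + s *\<^sub>R u))"
    by (rule smooth_has_derivative[OF assms])
  have "((\<lambda>s. y + s *\<^sub>R u) has_derivative (\<lambda>r. r *\<^sub>R u)) (at s)"
    by (auto intro!: derivative_eq_intros)
  from has_derivative_compose[OF this g]
  have "((\<lambda>s. g (y + s *\<^sub>R u)) has_derivative (\<lambda>r. DD g (y + s *\<^sub>R u) (r *\<^sub>R u))) (at s)" .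
  then show ?thesis
    unfolding has_field_derivative_def
    using linear_cmul[OF has_derivative_linear[OF g]] by (simp add: mult.commute[of _ "DD g _ _"])
qed

text \<open>The mean value theorem is applied first in direction \<open>u\<close>, then in direction
  \<open>v\<close>. The second difference on the left is symmetric in \<open>u\<close> and
  \<open>v\<close>, so it can be evaluated in both orders.\<close>

lemma second_difference:
  fixes g :: "'a::real_normed_vector \<Rightarrow> real"
  assumes g: "smooth_on S g" "open S" and h: "h > 0"
    and S: "\<And>r s. 0 \<le> r \<Longrightarrow> r \<le> h \<Longrightarrow> 0 \<le> s \<Longrightarrow> s \<le> h \<Longrightarrow> x + s *\<^sub>R u + r *\<^sub>R v \<in> S"
  obtains r s where "0 \<le> r" "r \<le> h" "0 \<le> s" "s \<le> h"
    "g (x + h *\<^sub>R u + h *\<^sub>R v) - g (x + h *\<^sub>R u) - g (x + h *\<^sub>R v) + g x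
      = h * h * DD (\<lambda>y. DD g y u) (x + s *\<^sub>R u + r *\<^sub>R v) v"
proof -
  have S': "x + h *\<^sub>R v + s *\<^sub>R u \<in> S" "x + s *\<^sub>R u \<in> S" if "0 \<le> s" "s \<le> h" for s
    using S[of h s] S[of 0 s] that h by (auto simp: add_ac)
  have "\<exists>s>0. s < h \<and> (g (x + h *\<^sub>R v + h *\<^sub>R u) - g (x + h *\<^sub>R u)) - (g (x + h *\<^sub>R v + 0 *\<^sub>R u) - g (x + 0 *\<^sub>R u))
      = (h - 0) * (DD g (x + h *\<^sub>R v + s *\<^sub>R u) u - DD g (x + s *\<^sub>R u) u)"
    using h S' by (intro MVT2) (auto intro!: DERIV_diff DERIV_along_line[OF g])
  then obtain s where s: "0 < s" "s < h" "(g (x + h *\<^sub>R v + h *\<^sub>R u) - g (x + h *\<^sub>R u)) - (g (x + h *\<^sub>R v) - g x)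
      = h * (DD g (x + h *\<^sub>R v + s *\<^sub>R u) u - DD g (x + s *\<^sub>R u) u)" by auto
  have "\<exists>r>0. r < h \<and> DD g (x + s *\<^sub>R u + h *\<^sub>R v) u - DD g (x + s *\<^sub>R u + 0 *\<^sub>R v) u
      = (h - 0) * DD (\<lambda>y. DD g y u) (x + s *\<^sub>R u + r *\<^sub>R v) v"
    using h S s by (intro MVT2 DERIV_along_line[OF smooth_DD[OF g] g(2)]) auto
  then obtain r where r: "0 < r" "r < h" "DD g (x + s *\<^sub>R u + h *\<^sub>R v) u - DD g (x + s *\<^sub>R u) u
      = h * DD (\<lambda>y. DD g y u) (x + s *\<^sub>R u + r *\<^sub>R v) v" by auto
  show ?thesis
    by (rule that[of r s]) (use r s in \<open>auto simp: algebra_simps\<close>)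
qed

text \<open>One second difference, computed in both orders, gives equal values of the two mixed
  derivatives at two points near \<open>x\<close>. Both derivatives are continuous at
  \<open>x\<close>.\<close>

lemma DD_symmetric_real:
  fixes g :: "'a::real_normed_vector \<Rightarrow> real"
  assumes g: "smooth_on S g" "open S" and x: "x \<in> S"
  shows "DD (\<lambda>y. DD g y u) x v = DD (\<lambda>y. DD g y v) x u"
proof -
  define A where "A y = DD (\<lambda>y. DD g y u) y v" for y
  define B where "B y = DD (\<lambda>y. DD g y v) y u" for y
  have "\<bar>A x - B x\<bar> \<le> 0 + e" if e: "e > 0" for e
  proof -
    have "smooth_on S A" "smooth_on S B"
      unfolding A_def B_def by (intro smooth_DD g)+
    then have "isCont A x" "isCont B x"
      using smooth_continuous continuous_on_eq_continuous_at[OF g(2)] x by auto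
    then have "(A \<longlongrightarrow> A x) (nhds x)" "(B \<longlongrightarrow> B x) (nhds x)"
      by (auto simp: isCont_def tendsto_nhds_iff)
    then have "\<forall>\<^sub>F y in nhds x. dist (A y) (A x) < e / 2" "\<forall>\<^sub>F y in nhds x. dist (B y) (B x) < e / 2"
      using e half_gt_zero[OF e] unfolding tendsto_iff by blast+
    moreover have "\<forall>\<^sub>F y in nhds x. y \<in> S" using g(2) x by (rule eventually_nhds_in_open)
    ultimately have "\<forall>\<^sub>F y in nhds x. dist (A y) (A x) < e / 2 \<and> dist (B y) (B x) < e / 2 \<and> y \<in> S"
      by eventually_elim auto
    then obtain d where d: "d > 0"
      "\<And>y. dist y x < d \<Longrightarrow> dist (A y) (A x) < e / 2 \<and> dist (B y) (B x) < e / 2 \<and> y \<in> S"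
      unfolding eventually_nhds_metric by auto
    \<comment> \<open>The parallelogram spanned by \<open>h *\<^sub>R u\<close> and
      \<open>h *\<^sub>R v\<close> then stays within distance \<open>d\<close> of \<open>x\<close>,
      where both mixed derivatives vary by less than \<open>e / 2\<close>. The summand 1 keeps the
      denominator positive.\<close>
    define h where "h = d / (2 * (norm u + norm v + 1))"
    have n: "norm u + norm v + 1 > 0" using norm_ge_zero[of u] norm_ge_zero[of v] by linarith
    have h: "h > 0" using d n by (simp add: h_def)
    have close: "dist (x + s *\<^sub>R u + r *\<^sub>R v) x < d" if "0 \<le> r" "r \<le> h" "0 \<le> s" "s \<le> h" for r s
    proof -
      have "dist (x + s *\<^sub>R u + r *\<^sub>R v) x = norm (s *\<^sub>R u + r *\<^sub>R v)" by (simp add: dist_norm)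
      also have "\<dots> \<le> s * norm u + r * norm v" using that norm_triangle_ineq[of "s *\<^sub>R u" "r *\<^sub>R v"] by simp
      also have "\<dots> \<le> h * norm u + h * norm v" using that by (intro add_mono mult_right_mono) auto
      also have "\<dots> \<le> h * (norm u + norm v + 1)" using h by (simp add: algebra_simps)
      also have "\<dots> = d / 2" using n by (simp add: h_def field_simps)
      also have "\<dots> < d" using d(1) by simp
      finally show ?thesis .
    qed
    obtain r s where 1: "0 \<le> r" "r \<le> h" "0 \<le> s" "s \<le> h"
      "g (x + h *\<^sub>R u + h *\<^sub>R v) - g (x + h *\<^sub>R u) - g (x + h *\<^sub>R v) + g x = h * h * A (x + s *\<^sub>R u + r *\<^sub>R v)"
      using second_difference[OF g h, of x u v] close d(2) unfolding A_def by metis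
    have close': "dist (x + s *\<^sub>R v + r *\<^sub>R u) x < d" if "0 \<le> r" "r \<le> h" "0 \<le> s" "s \<le> h" for r s
      using close[of s r] that by (simp add: add_ac)
    obtain r' s' where 2: "0 \<le> r'" "r' \<le> h" "0 \<le> s'" "s' \<le> h"
      "g (x + h *\<^sub>R v + h *\<^sub>R u) - g (x + h *\<^sub>R v) - g (x + h *\<^sub>R u) + g x = h * h * B (x + s' *\<^sub>R v + r' *\<^sub>R u)"
      using second_difference[OF g h, of x v u] close' d(2) unfolding B_def by metis
    have "h * h * A (x + s *\<^sub>R u + r *\<^sub>R v) = h * h * B (x + s' *\<^sub>R v + r' *\<^sub>R u)"
      using 1(5) 2(5) by (simp add: add_ac algebra_simps)
    then have "A (x + s *\<^sub>R u + r *\<^sub>R v) = B (x + s' *\<^sub>R v + r' *\<^sub>R u)" using h by simp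
    moreover have "dist (A (x + s *\<^sub>R u + r *\<^sub>R v)) (A x) < e / 2" "dist (B (x + s' *\<^sub>R v + r' *\<^sub>R u)) (B x) < e / 2"
      using d(2) close[OF 1(1-4)] close'[OF 2(1-4)] by auto
    ultimately show ?thesis by (auto simp: dist_real_def abs_if split: if_splits)
  qed
  then have "\<bar>A x - B x\<bar> \<le> 0" by (rule field_le_epsilon)
  then show ?thesis by (simp add: A_def B_def)
qed

lemma DD_compose_linear:
  assumes "bounded_linear h" "smooth_on S f" "open S" "x \<in> S"
  shows "DD (\<lambda>y. h (f y)) x = (\<lambda>v. h (DD f x v))"
  by (intro DD_eq bounded_linear.has_derivative[OF assms(1)] smooth_has_derivative[OF assms(2-4)])

text \<open>Inner products with fixed vectors reduce the claim to real-valued functions.\<close>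

lemma DD_symmetric:
  fixes f :: "'a::real_normed_vector \<Rightarrow> 'b::real_inner"
  assumes f: "smooth_on S f" "open S" and x: "x \<in> S"
  shows "DD (\<lambda>y. DD f y u) x v = DD (\<lambda>y. DD f y v) x u"
proof -
  have "DD (\<lambda>y. DD f y u) x v \<bullet> z = DD (\<lambda>y. DD f y v) x u \<bullet> z" for z
  proof -
    have bl: "bounded_linear (\<lambda>y::'b. y \<bullet> z)" by (rule bounded_linear_inner_left)
    have g: "smooth_on S (\<lambda>y. f y \<bullet> z)" by (rule smooth_compose_linear[OF bl f(1)])
    have *: "DD (\<lambda>y. DD f y u) x v \<bullet> z = DD (\<lambda>y. DD (\<lambda>y. f y \<bullet> z) y u) x v" for u v
    proof -
      have "DD (\<lambda>y. DD (\<lambda>y. f y \<bullet> z) y u) x = DD (\<lambda>y. DD f y u \<bullet> z) x"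
        by (rule DD_cong[OF f(2) x]) (simp add: DD_compose_linear[OF bl f])
      then show ?thesis by (simp add: DD_compose_linear[OF bl smooth_DD[OF f] f(2) x])
    qed
    show ?thesis using DD_symmetric_real[OF g f(2) x] * by simp
  qed
  then have "(DD (\<lambda>y. DD f y u) x v - DD (\<lambda>y. DD f y v) x u) \<bullet> z = 0" for z
    by (simp add: inner_diff_left)
  then show ?thesis by (metis inner_eq_zero_iff right_minus_eq)
qed

subsection \<open>Smooth families of linear maps\<close>

text \<open>A factor that vanishes at \<open>x\<close> makes the product differentiable there even
  if \<open>k\<close> is only continuous. This breaks the circle in differentiating an inverse,
  where \<open>k\<close> is the inverse itself.\<close>

lemma has_derivative_scaleR_zero:
  fixes f :: "'a::real_normed_vector \<Rightarrow> real" and k :: "'a \<Rightarrow> 'b::real_normed_vector"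
  assumes f: "(f has_derivative f') (at x within S)" "f x = 0" and k: "(k \<longlongrightarrow> k x) (at x within S)"
  shows "((\<lambda>y. f y *\<^sub>R k y) has_derivative (\<lambda>h. f' h *\<^sub>R k x)) (at x within S)"
proof -
  note bl = has_derivative_bounded_linear[OF f(1)]
  obtain K where K: "\<And>h. norm (f' h) \<le> norm h * K" using bounded_linear.bounded[OF bl] by auto
  have "((\<lambda>y. ((f y - f x - f' (y - x)) /\<^sub>R norm (y - x)) *\<^sub>R k y) \<longlongrightarrow> 0 *\<^sub>R k x) (at x within S)"
    using f(1) by (intro tendsto_scaleR k) (simp add: has_derivative_at_within)
  moreover have "((\<lambda>y. (f' (y - x) / norm (y - x)) *\<^sub>R (k y - k x)) \<longlongrightarrow> 0) (at x within S)"
  proof (rule Lim_null_comparison[of _ "\<lambda>y. \<bar>K\<bar> * norm (k y - k x)"])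
    show "\<forall>\<^sub>F y in at x within S. norm ((f' (y - x) / norm (y - x)) *\<^sub>R (k y - k x)) \<le> \<bar>K\<bar> * norm (k y - k x)"
    proof (rule always_eventually, rule allI)
      fix y
      have "\<bar>f' (y - x)\<bar> \<le> norm (y - x) * \<bar>K\<bar>"
        using K[of "y - x"] mult_left_mono[of K "\<bar>K\<bar>" "norm (y - x)", OF abs_ge_self norm_ge_zero] by simp
      then have "\<bar>f' (y - x)\<bar> / norm (y - x) \<le> \<bar>K\<bar>"
        by (cases "y = x") (auto simp: divide_le_eq mult.commute)
      then show "norm ((f' (y - x) / norm (y - x)) *\<^sub>R (k y - k x)) \<le> \<bar>K\<bar> * norm (k y - k x)"
        using mult_right_mono[of "\<bar>f' (y - x)\<bar> / norm (y - x)" "\<bar>K\<bar>" "norm (k y - k x)"] by (simp add: abs_divide)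
    qed
    show "((\<lambda>y. \<bar>K\<bar> * norm (k y - k x)) \<longlongrightarrow> 0) (at x within S)"
      using k by (intro tendsto_mult_right_zero tendsto_norm_zero) (simp add: LIM_zero)
  qed
  ultimately have "((\<lambda>y. ((f y - f x - f' (y - x)) /\<^sub>R norm (y - x)) *\<^sub>R k y
      + (f' (y - x) / norm (y - x)) *\<^sub>R (k y - k x)) \<longlongrightarrow> 0 *\<^sub>R k x + 0) (at x within S)"
    by (rule tendsto_add)
  moreover have "((f y - f x - f' (y - x)) /\<^sub>R norm (y - x)) *\<^sub>R k y + (f' (y - x) / norm (y - x)) *\<^sub>R (k y - k x)
    = (f y *\<^sub>R k y - f x *\<^sub>R k x - f' (y - x) *\<^sub>R k x) /\<^sub>R norm (y - x)" for y
    using f(2) by (simp add: algebra_simps divide_inverse)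
  ultimately show ?thesis
    using f(2) bl by (simp add: has_derivative_at_within bounded_linear_scaleR_const)
qed

text \<open>Linearity in the argument survives differentiation in the parameter, so that
  \<open>Ck_apply\<close> can be used on the derivative of a family.\<close>

lemma linear_DD_family:
  fixes T :: "'a::real_normed_vector \<Rightarrow> 'b::real_vector \<Rightarrow> 'c::real_normed_vector"
  assumes S: "open S" and T: "\<And>v. smooth_on S (\<lambda>x. T x v)" "\<And>x. x \<in> S \<Longrightarrow> linear (T x)" and x: "x \<in> S"
  shows "linear (\<lambda>u. DD (\<lambda>y. T y u) x h)"
proof (rule linearI)
  note D = smooth_has_derivative[OF T(1) S x]
  show "DD (\<lambda>y. T y (a + b)) x h = DD (\<lambda>y. T y a) x h + DD (\<lambda>y. T y b) x h" for a b
    using DD_cong[OF S x, of "\<lambda>y. T y (a + b)" "\<lambda>y. T y a + T y b"]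
      DD_eq[OF has_derivative_add[OF D[of a] D[of b]]] by (simp add: linear_add[OF T(2)])
  show "DD (\<lambda>y. T y (r *\<^sub>R a)) x h = r *\<^sub>R DD (\<lambda>y. T y a) x h" for a r
    using DD_cong[OF S x, of "\<lambda>y. T y (r *\<^sub>R a)" "\<lambda>y. r *\<^sub>R T y a"]
      DD_eq[OF has_derivative_scaleR_right[OF D[of a]]] by (simp add: linear_cmul[OF T(2)])
qed

text \<open>The derivative of the identity \<open>T y (u y) = k\<close>. With the connection form or
  the differential of the projection as \<open>T\<close>, it trades the derivative of a field for a
  derivative of \<open>T\<close>.\<close>

lemma DD_apply_zero:
  fixes T :: "'a::real_normed_vector \<Rightarrow> 'b::real_inner \<Rightarrow> 'c::real_normed_vector"
  assumes fb: "fin_dim TYPE('b)" and S: "open S" and T: "\<And>v. smooth_on S (\<lambda>x. T x v)" "\<And>x. x \<in> S \<Longrightarrow> linear (T x)"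
    and u: "smooth_on S u" and x: "x \<in> S" and k: "\<And>y. y \<in> S \<Longrightarrow> T y (u y) = k"
  shows "DD (\<lambda>y. T y (u x)) x h + T x (DD u x h) = 0"
proof -
  have "((\<lambda>y. T y (u y)) has_derivative (\<lambda>h. DD (\<lambda>y. T y (u x)) x h + T x (DD u x h))) (at x within S)"
    by (rule has_derivative_apply[OF fb has_derivative_at_withinI[OF smooth_has_derivative[OF T(1) S x]] T(2)
        has_derivative_at_withinI[OF smooth_has_derivative[OF u S x]] x fat_open[OF S]])
  moreover have "((\<lambda>y. T y (u y)) has_derivative (\<lambda>h. 0)) (at x within S)"
    by (rule has_derivative_transform[OF x k has_derivative_const])
  ultimately have "(\<lambda>h. DD (\<lambda>y. T y (u x)) x h + T x (DD u x h)) = (\<lambda>h. 0)"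
    by (rule fat_unique_derivative[OF fat_open[OF S] x])
  then show ?thesis by (rule fun_cong)
qed

text \<open>Continuity of the inverse comes first, then differentiability, then higher orders: the
  derivative is minus \<open>R\<close> after the derivative of \<open>T\<close> after
  \<open>R\<close>, so it is as smooth as \<open>R\<close> is already known to be, and an induction
  on the order closes.\<close>

lemma smooth_inverse_family:
  fixes T :: "'a::real_normed_vector \<Rightarrow> 'b::real_inner \<Rightarrow> 'c::real_inner"
  assumes fb: "fin_dim TYPE('b)" and fc: "fin_dim TYPE('c)" and S: "open S"
    and T: "\<And>v. smooth_on S (\<lambda>x. T x v)" "\<And>x. x \<in> S \<Longrightarrow> linear (T x)"
    and R: "\<And>x v. x \<in> S \<Longrightarrow> R x (T x v) = v" "\<And>x w. x \<in> S \<Longrightarrow> T x (R x w) = w"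
  shows "smooth_on S (\<lambda>x. R x w)"
proof -
  obtain E \<epsilon> where E: "finite (E::'b set)" "\<And>x. x = (\<Sum>b\<in>E. (x \<bullet> \<epsilon> b) *\<^sub>R b)"
    using fin_dim_coords[OF fb] by metis
  obtain F \<phi> where F: "finite (F::'c set)" "\<And>x. x = (\<Sum>b\<in>F. (x \<bullet> \<phi> b) *\<^sub>R b)"
    using fin_dim_coords[OF fc] by metis
  have linR: "linear (R x)" if x: "x \<in> S" for x
  proof (rule linearI)
    show "R x (a + b) = R x a + R x b" for a b
      using R(1)[OF x, of "R x a + R x b"] by (simp add: linear_add[OF T(2)[OF x]] R(2)[OF x])
    show "R x (r *\<^sub>R a) = r *\<^sub>R R x a" for r a
      using R(1)[OF x, of "r *\<^sub>R R x a"] by (simp add: linear_cmul[OF T(2)[OF x]] R(2)[OF x])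
  qed
  have contR: "((\<lambda>y. R y w) \<longlongrightarrow> R x w) (at x)" if x: "x \<in> S" for x w
  proof -
    obtain m where m: "m > 0" "\<And>z. norm (R x z) \<le> norm z * m"
      using bounded_linear.pos_bounded[OF fin_dim_bounded_linear[OF fc linR[OF x]]] by auto
    \<comment> \<open>\<open>\<delta> y\<close> bounds the operator norm of
      \<open>T y - T x\<close>.\<close>
    define \<delta> where "\<delta> y = (\<Sum>b\<in>E. norm (\<epsilon> b) * norm (T y b - T x b))" for y
    have Tc: "((\<lambda>y. T y v) \<longlongrightarrow> T x v) (at x)" for v
      using smooth_continuous[OF T(1)] continuous_on_eq_continuous_at[OF S] x by (auto simp: isCont_def)
    have "((\<lambda>y. \<delta> y) \<longlongrightarrow> (\<Sum>b\<in>E. norm (\<epsilon> b) * norm (T x b - T x b))) (at x)"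
      unfolding \<delta>_def by (intro tendsto_intros Tc)
    \<comment> \<open>Below this threshold \<open>norm v \<le> 2 * m * norm (T y v)\<close> holds,
      which bounds \<open>R y\<close> uniformly near \<open>x\<close>.\<close>
    then have "\<forall>\<^sub>F y in at x. \<delta> y < 1 / (2 * m)"
      using m by (intro order_tendstoD) auto
    moreover have "\<forall>\<^sub>F y in at x. y \<in> S" using S x by (simp add: eventually_at_in_open')
    ultimately have "\<forall>\<^sub>F y in at x. norm (R y w - R x w) \<le> (2 * m) * norm (T y (R x w) - T x (R x w))"
    proof eventually_elim
      case (elim y)
      have d: "norm (T y v - T x v) \<le> \<delta> y * norm v" for v
      proof -
        have "T y v - T x v = (\<Sum>b\<in>E. (v \<bullet> \<epsilon> b) *\<^sub>R (T y b - T x b))"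
          using fin_dim_linear_sum[OF T(2)[OF elim(2)] E(2), of v] fin_dim_linear_sum[OF T(2)[OF x] E(2), of v]
          by (simp add: sum_subtractf scaleR_diff_right)
        also have "norm \<dots> \<le> (\<Sum>b\<in>E. \<bar>v \<bullet> \<epsilon> b\<bar> * norm (T y b - T x b))"
          by (intro order_trans[OF norm_sum] sum_mono) simp
        also have "\<dots> \<le> (\<Sum>b\<in>E. (norm v * norm (\<epsilon> b)) * norm (T y b - T x b))"
          by (intro sum_mono mult_right_mono Cauchy_Schwarz_ineq2) auto
        finally show ?thesis by (simp add: \<delta>_def sum_distrib_right sum_distrib_left mult_ac)
      qed
      have bound: "norm v \<le> 2 * m * norm (T y v)" for v
      proof -
        have "norm v = norm (R x (T x v))" using R x by simp
        also have "\<dots> \<le> norm (T x v) * m" by (rule m)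
        also have "\<dots> \<le> (norm (T y v) + norm (T y v - T x v)) * m"
          using m(1) norm_triangle_ineq2[of "T x v" "T y v"]
          by (intro mult_right_mono) (auto simp: norm_minus_commute)
        also have "\<dots> \<le> (norm (T y v) + \<delta> y * norm v) * m"
          using m(1) d by (intro mult_right_mono add_left_mono) auto
        also have "\<dots> \<le> m * norm (T y v) + (1 / (2 * m)) * norm v * m"
        proof -
          have "\<delta> y * norm v * m \<le> 1 / (2 * m) * norm v * m"
            using m(1) elim(1) by (intro mult_right_mono) auto
          then show ?thesis by (simp add: algebra_simps)
        qed
        also have "\<dots> = m * norm (T y v) + norm v / 2" using m(1) by simp
        finally show ?thesis by simp
      qed
      have "T y (R y w - R x w) = T x (R x w) - T y (R x w)"
        using linear_diff[OF T(2)[OF elim(2)]] R elim(2) x by simp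
      then show ?case using bound[of "R y w - R x w"] by (simp add: norm_minus_commute)
    qed
    moreover have "((\<lambda>y. (2 * m) * norm (T y (R x w) - T x (R x w))) \<longlongrightarrow> 0) (at x)"
      using Tc by (intro tendsto_mult_right_zero tendsto_norm_zero) (simp add: LIM_zero)
    ultimately have "((\<lambda>y. R y w - R x w) \<longlongrightarrow> 0) (at x)" by (rule Lim_null_comparison)
    then show ?thesis by (simp add: LIM_zero_iff)
  qed
  define R' where "R' x w h = - R x (DD (\<lambda>y. T y (R x w)) x h)" for x w h
  have derR: "((\<lambda>y. R y w) has_derivative R' x w) (at x)" if x: "x \<in> S" for x w
  proof -
    define u where "u = R x w"
    define g where "g y = T y u - T x u" for y
    have "((\<lambda>y. T y u) has_derivative DD (\<lambda>y. T y u) x) (at x)"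
      by (rule smooth_has_derivative[OF T(1) S x])
    then have g: "(g has_derivative DD (\<lambda>y. T y u) x) (at x)"
      unfolding g_def by (auto intro!: derivative_eq_intros)
    \<comment> \<open>The sum is \<open>R y (g y)\<close> in coordinates, and
      \<open>R y w = u - R y (g y)\<close>. Since \<open>g\<close> vanishes at \<open>x\<close>, the
      continuity of \<open>R\<close> just proved is enough.\<close>
    have "((\<lambda>y. \<Sum>b\<in>F. (g y \<bullet> \<phi> b) *\<^sub>R R y b) has_derivative
       (\<lambda>h. \<Sum>b\<in>F. (DD (\<lambda>y. T y u) x h \<bullet> \<phi> b) *\<^sub>R R x b)) (at x)"
      by (intro has_derivative_sum has_derivative_scaleR_zero bounded_linear.has_derivative[OF bounded_linear_inner_left g]
          contR x) (simp add: g_def)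
    then have "((\<lambda>y. u - (\<Sum>b\<in>F. (g y \<bullet> \<phi> b) *\<^sub>R R y b)) has_derivative
       (\<lambda>h. 0 - (\<Sum>b\<in>F. (DD (\<lambda>y. T y u) x h \<bullet> \<phi> b) *\<^sub>R R x b))) (at x)"
      by (intro has_derivative_diff has_derivative_const)
    then have "((\<lambda>y. u - (\<Sum>b\<in>F. (g y \<bullet> \<phi> b) *\<^sub>R R y b)) has_derivative R' x w) (at x)"
      unfolding R'_def u_def by (simp flip: fin_dim_linear_sum[OF linR[OF x] F(2)])
    then show ?thesis
    proof (rule has_derivative_transform_within_open[OF _ S x])
      fix y assume y: "y \<in> S"
      have "R y (g y) = u - R y w"
        using linear_diff[OF linR[OF y]] R y x by (simp add: g_def u_def)
      then show "u - (\<Sum>b\<in>F. (g y \<bullet> \<phi> b) *\<^sub>R R y b) = R y w"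
        by (simp flip: fin_dim_linear_sum[OF linR[OF y] F(2)])
    qed
  qed
  have "Ck_on k S (\<lambda>x. R x w)" for k w
  proof (induction k arbitrary: w)
    case 0
    show ?case using has_derivative_continuous_on[of S "\<lambda>x. R x w" "\<lambda>x. R' x w"]
      by (simp add: derR has_derivative_at_withinI)
  next
    case (Suc k)
    have "Ck_on k S (\<lambda>x. R' x w h)" for h
    proof -
      have "Ck_on k S (\<lambda>x. DD (\<lambda>y. T y v) x h)" for v
        using smooth_DD[OF T(1) S] unfolding smooth_on_def by blast
      from Ck_apply[of k S "\<lambda>x u. DD (\<lambda>y. T y u) x h" "\<lambda>x. R x w", OF fb this linear_DD_family[OF S T] Suc.IH]
      have "Ck_on k S (\<lambda>x. DD (\<lambda>y. T y (R x w)) x h)" .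
      from Ck_apply[of k S R, OF fc Suc.IH linR this]
      have "Ck_on k S (\<lambda>x. R x (DD (\<lambda>y. T y (R x w)) x h))" .
      then have "Ck_on k S (\<lambda>x. - R x (DD (\<lambda>y. T y (R x w)) x h))"
        by (rule Ck_compose_linear[OF bounded_linear_minus[OF bounded_linear_ident]])
      then show ?thesis by (simp add: R'_def)
    qed
    then show ?case unfolding Ck_on.simps
      by (intro exI[of _ "\<lambda>x. R' x w"]) (simp add: derR has_derivative_at_withinI)
  qed
  then show ?thesis by (simp add: smooth_on_def)
qed

subsection \<open>Bump functions\<close>

definition flat :: "real \<Rightarrow> real" where
  "flat x = (if x > 0 then exp (- inverse x) else 0)"

lemma flat_nonneg: "flat x \<ge> 0" and flat_pos: "flat x > 0 \<longleftrightarrow> x > 0"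
  by (auto simp: flat_def)

text \<open>The derivative of \<open>f n\<close> is a combination of \<open>f (n + 2)\<close> and
  \<open>f (n + 1)\<close>, so one induction on the order of smoothness treats all \<open>n\<close>
  at once.\<close>

lemma smooth_flat: "smooth_on S flat"
proof -
  define f where "f n x = (if x > 0 then inverse x ^ n * exp (- inverse x) else 0)" for n and x :: real
  have lim: "(f n \<longlongrightarrow> 0) (at 0)" for n
  proof (rule filterlim_split_at)
    have "\<forall>\<^sub>F x in at_left 0. 0 = f n x"
      by (simp add: eventually_at_filter f_def)
    then show "(f n \<longlongrightarrow> 0) (at_left 0)" using tendsto_cong[of "\<lambda>_. 0" "f n" "at_left 0" 0] by simp
    have "((\<lambda>x::real. inverse x ^ n / exp (inverse x)) \<longlongrightarrow> 0) (at_right 0)"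
      by (rule filterlim_compose[OF tendsto_power_div_exp_0 filterlim_inverse_at_top_right])
    moreover have "\<forall>\<^sub>F x in at_right 0. inverse x ^ n / exp (inverse x) = f n x"
      by (simp add: eventually_at_filter f_def exp_minus divide_inverse)
    ultimately show "(f n \<longlongrightarrow> 0) (at_right 0)"
      using tendsto_cong[of "\<lambda>x. inverse x ^ n / exp (inverse x)" "f n" "at_right 0" 0] by simp
  qed
  have der: "(f n has_real_derivative (f (n + 2) x - n * f (n + 1) x)) (at x)" for n x
  proof (cases x "0::real" rule: linorder_cases)
    case less
    have "((\<lambda>_. 0) has_real_derivative 0) (at x)" by simp
    then have "(f n has_real_derivative 0) (at x)"
      by (rule has_field_derivative_transform_within_open[of _ _ _ "{..<0}"]) (use less in \<open>auto simp: f_def\<close>)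
    then show ?thesis using less by (simp add: f_def)
  next
    case greater
    define y where "y = inverse x"
    have i: "(inverse has_real_derivative - (y * y)) (at x)"
      using DERIV_inverse[of x] greater by (simp add: y_def)
    have "((\<lambda>x. inverse x ^ n * exp (- inverse x)) has_real_derivative
        (real n * (- (y * y) * y ^ (n - 1))) * exp (- y) + (exp (- y) * (y * y)) * y ^ n) (at x)"
      using DERIV_mult[OF DERIV_power[OF i, of n] DERIV_fun_exp[OF DERIV_minus[OF i]]] by (simp add: y_def)
    moreover have "(real n * (- (y * y) * y ^ (n - 1))) * exp (- y) + (exp (- y) * (y * y)) * y ^ n
        = f (n + 2) x - n * f (n + 1) x"
      using greater by (cases n) (simp_all add: f_def y_def[symmetric] algebra_simps)
    ultimately have "((\<lambda>x. inverse x ^ n * exp (- inverse x)) has_real_derivative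
        (f (n + 2) x - n * f (n + 1) x)) (at x)" by simp
    then show ?thesis
      by (rule has_field_derivative_transform_within_open[of _ _ _ "{0<..}"]) (use greater in \<open>auto simp: f_def\<close>)
  next
    case equal
    \<comment> \<open>At the origin the difference quotient of \<open>f n\<close> is
      \<open>f (n + 1)\<close>, which tends to 0.\<close>
    have "f n h / h = f (n + 1) h" for h by (auto simp: f_def field_simps)
    then have "((\<lambda>h. (f n (0 + h) - f n 0) / h) \<longlongrightarrow> 0) (at 0)"
      using lim[of "n + 1"] by (simp add: f_def[of n 0])
    then show ?thesis using equal by (simp add: DERIV_def f_def[of _ 0])
  qed
  have "Ck_on k UNIV (f n)" for k n
  proof (induction k arbitrary: n)
    case 0
    show ?case unfolding Ck_on.simps by (rule DERIV_continuous_on) (rule der)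
  next
    case (Suc k)
    have "(f n has_derivative (\<lambda>v. v * (f (n + 2) x + - real n * f (n + 1) x))) (at x)" for x
    proof -
      have "(*) (f (n + 2) x - real n * f (n + 1) x) = (\<lambda>v. v * (f (n + 2) x + - real n * f (n + 1) x))"
        by (rule ext) (simp add: mult.commute)
      then show ?thesis using der[of n x] unfolding has_field_derivative_def by metis
    qed
    moreover have "Ck_on k UNIV (\<lambda>x. v * (f (n + 2) x + - real n * f (n + 1) x))" for v
      by (intro Ck_bilinear[OF bounded_bilinear_mult] Ck_const Ck_add Suc.IH)
    ultimately show ?case unfolding Ck_on.simps
      by (intro exI[of _ "\<lambda>x v. v * (f (n + 2) x + - real n * f (n + 1) x)"] conjI ballI allI) simp_all
  qed
  moreover have "f 0 = flat" by (rule ext) (simp add: f_def flat_def)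
  ultimately have "smooth_on UNIV flat" by (metis smooth_on_def)
  from smooth_subset[OF this] show ?thesis by simp
qed

section \<open>Manifolds and tangent vectors in charts\<close>

text \<open>The local half of \<open>manifold\<close>. It is inherited by tangent bundles, products
  and open subsets (\<open>man_tan\<close>, \<open>man_prod\<close>, \<open>man_restrict\<close>),
  so these constructions can be iterated.\<close>

definition man :: "('p, 'e::real_inner) atlas \<Rightarrow> bool" where
  "man A \<longleftrightarrow> smooth_atlas A \<and> fin_dim TYPE('e)"

lemma manifold_man: "manifold A \<Longrightarrow> man A"
  by (auto simp: manifold_def man_def fin_dim_def)

abbreviation transition :: "('p, 'e) chart \<Rightarrow> ('p, 'e) chart \<Rightarrow> 'e \<Rightarrow> 'e" where
  "transition c d \<equiv> snd d \<circ> chart_inv c"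

lemma charts_at_iff: "c \<in> charts_at A p \<longleftrightarrow> c \<in> A \<and> p \<in> fst c"
  by (auto simp: charts_at_def)

lemma pts_iff: "p \<in> pts A \<longleftrightarrow> (\<exists>c. c \<in> charts_at A p)"
  unfolding pts_def charts_at_def by blast

lemma chart_inv_mem: "x \<in> snd c ` fst c \<Longrightarrow> chart_inv c x \<in> fst c"
  unfolding chart_inv_def by (rule inv_into_into)

lemma chart_inv_right: "x \<in> snd c ` fst c \<Longrightarrow> snd c (chart_inv c x) = x"
  unfolding chart_inv_def by (rule f_inv_into_f)

lemma some_chart: "c \<in> charts_at A p \<Longrightarrow> (SOME c. c \<in> charts_at A p) \<in> charts_at A p"
  by (rule someI)

context
  fixes A :: "('p, 'e::real_inner) atlas"
  assumes man: "man A"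
begin

lemma chart_inj: "c \<in> A \<Longrightarrow> inj_on (snd c) (fst c)"
  using man by (auto simp: man_def smooth_atlas_def)

lemma chart_inv_left: "c \<in> A \<Longrightarrow> p \<in> fst c \<Longrightarrow> chart_inv c (snd c p) = p"
  unfolding chart_inv_def using chart_inj by (simp add: inv_into_f_f)

lemma open_chart: "c \<in> A \<Longrightarrow> open (snd c ` fst c)"
  using man by (auto simp: man_def smooth_atlas_def)

lemma open_overlap: "c \<in> A \<Longrightarrow> d \<in> A \<Longrightarrow> open (snd c ` (fst c \<inter> fst d))"
  using man by (auto simp: man_def smooth_atlas_def)

lemma smooth_transition:
  "c \<in> A \<Longrightarrow> d \<in> A \<Longrightarrow> smooth_on (snd c ` (fst c \<inter> fst d)) (transition c d)"
  using man by (auto simp: man_def smooth_atlas_def)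

lemma transition_has_derivative:
  assumes "c \<in> charts_at A p" "d \<in> charts_at A p"
  shows "(transition c d has_derivative DD (transition c d) (snd c p)) (at (snd c p))"
  using assms by (intro smooth_has_derivative[OF smooth_transition open_overlap]) (auto simp: charts_at_iff)

lemma linear_transition:
  assumes "c \<in> charts_at A p" "d \<in> charts_at A p"
  shows "linear (DD (transition c d) (snd c p))"
  using transition_has_derivative[OF assms] has_derivative_linear by blast

lemma transition_self:
  assumes "c \<in> charts_at A p"
  shows "DD (transition c c) (snd c p) v = v"
proof -
  have c: "c \<in> A" "p \<in> fst c" using assms by (auto simp: charts_at_iff)
  have "DD (transition c c) (snd c p) = DD (\<lambda>x. x) (snd c p)"
    using c by (intro DD_cong[OF open_chart[OF c(1)]]) (auto simp: chart_inv_left)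
  then show ?thesis by (simp add: DD_eq[OF has_derivative_ident])
qed

lemma transition_chain:
  assumes "c \<in> charts_at A p" "d \<in> charts_at A p" "e \<in> charts_at A p"
  shows "DD (transition d e) (snd d p) (DD (transition c d) (snd c p) v) = DD (transition c e) (snd c p) v"
proof -
  have c: "c \<in> A" "p \<in> fst c" "d \<in> A" "p \<in> fst d" "e \<in> A" "p \<in> fst e"
    using assms by (auto simp: charts_at_iff)
  have *: "transition c d (snd c p) = snd d p" using c by (simp add: chart_inv_left)
  have "(transition d e has_derivative DD (transition d e) (snd d p)) (at (transition c d (snd c p)))"
    unfolding * by (rule transition_has_derivative[OF assms(2,3)])
  from has_derivative_compose[OF transition_has_derivative[OF assms(1,2)] this]
  have "((\<lambda>x. transition d e (transition c d x)) has_derivative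
     (\<lambda>v. DD (transition d e) (snd d p) (DD (transition c d) (snd c p) v))) (at (snd c p))" .
  then have "DD (\<lambda>x. transition d e (transition c d x)) (snd c p) =
     (\<lambda>v. DD (transition d e) (snd d p) (DD (transition c d) (snd c p) v))" by (rule DD_eq)
  moreover have "DD (\<lambda>x. transition d e (transition c d x)) (snd c p) = DD (transition c e) (snd c p)"
    using c by (intro DD_cong[OF open_overlap[OF c(1,3)]]) (auto simp: chart_inv_left)
  ultimately show ?thesis by metis
qed

end

definition tvec :: "('p, 'e::real_inner) atlas \<Rightarrow> ('p, 'e) chart \<Rightarrow> 'p \<Rightarrow> 'e \<Rightarrow> ('p, 'e) tvec" where
  "tvec A c p v = (p, \<lambda>d. if d \<in> charts_at A p then DD (transition c d) (snd c p) v else 0)"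

lemma fst_tvec [simp]: "fst (tvec A c p v) = p"
  by (simp add: tvec_def)

lemma tan_space_fst: "Z \<in> tan_space A p \<Longrightarrow> fst Z = p"
  unfolding tan_space_def by blast

lemma tan_space_coord:
  "Z \<in> tan_space A p \<Longrightarrow> c \<in> charts_at A p \<Longrightarrow> d \<in> charts_at A p \<Longrightarrow>
    snd Z d = DD (transition c d) (snd c p) (snd Z c)"
  unfolding tan_space_def by blast

lemma tan_space_off: "Z \<in> tan_space A p \<Longrightarrow> c \<notin> charts_at A p \<Longrightarrow> snd Z c = 0"
  unfolding tan_space_def by blast

lemma tan_spaceI:
  assumes "fst Z = p" "\<And>c. c \<notin> charts_at A p \<Longrightarrow> snd Z c = 0"
    "\<And>c d. c \<in> charts_at A p \<Longrightarrow> d \<in> charts_at A p \<Longrightarrow> snd Z d = DD (transition c d) (snd c p) (snd Z c)"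
  shows "Z \<in> tan_space A p"
  unfolding tan_space_def using assms by blast

text \<open>Tangent vectors at a common point are compared in a single chart; most identities
  between vectors below are proved in this way.\<close>

lemma tan_space_eqI:
  assumes "Z \<in> tan_space A p" "W \<in> tan_space A p" "c \<in> charts_at A p" "snd Z c = snd W c"
  shows "Z = W"
proof (rule prod_eqI)
  show "fst Z = fst W" using assms by (simp add: tan_space_fst)
  show "snd Z = snd W"
  proof
    show "snd Z d = snd W d" for d
    proof (cases "d \<in> charts_at A p")
      case True
      then show ?thesis
        using tan_space_coord[OF assms(1,3) True] tan_space_coord[OF assms(2,3) True] assms(4) by metis
    next
      case False
      then show ?thesis using assms(1,2) by (simp add: tan_space_off)
    qed
  qed
qed

context
  fixes A :: "('p, 'e::real_inner) atlas"
  assumes man: "man A"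
begin

lemma tvec_coord: "c \<in> charts_at A p \<Longrightarrow> snd (tvec A c p v) c = v"
  by (simp add: tvec_def transition_self[OF man])

lemma tvec_in: "c \<in> charts_at A p \<Longrightarrow> tvec A c p v \<in> tan_space A p"
  unfolding tan_space_def by (auto simp: tvec_def transition_chain[OF man])

lemma tvec_collapse: "Z \<in> tan_space A p \<Longrightarrow> c \<in> charts_at A p \<Longrightarrow> tvec A c p (snd Z c) = Z"
  by (rule tan_space_eqI[OF tvec_in]) (auto simp: tvec_coord)

lemma tzero_in: "tzero p \<in> tan_space A p"
  unfolding tan_space_def by (auto simp: tzero_def linear_0[OF linear_transition[OF man]])

lemma tadd_in:
  assumes "Z \<in> tan_space A p" "W \<in> tan_space A p"
  shows "tadd Z W \<in> tan_space A p"
proof (rule tan_spaceI)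
  fix c d assume c: "c \<in> charts_at A p" "d \<in> charts_at A p"
  show "snd (tadd Z W) d = DD (transition c d) (snd c p) (snd (tadd Z W) c)"
    using tan_space_coord[OF assms(1) c] tan_space_coord[OF assms(2) c]
    by (simp add: tadd_def linear_add[OF linear_transition[OF man c]])
qed (use tan_space_fst[OF assms(1)] tan_space_off[OF assms(1)] tan_space_off[OF assms(2)] in \<open>simp_all add: tadd_def\<close>)

lemma tscale_in:
  assumes "Z \<in> tan_space A p"
  shows "tscale r Z \<in> tan_space A p"
proof (rule tan_spaceI)
  fix c d assume c: "c \<in> charts_at A p" "d \<in> charts_at A p"
  show "snd (tscale r Z) d = DD (transition c d) (snd c p) (snd (tscale r Z) c)"
    using tan_space_coord[OF assms(1) c]
    by (simp add: tscale_def linear_cmul[OF linear_transition[OF man c]])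
qed (use tan_space_fst[OF assms(1)] tan_space_off[OF assms(1)] in \<open>simp_all add: tscale_def\<close>)

lemma tdiff_in: "Z \<in> tan_space A p \<Longrightarrow> W \<in> tan_space A p \<Longrightarrow> tdiff Z W \<in> tan_space A p"
  by (simp add: tdiff_def tadd_in tscale_in)

end

lemma tcoord_simps [simp]:
  "snd (tzero p) c = 0" "snd (tadd Z W) c = snd Z c + snd W c" "snd (tscale r Z) c = r *\<^sub>R snd Z c"
  "snd (tdiff Z W) c = snd Z c - snd W c"
  "fst (tzero p) = p" "fst (tadd Z W) = fst Z" "fst (tscale r Z) = fst Z" "fst (tdiff Z W) = fst Z"
  by (simp_all add: tzero_def tadd_def tscale_def tdiff_def)

subsection \<open>The tangent bundle\<close>

lemma tvec_zero: "man A \<Longrightarrow> c \<in> charts_at A p \<Longrightarrow> tvec A c p 0 = tzero p"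
  by (rule tan_space_eqI[OF tvec_in tzero_in]) (auto simp: tvec_coord)

lemma tan_chart_domain: "Z \<in> fst (tan_chart A c) \<longleftrightarrow> fst Z \<in> fst c \<and> Z \<in> tan_space A (fst Z)"
  unfolding tan_chart_def using tan_space_fst by fastforce

lemma snd_tan_chart [simp]: "snd (tan_chart A c) Z = (snd c (fst Z), snd Z c)"
  by (simp add: tan_chart_def)

lemma charts_at_tan:
  "Z \<in> tan_space A p \<Longrightarrow> charts_at (tan_atlas A) Z = tan_chart A ` charts_at A p"
  by (auto simp: charts_at_def tan_atlas_def tan_chart_domain tan_space_fst)

lemma charts_at_tanI: "c \<in> charts_at A p \<Longrightarrow> Z \<in> tan_space A p \<Longrightarrow> tan_chart A c \<in> charts_at (tan_atlas A) Z"
  by (simp add: charts_at_tan)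

lemma pts_tan: "Z \<in> pts (tan_atlas A) \<longleftrightarrow> fst Z \<in> pts A \<and> Z \<in> tan_space A (fst Z)"
  by (auto simp: pts_def tan_atlas_def tan_chart_domain)

context
  fixes A :: "('p, 'e::real_inner) atlas"
  assumes man: "man A"
begin

lemma tan_chart_inj: "c \<in> A \<Longrightarrow> inj_on (snd (tan_chart A c)) (fst (tan_chart A c))"
proof (rule inj_onI)
  fix Z W assume c: "c \<in> A" and Z: "Z \<in> fst (tan_chart A c)" and W: "W \<in> fst (tan_chart A c)"
    and eq: "snd (tan_chart A c) Z = snd (tan_chart A c) W"
  have f: "fst Z = fst W"
    using inj_onD[OF chart_inj[OF man c], of "fst Z" "fst W"] Z W eq by (auto simp: tan_chart_domain)
  show "Z = W"
    by (rule tan_space_eqI[of _ A "fst Z" _ c]) (use Z W eq f c in \<open>auto simp: tan_chart_domain charts_at_iff\<close>)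
qed

lemma tvec_in_tan_chart: "c \<in> A \<Longrightarrow> p \<in> fst c \<Longrightarrow> tvec A c p v \<in> fst (tan_chart A c)"
  using tvec_in[OF man, of c p v] by (simp add: tan_chart_domain charts_at_iff)

lemma tan_chart_overlap:
  assumes "c \<in> A" "d \<in> A"
  shows "snd (tan_chart A c) ` (fst (tan_chart A c) \<inter> fst (tan_chart A d)) = snd c ` (fst c \<inter> fst d) \<times> UNIV"
proof (intro equalityI subsetI)
  fix z assume "z \<in> snd c ` (fst c \<inter> fst d) \<times> (UNIV :: 'e set)"
  then obtain p v where p: "p \<in> fst c" "p \<in> fst d" "z = (snd c p, v)" by auto
  have "tvec A c p v \<in> fst (tan_chart A c) \<inter> fst (tan_chart A d)"
    using tvec_in[OF man, of c p v] p assms by (auto simp: tan_chart_domain charts_at_iff)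
  moreover have "snd (tan_chart A c) (tvec A c p v) = z"
    using p assms by (simp add: tvec_coord[OF man] charts_at_iff)
  ultimately show "z \<in> snd (tan_chart A c) ` (fst (tan_chart A c) \<inter> fst (tan_chart A d))" by blast
qed (auto simp: tan_chart_domain)

lemma tan_chart_image: "c \<in> A \<Longrightarrow> snd (tan_chart A c) ` fst (tan_chart A c) = (snd c ` fst c) \<times> UNIV"
  using tan_chart_overlap[of c c] by simp

lemma chart_inv_tan_chart:
  assumes "c \<in> A" "x \<in> snd c ` fst c"
  shows "chart_inv (tan_chart A c) (x, v) = tvec A c (chart_inv c x) v"
proof -
  have p: "chart_inv c x \<in> fst c" "snd c (chart_inv c x) = x"
    using chart_inv_mem[OF assms(2)] chart_inv_right[OF assms(2)] by auto
  then have "snd (tan_chart A c) (tvec A c (chart_inv c x) v) = (x, v)"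
    using assms(1) by (simp add: tvec_coord[OF man] charts_at_iff)
  then show ?thesis
    using inv_into_f_f[OF tan_chart_inj[OF assms(1)] tvec_in_tan_chart[OF assms(1) p(1), of v]]
    unfolding chart_inv_def[of "tan_chart A c"] by metis
qed

lemma transition_tan:
  assumes "c \<in> A" "d \<in> A" "z \<in> snd c ` (fst c \<inter> fst d) \<times> UNIV"
  shows "transition (tan_chart A c) (tan_chart A d) z
    = (transition c d (fst z), DD (transition c d) (fst z) (snd z))"
proof -
  obtain p where p: "p \<in> fst c" "p \<in> fst d" "fst z = snd c p" using assms by auto
  then have "chart_inv c (fst z) = p" using chart_inv_left[OF man] assms by simp
  then have "chart_inv (tan_chart A c) z = tvec A c p (snd z)"
    using chart_inv_tan_chart[OF assms(1), of "fst z" "snd z"] p by (metis imageI prod.collapse)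
  then show ?thesis using p assms \<open>chart_inv c (fst z) = p\<close> by (simp add: tvec_def charts_at_iff)
qed

lemma smooth_DD_joint:
  fixes f :: "'e \<Rightarrow> 'b::real_normed_vector"
  assumes f: "smooth_on S f" "open S"
  shows "smooth_on (S \<times> UNIV) (\<lambda>z. DD f (fst z) (snd z))"
proof (rule smooth_apply)
  show "fin_dim TYPE('e)" using man by (simp add: man_def)
  then show "smooth_on (S \<times> UNIV) (\<lambda>z::'e \<times> 'e. DD f (fst z) v)" for v
    by (rule smooth_compose[OF _ smooth_DD[OF f] smooth_fst[OF smooth_ident]]) auto
  show "linear (DD f (fst z))" if "z \<in> S \<times> (UNIV :: 'e set)" for z
    using that by (intro linear_DD[OF f]) auto
  show "smooth_on (S \<times> UNIV) (\<lambda>z::'e \<times> 'e. snd z)" by (rule smooth_snd[OF smooth_ident])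
qed

text \<open>The tangent map in coordinates, differentiated once more: the base component
  \<open>h\<close> meets the second derivative of \<open>f\<close>, the fibre component
  \<open>k\<close> only the first.\<close>

lemma DD_joint:
  fixes f :: "'e \<Rightarrow> 'b::real_normed_vector"
  assumes f: "smooth_on S f" "open S" and x: "x \<in> S"
  shows "((\<lambda>z. DD f (fst z) (snd z)) has_derivative (\<lambda>(h, k). DD (\<lambda>y. DD f y v) x h + DD f x k)) (at (x, v))"
proof -
  have fe: "fin_dim TYPE('e)" using man by (simp add: man_def)
  have o: "open (S \<times> (UNIV :: 'e set))" using f(2) by (simp add: open_Times)
  have 1: "((\<lambda>z::'e \<times> 'e. DD f (fst z) w) has_derivative (\<lambda>h. DD (\<lambda>y. DD f y w) x (fst h))) (at (x, v))" for w
    using has_derivative_compose[OF has_derivative_fst[OF has_derivative_ident], of "\<lambda>y. DD f y w" _ "(x, v)" UNIV]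
      smooth_has_derivative[OF smooth_DD[OF f] f(2) x] by simp
  have "((\<lambda>z. DD f (fst z) (snd z)) has_derivative
      (\<lambda>h. DD (\<lambda>y. DD f y (snd (x, v))) x (fst h) + DD f (fst (x, v)) (snd h))) (at (x, v) within S \<times> UNIV)"
  proof (rule has_derivative_apply[OF fe])
    show "((\<lambda>z::'e \<times> 'e. DD f (fst z) w) has_derivative (\<lambda>h. DD (\<lambda>y. DD f y w) x (fst h))) (at (x, v) within S \<times> UNIV)" for w
      using 1 by (rule has_derivative_at_withinI)
    show "linear (DD f (fst z))" if "z \<in> S \<times> (UNIV :: 'e set)" for z
      using that by (intro linear_DD[OF f]) auto
  qed (use x fat_open[OF o] in \<open>auto intro: derivative_eq_intros\<close>)
  then show ?thesis using x at_within_open[OF _ o, of "(x, v)"] by (simp add: case_prod_unfold)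
qed

lemma man_tan: "man (tan_atlas A)"
proof -
  have fe: "fin_dim TYPE('e)" using man by (simp add: man_def)
  have "smooth_on (snd c ` (fst c \<inter> fst d) \<times> UNIV) (transition (tan_chart A c) (tan_chart A d))"
    if c: "c \<in> A" "d \<in> A" for c d
  proof -
    note tr = smooth_transition[OF man c] open_overlap[OF man c]
    have "smooth_on (snd c ` (fst c \<inter> fst d) \<times> UNIV)
        (\<lambda>z. (transition c d (fst z), DD (transition c d) (fst z) (snd z)))"
      by (intro smooth_Pair smooth_compose[OF fe tr(1) smooth_fst[OF smooth_ident]] smooth_DD_joint tr) auto
    then show ?thesis by (rule smooth_cong[THEN iffD1, rotated]) (rule transition_tan[OF c, symmetric])
  qed
  then show ?thesis
    unfolding man_def smooth_atlas_def tan_atlas_def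
    using fin_dim_prod[OF fe fe] open_chart[OF man] open_overlap[OF man]
    by (auto simp: tan_chart_inj tan_chart_image tan_chart_overlap open_Times simp del: snd_tan_chart)
qed

text \<open>The second-order term pairs the fibre coordinate \<open>v\<close> of the point with the
  base component \<open>h\<close> of the vector. It does not change when \<open>v\<close> and
  \<open>h\<close> are exchanged, and this is why the flip is well defined.\<close>

lemma DD_transition_tan:
  assumes c: "c \<in> charts_at A p" "d \<in> charts_at A p"
  shows "DD (transition (tan_chart A c) (tan_chart A d)) (snd c p, v) (h, k)
    = (DD (transition c d) (snd c p) h,
       DD (\<lambda>y. DD (transition c d) y v) (snd c p) h + DD (transition c d) (snd c p) k)"
proof -
  have cA: "c \<in> A" "d \<in> A" "snd c p \<in> snd c ` (fst c \<inter> fst d)" using c by (auto simp: charts_at_iff)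
  note tr = smooth_transition[OF man cA(1,2)] open_overlap[OF man cA(1,2)]
  have 1: "((\<lambda>z::'e \<times> 'e. transition c d (fst z)) has_derivative (\<lambda>h. DD (transition c d) (snd c p) (fst h))) (at (snd c p, v))"
    using has_derivative_compose[OF has_derivative_fst[OF has_derivative_ident], of "transition c d" _ "(snd c p, v)" UNIV]
      smooth_has_derivative[OF tr cA(3)] by simp
  have "DD (transition (tan_chart A c) (tan_chart A d)) (snd c p, v)
      = DD (\<lambda>z. (transition c d (fst z), DD (transition c d) (fst z) (snd z))) (snd c p, v)"
    by (rule DD_cong[of "snd c ` (fst c \<inter> fst d) \<times> UNIV"])
       (use tr cA in \<open>auto simp: open_Times transition_tan simp del: comp_apply\<close>)
  also have "\<dots> = (\<lambda>h. (DD (transition c d) (snd c p) (fst h),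
      (\<lambda>(h, k). DD (\<lambda>y. DD (transition c d) y v) (snd c p) h + DD (transition c d) (snd c p) k) h))"
    by (rule DD_eq[OF has_derivative_Pair[OF 1 DD_joint[OF tr cA(3)]]])
  finally show ?thesis by simp
qed

end

text \<open>A candidate \<open>W0\<close> is built in the one chart \<open>c\<close> and then shown
  to have the flipped coordinates in every chart, as the definite description demands. Its base
  point is the vector with coordinate \<open>x'\<close>, the base component of
  \<open>W\<close>.\<close>

lemma canonical_flip_coord:
  assumes man: "man A" and Z: "Z \<in> tan_space A p" and W: "W \<in> tan_space (tan_atlas A) Z" and c: "c \<in> charts_at A p"
    and xv: "snd W (tan_chart A c) = (x', v')"
  shows "canonical_flip A W \<in> tan_space (tan_atlas A) (tvec A c p x')"
    and "snd (canonical_flip A W) (tan_chart A c) = (snd Z c, v')"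
proof -
  let ?T = "tan_atlas A"
  define W0 where "W0 = tvec ?T (tan_chart A c) (tvec A c p x') (snd Z c, v')"
  note mT = man_tan[OF man]
  have tp: "tvec A c p x' \<in> tan_space A p" by (rule tvec_in[OF man c])
  have C: "tan_chart A d \<in> charts_at ?T (tvec A c p x')" "tan_chart A d \<in> charts_at ?T Z"
    if "d \<in> charts_at A p" for d using charts_at_tanI[OF that] tp Z by auto
  have W0: "W0 \<in> tan_space ?T (tvec A c p x')" "snd W0 (tan_chart A c) = (snd Z c, v')"
    unfolding W0_def by (auto simp: tvec_in[OF mT] tvec_coord[OF mT] C c)
  have fW: "fst W = Z" "fst Z = p" using W Z by (auto dest: tan_space_fst)
  have fW0: "fst W0 = tvec A c p x'" by (simp add: W0_def)
  have coord: "snd (tvec A c p x') d = fst (snd W (tan_chart A d))"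
    "snd W0 (tan_chart A d) = (snd Z d, snd (snd W (tan_chart A d)))" if d: "d \<in> charts_at A p" for d
  proof -
    have "snd W (tan_chart A d) = DD (transition (tan_chart A c) (tan_chart A d)) (snd (tan_chart A c) Z) (x', v')"
      using tan_space_coord[OF W C(2)[OF c] C(2)[OF d]] xv by simp
    then have Wd: "snd W (tan_chart A d) = (DD (transition c d) (snd c p) x',
       DD (\<lambda>y. DD (transition c d) y (snd Z c)) (snd c p) x' + DD (transition c d) (snd c p) v')"
      using DD_transition_tan[OF man c d, of "snd Z c" x' v'] fW by simp
    then show "snd (tvec A c p x') d = fst (snd W (tan_chart A d))"
      using d by (simp add: tvec_def)
    have "snd W0 (tan_chart A d) = DD (transition (tan_chart A c) (tan_chart A d))
        (snd (tan_chart A c) (tvec A c p x')) (snd Z c, v')"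
      using tan_space_coord[OF W0(1) C(1)[OF c] C(1)[OF d]] W0(2) by simp
    then have "snd W0 (tan_chart A d) = (DD (transition c d) (snd c p) (snd Z c),
       DD (\<lambda>y. DD (transition c d) y x') (snd c p) (snd Z c) + DD (transition c d) (snd c p) v')"
      using DD_transition_tan[OF man c d, of x' "snd Z c" v'] c by (simp add: tvec_coord[OF man])
    \<comment> \<open>Here the flip uses that the second derivative of the transition is
      symmetric.\<close>
    moreover have "DD (\<lambda>y. DD (transition c d) y x') (snd c p) (snd Z c)
        = DD (\<lambda>y. DD (transition c d) y (snd Z c)) (snd c p) x'"
      using c d by (intro DD_symmetric[OF smooth_transition[OF man] open_overlap[OF man]]) (auto simp: charts_at_iff)
    moreover have "DD (transition c d) (snd c p) (snd Z c) = snd Z d"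
      using tan_space_coord[OF Z c d] by simp
    ultimately show "snd W0 (tan_chart A d) = (snd Z d, snd (snd W (tan_chart A d)))"
      using Wd by simp
  qed
  have dom: "W0 \<in> fst (tan_chart ?T (tan_chart A d))" if "d \<in> charts_at A p" for d
    using W0(1) C(1)[OF that] fW0 by (simp add: tan_chart_domain charts_at_iff)
  have "canonical_flip A W = W0"
    unfolding canonical_flip_def
  proof (rule the_equality)
    show "W0 \<in> pts (tan_atlas ?T) \<and> (\<forall>c\<in>charts_at A (fst (fst W)). let C = tan_chart ?T (tan_chart A c) in
        W0 \<in> fst C \<and> snd C W0 = (\<lambda>((x, v), (x', v')). ((x, x'), (v, v'))) (snd C W))"
    proof (intro conjI ballI)
      show "W0 \<in> pts (tan_atlas ?T)"
        using W0(1) C(1)[OF c] fW0 pts_iff[of "tvec A c p x'" ?T] unfolding pts_tan by metis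
      fix d assume "d \<in> charts_at A (fst (fst W))"
      then have d: "d \<in> charts_at A p" using fW by simp
      show "let C = tan_chart ?T (tan_chart A d) in
        W0 \<in> fst C \<and> snd C W0 = (\<lambda>((x, v), (x', v')). ((x, x'), (v, v'))) (snd C W)"
        using dom[OF d] coord[OF d] fW fW0 by (simp add: Let_def case_prod_unfold)
    qed
    fix W' assume W': "W' \<in> pts (tan_atlas ?T) \<and> (\<forall>c\<in>charts_at A (fst (fst W)). let C = tan_chart ?T (tan_chart A c) in
        W' \<in> fst C \<and> snd C W' = (\<lambda>((x, v), (x', v')). ((x, x'), (v, v'))) (snd C W))"
    let ?C = "tan_chart ?T (tan_chart A c)"
    have c': "c \<in> charts_at A (fst (fst W))" using c fW by simp
    have "W' \<in> fst ?C" "snd ?C W' = (\<lambda>((x, v), (x', v')). ((x, x'), (v, v'))) (snd ?C W)"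
      using W' c' unfolding Let_def by blast+
    moreover have "snd ?C W0 = (\<lambda>((x, v), (x', v')). ((x, x'), (v, v'))) (snd ?C W)"
      using coord[OF c] fW fW0 by (simp add: case_prod_unfold)
    moreover have "inj_on (snd ?C) (fst ?C)"
      using chart_inj[OF man_tan[OF mT]] c by (auto simp: tan_atlas_def charts_at_iff)
    ultimately show "W' = W0" using dom[OF c] inj_onD by metis
  qed
  then show "canonical_flip A W \<in> tan_space (tan_atlas A) (tvec A c p x')"
    "snd (canonical_flip A W) (tan_chart A c) = (snd Z c, v')" using W0 by auto
qed

subsection \<open>Curves\<close>

context
  fixes A :: "('p, 'e::real_inner) atlas" and I :: "real set"
  assumes man: "man A" and I: "fat I"
begin

lemma fat_openin:
  assumes "openin (top_of_set I) J" shows "fat J"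
  using assms fat_Int_open[OF I] unfolding openin_open by blast

lemma smooth_curve_local:
  assumes "smooth_curve I A \<gamma>" "t \<in> I" "c \<in> charts_at A (\<gamma> t)"
  obtains V where "open V" "t \<in> V" "\<And>s. s \<in> I \<inter> V \<Longrightarrow> \<gamma> s \<in> fst c" "smooth_on (I \<inter> V) (\<lambda>s. snd c (\<gamma> s))"
proof -
  have c: "c \<in> A" "\<gamma> t \<in> fst c" using assms(3) by (auto simp: charts_at_iff)
  have 1: "openin (top_of_set I) {t \<in> I. \<gamma> t \<in> fst c}" "smooth_on {t \<in> I. \<gamma> t \<in> fst c} (\<lambda>s. snd c (\<gamma> s))"
    using assms(1) c(1) unfolding smooth_curve_def comp_def by blast+
  from 1(1) obtain V where V: "open V" "{t \<in> I. \<gamma> t \<in> fst c} = I \<inter> V"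
    unfolding openin_open by blast
  moreover have "smooth_on (I \<inter> V) (\<lambda>s. snd c (\<gamma> s))" using 1(2) V(2) by simp
  ultimately show ?thesis using that[of V] c(2) assms(2) by blast
qed

text \<open>\<open>smooth_curve\<close> quantifies over all charts; transitions reduce this to one
  chart around each time, and fatness of \<open>I\<close> allows the local statements to be
  glued.\<close>

lemma smooth_curveI:
  assumes "\<And>t. t \<in> I \<Longrightarrow> \<exists>c\<in>A. \<exists>V. open V \<and> t \<in> V \<and> (\<forall>s\<in>I\<inter>V. \<gamma> s \<in> fst c) \<and> smooth_on (I \<inter> V) (\<lambda>s. snd c (\<gamma> s))"
  shows "smooth_curve I A \<gamma>"
proof -
  have fe: "fin_dim TYPE('e)" using man by (simp add: man_def)
  have loc: "\<exists>V. open V \<and> t \<in> V \<and> (\<forall>s\<in>I\<inter>V. \<gamma> s \<in> fst d) \<and> smooth_on (I \<inter> V) (\<lambda>s. snd d (\<gamma> s))"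
    if t: "t \<in> I" "\<gamma> t \<in> fst d" "d \<in> A" for t d
  proof -
    obtain c V where c: "c \<in> A" and V: "open V" "t \<in> V" "\<forall>s\<in>I\<inter>V. \<gamma> s \<in> fst c"
      "smooth_on (I \<inter> V) (\<lambda>s. snd c (\<gamma> s))" using assms[OF t(1)] by blast
    let ?O = "snd c ` (fst c \<inter> fst d)"
    have "openin (top_of_set (I \<inter> V)) ((I \<inter> V) \<inter> (\<lambda>s. snd c (\<gamma> s)) -` ?O)"
      by (rule continuous_openin_preimage_gen[OF smooth_continuous[OF V(4)] open_overlap[OF man c t(3)]])
    then obtain W where W: "open W" "(I \<inter> V) \<inter> (\<lambda>s. snd c (\<gamma> s)) -` ?O = (I \<inter> V) \<inter> W"
      unfolding openin_open by blast
    have mem: "snd c (\<gamma> s) \<in> ?O \<longleftrightarrow> \<gamma> s \<in> fst d" if "s \<in> I \<inter> V" for s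
    proof
      assume "snd c (\<gamma> s) \<in> ?O"
      then obtain q where q: "q \<in> fst c" "q \<in> fst d" "snd c q = snd c (\<gamma> s)" by auto
      moreover have "\<gamma> s \<in> fst c" using V(3) that by blast
      ultimately have "q = \<gamma> s" using inj_onD[OF chart_inj[OF man c]] by blast
      then show "\<gamma> s \<in> fst d" using q by simp
    next
      assume "\<gamma> s \<in> fst d"
      moreover have "\<gamma> s \<in> fst c" using V(3) that by blast
      ultimately show "snd c (\<gamma> s) \<in> ?O" by blast
    qed
    have d: "\<gamma> s \<in> fst c \<and> \<gamma> s \<in> fst d" if "s \<in> I \<inter> (V \<inter> W)" for s
      using that mem[of s] W(2) V(3) by blast
    have "smooth_on (I \<inter> (V \<inter> W)) (\<lambda>s. transition c d (snd c (\<gamma> s)))"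
      by (rule smooth_compose[OF fe smooth_transition[OF man c t(3)] smooth_subset[OF V(4)]]) (use d in blast)+
    then have "smooth_on (I \<inter> (V \<inter> W)) (\<lambda>s. snd d (\<gamma> s))"
      by (rule smooth_cong[THEN iffD1, rotated]) (simp add: d chart_inv_left[OF man c])
    moreover have "t \<in> W" using W(2) mem[of t] V(2) t by blast
    ultimately show ?thesis using V(1,2) W(1) d by (intro exI[of _ "V \<inter> W"]) (simp add: open_Int)
  qed
  show ?thesis unfolding smooth_curve_def
  proof (intro conjI ballI)
    show "\<gamma> t \<in> pts A" if "t \<in> I" for t using assms[OF that] that unfolding pts_def by blast
    fix d assume d: "d \<in> A"
    have *: "\<exists>V. open V \<and> t \<in> V \<and> (\<forall>s\<in>I\<inter>V. \<gamma> s \<in> fst d)" if "t \<in> {t \<in> I. \<gamma> t \<in> fst d}" for t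
      using loc[of t d] that d by blast
    show o: "openin (top_of_set I) {t \<in> I. \<gamma> t \<in> fst d}"
    proof (subst openin_subopen, intro ballI)
      fix t assume t: "t \<in> {t \<in> I. \<gamma> t \<in> fst d}"
      then obtain V where "open V" "t \<in> V" "\<forall>s\<in>I\<inter>V. \<gamma> s \<in> fst d" using * by blast
      then show "\<exists>T. openin (top_of_set I) T \<and> t \<in> T \<and> T \<subseteq> {t \<in> I. \<gamma> t \<in> fst d}"
        using t by (intro exI[of _ "I \<inter> V"] conjI openin_open_Int) blast+
    qed
    show "smooth_on {t \<in> I. \<gamma> t \<in> fst d} (snd d \<circ> \<gamma>)"
    proof (rule smooth_local[OF fat_openin[OF o]])
      fix t assume "t \<in> {t \<in> I. \<gamma> t \<in> fst d}"
      then obtain V where "open V" "t \<in> V" "smooth_on (I \<inter> V) (\<lambda>s. snd d (\<gamma> s))" using loc[of t d] d by blast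
      then show "\<exists>V. open V \<and> t \<in> V \<and> smooth_on ({t \<in> I. \<gamma> t \<in> fst d} \<inter> V) (snd d \<circ> \<gamma>)"
        unfolding comp_def using smooth_subset[of "I \<inter> V" "\<lambda>s. snd d (\<gamma> s)" "{t \<in> I. \<gamma> t \<in> fst d} \<inter> V"] by blast
    qed
  qed
qed

lemma has_vector_derivative_eq:
  assumes "t \<in> I" "(f has_vector_derivative v) (at t within I)"
  shows "vector_derivative f (at t within I) = v"
proof -
  have "(f has_vector_derivative vector_derivative f (at t within I)) (at t within I)"
    unfolding vector_derivative_def by (rule someI[where x = v]) (rule assms(2))
  from fat_unique_derivative[OF I assms(1) this[unfolded has_vector_derivative_def] assms(2)[unfolded has_vector_derivative_def]]
  show ?thesis by (metis scaleR_one)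
qed

lemma smooth_has_vector_derivative:
  fixes f :: "real \<Rightarrow> 'b::real_normed_vector"
  assumes "open V" "t \<in> I \<inter> V" "smooth_on (I \<inter> V) f"
  shows "(f has_vector_derivative vector_derivative f (at t within I)) (at t within I)"
proof -
  obtain D where D: "(f has_derivative D) (at t within I \<inter> V)"
    using smooth_has_derivative_within[OF assms(3,2)] .
  then have "(f has_derivative D) (at t within I)"
    using assms by (simp add: has_derivative_at_within_Int_open)
  moreover have "D = (\<lambda>h. h *\<^sub>R D 1)"
  proof
    show "D h = h *\<^sub>R D 1" for h
      using linear_cmul[OF has_derivative_linear[OF D], of h 1] by (metis mult.right_neutral real_scaleR_def)
  qed
  ultimately have "(f has_vector_derivative D 1) (at t within I)" unfolding has_vector_derivative_def by simp
  then show ?thesis using has_vector_derivative_eq assms(2) by (metis IntD1)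
qed

lemma smooth_vector_derivative:
  fixes f :: "real \<Rightarrow> 'b::real_normed_vector"
  assumes V: "open V" "smooth_on (I \<inter> V) f"
  shows "smooth_on (I \<inter> V) (\<lambda>s. vector_derivative f (at s within I))"
proof -
  have "smooth_on (I \<inter> V) (\<lambda>s. 1 *\<^sub>R vector_derivative f (at s within I))"
  proof (rule smooth_derivative_within[OF V(2) fat_Int_open[OF I V(1)]])
    fix s assume s: "s \<in> I \<inter> V"
    show "(f has_derivative (\<lambda>h. h *\<^sub>R vector_derivative f (at s within I))) (at s within I \<inter> V)"
      using smooth_has_vector_derivative[OF V(1) s V(2)] s V(1)
      by (simp add: has_derivative_at_within_Int_open has_vector_derivative_def)
  qed
  then show ?thesis by simp
qed

lemma velocity_coord:
  assumes "smooth_curve I A \<gamma>" "t \<in> I" "c \<in> charts_at A (\<gamma> t)"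
  shows "((\<lambda>s. snd c (\<gamma> s)) has_vector_derivative snd (velocity I A \<gamma> t) c) (at t within I)"
proof -
  obtain V where V: "open V" "t \<in> V" "smooth_on (I \<inter> V) (\<lambda>s. snd c (\<gamma> s))"
    using smooth_curve_local[OF assms] by metis
  then show ?thesis
    using smooth_has_vector_derivative[OF V(1) _ V(3)] assms(2,3) by (simp add: velocity_def comp_def)
qed

lemma velocity_coordI:
  assumes "t \<in> I" "c \<in> charts_at A (\<gamma> t)" "((\<lambda>s. snd c (\<gamma> s)) has_vector_derivative v) (at t within I)"
  shows "snd (velocity I A \<gamma> t) c = v"
  using has_vector_derivative_eq[OF assms(1,3)] assms(2) by (simp add: velocity_def comp_def)

lemma velocity_in:
  assumes "smooth_curve I A \<gamma>" "t \<in> I"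
  shows "velocity I A \<gamma> t \<in> tan_space A (\<gamma> t)"
proof (rule tan_spaceI)
  fix c d assume c: "c \<in> charts_at A (\<gamma> t)" "d \<in> charts_at A (\<gamma> t)"
  have cA: "c \<in> A" using c by (simp add: charts_at_iff)
  obtain V where V: "open V" "t \<in> V" "\<And>s. s \<in> I \<inter> V \<Longrightarrow> \<gamma> s \<in> fst c"
    using smooth_curve_local[OF assms c(1)] by metis
  have "((\<lambda>s. transition c d (snd c (\<gamma> s))) has_derivative
      (\<lambda>h. DD (transition c d) (snd c (\<gamma> t)) (h *\<^sub>R snd (velocity I A \<gamma> t) c))) (at t within I)"
    by (rule has_derivative_compose[OF velocity_coord[OF assms c(1), unfolded has_vector_derivative_def]
          transition_has_derivative[OF man c]])
  then have "((\<lambda>s. transition c d (snd c (\<gamma> s))) has_vector_derivative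
      DD (transition c d) (snd c (\<gamma> t)) (snd (velocity I A \<gamma> t) c)) (at t within I \<inter> V)"
    using V(1,2) unfolding has_vector_derivative_def has_derivative_at_within_Int_open[OF V(2,1)]
    by (simp add: linear_cmul[OF linear_transition[OF man c]])
  then have "((\<lambda>s. snd d (\<gamma> s)) has_vector_derivative
      DD (transition c d) (snd c (\<gamma> t)) (snd (velocity I A \<gamma> t) c)) (at t within I \<inter> V)"
    by (rule has_vector_derivative_transform[rotated 2]) (use assms(2) V chart_inv_left[OF man cA] in auto)
  then have "((\<lambda>s. snd d (\<gamma> s)) has_vector_derivative
      DD (transition c d) (snd c (\<gamma> t)) (snd (velocity I A \<gamma> t) c)) (at t within I)"
    unfolding has_vector_derivative_def has_derivative_at_within_Int_open[OF V(2,1)] .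
  then show "snd (velocity I A \<gamma> t) d = DD (transition c d) (snd c (\<gamma> t)) (snd (velocity I A \<gamma> t) c)"
    using velocity_coordI[of t d \<gamma>] assms(2) c(2) by blast
qed (simp_all add: velocity_def)

end

lemma smooth_curve_shrink:
  assumes "man A" "fat I" "fat J" "J \<subseteq> I" "smooth_curve I A \<gamma>"
  shows "smooth_curve J A \<gamma>"
proof (rule smooth_curveI[OF assms(1,3)])
  fix t assume t: "t \<in> J"
  then have "t \<in> I" using assms(4) by auto
  moreover from this obtain c where "c \<in> charts_at A (\<gamma> t)"
    using assms(5) unfolding smooth_curve_def pts_iff by blast
  ultimately obtain V where "open V" "t \<in> V" "\<And>s. s \<in> I \<inter> V \<Longrightarrow> \<gamma> s \<in> fst c" "smooth_on (I \<inter> V) (\<lambda>s. snd c (\<gamma> s))"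
    using smooth_curve_local[OF assms(1,2,5)] by metis
  then show "\<exists>c\<in>A. \<exists>V. open V \<and> t \<in> V \<and> (\<forall>s\<in>J\<inter>V. \<gamma> s \<in> fst c) \<and> smooth_on (J \<inter> V) (\<lambda>s. snd c (\<gamma> s))"
    using \<open>c \<in> charts_at A (\<gamma> t)\<close> assms(4)
    by (intro bexI[of _ c] exI[of _ V]) (auto simp: charts_at_iff intro: smooth_subset)
qed

subsection \<open>Smooth maps, tangent maps and products\<close>

lemma smooth_map_chart:
  assumes "smooth_map A B f" "c \<in> A" "d \<in> B"
  shows "open (snd c ` {p \<in> fst c. f p \<in> fst d})"
    and "smooth_on (snd c ` {p \<in> fst c. f p \<in> fst d}) (\<lambda>x. snd d (f (chart_inv c x)))"
  using assms unfolding smooth_map_def comp_def by blast+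

lemma smooth_map_local:
  assumes "man A" "smooth_map A B f" "c \<in> charts_at A p" "d \<in> charts_at B (f p)"
  obtains V where "open V" "snd c p \<in> V" "V \<subseteq> snd c ` fst c" "\<And>x. x \<in> V \<Longrightarrow> f (chart_inv c x) \<in> fst d"
    "smooth_on V (\<lambda>x. snd d (f (chart_inv c x)))"
proof
  let ?V = "snd c ` {p \<in> fst c. f p \<in> fst d}"
  have c: "c \<in> A" "d \<in> B" "p \<in> fst c" "f p \<in> fst d" using assms(3,4) by (auto simp: charts_at_iff)
  show "open ?V" "smooth_on ?V (\<lambda>x. snd d (f (chart_inv c x)))"
    using smooth_map_chart[OF assms(2) c(1,2)] by auto
  show "f (chart_inv c x) \<in> fst d" if "x \<in> ?V" for x
    using that chart_inv_left[OF assms(1) c(1)] by auto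
qed (use assms in \<open>auto simp: charts_at_iff\<close>)

text \<open>As for curves, one pair of charts around each point is enough. \<open>V1\<close> handles
  the change of chart in the target, \<open>V2\<close> the change in the source.\<close>

lemma smooth_mapI:
  assumes A: "man A" and B: "man B"
    and f: "\<And>p. p \<in> pts A \<Longrightarrow> \<exists>c\<in>charts_at A p. \<exists>d\<in>B. \<exists>V. open V \<and> snd c p \<in> V \<and> V \<subseteq> snd c ` fst c \<and>
      (\<forall>x\<in>V. f (chart_inv c x) \<in> fst d) \<and> smooth_on V (\<lambda>x. snd d (f (chart_inv c x)))"
  shows "smooth_map A B f"
proof -
  have loc: "\<exists>V. open V \<and> x \<in> V \<and> V \<subseteq> snd c ` {p \<in> fst c. f p \<in> fst d} \<and> smooth_on V (\<lambda>x. snd d (f (chart_inv c x)))"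
    if x: "x \<in> snd c ` {p \<in> fst c. f p \<in> fst d}" and cd: "c \<in> A" "d \<in> B" for x c d
  proof -
    obtain p where p: "p \<in> fst c" "f p \<in> fst d" "x = snd c p" using x by auto
    then have "p \<in> pts A" using cd unfolding pts_def by blast
    then obtain c' d' V where c': "c' \<in> A" "p \<in> fst c'" "d' \<in> B" and V: "open V" "snd c' p \<in> V"
      "V \<subseteq> snd c' ` fst c'" "\<forall>x\<in>V. f (chart_inv c' x) \<in> fst d'" "smooth_on V (\<lambda>x. snd d' (f (chart_inv c' x)))"
      using f[of p] by (auto simp: charts_at_iff)
    define h where "h y = snd d' (f (chart_inv c' y))" for y
    define V1 where "V1 = V \<inter> h -` (snd d' ` (fst d' \<inter> fst d))"
    have sh: "smooth_on V h" using V(5) by (simp add: h_def[abs_def])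
    have oV1: "open V1"
      unfolding V1_def by (rule continuous_open_preimage[OF smooth_continuous[OF sh] V(1) open_overlap[OF B c'(3) cd(2)]])
    have V1: "f (chart_inv c' y) \<in> fst d" "snd d (f (chart_inv c' y)) = transition d' d (h y)" if y: "y \<in> V1" for y
    proof -
      obtain r where r: "r \<in> fst d'" "r \<in> fst d" "h y = snd d' r" using y by (auto simp: V1_def)
      moreover have "f (chart_inv c' y) \<in> fst d'" using V(4) y by (auto simp: V1_def)
      ultimately have "f (chart_inv c' y) = r"
        using inj_onD[OF chart_inj[OF B c'(3)]] by (auto simp: h_def)
      then show "f (chart_inv c' y) \<in> fst d" "snd d (f (chart_inv c' y)) = transition d' d (h y)"
        using r chart_inv_left[OF B c'(3)] by auto
    qed
    have "smooth_on V1 (\<lambda>y. transition d' d (h y))"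
      by (rule smooth_compose[OF _ smooth_transition[OF B c'(3) cd(2)] smooth_subset[OF sh]])
         (use B in \<open>auto simp: V1_def man_def\<close>)
    then have s1: "smooth_on V1 (\<lambda>y. snd d (f (chart_inv c' y)))"
      by (rule smooth_cong[THEN iffD1, rotated]) (simp only: V1(2))
    let ?O = "snd c ` (fst c \<inter> fst c')"
    note tr = smooth_transition[OF A cd(1) c'(1)]
    define V2 where "V2 = ?O \<inter> transition c c' -` V1"
    have oV2: "open V2"
      unfolding V2_def
      by (rule continuous_open_preimage[OF smooth_continuous[OF tr] open_overlap[OF A cd(1) c'(1)] oV1])
    have V2: "chart_inv c y \<in> fst c" "snd c (chart_inv c y) = y" "chart_inv c' (transition c c' y) = chart_inv c y"
      "transition c c' y \<in> V1" if "y \<in> V2" for y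
      using that chart_inv_left[OF A cd(1)] chart_inv_left[OF A c'(1)] by (auto simp: V2_def)
    have "smooth_on V2 (\<lambda>y. snd d (f (chart_inv c' (transition c c' y))))"
      by (rule smooth_compose[OF _ s1 smooth_subset[OF tr]]) (use A in \<open>auto simp: V2_def man_def\<close>)
    then have "smooth_on V2 (\<lambda>y. snd d (f (chart_inv c y)))"
      by (rule smooth_cong[THEN iffD1, rotated]) (simp only: V2(3))
    moreover have "x \<in> V2"
    proof -
      have "h (snd c' p) = snd d' (f p)" using chart_inv_left[OF A c'(1,2)] by (simp add: h_def)
      moreover have "f p \<in> fst d'" using V(2,4) chart_inv_left[OF A c'(1,2)] by force
      ultimately show ?thesis
        using p c' V(2) chart_inv_left[OF A cd(1) p(1)] by (auto simp: V2_def V1_def)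
    qed
    moreover have "V2 \<subseteq> snd c ` {p \<in> fst c. f p \<in> fst d}"
    proof
      fix y assume y: "y \<in> V2"
      then have "f (chart_inv c y) \<in> fst d" using V1(1)[OF V2(4)[OF y]] V2(3)[OF y] by simp
      then show "y \<in> snd c ` {p \<in> fst c. f p \<in> fst d}"
        using V2(1,2)[OF y] by (intro image_eqI[of _ _ "chart_inv c y"]) auto
    qed
    ultimately show ?thesis using oV2 by blast
  qed
  show ?thesis unfolding smooth_map_def
  proof (intro conjI ballI)
    fix p assume "p \<in> pts A"
    from f[OF this] obtain c d V where c: "c \<in> A" "p \<in> fst c" "d \<in> B" "snd c p \<in> V"
      "\<forall>x\<in>V. f (chart_inv c x) \<in> fst d" by (auto simp: charts_at_iff)
    then have "f p \<in> fst d" using chart_inv_left[OF A c(1,2)] by force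
    then show "f p \<in> pts B" using c(3) unfolding pts_def by blast
  next
    fix c d assume cd: "c \<in> A" "d \<in> B"
    show o: "open (snd c ` {p \<in> fst c. f p \<in> fst d})"
      unfolding open_subopen[of "snd c ` {p \<in> fst c. f p \<in> fst d}"] using loc[OF _ cd] by blast
    show "smooth_on (snd c ` {p \<in> fst c. f p \<in> fst d}) (snd d \<circ> f \<circ> chart_inv c)"
    proof (rule smooth_local[OF fat_open[OF o]])
      fix x assume x: "x \<in> snd c ` {p \<in> fst c. f p \<in> fst d}"
      obtain V where V: "open V" "x \<in> V" "V \<subseteq> snd c ` {p \<in> fst c. f p \<in> fst d}"
        "smooth_on V (\<lambda>x. snd d (f (chart_inv c x)))" using loc[OF x cd] by blast
      then have "smooth_on (snd c ` {p \<in> fst c. f p \<in> fst d} \<inter> V) (snd d \<circ> f \<circ> chart_inv c)"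
        unfolding comp_def by (metis Int_lower2 smooth_subset)
      with V show "\<exists>V. open V \<and> x \<in> V \<and> smooth_on (snd c ` {p \<in> fst c. f p \<in> fst d} \<inter> V) (snd d \<circ> f \<circ> chart_inv c)"
        by blast
    qed
  qed
qed

text \<open>\<open>tan_map\<close> picks an arbitrary chart of the source. The chain rule with a
  transition shows that every chart gives the same result.\<close>

lemma tan_map_coord:
  assumes A: "man A" and B: "man B" and f: "smooth_map A B f" and Z: "Z \<in> tan_space A p"
    and c: "c \<in> charts_at A p" and d: "d \<in> charts_at B (f p)"
  shows "snd (tan_map A B f Z) d = DD (\<lambda>x. snd d (f (chart_inv c x))) (snd c p) (snd Z c)"
proof -
  define e where "e = (SOME c. c \<in> charts_at A p)"
  have e: "e \<in> charts_at A p" unfolding e_def by (rule some_chart[OF c])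
  have cA: "c \<in> A" "p \<in> fst c" "e \<in> A" "p \<in> fst e" using c e by (auto simp: charts_at_iff)
  obtain V where V: "open V" "snd e p \<in> V" "V \<subseteq> snd e ` fst e" "smooth_on V (\<lambda>x. snd d (f (chart_inv e x)))"
    using smooth_map_local[OF A f e d] by metis
  let ?O = "snd c ` (fst c \<inter> fst e)"
  have "((\<lambda>x. snd d (f (chart_inv e x))) has_derivative DD (\<lambda>x. snd d (f (chart_inv e x))) (snd e p)) (at (snd e p))"
    by (rule smooth_has_derivative[OF V(4,1,2)])
  moreover have "transition c e (snd c p) = snd e p" using chart_inv_left[OF A cA(1,2)] by simp
  ultimately have "((\<lambda>x. snd d (f (chart_inv e x))) has_derivative DD (\<lambda>x. snd d (f (chart_inv e x))) (snd e p))
     (at (transition c e (snd c p)))" by metis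
  from has_derivative_compose[OF transition_has_derivative[OF A c e] this]
  have "DD (\<lambda>x. snd d (f (chart_inv e (transition c e x)))) (snd c p) =
    (\<lambda>v. DD (\<lambda>x. snd d (f (chart_inv e x))) (snd e p) (DD (transition c e) (snd c p) v))" by (rule DD_eq)
  moreover have "DD (\<lambda>x. snd d (f (chart_inv e (transition c e x)))) (snd c p) = DD (\<lambda>x. snd d (f (chart_inv c x))) (snd c p)"
    using cA by (intro DD_cong[OF open_overlap[OF A cA(1,3)]]) (auto simp: chart_inv_left[OF A])
  moreover have "snd Z e = DD (transition c e) (snd c p) (snd Z c)"
    by (rule tan_space_coord[OF Z c e])
  ultimately have "DD (\<lambda>x. snd d (f (chart_inv e x))) (snd e p) (snd Z e) = DD (\<lambda>x. snd d (f (chart_inv c x))) (snd c p) (snd Z c)"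
    by metis
  then show ?thesis
    using d tan_space_fst[OF Z] by (simp add: tan_map_def Let_def comp_def e_def)
qed

lemma tan_map_eq:
  assumes "man A" "man B" "smooth_map A B f" "Z \<in> tan_space A p" "c \<in> charts_at A p" "d \<in> charts_at B (f p)"
  shows "tan_map A B f Z = tvec B d (f p) (DD (\<lambda>x. snd d (f (chart_inv c x))) (snd c p) (snd Z c))"
proof (rule prod_eqI)
  show "fst (tan_map A B f Z) = fst (tvec B d (f p) (DD (\<lambda>x. snd d (f (chart_inv c x))) (snd c p) (snd Z c)))"
    using tan_space_fst[OF assms(4)] by (simp add: tan_map_def Let_def)
  show "snd (tan_map A B f Z) = snd (tvec B d (f p) (DD (\<lambda>x. snd d (f (chart_inv c x))) (snd c p) (snd Z c)))"
  proof
    fix e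
    show "snd (tan_map A B f Z) e = snd (tvec B d (f p) (DD (\<lambda>x. snd d (f (chart_inv c x))) (snd c p) (snd Z c))) e"
    proof (cases "e \<in> charts_at B (f p)")
      case False
      then show ?thesis using tan_space_fst[OF assms(4)] by (simp add: tan_map_def tvec_def Let_def)
    next
      case e: True
      obtain V where V: "open V" "snd c p \<in> V" "\<And>x. x \<in> V \<Longrightarrow> f (chart_inv c x) \<in> fst d"
        "smooth_on V (\<lambda>x. snd d (f (chart_inv c x)))"
        using smooth_map_local[OF assms(1,3,5,6)] by metis
      let ?h = "\<lambda>x. snd d (f (chart_inv c x))"
      have cA: "c \<in> A" "p \<in> fst c" "d \<in> B" using assms(5,6) by (auto simp: charts_at_iff)
      have h: "(?h has_derivative DD ?h (snd c p)) (at (snd c p))" by (rule smooth_has_derivative[OF V(4,1,2)])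
      have "snd d (f p) = ?h (snd c p)" using chart_inv_left[OF assms(1) cA(1,2)] by simp
      then have "(transition d e has_derivative DD (transition d e) (snd d (f p))) (at (?h (snd c p)))"
        using transition_has_derivative[OF assms(2,6) e] by metis
      from has_derivative_compose[OF h this]
      have "DD (\<lambda>x. transition d e (?h x)) (snd c p) = (\<lambda>v. DD (transition d e) (snd d (f p)) (DD ?h (snd c p) v))"
        by (rule DD_eq)
      moreover have "DD (\<lambda>x. transition d e (?h x)) (snd c p) = DD (\<lambda>x. snd e (f (chart_inv c x))) (snd c p)"
        by (rule DD_cong[OF V(1,2)]) (simp add: chart_inv_left[OF assms(2) cA(3) V(3)])
      ultimately have "DD (\<lambda>x. snd e (f (chart_inv c x))) (snd c p) (snd Z c)
          = DD (transition d e) (snd d (f p)) (DD ?h (snd c p) (snd Z c))" by metis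
      then show ?thesis
        using tan_map_coord[OF assms(1-5) e] e by (simp add: tvec_def)
    qed
  qed
qed

lemma tan_map_in:
  assumes "man A" "man B" "smooth_map A B f" "Z \<in> tan_space A p" "p \<in> pts A"
  shows "tan_map A B f Z \<in> tan_space B (f p)"
proof -
  obtain c where c: "c \<in> charts_at A p" using assms(5) pts_iff by metis
  have "f p \<in> pts B" using assms(3,5) unfolding smooth_map_def by blast
  then obtain d where d: "d \<in> charts_at B (f p)" using pts_iff by metis
  show ?thesis unfolding tan_map_eq[OF assms(1-4) c d] by (rule tvec_in[OF assms(2) d])
qed

text \<open>This frees \<open>differential\<close> from the arbitrary chart in its
  definition.\<close>

lemma differential_coord:
  assumes A: "man A" and Z: "Z \<in> tan_space A p" and c: "c \<in> charts_at A p"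
    and f: "((\<lambda>x. f (chart_inv c x)) has_derivative D) (at (snd c p))"
  shows "differential A f Z = D (snd Z c)"
proof -
  define e where "e = (SOME c. c \<in> charts_at A p)"
  have e: "e \<in> charts_at A p" unfolding e_def by (rule some_chart[OF c])
  have cA: "c \<in> A" "p \<in> fst c" "e \<in> A" "p \<in> fst e" using c e by (auto simp: charts_at_iff)
  let ?O = "snd e ` (fst e \<inter> fst c)"
  have "transition e c (snd e p) = snd c p" using chart_inv_left[OF A cA(3,4)] by simp
  then have "((\<lambda>x. f (chart_inv c x)) has_derivative D) (at (transition e c (snd e p)))" using f by metis
  from has_derivative_compose[OF transition_has_derivative[OF A e c] this]
  have "DD (\<lambda>x. f (chart_inv c (transition e c x))) (snd e p) = (\<lambda>v. D (DD (transition e c) (snd e p) v))" by (rule DD_eq)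
  moreover have "DD (\<lambda>x. f (chart_inv c (transition e c x))) (snd e p) = DD (\<lambda>x. f (chart_inv e x)) (snd e p)"
    using cA by (intro DD_cong[OF open_overlap[OF A cA(3,1)]]) (auto simp: chart_inv_left[OF A])
  moreover have "snd Z c = DD (transition e c) (snd e p) (snd Z e)"
    by (rule tan_space_coord[OF Z e c])
  ultimately have "DD (\<lambda>x. f (chart_inv e x)) (snd e p) (snd Z e) = D (snd Z c)" by metis
  then show ?thesis
    using tan_space_fst[OF Z] by (simp add: differential_def Let_def comp_def e_def)
qed

lemma smooth_curve_map:
  assumes A: "man A" and B: "man B" and I: "fat I" and f: "smooth_map A B f" and \<gamma>: "smooth_curve I A \<gamma>"
  shows "smooth_curve I B (\<lambda>s. f (\<gamma> s))"
    and "t \<in> I \<Longrightarrow> velocity I B (\<lambda>s. f (\<gamma> s)) t = tan_map A B f (velocity I A \<gamma> t)"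
proof -
  have loc: "\<exists>V. open V \<and> t \<in> V \<and> (\<forall>s\<in>I\<inter>V. f (\<gamma> s) \<in> fst d) \<and> smooth_on (I \<inter> V) (\<lambda>s. snd d (f (\<gamma> s))) \<and>
     ((\<lambda>s. snd d (f (\<gamma> s))) has_vector_derivative snd (tan_map A B f (velocity I A \<gamma> t)) d) (at t within I)"
    if t: "t \<in> I" and d: "d \<in> charts_at B (f (\<gamma> t))" for t d
  proof -
    obtain c where c: "c \<in> charts_at A (\<gamma> t)"
      using t \<gamma> unfolding smooth_curve_def pts_iff by blast
    then have cA: "c \<in> A" by (simp add: charts_at_iff)
    obtain V where V: "open V" "t \<in> V" "\<And>s. s \<in> I \<inter> V \<Longrightarrow> \<gamma> s \<in> fst c" "smooth_on (I \<inter> V) (\<lambda>s. snd c (\<gamma> s))"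
      using smooth_curve_local[OF A I \<gamma> t c] by metis
    obtain U where U: "open U" "snd c (\<gamma> t) \<in> U" "\<And>x. x \<in> U \<Longrightarrow> f (chart_inv c x) \<in> fst d"
      "smooth_on U (\<lambda>x. snd d (f (chart_inv c x)))"
      using smooth_map_local[OF A f c d] by metis
    have "openin (top_of_set (I \<inter> V)) ((I \<inter> V) \<inter> (\<lambda>s. snd c (\<gamma> s)) -` U)"
      by (rule continuous_openin_preimage_gen[OF smooth_continuous[OF V(4)] U(1)])
    then obtain W where W: "open W" "(I \<inter> V) \<inter> (\<lambda>s. snd c (\<gamma> s)) -` U = (I \<inter> V) \<inter> W"
      unfolding openin_open by blast
    have inv: "chart_inv c (snd c (\<gamma> s)) = \<gamma> s" if "s \<in> I \<inter> V" for s
      using chart_inv_left[OF A cA V(3)[OF that]] .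
    have U': "snd c (\<gamma> s) \<in> U" if "s \<in> I \<inter> (V \<inter> W)" for s using W(2) that by blast
    have "smooth_on (I \<inter> (V \<inter> W)) (\<lambda>s. snd d (f (chart_inv c (snd c (\<gamma> s)))))"
      by (rule smooth_compose[OF _ U(4) smooth_subset[OF V(4)]]) (use A U' in \<open>auto simp: man_def\<close>)
    then have 1: "smooth_on (I \<inter> (V \<inter> W)) (\<lambda>s. snd d (f (\<gamma> s)))"
      by (rule smooth_cong[THEN iffD1, rotated]) (simp add: inv)
    have "((\<lambda>s. snd d (f (chart_inv c (snd c (\<gamma> s))))) has_derivative
       (\<lambda>h. DD (\<lambda>x. snd d (f (chart_inv c x))) (snd c (\<gamma> t)) (h *\<^sub>R snd (velocity I A \<gamma> t) c))) (at t within I)"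
      by (rule has_derivative_compose[OF velocity_coord[OF A I \<gamma> t c, unfolded has_vector_derivative_def]
          smooth_has_derivative[OF U(4,1,2)]])
    then have "((\<lambda>s. snd d (f (chart_inv c (snd c (\<gamma> s))))) has_vector_derivative
       snd (tan_map A B f (velocity I A \<gamma> t)) d) (at t within I \<inter> V)"
      unfolding has_vector_derivative_def has_derivative_at_within_Int_open[OF V(2,1)]
      using tan_map_coord[OF A B f velocity_in[OF A I \<gamma> t] c d]
      by (simp add: linear_cmul[OF linear_DD[OF U(4,1,2)]])
    then have "((\<lambda>s. snd d (f (\<gamma> s))) has_vector_derivative
       snd (tan_map A B f (velocity I A \<gamma> t)) d) (at t within I \<inter> V)"
      by (rule has_vector_derivative_transform[rotated 2]) (use t V(2) inv in auto)
    then have 2: "((\<lambda>s. snd d (f (\<gamma> s))) has_vector_derivative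
       snd (tan_map A B f (velocity I A \<gamma> t)) d) (at t within I)"
      unfolding has_vector_derivative_def has_derivative_at_within_Int_open[OF V(2,1)] .
    have "t \<in> W" using W(2) t V(2) U(2) by blast
    then show ?thesis
      using V(1,2) W(1) 1 2 inv U(3)[OF U'] by (intro exI[of _ "V \<inter> W"]) (simp add: open_Int)
  qed
  have ex: "\<exists>d. d \<in> charts_at B (f (\<gamma> t))" if "t \<in> I" for t
    using that f \<gamma> unfolding smooth_map_def smooth_curve_def pts_iff[symmetric] by blast
  show sc: "smooth_curve I B (\<lambda>s. f (\<gamma> s))"
  proof (rule smooth_curveI[OF B I])
    fix t assume t: "t \<in> I"
    obtain d where d: "d \<in> charts_at B (f (\<gamma> t))" using ex[OF t] by blast
    then have "d \<in> B" by (simp add: charts_at_iff)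
    then show "\<exists>c\<in>B. \<exists>V. open V \<and> t \<in> V \<and> (\<forall>s\<in>I\<inter>V. f (\<gamma> s) \<in> fst c) \<and> smooth_on (I \<inter> V) (\<lambda>s. snd c (f (\<gamma> s)))"
      using loc[OF t d] by blast
  qed
  assume t: "t \<in> I"
  obtain d where d: "d \<in> charts_at B (f (\<gamma> t))" using ex[OF t] by blast
  have "\<gamma> t \<in> pts A" using \<gamma> t unfolding smooth_curve_def by blast
  then show "velocity I B (\<lambda>s. f (\<gamma> s)) t = tan_map A B f (velocity I A \<gamma> t)"
    using loc[OF t d] velocity_coordI[where ?\<gamma>="\<lambda>s. f (\<gamma> s)", OF B I t d]
    by (intro tan_space_eqI[OF velocity_in[OF B I sc t] tan_map_in[OF A B f velocity_in[OF A I \<gamma> t]] d]) auto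
qed

lemma smooth_map_compose:
  assumes A: "man A" and B: "man B" and C: "man C" and f: "smooth_map A B f" and g: "smooth_map B C g"
  shows "smooth_map A C (\<lambda>p. g (f p))"
proof (rule smooth_mapI[OF A C])
  fix p assume p: "p \<in> pts A"
  obtain c where c: "c \<in> charts_at A p" using p pts_iff by metis
  have "f p \<in> pts B" using p f unfolding smooth_map_def by blast
  moreover from this have "g (f p) \<in> pts C" using g unfolding smooth_map_def by blast
  ultimately obtain d e where d: "d \<in> charts_at B (f p)" and e: "e \<in> charts_at C (g (f p))"
    using pts_iff by metis
  have cA: "c \<in> A" "p \<in> fst c" "d \<in> B" "e \<in> C" using c d e by (auto simp: charts_at_iff)
  obtain V where V: "open V" "snd c p \<in> V" "V \<subseteq> snd c ` fst c" "\<And>x. x \<in> V \<Longrightarrow> f (chart_inv c x) \<in> fst d"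
    "smooth_on V (\<lambda>x. snd d (f (chart_inv c x)))" using smooth_map_local[OF A f c d] by metis
  obtain U where U: "open U" "snd d (f p) \<in> U" "\<And>x. x \<in> U \<Longrightarrow> g (chart_inv d x) \<in> fst e"
    "smooth_on U (\<lambda>x. snd e (g (chart_inv d x)))" using smooth_map_local[OF B g d e] by metis
  let ?W = "V \<inter> (\<lambda>x. snd d (f (chart_inv c x))) -` U"
  have oW: "open ?W" by (rule continuous_open_preimage[OF smooth_continuous[OF V(5)] V(1) U(1)])
  have inv: "chart_inv d (snd d (f (chart_inv c x))) = f (chart_inv c x)" if "x \<in> V" for x
    using chart_inv_left[OF B cA(3) V(4)[OF that]] .
  have "smooth_on ?W (\<lambda>x. snd e (g (chart_inv d (snd d (f (chart_inv c x))))))"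
    by (rule smooth_compose[OF _ U(4) smooth_subset[OF V(5)]]) (use B in \<open>auto simp: man_def\<close>)
  then have "smooth_on ?W (\<lambda>x. snd e (g (f (chart_inv c x))))"
    by (rule smooth_cong[THEN iffD1, rotated]) (simp add: inv)
  moreover have "g (f (chart_inv c x)) \<in> fst e" if "x \<in> ?W" for x
    using U(3)[of "snd d (f (chart_inv c x))"] that inv by auto
  moreover have "snd c p \<in> ?W" using V(2) U(2) chart_inv_left[OF A cA(1,2)] by auto
  ultimately show "\<exists>c\<in>charts_at A p. \<exists>e\<in>C. \<exists>V. open V \<and> snd c p \<in> V \<and> V \<subseteq> snd c ` fst c \<and>
      (\<forall>x\<in>V. g (f (chart_inv c x)) \<in> fst e) \<and> smooth_on V (\<lambda>x. snd e (g (f (chart_inv c x))))"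
    using c cA(4) oW V(3) by (intro bexI[of _ c] bexI[of _ e] exI[of _ ?W] conjI) auto
qed

abbreviation prod_chart :: "('p, 'e) chart \<Rightarrow> ('r, 'f) chart \<Rightarrow> ('p \<times> 'r, 'e \<times> 'f) chart" where
  "prod_chart c d \<equiv> (fst c \<times> fst d, map_prod (snd c) (snd d))"

lemma prod_atlas_eq: "prod_atlas A B = (\<lambda>(c, d). prod_chart c d) ` (A \<times> B)"
  by (simp add: prod_atlas_def)

lemma charts_at_prod: "c \<in> charts_at A p \<Longrightarrow> d \<in> charts_at B r \<Longrightarrow> prod_chart c d \<in> charts_at (prod_atlas A B) (p, r)"
  unfolding prod_atlas_eq charts_at_iff by auto

lemma pts_prod: "pts (prod_atlas A B) = pts A \<times> pts B"
  unfolding prod_atlas_eq pts_def by auto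

context
  fixes A :: "('p, 'e::real_inner) atlas" and B :: "('r, 'f::real_inner) atlas"
  assumes A: "man A" and B: "man B"
begin

lemma prod_chart_inj:
  assumes "c \<in> A" "d \<in> B" shows "inj_on (map_prod (snd c) (snd d)) (fst c \<times> fst d)"
  using map_prod_inj_on[OF chart_inj[OF A assms(1)] chart_inj[OF B assms(2)]] .

lemma chart_inv_prod:
  assumes "c \<in> A" "d \<in> B" "x \<in> snd c ` fst c" "y \<in> snd d ` fst d"
  shows "chart_inv (prod_chart c d) (x, y) = (chart_inv c x, chart_inv d y)"
proof -
  obtain p r where p: "p \<in> fst c" "x = snd c p" "r \<in> fst d" "y = snd d r" using assms by auto
  then have "chart_inv (prod_chart c d) (map_prod (snd c) (snd d) (p, r)) = (p, r)"
    unfolding chart_inv_def fst_conv snd_conv by (intro inv_into_f_f prod_chart_inj assms) auto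
  then show ?thesis using p chart_inv_left[OF A assms(1)] chart_inv_left[OF B assms(2)] by simp
qed

lemma prod_overlap:
  "map_prod (snd c) (snd d) ` (fst c \<times> fst d \<inter> fst c' \<times> fst d') = (snd c ` (fst c \<inter> fst c')) \<times> (snd d ` (fst d \<inter> fst d'))"
  by (auto simp: map_prod_def image_iff)

lemma man_prod: "man (prod_atlas A B)"
proof -
  have fe: "fin_dim TYPE('e)" "fin_dim TYPE('f)" using A B by (auto simp: man_def)
  have "smooth_on ((snd c ` (fst c \<inter> fst c')) \<times> (snd d ` (fst d \<inter> fst d')))
      (map_prod (snd c') (snd d') \<circ> chart_inv (prod_chart c d))"
    if c: "c \<in> A" "d \<in> B" "c' \<in> A" "d' \<in> B" for c d c' d'
  proof -
    have "smooth_on ((snd c ` (fst c \<inter> fst c')) \<times> (snd d ` (fst d \<inter> fst d')))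
       (\<lambda>z. (transition c c' (fst z), transition d d' (snd z)))"
      by (intro smooth_Pair smooth_compose[OF fe(1) smooth_transition[OF A c(1,3)] smooth_fst[OF smooth_ident]]
          smooth_compose[OF fe(2) smooth_transition[OF B c(2,4)] smooth_snd[OF smooth_ident]]) auto
    then show ?thesis
      by (rule smooth_cong[THEN iffD1, rotated]) (use c in \<open>auto simp: chart_inv_prod\<close>)
  qed
  then show ?thesis
    unfolding man_def smooth_atlas_def prod_atlas_eq
    using fin_dim_prod[OF fe] open_chart[OF A] open_chart[OF B] open_overlap[OF A] open_overlap[OF B]
    by (auto simp: prod_chart_inj prod_overlap open_Times map_prod_surj_on)
qed

lemma smooth_curve_Pair:
  assumes I: "fat I" and \<alpha>: "smooth_curve I A \<alpha>" and \<beta>: "smooth_curve I B \<beta>"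
  shows "smooth_curve I (prod_atlas A B) (\<lambda>s. (\<alpha> s, \<beta> s))"
proof (rule smooth_curveI[OF man_prod I])
  fix t assume t: "t \<in> I"
  obtain c where c: "c \<in> charts_at A (\<alpha> t)" using t \<alpha> unfolding smooth_curve_def pts_iff by blast
  obtain d where d: "d \<in> charts_at B (\<beta> t)" using t \<beta> unfolding smooth_curve_def pts_iff by blast
  obtain V where V: "open V" "t \<in> V" "\<And>s. s \<in> I \<inter> V \<Longrightarrow> \<alpha> s \<in> fst c" "smooth_on (I \<inter> V) (\<lambda>s. snd c (\<alpha> s))"
    using smooth_curve_local[OF A I \<alpha> t c] by metis
  obtain U where U: "open U" "t \<in> U" "\<And>s. s \<in> I \<inter> U \<Longrightarrow> \<beta> s \<in> fst d" "smooth_on (I \<inter> U) (\<lambda>s. snd d (\<beta> s))"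
    using smooth_curve_local[OF B I \<beta> t d] by metis
  have "smooth_on (I \<inter> (V \<inter> U)) (\<lambda>s. (snd c (\<alpha> s), snd d (\<beta> s)))"
    by (rule smooth_Pair[OF smooth_subset[OF V(4)] smooth_subset[OF U(4)]]) auto
  moreover have "prod_chart c d \<in> prod_atlas A B" using charts_at_prod[OF c d] by (simp add: charts_at_iff)
  ultimately show "\<exists>c\<in>prod_atlas A B. \<exists>V. open V \<and> t \<in> V \<and> (\<forall>s\<in>I\<inter>V. (\<alpha> s, \<beta> s) \<in> fst c) \<and>
      smooth_on (I \<inter> V) (\<lambda>s. snd c (\<alpha> s, \<beta> s))"
    using V U by (intro bexI[of _ "prod_chart c d"] exI[of _ "V \<inter> U"]) auto
qed

lemma velocity_Pair:
  assumes I: "fat I" and \<alpha>: "smooth_curve I A \<alpha>" and \<beta>: "smooth_curve I B \<beta>" and t: "t \<in> I"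
    and c: "c \<in> charts_at A (\<alpha> t)" and d: "d \<in> charts_at B (\<beta> t)"
  shows "snd (velocity I (prod_atlas A B) (\<lambda>s. (\<alpha> s, \<beta> s)) t) (prod_chart c d)
    = (snd (velocity I A \<alpha> t) c, snd (velocity I B \<beta> t) d)"
proof (rule velocity_coordI[where ?\<gamma>="\<lambda>s. (\<alpha> s, \<beta> s)", OF man_prod I t charts_at_prod[OF c d]])
  show "((\<lambda>s. snd (prod_chart c d) (\<alpha> s, \<beta> s)) has_vector_derivative
     (snd (velocity I A \<alpha> t) c, snd (velocity I B \<beta> t) d)) (at t within I)"
    using has_vector_derivative_Pair[OF velocity_coord[OF A I \<alpha> t c] velocity_coord[OF B I \<beta> t d]] by simp
qed

end

subsection \<open>Lie brackets\<close>

text \<open>Smoothness of a field near \<open>p\<close> as seen in one chart. The bracket at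
  \<open>p\<close> depends on nothing more, and lifts and fundamental fields are recognized to have
  it without being packaged as vector fields.\<close>

definition field_at :: "('p, 'e::real_inner) atlas \<Rightarrow> ('p \<Rightarrow> ('p, 'e) tvec) \<Rightarrow> 'p \<Rightarrow> ('p, 'e) chart \<Rightarrow> bool" where
  "field_at A X p c \<longleftrightarrow> (\<exists>V. open V \<and> snd c p \<in> V \<and> V \<subseteq> snd c ` fst c \<and>
     (\<forall>x\<in>V. X (chart_inv c x) \<in> tan_space A (chart_inv c x)) \<and> smooth_on V (\<lambda>x. snd (X (chart_inv c x)) c))"

lemma vector_field_on_chart:
  assumes A: "man A" and W: "openin (manifold_topology A) W" and X: "vector_field_on A W X" and c: "c \<in> A"
  shows "open (snd c ` (W \<inter> fst c))" and "smooth_on (snd c ` (W \<inter> fst c)) (\<lambda>x. snd (X (chart_inv c x)) c)"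
proof -
  have sA: "smooth_atlas A" using A by (simp add: man_def)
  let ?V = "snd c ` (W \<inter> fst c)"
  show "open ?V" using W(1) c openin_manifold_topology[OF sA] by blast
  have XW: "X q \<in> tan_space A q" if "q \<in> W" for q
    using X that unfolding vector_field_on_def by blast
  let ?c = "(fst c \<inter> W, snd c)"
  have "?c \<in> restrict_atlas A W" "tan_chart A c \<in> tan_atlas A"
    using c by (auto simp: restrict_atlas_def tan_atlas_def)
  moreover have "smooth_map (restrict_atlas A W) (tan_atlas A) X"
    using X unfolding vector_field_on_def by blast
  ultimately have "smooth_on (snd ?c ` {p \<in> fst ?c. X p \<in> fst (tan_chart A c)})
     (\<lambda>x. snd (tan_chart A c) (X (chart_inv ?c x)))" using smooth_map_chart(2) by blast
  moreover have "{p \<in> fst ?c. X p \<in> fst (tan_chart A c)} = W \<inter> fst c"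
  proof -
    have "X q \<in> fst (tan_chart A c) \<longleftrightarrow> q \<in> fst c" if "q \<in> W" for q
      using XW[OF that] tan_space_fst[OF XW[OF that]] by (simp add: tan_chart_domain)
    then show ?thesis by auto
  qed
  ultimately have "smooth_on ?V (\<lambda>x. snd (tan_chart A c) (X (chart_inv ?c x)))" by simp
  then have 1: "smooth_on ?V (\<lambda>x. snd (snd (tan_chart A c) (X (chart_inv ?c x))))" by (rule smooth_snd)
  \<comment> \<open>Restricting the chart changes the set over which \<open>inv_into\<close>
    chooses; the two inverses agree on the image of the smaller domain.\<close>
  have inv: "chart_inv ?c x = chart_inv c x" if x: "x \<in> ?V" for x
  proof -
    obtain q where q: "q \<in> W" "q \<in> fst c" "x = snd c q" using x by blast
    have "inj_on (snd c) (fst c \<inter> W)" using inj_on_subset[OF chart_inj[OF A c]] by blast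
    then have "chart_inv ?c x = q" unfolding chart_inv_def using q by (simp add: inv_into_f_f)
    then show ?thesis using q chart_inv_left[OF A c] by simp
  qed
  from 1 show "smooth_on ?V (\<lambda>x. snd (X (chart_inv c x)) c)"
    by (rule smooth_cong[THEN iffD1, rotated]) (simp add: inv)
qed

lemma vector_field_on_field_at:
  assumes A: "man A" and W: "openin (manifold_topology A) W" "p \<in> W" and X: "vector_field_on A W X"
    and c: "c \<in> charts_at A p"
  shows "field_at A X p c"
proof -
  have cA: "c \<in> A" "p \<in> fst c" using c by (auto simp: charts_at_iff)
  let ?V = "snd c ` (W \<inter> fst c)"
  have "X (chart_inv c x) \<in> tan_space A (chart_inv c x)" if x: "x \<in> ?V" for x
  proof -
    obtain q where "q \<in> W" "q \<in> fst c" "x = snd c q" using x by blast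
    then show ?thesis using X chart_inv_left[OF A cA(1)] unfolding vector_field_on_def by simp
  qed
  then show ?thesis
    unfolding field_at_def using vector_field_on_chart[OF A W(1) X cA(1)] W(2) cA by (intro exI[of _ ?V]) auto
qed

text \<open>Under a change of charts each of the two terms of the bracket acquires a second
  derivative of the transition; by symmetry (\<open>sym\<close>) these cancel.\<close>

lemma lie_bracket_in:
  fixes A :: "('p, 'e::real_inner) atlas"
  assumes A: "man A" and p: "p \<in> pts A"
    and X: "\<And>c. c \<in> charts_at A p \<Longrightarrow> field_at A X p c" and Y: "\<And>c. c \<in> charts_at A p \<Longrightarrow> field_at A Y p c"
  shows "lie_bracket A X Y p \<in> tan_space A p"
proof (rule tan_spaceI)
  fix c d assume c: "c \<in> charts_at A p" and d: "d \<in> charts_at A p"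
  have cA: "c \<in> A" "p \<in> fst c" "d \<in> A" "p \<in> fst d" using c d by (auto simp: charts_at_iff)
  define \<phi> where "\<phi> = transition c d"
  let ?O = "snd c ` (fst c \<inter> fst d)"
  have \<phi>: "smooth_on ?O \<phi>" "open ?O" and xO: "snd c p \<in> ?O"
    using smooth_transition[OF A cA(1,3)] open_overlap[OF A cA(1,3)] cA by (auto simp: \<phi>_def)
  have fe: "fin_dim TYPE('e)" using A by (simp add: man_def)
  have \<phi>x: "\<phi> (snd c p) = snd d p" using cA by (simp add: \<phi>_def chart_inv_left[OF A])
  define R where "R X c x = snd (X (chart_inv c x)) c" for X :: "'p \<Rightarrow> ('p, 'e) tvec" and c x
  have push: "R X d (snd d p) = DD \<phi> (snd c p) (R X c (snd c p))"
    and dpush: "DD (R X d) (snd d p) (DD \<phi> (snd c p) h) = DD (\<lambda>y. DD \<phi> y (R X c (snd c p))) (snd c p) h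
        + DD \<phi> (snd c p) (DD (R X c) (snd c p) h)"
    if f: "field_at A X p c" "field_at A X p d" for X h
  proof -
    obtain V where V: "open V" "snd c p \<in> V" "V \<subseteq> snd c ` fst c"
      "\<And>x. x \<in> V \<Longrightarrow> X (chart_inv c x) \<in> tan_space A (chart_inv c x)" "smooth_on V (R X c)"
      using f(1) unfolding field_at_def R_def[abs_def] by blast
    obtain U where U: "open U" "snd d p \<in> U" "smooth_on U (R X d)"
      using f(2) unfolding field_at_def R_def[abs_def] by blast
    let ?V = "V \<inter> ?O"
    have oV: "open ?V" "snd c p \<in> ?V" using V(1,2) \<phi>(2) xO by auto
    have eq: "R X d (\<phi> x) = DD \<phi> x (R X c x)" if x: "x \<in> ?V" for x
    proof -
      obtain q where q: "q \<in> fst c" "q \<in> fst d" "x = snd c q" using x by auto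
      then have iq: "chart_inv c x = q" "chart_inv d (\<phi> x) = q"
        using chart_inv_left[OF A cA(1)] chart_inv_left[OF A cA(3)] by (auto simp: \<phi>_def)
      have "X q \<in> tan_space A q" using V(4)[of x] x iq by simp
      moreover have "c \<in> charts_at A q" "d \<in> charts_at A q" using q cA by (auto simp: charts_at_iff)
      ultimately have "snd (X q) d = DD (transition c d) (snd c q) (snd (X q) c)" by (rule tan_space_coord)
      then show ?thesis unfolding R_def iq by (simp only: \<phi>_def q(3))
    qed
    from eq[OF oV(2)] show "R X d (snd d p) = DD \<phi> (snd c p) (R X c (snd c p))" by (simp add: \<phi>x)
    have l: "DD (\<lambda>x. R X d (\<phi> x)) (snd c p) = (\<lambda>h. DD (R X d) (snd d p) (DD \<phi> (snd c p) h))"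
      by (rule DD_eq[OF has_derivative_compose[OF smooth_has_derivative[OF \<phi> xO]]])
         (simp add: \<phi>x smooth_has_derivative[OF U(3,1,2)])
    have "((\<lambda>x. DD \<phi> x (R X c x)) has_derivative (\<lambda>h. DD (\<lambda>y. DD \<phi> y (R X c (snd c p))) (snd c p) h
        + DD \<phi> (snd c p) (DD (R X c) (snd c p) h))) (at (snd c p) within ?O)"
      by (rule has_derivative_apply[OF fe])
         (simp_all add: xO fat_open[OF \<phi>(2)] linear_DD[OF \<phi>]
           has_derivative_at_withinI[OF smooth_has_derivative[OF smooth_DD[OF \<phi>] \<phi>(2) xO]]
           has_derivative_at_withinI[OF smooth_has_derivative[OF V(5,1,2)]])
    then have "DD (\<lambda>x. DD \<phi> x (R X c x)) (snd c p) = (\<lambda>h. DD (\<lambda>y. DD \<phi> y (R X c (snd c p))) (snd c p) h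
        + DD \<phi> (snd c p) (DD (R X c) (snd c p) h))"
      using at_within_open[OF xO \<phi>(2)] by (intro DD_eq) simp
    moreover have "DD (\<lambda>x. DD \<phi> x (R X c x)) (snd c p) = DD (\<lambda>x. R X d (\<phi> x)) (snd c p)"
      by (rule DD_cong[OF oV]) (simp add: eq)
    ultimately show "DD (R X d) (snd d p) (DD \<phi> (snd c p) h) = DD (\<lambda>y. DD \<phi> y (R X c (snd c p))) (snd c p) h
        + DD \<phi> (snd c p) (DD (R X c) (snd c p) h)" using l by metis
  qed
  have br: "snd (lie_bracket A X Y p) e = DD (R Y e) (snd e p) (R X e (snd e p)) - DD (R X e) (snd e p) (R Y e (snd e p))"
    if "e \<in> charts_at A p" for e
    using that by (simp add: lie_bracket_def Let_def R_def[abs_def])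
  have sym: "DD (\<lambda>y. DD \<phi> y (R Y c (snd c p))) (snd c p) (R X c (snd c p)) =
      DD (\<lambda>y. DD \<phi> y (R X c (snd c p))) (snd c p) (R Y c (snd c p))"
    by (rule DD_symmetric[OF \<phi> xO])
  have "snd (lie_bracket A X Y p) d = DD \<phi> (snd c p) (snd (lie_bracket A X Y p) c)"
    unfolding br[OF d] br[OF c] push[OF X[OF c] X[OF d]] push[OF Y[OF c] Y[OF d]]
      dpush[OF X[OF c] X[OF d]] dpush[OF Y[OF c] Y[OF d]] sym
    using linear_diff[OF linear_DD[OF \<phi> xO]] by simp
  then show "snd (lie_bracket A X Y p) d = DD (transition c d) (snd c p) (snd (lie_bracket A X Y p) c)"
    by (simp add: \<phi>_def)
qed (simp_all add: lie_bracket_def)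

subsection \<open>Extension of tangent vectors to vector fields\<close>

lemma openin_pts: "man A \<Longrightarrow> openin (manifold_topology A) (pts A)"
proof -
  assume A: "man A"
  have "pts A \<inter> fst c = fst c" if "c \<in> A" for c using that by (auto simp: pts_def)
  then show ?thesis
    using openin_manifold_topology[of A "pts A"] open_chart[OF A] A by (simp add: man_def)
qed

text \<open>Compact sets are closed in a Hausdorff space. Hence a field with compact support inside
  a chart can be continued by zero.\<close>

lemma closedin_chart_image:
  assumes M: "manifold A" and c: "c \<in> A" and K: "compact K" "K \<subseteq> snd c ` fst c"
  shows "openin (manifold_topology A) (pts A - chart_inv c ` K)"
proof -
  have A: "man A" using manifold_man[OF M] .
  have sA: "smooth_atlas A" using A by (simp add: man_def)
  note op = openin_manifold_topology[OF sA]
  have ts: "topspace (manifold_topology A) = pts A"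
  proof -
    have "openin (manifold_topology A) (pts A)" by (rule openin_pts[OF A])
    moreover have "openin (manifold_topology A) W \<Longrightarrow> W \<subseteq> pts A" for W unfolding op by blast
    ultimately show ?thesis by (metis openin_subset openin_topspace subset_antisym)
  qed
  have cont: "continuous_map (top_of_set (snd c ` fst c)) (manifold_topology A) (chart_inv c)"
    unfolding continuous_map_def
  proof (intro conjI allI impI)
    show "chart_inv c \<in> topspace (top_of_set (snd c ` fst c)) \<rightarrow> topspace (manifold_topology A)"
      using chart_inv_mem[of _ c] c unfolding ts pts_def by auto
    fix U assume U: "openin (manifold_topology A) U"
    have "{x \<in> snd c ` fst c. chart_inv c x \<in> U} = snd c ` (U \<inter> fst c)"
      using chart_inv_left[OF A c] by auto
    moreover have "open (snd c ` (U \<inter> fst c))" using U c unfolding op by blast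
    ultimately show "openin (top_of_set (snd c ` fst c)) {x \<in> topspace (top_of_set (snd c ` fst c)). chart_inv c x \<in> U}"
      using open_openin_trans[OF open_chart[OF A c], of "snd c ` (U \<inter> fst c)"] by auto
  qed
  have "compactin (top_of_set (snd c ` fst c)) K" using K by (simp add: compactin_subtopology)
  then have "compactin (manifold_topology A) (chart_inv c ` K)" by (rule image_compactin[OF _ cont])
  then have "closedin (manifold_topology A) (chart_inv c ` K)"
    using M compactin_imp_closedin unfolding manifold_def by blast
  then show ?thesis by (simp add: closedin_def ts)
qed

lemma vector_field_field_at:
  assumes "man A" "vector_field A X" "c \<in> charts_at A p"
  shows "field_at A X p c"
  using vector_field_on_field_at[OF assms(1) openin_pts[OF assms(1)] _ assms(2,3)] assms(3) pts_iff by metis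

text \<open>The field with constant coordinates \<open>snd Z c\<close> in a chart is multiplied by a
  bump function and continued by zero.\<close>

lemma vector_field_extension:
  fixes A :: "('p, 'e::real_inner) atlas"
  assumes M: "manifold A" and p: "p \<in> pts A" and Z: "Z \<in> tan_space A p"
  obtains X where "vector_field A X" "X p = Z"
proof -
  have A: "man A" using manifold_man[OF M] .
  have fe: "fin_dim TYPE('e)" using A by (simp add: man_def)
  obtain c where c: "c \<in> charts_at A p" using p pts_iff by metis
  then have cA: "c \<in> A" "p \<in> fst c" by (auto simp: charts_at_iff)
  define x0 where "x0 = snd c p"
  obtain r where r: "r > 0" "cball x0 r \<subseteq> snd c ` fst c"
    using open_chart[OF A cA(1)] cA(2) open_contains_cball unfolding x0_def by (metis image_eqI)
  define K where "K = chart_inv c ` cball x0 r"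
  have oK: "openin (manifold_topology A) (pts A - K)"
    unfolding K_def by (rule closedin_chart_image[OF M cA(1) fin_dim_compact_cball[OF fe] r(2)])
  \<comment> \<open>The normalization makes \<open>\<psi>\<close> equal to 1 at \<open>x0\<close>;
    outside the ball the argument of \<open>flat\<close> is negative. Using the squared distance
    keeps \<open>\<psi>\<close> smooth at \<open>x0\<close>.\<close>
  define \<psi> where "\<psi> x = flat (r^2 - (x - x0) \<bullet> (x - x0)) / flat (r^2)" for x
  have s\<psi>: "smooth_on V \<psi>" for V
  proof -
    have 1: "smooth_on V (\<lambda>x. r^2 - (x - x0) \<bullet> (x - x0))"
      by (intro smooth_diff smooth_inner smooth_ident smooth_const)
    have "smooth_on V (\<lambda>x. flat (r^2 - (x - x0) \<bullet> (x - x0)) * (1 / flat (r^2)))"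
      by (rule smooth_mult[OF smooth_compose[OF fin_dim_real smooth_flat[of UNIV] 1] smooth_const]) simp
    then show ?thesis by (simp add: \<psi>_def[abs_def])
  qed
  have \<psi>0: "\<psi> x0 = 1" using flat_pos[of "r^2"] r(1) by (simp add: \<psi>_def)
  have \<psi>_out: "\<psi> x = 0" if "x \<notin> cball x0 r" for x
  proof -
    have "r < norm (x - x0)" using that by (simp add: dist_norm norm_minus_commute)
    then have "r^2 < (norm (x - x0))^2" using r(1) by (intro power_strict_mono) auto
    then show ?thesis by (simp add: \<psi>_def flat_def power2_norm_eq_inner)
  qed
  define X where "X q = (if q \<in> fst c then tvec A c q (\<psi> (snd c q) *\<^sub>R snd Z c) else tzero q)" for q
  have X_in: "X q \<in> tan_space A q" if "q \<in> pts A" for q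
    using that tvec_in[OF A] tzero_in[OF A] cA(1) by (auto simp: X_def charts_at_iff)
  have X_zero: "X q = tzero q" if q: "q \<in> pts A - K" for q
  proof (cases "q \<in> fst c")
    case True
    have "snd c q \<notin> cball x0 r"
    proof
      assume "snd c q \<in> cball x0 r"
      then have "chart_inv c (snd c q) \<in> K" by (auto simp: K_def)
      then show False using q chart_inv_left[OF A cA(1) True] by simp
    qed
    then have "X q = tvec A c q 0" using True by (simp add: X_def \<psi>_out)
    then show ?thesis using tvec_zero[OF A, of c q] True cA by (simp add: charts_at_iff)
  qed (simp add: X_def)
  have "restrict_atlas A (pts A) = A"
  proof -
    have "(fst c \<inter> pts A, snd c) = c" if "c \<in> A" for c
      using that by (intro prod_eqI) (auto simp: pts_def)
    then have "(\<lambda>c. (fst c \<inter> pts A, snd c)) ` A = id ` A" by (intro image_cong) auto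
    then show ?thesis by (simp add: restrict_atlas_def)
  qed
  moreover have "smooth_map A (tan_atlas A) X"
  proof (rule smooth_mapI[OF A man_tan[OF A]])
    fix q assume q: "q \<in> pts A"
    show "\<exists>c\<in>charts_at A q. \<exists>d\<in>tan_atlas A. \<exists>V. open V \<and> snd c q \<in> V \<and> V \<subseteq> snd c ` fst c \<and>
        (\<forall>x\<in>V. X (chart_inv c x) \<in> fst d) \<and> smooth_on V (\<lambda>x. snd d (X (chart_inv c x)))"
    proof (cases "q \<in> fst c")
      case True
      have Xc: "X (chart_inv c x) = tvec A c (chart_inv c x) (\<psi> x *\<^sub>R snd Z c)" if "x \<in> snd c ` fst c" for x
        using chart_inv_mem[OF that] chart_inv_right[OF that] by (simp add: X_def)
      have "smooth_on (snd c ` fst c) (\<lambda>x. (x, \<psi> x *\<^sub>R snd Z c))"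
        by (intro smooth_Pair smooth_ident smooth_scaleR s\<psi> smooth_const)
      then have s: "smooth_on (snd c ` fst c) (\<lambda>x. snd (tan_chart A c) (X (chart_inv c x)))"
        by (rule smooth_cong[THEN iffD1, rotated])
           (simp add: Xc chart_inv_right tvec_coord[OF A] chart_inv_mem cA charts_at_iff)
      show ?thesis
      proof (intro bexI[of _ c] bexI[of _ "tan_chart A c"] exI[of _ "snd c ` fst c"] conjI ballI)
        show "X (chart_inv c x) \<in> fst (tan_chart A c)" if "x \<in> snd c ` fst c" for x
          unfolding Xc[OF that] by (rule tvec_in_tan_chart[OF A cA(1) chart_inv_mem[OF that]])
      qed (use s True open_chart[OF A cA(1)] cA in \<open>auto simp: tan_atlas_def charts_at_iff simp del: snd_tan_chart\<close>)
    next
      case False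
      \<comment> \<open>A point outside the domain of \<open>c\<close> lies in the open complement
        of \<open>K\<close>, on which the field is zero in every chart.\<close>
      have "K \<subseteq> fst c" unfolding K_def using chart_inv_mem[of _ c] r(2) by blast
      then have qK: "q \<in> pts A - K" using q False by blast
      obtain e where e: "e \<in> charts_at A q" using q pts_iff by metis
      then have eA: "e \<in> A" "q \<in> fst e" by (auto simp: charts_at_iff)
      let ?V = "snd e ` ((pts A - K) \<inter> fst e)"
      have oV: "open ?V" using oK eA(1) A unfolding man_def using openin_manifold_topology by blast
      have Xe: "X (chart_inv e x) = tzero (chart_inv e x)" "x \<in> snd e ` fst e" if x: "x \<in> ?V" for x
      proof -
        obtain q' where "q' \<in> pts A - K" "q' \<in> fst e" "x = snd e q'" using x by blast
        then show "X (chart_inv e x) = tzero (chart_inv e x)" "x \<in> snd e ` fst e"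
          using X_zero chart_inv_left[OF A eA(1)] by auto
      qed
      have "smooth_on ?V (\<lambda>x. (x, 0::'e))" by (intro smooth_Pair smooth_ident smooth_const)
      then have s: "smooth_on ?V (\<lambda>x. snd (tan_chart A e) (X (chart_inv e x)))"
        by (rule smooth_cong[THEN iffD1, rotated]) (simp add: Xe chart_inv_right)
      show ?thesis
      proof (intro bexI[of _ e] bexI[of _ "tan_chart A e"] exI[of _ ?V] conjI ballI)
        show "X (chart_inv e x) \<in> fst (tan_chart A e)" if "x \<in> ?V" for x
          unfolding Xe(1)[OF that] using chart_inv_mem[OF Xe(2)[OF that]] tzero_in[OF A]
          by (simp add: tan_chart_domain)
      qed (use s e oV qK eA in \<open>auto simp: tan_atlas_def simp del: snd_tan_chart\<close>)
    qed
  qed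
  ultimately have "vector_field A X" using X_in by (simp add: vector_field_on_def)
  moreover have "X p = Z"
    using cA(2) \<psi>0 tvec_collapse[OF A Z c] by (simp add: X_def x0_def)
  ultimately show ?thesis using that by blast
qed

section \<open>Local solutions of ordinary differential equations\<close>

text \<open>On the compact ball the operator norm of the derivative is controlled by its values on
  the finitely many vectors of \<open>E\<close>.\<close>

lemma smooth_lipschitz_cball:
  fixes F :: "'a::real_inner \<Rightarrow> 'b::real_normed_vector"
  assumes fd: "fin_dim TYPE('a)" and F: "smooth_on U F" "open U" "cball x r \<subseteq> U"
  obtains K where "K > 0" "\<And>y z. y \<in> cball x r \<Longrightarrow> z \<in> cball x r \<Longrightarrow> norm (F y - F z) \<le> K * norm (y - z)"
proof -
  obtain E w where E: "finite (E::'a set)" "\<And>x. x = (\<Sum>b\<in>E. (x \<bullet> w b) *\<^sub>R b)"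
    using fin_dim_coords[OF fd] by metis
  note cpt = fin_dim_compact_cball[OF fd, of x r]
  have "\<exists>B. \<forall>y\<in>cball x r. norm (DD F y b) \<le> B" for b
  proof -
    have "continuous_on (cball x r) (\<lambda>y. DD F y b)"
      using smooth_continuous[OF smooth_DD[OF F(1,2)]] F(3) by (rule continuous_on_subset)
    then have "bounded ((\<lambda>y. DD F y b) ` cball x r)"
      using compact_continuous_image[OF _ cpt] compact_imp_bounded by blast
    then show ?thesis unfolding bounded_iff by blast
  qed
  then obtain B where B: "\<And>b y. y \<in> cball x r \<Longrightarrow> norm (DD F y b) \<le> B b" by metis
  define K where "K = (\<Sum>b\<in>E. norm (w b) * \<bar>B b\<bar>) + 1"
  have K: "K > 0" unfolding K_def by (intro add_nonneg_pos sum_nonneg) auto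
  have on: "onorm (DD F y) \<le> K" if y: "y \<in> cball x r" for y
  proof (rule onorm_bound)
    show "norm (DD F y v) \<le> K * norm v" for v
    proof -
      have "linear (DD F y)" using linear_DD[OF F(1,2)] F(3) y by blast
      then have "DD F y v = (\<Sum>b\<in>E. (v \<bullet> w b) *\<^sub>R DD F y b)" using fin_dim_linear_sum[OF _ E(2)] by blast
      then have "norm (DD F y v) \<le> (\<Sum>b\<in>E. \<bar>v \<bullet> w b\<bar> * norm (DD F y b))"
        using norm_sum[of "\<lambda>b. (v \<bullet> w b) *\<^sub>R DD F y b" E] by simp
      also have "\<dots> \<le> (\<Sum>b\<in>E. (norm v * norm (w b)) * \<bar>B b\<bar>)"
        using B[OF y] by (intro sum_mono mult_mono Cauchy_Schwarz_ineq2) (auto intro: order_trans[OF _ abs_ge_self])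
      also have "\<dots> \<le> K * norm v" by (simp add: K_def sum_distrib_left sum_distrib_right algebra_simps)
      finally show ?thesis .
    qed
  qed (use K in simp)
  show ?thesis
  proof (rule that[OF K])
    fix y z assume yz: "y \<in> cball x r" "z \<in> cball x r"
    show "norm (F y - F z) \<le> K * norm (y - z)"
    proof (rule differentiable_bound[OF convex_cball _ _ yz])
      show "(F has_derivative DD F u) (at u within cball x r)" if "u \<in> cball x r" for u
        using smooth_has_derivative[OF F(1,2)] F(3) that by (blast intro: has_derivative_at_withinI)
    qed (rule on)
  qed
qed

text \<open>Antiderivatives are taken coordinate by coordinate and reassembled; subtracting
  \<open>h e t0\<close> fixes the value at \<open>t0\<close>.\<close>

lemma fin_dim_antiderivative:
  fixes g :: "real \<Rightarrow> 'b::real_inner"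
  assumes fd: "fin_dim TYPE('b)" and g: "continuous_on {a..b} g"
  obtains G where "G t0 = y0" "\<And>t. t \<in> {a..b} \<Longrightarrow> (G has_vector_derivative g t) (at t within {a..b})"
proof -
  obtain E w where E: "finite (E::'b set)" "\<And>x. x = (\<Sum>b\<in>E. (x \<bullet> w b) *\<^sub>R b)"
    using fin_dim_coords[OF fd] by metis
  have "\<exists>h. \<forall>t\<in>{a..b}. (h has_vector_derivative (g t \<bullet> w e)) (at t within {a..b})" for e
  proof -
    have "continuous_on {a..b} (\<lambda>t. g t \<bullet> w e)" using g by (intro continuous_intros)
    from antiderivative_continuous[OF this] obtain h
      where "\<And>t. t \<in> {a..b} \<Longrightarrow> (h has_vector_derivative (g t \<bullet> w e)) (at t within {a..b})" by blast
    then show ?thesis by (intro exI[of _ h] ballI)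
  qed
  then have "\<forall>e. \<exists>h. \<forall>t\<in>{a..b}. (h has_vector_derivative (g t \<bullet> w e)) (at t within {a..b})" by blast
  from choice[OF this] obtain h
    where h: "\<And>e t. t \<in> {a..b} \<Longrightarrow> (h e has_vector_derivative (g t \<bullet> w e)) (at t within {a..b})" by blast
  define G where "G t = y0 + (\<Sum>e\<in>E. (h e t - h e t0) *\<^sub>R e)" for t
  show ?thesis
  proof (rule that)
    show "G t0 = y0" by (simp add: G_def)
    fix t assume t: "t \<in> {a..b}"
    have "(h e has_derivative (\<lambda>x. x *\<^sub>R (g t \<bullet> w e))) (at t within {a..b})" for e
      using h[OF t] by (simp add: has_vector_derivative_def)
    then have "(G has_derivative (\<lambda>x. 0 + (\<Sum>e\<in>E. (x *\<^sub>R (g t \<bullet> w e) - 0) *\<^sub>R e))) (at t within {a..b})"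
      unfolding G_def by (intro has_derivative_add has_derivative_sum has_derivative_scaleR_left has_derivative_diff
          has_derivative_const)
    then have "(G has_derivative (\<lambda>x. \<Sum>e\<in>E. (x *\<^sub>R (g t \<bullet> w e)) *\<^sub>R e)) (at t within {a..b})" by simp
    moreover have "(\<Sum>e\<in>E. (x *\<^sub>R (g t \<bullet> w e)) *\<^sub>R e) = x *\<^sub>R g t" for x
    proof -
      have "(\<Sum>e\<in>E. (x *\<^sub>R (g t \<bullet> w e)) *\<^sub>R e) = x *\<^sub>R (\<Sum>e\<in>E. (g t \<bullet> w e) *\<^sub>R e)" by (simp add: scaleR_sum_right)
      then show ?thesis by (simp only: E(2)[symmetric])
    qed
    ultimately show "(G has_vector_derivative g t) (at t within {a..b})" by (simp add: has_vector_derivative_def)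
  qed
qed

lemma vector_derivative_bound:
  fixes f :: "real \<Rightarrow> 'b::real_normed_vector"
  assumes "\<And>t. t \<in> {a..b} \<Longrightarrow> (f has_vector_derivative f' t) (at t within {a..b})"
    "\<And>t. t \<in> {a..b} \<Longrightarrow> norm (f' t) \<le> B" "s \<in> {a..b}" "t \<in> {a..b}"
  shows "norm (f t - f s) \<le> B * \<bar>t - s\<bar>"
proof -
  have B: "B \<ge> 0" using assms(2)[OF assms(3)] norm_ge_zero order_trans by blast
  have "norm (f t - f s) \<le> B * norm (t - s)"
  proof (rule differentiable_bound[OF _ _ _ assms(4,3)])
    show "(f has_derivative (\<lambda>h. h *\<^sub>R f' u)) (at u within {a..b})" if "u \<in> {a..b}" for u
      using assms(1)[OF that] by (simp add: has_vector_derivative_def)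
    show "onorm (\<lambda>h. h *\<^sub>R f' u) \<le> B" if "u \<in> {a..b}" for u
      using assms(2)[OF that] B by (intro onorm_bound) (auto simp: mult.commute[of B] intro: mult_left_mono)
  qed simp
  then show ?thesis by simp
qed

text \<open>Picard iteration for an autonomous equation, followed by a bootstrap from continuity to
  smoothness.\<close>

lemma local_ode_solution:
  fixes F :: "'a::real_inner \<Rightarrow> 'a"
  assumes fd: "fin_dim TYPE('a)" and F: "smooth_on U F" "open U" and y0: "y0 \<in> U"
  obtains \<epsilon> y where "\<epsilon> > 0" "y 0 = y0" "\<And>t. \<bar>t\<bar> < \<epsilon> \<Longrightarrow> y t \<in> U"
    "\<And>t. \<bar>t\<bar> < \<epsilon> \<Longrightarrow> (y has_vector_derivative F (y t)) (at t)" "smooth_on {-\<epsilon><..<\<epsilon>} y"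
proof -
  obtain r where r: "r > 0" "cball y0 r \<subseteq> U" using F(2) y0 open_contains_cball by metis
  let ?C = "cball y0 r"
  note cpt = fin_dim_compact_cball[OF fd, of y0 r]
  have cF: "continuous_on ?C F" using smooth_continuous[OF F(1)] r(2) by (rule continuous_on_subset)
  obtain M where M: "M > 0" "\<And>y. y \<in> ?C \<Longrightarrow> norm (F y) \<le> M"
    using compact_imp_bounded[OF compact_continuous_image[OF cF cpt]] bounded_pos by (metis image_eqI)
  obtain K where K: "K > 0" "\<And>y z. y \<in> ?C \<Longrightarrow> z \<in> ?C \<Longrightarrow> norm (F y - F z) \<le> K * norm (y - z)"
    using smooth_lipschitz_cball[OF fd F r(2)] by metis
  \<comment> \<open>\<open>r / M\<close> keeps the iterates in the ball of radius \<open>r\<close>;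
    \<open>1 / (2 * K)\<close> makes the integral operator a contraction with factor 1/2.\<close>
  define \<epsilon> where "\<epsilon> = min (r / M) (1 / (2 * K))"
  have \<epsilon>: "\<epsilon> > 0" "M * \<epsilon> \<le> r" "K * \<epsilon> \<le> 1 / 2"
    using r M K by (auto simp: \<epsilon>_def min_def field_simps)
  let ?I = "{-\<epsilon>..\<epsilon>}"
  have zero: "0 \<in> ?I" using \<epsilon> by simp
  \<comment> \<open>The Picard operator, with the integral expressed as an antiderivative that takes
    the value \<open>y0\<close> at 0. Its defining property is available for functions satisfying
    \<open>adm\<close>.\<close>
  define P where "P y = (SOME G. G 0 = y0 \<and> (\<forall>t\<in>?I. (G has_vector_derivative F (y t)) (at t within ?I)))" for y
  define adm where "adm y \<longleftrightarrow> continuous_on ?I y \<and> (\<forall>t\<in>?I. y t \<in> ?C)" for y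
  have P: "P y 0 = y0" "\<And>t. t \<in> ?I \<Longrightarrow> (P y has_vector_derivative F (y t)) (at t within ?I)"
    if y: "adm y" for y
  proof -
    have "continuous_on ?I (\<lambda>t. F (y t))"
      using y cF by (auto simp: adm_def intro: continuous_on_compose2)
    then have "\<exists>G. G 0 = y0 \<and> (\<forall>t\<in>?I. (G has_vector_derivative F (y t)) (at t within ?I))"
      using fin_dim_antiderivative[OF fd, of "-\<epsilon>" \<epsilon> "\<lambda>t. F (y t)" 0 y0] by metis
    then have "P y 0 = y0 \<and> (\<forall>t\<in>?I. (P y has_vector_derivative F (y t)) (at t within ?I))"
      unfolding P_def by (rule someI_ex)
    then show "P y 0 = y0" "\<And>t. t \<in> ?I \<Longrightarrow> (P y has_vector_derivative F (y t)) (at t within ?I)" by auto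
  qed
  have PM: "norm (P y t - P y s) \<le> M * \<bar>t - s\<bar>" if y: "adm y" and "s \<in> ?I" "t \<in> ?I" for y s t
    by (rule vector_derivative_bound[OF P(2)[OF y]]) (use y that M in \<open>auto simp: adm_def\<close>)
  have P_close: "norm (P y t - y0) \<le> r" if "adm y" "t \<in> ?I" for y t
  proof -
    have "norm (P y t - P y 0) \<le> M * \<bar>t - 0\<bar>" by (rule PM[OF that(1) zero that(2)])
    also have "\<dots> \<le> M * \<epsilon>" using that(2) M(1) by (intro mult_left_mono) auto
    finally show ?thesis using \<epsilon>(2) P(1)[OF that(1)] by simp
  qed
  have P_adm: "adm (P y)" if y: "adm y" for y
  proof -
    have "continuous_on ?I (P y)"
      using P(2)[OF y] by (intro continuous_on_vector_derivative) auto
    then show ?thesis using P_close[OF y] by (auto simp: adm_def dist_norm norm_minus_commute)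
  qed
  have contract: "norm (P y t - P z t) \<le> D / 2"
    if y: "adm y" "adm z" and D: "\<And>s. s \<in> ?I \<Longrightarrow> norm (y s - z s) \<le> D" and t: "t \<in> ?I" for y z D t
  proof -
    have D0: "D \<ge> 0" using D[OF zero] norm_ge_zero order_trans by blast
    have "norm ((P y t - P z t) - (P y 0 - P z 0)) \<le> (K * D) * \<bar>t - 0\<bar>"
    proof (rule vector_derivative_bound[OF _ _ zero t])
      show "((\<lambda>t. P y t - P z t) has_vector_derivative F (y s) - F (z s)) (at s within ?I)" if "s \<in> ?I" for s
        using P(2)[OF y(1) that] P(2)[OF y(2) that] by (rule has_vector_derivative_diff)
      show "norm (F (y s) - F (z s)) \<le> K * D" if s: "s \<in> ?I" for s
      proof -
        have "norm (F (y s) - F (z s)) \<le> K * norm (y s - z s)"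
          using y s by (intro K(2)) (auto simp: adm_def)
        also have "\<dots> \<le> K * D" using D[OF s] K(1) by (intro mult_left_mono) auto
        finally show ?thesis .
      qed
    qed
    also have "\<dots> \<le> (K * D) * \<epsilon>" using t K(1) D0 by (intro mult_left_mono) auto
    also have "\<dots> = (K * \<epsilon>) * D" by simp
    also have "\<dots> \<le> (1 / 2) * D" using \<epsilon>(3) D0 by (intro mult_right_mono) auto
    finally show ?thesis using P(1)[OF y(1)] P(1)[OF y(2)] by simp
  qed
  define Y where "Y n = (P ^^ n) (\<lambda>_. y0)" for n
  have Y_Suc: "Y (Suc n) = P (Y n)" for n by (simp add: Y_def)
  have Y_adm: "adm (Y n)" for n
  proof (induction n)
    case 0
    show ?case using r by (simp add: Y_def adm_def)
  next
    case (Suc n)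
    then show ?case by (simp add: Y_Suc P_adm)
  qed
  have step: "norm (Y (Suc n) t - Y n t) \<le> r / 2 ^ n" if "t \<in> ?I" for n t
    using that
  proof (induction n arbitrary: t)
    case 0
    then show ?case using P_close[OF Y_adm[of 0]] by (simp add: Y_def)
  next
    case (Suc n)
    have "norm (P (Y (Suc n)) t - P (Y n) t) \<le> (r / 2 ^ n) / 2"
      by (rule contract[OF Y_adm Y_adm Suc.IH Suc.prems])
    then show ?case by (simp add: Y_Suc)
  qed
  \<comment> \<open>A telescoping bound: the steps \<open>r / 2 ^ m\<close> with
    \<open>m \<ge> n\<close> add up to at most \<open>2 * r / 2 ^ n\<close>.\<close>
  have far: "norm (Y (n + k) t - Y n t) \<le> 2 * r / 2 ^ n" if t: "t \<in> ?I" for n k t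
  proof -
    have "norm (Y (n + k) t - Y n t) \<le> 2 * r / 2 ^ n - 2 * r / 2 ^ (n + k)"
    proof (induction k)
      case (Suc k)
      have "norm (Y (n + Suc k) t - Y n t) \<le> norm (Y (Suc (n + k)) t - Y (n + k) t) + norm (Y (n + k) t - Y n t)"
        using norm_triangle_ineq[of "Y (Suc (n + k)) t - Y (n + k) t" "Y (n + k) t - Y n t"] by simp
      also have "\<dots> \<le> r / 2 ^ (n + k) + (2 * r / 2 ^ n - 2 * r / 2 ^ (n + k))"
        using step[OF t, of "n + k"] Suc by linarith
      also have "\<dots> = 2 * r / 2 ^ n - 2 * r / 2 ^ (n + Suc k)" by (simp add: field_simps)
      finally show ?case .
    qed simp
    also have "\<dots> \<le> 2 * r / 2 ^ n" using r(1) by simp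
    finally show ?thesis .
  qed
  have small: "(\<lambda>n. 2 * r / 2 ^ n) \<longlonglongrightarrow> 0"
  proof -
    have "(\<lambda>n. 2 * r * (1 / 2) ^ n) \<longlonglongrightarrow> 0" by (intro tendsto_mult_right_zero LIMSEQ_realpow_zero) auto
    then show ?thesis by (simp add: power_divide)
  qed
  \<comment> \<open>Completeness is taken from the ball, which is compact.\<close>
  have "\<exists>l\<in>?C. (\<lambda>n. Y n t) \<longlonglongrightarrow> l" if t: "t \<in> ?I" for t
  proof -
    have "Cauchy (\<lambda>n. Y n t)"
    proof (rule CauchyI)
      fix e :: real assume "e > 0"
      then have "\<forall>\<^sub>F n in sequentially. 2 * r / 2 ^ n < e / 2" by (intro order_tendstoD(2)[OF small]) simp
      then obtain N where N: "2 * r / 2 ^ N < e / 2" unfolding eventually_sequentially by blast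
      have "norm (Y m t - Y n t) < e" if "m \<ge> N" "n \<ge> N" for m n
      proof -
        have "norm (Y m t - Y n t) \<le> norm (Y (N + (m - N)) t - Y N t) + norm (Y (N + (n - N)) t - Y N t)"
          using that norm_triangle_ineq4[of "Y m t - Y N t" "Y n t - Y N t"] by simp
        also have "\<dots> \<le> 2 * r / 2 ^ N + 2 * r / 2 ^ N" by (intro add_mono far t)
        finally show ?thesis using N by simp
      qed
      then show "\<exists>M. \<forall>m\<ge>M. \<forall>n\<ge>M. norm (Y m t - Y n t) < e" by blast
    qed
    moreover have "\<forall>n. Y n t \<in> ?C" using Y_adm t by (simp add: adm_def)
    ultimately show ?thesis
      using compact_imp_complete[OF cpt, unfolded complete_def, THEN spec[of _ "\<lambda>n. Y n t"]] by simp
  qed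
  then obtain y where y: "\<And>t. t \<in> ?I \<Longrightarrow> y t \<in> ?C" "\<And>t. t \<in> ?I \<Longrightarrow> (\<lambda>n. Y n t) \<longlonglongrightarrow> y t" by metis
  have y_far: "norm (y t - Y n t) \<le> 2 * r / 2 ^ n" if t: "t \<in> ?I" for t n
  proof (rule LIMSEQ_le_const2)
    show "(\<lambda>k. norm (Y (k + n) t - Y n t)) \<longlonglongrightarrow> norm (y t - Y n t)"
      by (intro tendsto_intros LIMSEQ_ignore_initial_segment y(2) t)
    show "\<exists>N. \<forall>k\<ge>N. norm (Y (k + n) t - Y n t) \<le> 2 * r / 2 ^ n"
      using far[OF t, of n] by (auto simp: add.commute)
  qed
  \<comment> \<open>The common Lipschitz constant \<open>M\<close> of the iterates passes to the
    limit and gives its continuity.\<close>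
  have "norm (y t - y s) \<le> M * \<bar>t - s\<bar>" if "s \<in> ?I" "t \<in> ?I" for s t
  proof (rule LIMSEQ_le_const2)
    show "(\<lambda>k. norm (Y k t - Y k s)) \<longlonglongrightarrow> norm (y t - y s)"
      by (intro tendsto_intros y(2) that)
    have "norm (Y k t - Y k s) \<le> M * \<bar>t - s\<bar>" for k
      using PM[OF Y_adm that] M(1) by (cases k) (simp_all add: Y_Suc, simp add: Y_def)
    then show "\<exists>N. \<forall>k\<ge>N. norm (Y k t - Y k s) \<le> M * \<bar>t - s\<bar>" by blast
  qed
  then have "continuous_on ?I y"
    by (intro lipschitz_on_continuous_on[of M]) (auto simp: lipschitz_on_def dist_norm M less_imp_le)
  then have adm: "adm y" using y(1) by (simp add: adm_def)
  \<comment> \<open>\<open>Y (Suc n) t\<close> tends to \<open>y t\<close>, and by the contraction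
    property also to \<open>P y t\<close>.\<close>
  have fixpt: "P y t = y t" if t: "t \<in> ?I" for t
  proof (rule LIMSEQ_unique)
    show "(\<lambda>n. Y (Suc n) t) \<longlonglongrightarrow> y t" using y(2)[OF t] by (rule LIMSEQ_Suc)
    have "norm (Y (Suc n) t - P y t) \<le> 2 * r / 2 ^ n" for n
    proof -
      have "norm (P y t - P (Y n) t) \<le> (2 * r / 2 ^ n) / 2"
        by (rule contract[OF adm Y_adm y_far t])
      also have "\<dots> \<le> 2 * r / 2 ^ n" using r(1) by (simp add: divide_right_mono)
      finally show ?thesis by (simp add: Y_Suc norm_minus_commute)
    qed
    then have "(\<lambda>n. Y (Suc n) t - P y t) \<longlonglongrightarrow> 0"
      by (intro Lim_null_comparison[OF _ small]) simp
    then show "(\<lambda>n. Y (Suc n) t) \<longlonglongrightarrow> P y t" by (simp add: LIM_zero_iff)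
  qed
  have der: "(y has_vector_derivative F (y t)) (at t)" if t: "\<bar>t\<bar> < \<epsilon>" for t
  proof -
    have t': "t \<in> {-\<epsilon><..<\<epsilon>}" "t \<in> ?I" using t by auto
    have "(P y has_vector_derivative F (y t)) (at t)"
      using P(2)[OF adm t'(2)] at_within_Icc_at[of "-\<epsilon>" t \<epsilon>] t' by auto
    then show ?thesis
      by (rule has_vector_derivative_transform_within_open[where S = "{-\<epsilon><..<\<epsilon>}"]) (use t' fixpt in auto)
  qed
  have der': "(y has_vector_derivative F (y t)) (at t within {-\<epsilon><..<\<epsilon>})" if "t \<in> {-\<epsilon><..<\<epsilon>}" for t
    by (rule has_vector_derivative_at_within[OF der]) (use that in auto)
  have yU: "y ` {-\<epsilon><..<\<epsilon>} \<subseteq> U"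
  proof
    fix z assume "z \<in> y ` {-\<epsilon><..<\<epsilon>}"
    then obtain t where "z = y t" "t \<in> ?I" by auto
    then show "z \<in> U" using y(1)[of t] r(2) by blast
  qed
  \<comment> \<open>Bootstrap: if \<open>y\<close> is of class \<open>k\<close>, then so is its
    derivative \<open>F (y t)\<close>.\<close>
  have "Ck_on k {-\<epsilon><..<\<epsilon>} y" for k
  proof (induction k)
    case 0
    show ?case unfolding Ck_on.simps by (rule continuous_on_vector_derivative[OF der'])
  next
    case (Suc k)
    have "Ck_on k {-\<epsilon><..<\<epsilon>} (\<lambda>t. F (y t))"
    proof (rule Ck_compose[OF fd Suc])
      show "Ck_on k U F" using F(1) by (simp add: smooth_on_def)
    qed (rule yU)
    then have "Ck_on k {-\<epsilon><..<\<epsilon>} (\<lambda>t. v *\<^sub>R F (y t))" for v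
      by (rule Ck_compose_linear[OF bounded_linear_scaleR_right])
    moreover have "(y has_derivative (\<lambda>v. v *\<^sub>R F (y t))) (at t within {-\<epsilon><..<\<epsilon>})" if "t \<in> {-\<epsilon><..<\<epsilon>}" for t
      using der'[OF that] unfolding has_vector_derivative_def .
    ultimately show ?case unfolding Ck_on.simps by (intro exI[of _ "\<lambda>t v. v *\<^sub>R F (y t)"]) blast
  qed
  then have "smooth_on {-\<epsilon><..<\<epsilon>} y" by (simp add: smooth_on_def)
  moreover have "y 0 = y0" using fixpt[OF zero] P(1)[OF adm] by simp
  moreover have "y t \<in> U" if "\<bar>t\<bar> < \<epsilon>" for t
  proof -
    have "t \<in> {-\<epsilon><..<\<epsilon>}" using that by auto
    then show ?thesis using yU by blast
  qed
  ultimately show ?thesis using that[OF \<epsilon>(1)] der by simp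
qed

section \<open>One-parameter subgroups of a Lie group\<close>

lemma vector_derivative_iff_shift:
  "((\<lambda>r. f (t + r)) has_vector_derivative v) (at (0::real)) \<longleftrightarrow> (f has_vector_derivative v) (at t)"
proof
  assume "(f has_vector_derivative v) (at t)"
  then have "(f has_vector_derivative v) (at (t + 0))" by simp
  moreover have "((\<lambda>r. t + r) has_vector_derivative 1) (at 0)" by (auto intro!: derivative_eq_intros)
  ultimately show "((\<lambda>r. f (t + r)) has_vector_derivative v) (at 0)"
    using vector_diff_chain_at[of "\<lambda>r. t + r" 1 0 f v] by (simp add: comp_def)
next
  assume "((\<lambda>r. f (t + r)) has_vector_derivative v) (at 0)"
  then have "((\<lambda>r. f (t + r)) has_vector_derivative v) (at (t - t))" by simp
  moreover have "((\<lambda>s. s - t) has_vector_derivative 1) (at t)" by (auto intro!: derivative_eq_intros)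
  ultimately show "(f has_vector_derivative v) (at t)"
    using vector_diff_chain_at[of "\<lambda>s. s - t" 1 t "\<lambda>r. f (t + r)" v] by (simp add: comp_def)
qed

lemma velocity_shift:
  fixes A :: "('p, 'e::real_inner) atlas"
  shows "velocity UNIV A (\<lambda>r. \<gamma> (t + r)) 0 = velocity UNIV A \<gamma> t"
proof -
  have "vector_derivative (snd c \<circ> (\<lambda>r. \<gamma> (t + r))) (at 0) = vector_derivative (snd c \<circ> \<gamma>) (at t)" for c :: "('p, 'e) chart"
    using vector_derivative_iff_shift[of "snd c \<circ> \<gamma>" t] by (simp add: vector_derivative_def comp_def)
  then show ?thesis by (simp add: velocity_def cong: if_cong)
qed

lemma velocity_open: "open J \<Longrightarrow> t \<in> J \<Longrightarrow> velocity J A \<gamma> t = velocity UNIV A \<gamma> t"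
  using at_within_open[of t J] by (simp add: velocity_def cong: if_cong)

lemma velocity_cong:
  fixes A :: "('p, 'e::real_inner) atlas"
  assumes "open V" "t \<in> V" "\<And>s. s \<in> V \<Longrightarrow> \<gamma> s = \<delta> s"
  shows "velocity UNIV A \<gamma> t = velocity UNIV A \<delta> t"
proof -
  have "(snd c \<circ> \<gamma> has_vector_derivative v) (at t) \<longleftrightarrow> (snd c \<circ> \<delta> has_vector_derivative v) (at t)" for c :: "('p, 'e) chart" and v
    using has_vector_derivative_transform_within_open[of "snd c \<circ> \<gamma>" v t V "snd c \<circ> \<delta>"]
      has_vector_derivative_transform_within_open[of "snd c \<circ> \<delta>" v t V "snd c \<circ> \<gamma>"] assms by auto
  then have "vector_derivative (snd c \<circ> \<gamma>) (at t) = vector_derivative (snd c \<circ> \<delta>) (at t)" for c :: "('p, 'e) chart"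
    by (simp add: vector_derivative_def)
  then show ?thesis using assms by (simp add: velocity_def cong: if_cong)
qed

lemma velocity_const:
  assumes "man A" "p \<in> pts A"
  shows "velocity UNIV A (\<lambda>_. p) t = tzero p"
  by (simp add: velocity_def tzero_def comp_def vector_derivative_const_at fun_eq_iff)

lemma smooth_curve_const:
  assumes "man A" "fat I" "p \<in> pts A"
  shows "smooth_curve I A (\<lambda>_. p)"
proof (rule smooth_curveI[OF assms(1,2)])
  obtain c where "c \<in> A" "p \<in> fst c" using assms(3) unfolding pts_def by blast
  then show "\<exists>c\<in>A. \<exists>V. open V \<and> t \<in> V \<and> (\<forall>s\<in>I\<inter>V. p \<in> fst c) \<and> smooth_on (I \<inter> V) (\<lambda>s. snd c p)" for t
    by (intro bexI[of _ c] exI[of _ UNIV]) (auto intro: smooth_const)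
qed

lemma smooth_curve_reparam:
  assumes A: "man A" and I: "fat I" "fat J" and \<gamma>: "smooth_curve I A \<gamma>"
    and h: "smooth_on J h" "\<And>s. s \<in> J \<Longrightarrow> h s \<in> I"
  shows "smooth_curve J A (\<lambda>s. \<gamma> (h s))"
proof (rule smooth_curveI[OF A I(2)])
  fix t assume t: "t \<in> J"
  then have "h t \<in> I" using h(2) by blast
  moreover obtain c where c: "c \<in> charts_at A (\<gamma> (h t))"
    using \<gamma> calculation unfolding smooth_curve_def pts_iff by blast
  ultimately obtain V where V: "open V" "h t \<in> V" "\<And>s. s \<in> I \<inter> V \<Longrightarrow> \<gamma> s \<in> fst c" "smooth_on (I \<inter> V) (\<lambda>s. snd c (\<gamma> s))"
    using smooth_curve_local[OF A I(1) \<gamma>] by metis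
  have "openin (top_of_set J) (J \<inter> h -` V)"
    by (rule continuous_openin_preimage_gen[OF smooth_continuous[OF h(1)] V(1)])
  then obtain W where W: "open W" "J \<inter> h -` V = J \<inter> W" unfolding openin_open by blast
  have "smooth_on (J \<inter> W) (\<lambda>s. snd c (\<gamma> (h s)))"
    by (rule smooth_compose[OF fin_dim_real V(4) smooth_subset[OF h(1)]]) (use h(2) W(2) in blast)+
  moreover have "\<forall>s\<in>J\<inter>W. \<gamma> (h s) \<in> fst c" using V(3) h(2) W(2) by blast
  moreover have "t \<in> W" using W(2) V(2) t by blast
  ultimately show "\<exists>c\<in>A. \<exists>V. open V \<and> t \<in> V \<and> (\<forall>s\<in>J\<inter>V. \<gamma> (h s) \<in> fst c) \<and> smooth_on (J \<inter> V) (\<lambda>s. snd c (\<gamma> (h s)))"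
    using c W(1) unfolding charts_at_iff by blast
qed

lemma smooth_curve_locally:
  assumes A: "man A" and I: "fat I" and loc: "\<And>t. t \<in> I \<Longrightarrow> \<exists>V. open V \<and> t \<in> V \<and> smooth_curve (I \<inter> V) A \<gamma>"
  shows "smooth_curve I A \<gamma>"
proof (rule smooth_curveI[OF A I])
  fix t assume t: "t \<in> I"
  obtain V where V: "open V" "t \<in> V" "smooth_curve (I \<inter> V) A \<gamma>" using loc[OF t] by blast
  then obtain c where c: "c \<in> charts_at A (\<gamma> t)"
    using t unfolding smooth_curve_def pts_iff by blast
  obtain W where "open W" "t \<in> W" "\<And>s. s \<in> (I \<inter> V) \<inter> W \<Longrightarrow> \<gamma> s \<in> fst c" "smooth_on ((I \<inter> V) \<inter> W) (\<lambda>s. snd c (\<gamma> s))"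
    using smooth_curve_local[OF A fat_Int_open[OF I V(1)] V(3) _ c] t V(2) by blast
  then show "\<exists>c\<in>A. \<exists>V. open V \<and> t \<in> V \<and> (\<forall>s\<in>I\<inter>V. \<gamma> s \<in> fst c) \<and> smooth_on (I \<inter> V) (\<lambda>s. snd c (\<gamma> s))"
    using V c unfolding charts_at_iff by (intro bexI[of _ c] exI[of _ "V \<inter> W"]) (auto simp: Int_assoc)
qed

lemma smooth_curve_cong:
  assumes "\<And>t. t \<in> I \<Longrightarrow> \<gamma> t = \<delta> t"
  shows "smooth_curve I A \<gamma> \<longleftrightarrow> smooth_curve I A \<delta>"
proof -
  have "{t \<in> I. \<gamma> t \<in> fst c} = {t \<in> I. \<delta> t \<in> fst c}" for c :: "('a, 'b) chart" using assms by auto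
  moreover have "smooth_on {t \<in> I. \<delta> t \<in> fst c} (snd c \<circ> \<gamma>) \<longleftrightarrow> smooth_on {t \<in> I. \<delta> t \<in> fst c} (snd c \<circ> \<delta>)"
    for c :: "('a, 'b) chart" using assms by (intro smooth_cong) auto
  ultimately show ?thesis using assms by (auto simp: smooth_curve_def)
qed

lemma velocity_scale:
  assumes A: "man A" and \<gamma>: "smooth_curve UNIV A \<gamma>"
  shows "velocity UNIV A (\<lambda>s. \<gamma> (t * s)) 0 = tscale t (velocity UNIV A \<gamma> 0)"
proof -
  have f: "fat (UNIV::real set)" by (simp add: fat_open)
  have 0: "smooth_curve UNIV A (\<lambda>s. \<gamma> (t * s))"
    by (rule smooth_curve_reparam[OF A f f \<gamma> smooth_bounded_linear[OF bounded_linear_mult_right]]) simp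
  obtain c where c: "c \<in> charts_at A (\<gamma> 0)" using \<gamma> unfolding smooth_curve_def pts_iff by blast
  have "((\<lambda>s. snd c (\<gamma> s)) has_vector_derivative snd (velocity UNIV A \<gamma> 0) c) (at (t * 0))"
    using velocity_coord[OF A f \<gamma> _ c] by simp
  moreover have "((\<lambda>s. t * s) has_vector_derivative t) (at 0)" by (auto intro!: derivative_eq_intros)
  ultimately have "((\<lambda>s. snd c (\<gamma> (t * s))) has_vector_derivative t *\<^sub>R snd (velocity UNIV A \<gamma> 0) c) (at 0)"
    using vector_diff_chain_at[of "\<lambda>s. t * s" t 0 "\<lambda>s. snd c (\<gamma> s)"] by (simp add: comp_def)
  then have "snd (velocity UNIV A (\<lambda>s. \<gamma> (t * s)) 0) c = t *\<^sub>R snd (velocity UNIV A \<gamma> 0) c"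
    using velocity_coordI[OF A f, of 0 c "\<lambda>s. \<gamma> (t * s)"] c by simp
  then show ?thesis
    using tan_space_eqI[of "velocity UNIV A (\<lambda>s. \<gamma> (t * s)) 0" A "\<gamma> 0" "tscale t (velocity UNIV A \<gamma> 0)" c]
      velocity_in[OF A f 0, of 0] tscale_in[OF A velocity_in[OF A f \<gamma>, of 0]] c by simp
qed

text \<open>In a chart the vanishing derivative makes the curve locally constant; connectedness of
  \<open>J\<close> does the rest.\<close>

lemma zero_velocity_constant:
  assumes A: "man A" and J: "open J" "connected J" and \<gamma>: "smooth_curve J A \<gamma>"
    and v: "\<And>t. t \<in> J \<Longrightarrow> velocity UNIV A \<gamma> t = tzero (\<gamma> t)" and st: "s \<in> J" "t \<in> J"
  shows "\<gamma> s = \<gamma> t"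
proof -
  have fJ: "fat J" by (rule fat_open[OF J(1)])
  have "\<gamma> constant_on J"
  proof (rule locally_constant_imp_constant[OF J(2)])
    fix a assume a: "a \<in> J"
    obtain c where c: "c \<in> charts_at A (\<gamma> a)" using \<gamma> a unfolding smooth_curve_def pts_iff by blast
    then have cA: "c \<in> A" by (simp add: charts_at_iff)
    obtain V where V: "open V" "a \<in> V" "\<And>s. s \<in> J \<inter> V \<Longrightarrow> \<gamma> s \<in> fst c" "smooth_on (J \<inter> V) (\<lambda>s. snd c (\<gamma> s))"
      using smooth_curve_local[OF A fJ \<gamma> a c] by metis
    obtain e where e: "e > 0" "ball a e \<subseteq> J \<inter> V"
      using open_contains_ball[of "J \<inter> V"] open_Int[OF J(1) V(1)] a V(2) by blast
    have "\<gamma> s = \<gamma> a" if s: "s \<in> ball a e" for s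
    proof -
      have "((\<lambda>s. snd c (\<gamma> s)) has_derivative (\<lambda>h. 0)) (at u within ball a e)" if u: "u \<in> ball a e" for u
      proof -
        have uJ: "u \<in> J" "\<gamma> u \<in> fst c" using u e(2) V(3) by blast+
        then have "((\<lambda>s. snd c (\<gamma> s)) has_vector_derivative snd (velocity J A \<gamma> u) c) (at u within J)"
          using velocity_coord[OF A fJ \<gamma> uJ(1)] cA by (simp add: charts_at_iff)
        then have "((\<lambda>s. snd c (\<gamma> s)) has_derivative (\<lambda>h. 0)) (at u within J)"
          using v[OF uJ(1)] velocity_open[OF J(1) uJ(1), of A \<gamma>] by (simp add: has_vector_derivative_def)
        then show ?thesis by (rule has_derivative_subset) (use e(2) in auto)
      qed
      then have "\<exists>k. \<forall>u\<in>ball a e. snd c (\<gamma> u) = k"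
        by (rule has_derivative_zero_constant[OF convex_ball])
      then have eq: "snd c (\<gamma> s) = snd c (\<gamma> a)" using s e(1) by auto
      have "s \<in> J \<inter> V" "a \<in> J \<inter> V" using s a V(2) e(2) by blast+
      then show ?thesis using inj_onD[OF chart_inj[OF A cA] eq] V(3) by blast
    qed
    moreover have "openin (top_of_set J) (ball a e)" "a \<in> ball a e"
      using e open_openin_trans[OF J(1), of "ball a e"] by auto
    ultimately show "\<exists>T. openin (top_of_set J) T \<and> a \<in> T \<and> (\<forall>x\<in>T. \<gamma> x = \<gamma> a)" by blast
  qed
  then show ?thesis using st unfolding constant_on_def by auto
qed

lemma velocity_Pair_eq:
  assumes A: "man A" and B: "man B" and I: "fat I" "fat J" "t \<in> I" "s \<in> J"
    and \<alpha>: "smooth_curve I A \<alpha>" and \<beta>: "smooth_curve I B \<beta>"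
    and \<alpha>': "smooth_curve J A \<alpha>'" and \<beta>': "smooth_curve J B \<beta>'"
    and eq: "velocity I A \<alpha> t = velocity J A \<alpha>' s" "velocity I B \<beta> t = velocity J B \<beta>' s"
  shows "velocity I (prod_atlas A B) (\<lambda>u. (\<alpha> u, \<beta> u)) t = velocity J (prod_atlas A B) (\<lambda>u. (\<alpha>' u, \<beta>' u)) s"
proof -
  have p: "\<alpha> t = \<alpha>' s" "\<beta> t = \<beta>' s"
    using arg_cong[OF eq(1), of fst] arg_cong[OF eq(2), of fst] by (simp_all add: velocity_def)
  obtain c where c: "c \<in> charts_at A (\<alpha> t)" using \<alpha> I(3) unfolding smooth_curve_def pts_iff by blast
  obtain d where d: "d \<in> charts_at B (\<beta> t)" using \<beta> I(3) unfolding smooth_curve_def pts_iff by blast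
  note P = man_prod[OF A B]
  show ?thesis
  proof (rule tan_space_eqI[OF _ _ charts_at_prod[OF c d]])
    show "velocity I (prod_atlas A B) (\<lambda>u. (\<alpha> u, \<beta> u)) t \<in> tan_space (prod_atlas A B) (\<alpha> t, \<beta> t)"
      using velocity_in[OF P I(1) smooth_curve_Pair[OF A B I(1) \<alpha> \<beta>] I(3)] .
    show "velocity J (prod_atlas A B) (\<lambda>u. (\<alpha>' u, \<beta>' u)) s \<in> tan_space (prod_atlas A B) (\<alpha> t, \<beta> t)"
      using velocity_in[OF P I(2) smooth_curve_Pair[OF A B I(2) \<alpha>' \<beta>'] I(4)] p by simp
    show "snd (velocity I (prod_atlas A B) (\<lambda>u. (\<alpha> u, \<beta> u)) t) (prod_chart c d) =
        snd (velocity J (prod_atlas A B) (\<lambda>u. (\<alpha>' u, \<beta>' u)) s) (prod_chart c d)"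
      using velocity_Pair[OF A B I(1) \<alpha> \<beta> I(3) c d]
        velocity_Pair[OF A B I(2) \<alpha>' \<beta>' I(4), of c d] c d p eq by simp
  qed
qed

lemma smooth_curve_map2:
  assumes A: "man A" and B: "man B" and C: "man C" and I: "fat I"
    and f: "smooth_map (prod_atlas A B) C (\<lambda>(x, y). f x y)"
    and \<alpha>: "smooth_curve I A \<alpha>" and \<beta>: "smooth_curve I B \<beta>"
  shows "smooth_curve I C (\<lambda>u. f (\<alpha> u) (\<beta> u))"
  using smooth_curve_map(1)[OF man_prod[OF A B] C I f smooth_curve_Pair[OF A B I \<alpha> \<beta>]] by simp

text \<open>The velocity of \<open>f\<close> along a pair of curves depends on the curves only
  through their velocities. This takes the place of a formula for the differential of a
  multiplication or an action: a curve may be exchanged for a simpler one tangent to it.\<close>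

lemma velocity_map2_eq:
  assumes A: "man A" and B: "man B" and C: "man C" and I: "fat I" "fat J" "t \<in> I" "s \<in> J"
    and f: "smooth_map (prod_atlas A B) C (\<lambda>(x, y). f x y)"
    and \<alpha>: "smooth_curve I A \<alpha>" and \<beta>: "smooth_curve I B \<beta>"
    and \<alpha>': "smooth_curve J A \<alpha>'" and \<beta>': "smooth_curve J B \<beta>'"
    and eq: "velocity I A \<alpha> t = velocity J A \<alpha>' s" "velocity I B \<beta> t = velocity J B \<beta>' s"
  shows "velocity I C (\<lambda>u. f (\<alpha> u) (\<beta> u)) t = velocity J C (\<lambda>u. f (\<alpha>' u) (\<beta>' u)) s"
  using smooth_curve_map(2)[OF man_prod[OF A B] C I(1) f smooth_curve_Pair[OF A B I(1) \<alpha> \<beta>] I(3)]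
    smooth_curve_map(2)[OF man_prod[OF A B] C I(2) f smooth_curve_Pair[OF A B I(2) \<alpha>' \<beta>'] I(4)]
    velocity_Pair_eq[OF A B I \<alpha> \<beta> \<alpha>' \<beta>' eq] by simp

section \<open>The left-invariant equation on a Lie group\<close>

locale lie_group_loc =
  fixes A :: "('g, 'h::real_inner) atlas" and G :: "'g monoid"
  assumes lie: "lie_group A G"
begin

lemma man: "man A" and grp: "group G" and carrier: "carrier G = pts A"
  and smooth_mult: "smooth_map (prod_atlas A A) A (\<lambda>(g, h). g \<otimes>\<^bsub>G\<^esub> h)"
  and smooth_inv: "smooth_map A A (\<lambda>g. inv\<^bsub>G\<^esub> g)"
  using lie manifold_man by (auto simp: lie_group_def)

sublocale group G by (rule grp)

lemma fatU: "fat (UNIV::real set)" by (simp add: fat_open)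

lemma one_pts: "\<one>\<^bsub>G\<^esub> \<in> pts A" using carrier by auto

lemma curve_pts: "smooth_curve I A \<gamma> \<Longrightarrow> t \<in> I \<Longrightarrow> \<gamma> t \<in> carrier G"
  unfolding smooth_curve_def carrier by blast

lemma chart_carrier: "g \<in> A \<Longrightarrow> p \<in> fst g \<Longrightarrow> p \<in> carrier G"
  unfolding carrier pts_def by blast

lemmas curve_mult = smooth_curve_map2[OF man man man _ smooth_mult]
lemmas velocity_mult_eq = velocity_map2_eq[OF man man man _ _ _ _ smooth_mult]

text \<open>The equation of an integral curve of the left-invariant field generated by the velocity
  of \<open>c\<close> at 0. The field is encoded by the left translates of the curve
  \<open>c\<close>, so that no differential of a translation has to be written.\<close>

definition left_invariant :: "(real \<Rightarrow> 'g) \<Rightarrow> real set \<Rightarrow> (real \<Rightarrow> 'g) \<Rightarrow> real set \<Rightarrow> bool" where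
  "left_invariant c K u J \<longleftrightarrow> smooth_curve J A u \<and>
     (\<forall>t\<in>J. velocity UNIV A u t = velocity UNIV A (\<lambda>r. u t \<otimes>\<^bsub>G\<^esub> c r) 0)"

text \<open>The quotient \<open>u v\<^sup>-\<^sup>1\<close> of two solutions has zero velocity: to first order it agrees at \<open>t + r\<close>
  with \<open>(u t) (c r) (c r)\<^sup>-\<^sup>1 (v t)\<^sup>-\<^sup>1\<close>.\<close>

lemma left_invariant_unique:
  assumes K: "open K" "0 \<in> K" "smooth_curve K A c" "c 0 = \<one>\<^bsub>G\<^esub>"
    and J: "open J" "connected J" and u: "left_invariant c K u J" and v: "left_invariant c K v J"
    and s: "s \<in> J" "u s = v s" and t: "t \<in> J"
  shows "u t = v t"
proof -
  have fJ: "fat J" and fK: "fat K" using J K by (auto intro: fat_open)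
  have su: "smooth_curve J A u" and sv: "smooth_curve J A v" using u v by (auto simp: left_invariant_def)
  have si: "smooth_curve J A (\<lambda>x. inv\<^bsub>G\<^esub> (v x))" by (rule smooth_curve_map(1)[OF man man fJ smooth_inv sv])
  note sw = curve_mult[OF fJ su si]
  have "velocity UNIV A (\<lambda>x. u x \<otimes>\<^bsub>G\<^esub> inv\<^bsub>G\<^esub> (v x)) x = tzero (u x \<otimes>\<^bsub>G\<^esub> inv\<^bsub>G\<^esub> (v x))" if x: "x \<in> J" for x
  proof -
    have px: "u x \<in> pts A" "v x \<in> pts A" using curve_pts su sv x carrier by blast+
    note cu = curve_mult[OF fK smooth_curve_const[OF man fK px(1)] K(3)]
    note cv = curve_mult[OF fK smooth_curve_const[OF man fK px(2)] K(3)]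
    note ci = smooth_curve_map(1)[OF man man fK smooth_inv cv]
    have eu: "velocity J A u x = velocity K A (\<lambda>r. u x \<otimes>\<^bsub>G\<^esub> c r) 0"
      and ev: "velocity J A v x = velocity K A (\<lambda>r. v x \<otimes>\<^bsub>G\<^esub> c r) 0"
      using u v x unfolding left_invariant_def velocity_open[OF J(1) x] velocity_open[OF K(1,2)] by blast+
    have "velocity J A (\<lambda>x. inv\<^bsub>G\<^esub> (v x)) x = velocity K A (\<lambda>r. inv\<^bsub>G\<^esub> (v x \<otimes>\<^bsub>G\<^esub> c r)) 0"
      using smooth_curve_map(2)[OF man man fJ smooth_inv sv x] smooth_curve_map(2)[OF man man fK smooth_inv cv K(2)] ev
      by simp
    from velocity_mult_eq[OF fJ fK x K(2) su si cu ci eu this]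
    have "velocity J A (\<lambda>x. u x \<otimes>\<^bsub>G\<^esub> inv\<^bsub>G\<^esub> (v x)) x = velocity K A (\<lambda>r. (u x \<otimes>\<^bsub>G\<^esub> c r) \<otimes>\<^bsub>G\<^esub> inv\<^bsub>G\<^esub> (v x \<otimes>\<^bsub>G\<^esub> c r)) 0" .
    also have "\<dots> = velocity UNIV A (\<lambda>r. (u x \<otimes>\<^bsub>G\<^esub> c r) \<otimes>\<^bsub>G\<^esub> inv\<^bsub>G\<^esub> (v x \<otimes>\<^bsub>G\<^esub> c r)) 0"
      by (rule velocity_open[OF K(1,2)])
    also have "\<dots> = velocity UNIV A (\<lambda>r. u x \<otimes>\<^bsub>G\<^esub> inv\<^bsub>G\<^esub> (v x)) 0"
    proof (rule velocity_cong[OF K(1,2)])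
      fix r assume "r \<in> K"
      then have "c r \<in> carrier G" using curve_pts K(3) by blast
      then show "(u x \<otimes>\<^bsub>G\<^esub> c r) \<otimes>\<^bsub>G\<^esub> inv\<^bsub>G\<^esub> (v x \<otimes>\<^bsub>G\<^esub> c r) = u x \<otimes>\<^bsub>G\<^esub> inv\<^bsub>G\<^esub> (v x)"
        using px unfolding carrier[symmetric] by (simp add: inv_mult_group m_assoc) (simp flip: m_assoc)
    qed
    also have "\<dots> = tzero (u x \<otimes>\<^bsub>G\<^esub> inv\<^bsub>G\<^esub> (v x))"
    proof (rule velocity_const[OF man])
      show "u x \<otimes>\<^bsub>G\<^esub> inv\<^bsub>G\<^esub> (v x) \<in> pts A" using px by (simp flip: carrier)
    qed
    finally show ?thesis unfolding velocity_open[OF J(1) x] .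
  qed
  then have "u t \<otimes>\<^bsub>G\<^esub> inv\<^bsub>G\<^esub> (v t) = u s \<otimes>\<^bsub>G\<^esub> inv\<^bsub>G\<^esub> (v s)"
    by (rule zero_velocity_constant[OF man J sw _ t s(1)])
  then have "u t \<otimes>\<^bsub>G\<^esub> inv\<^bsub>G\<^esub> (v t) = \<one>\<^bsub>G\<^esub>"
    using s curve_pts[OF sv s(1)] by simp
  then have "u t \<otimes>\<^bsub>G\<^esub> inv\<^bsub>G\<^esub> (v t) \<otimes>\<^bsub>G\<^esub> v t = v t" using curve_pts[OF sv t] by simp
  then show ?thesis using curve_pts[OF sv t] curve_pts[OF su t] by (simp add: m_assoc)
qed

definition homcurve :: "(real \<Rightarrow> 'g) \<Rightarrow> bool" where
  "homcurve c \<longleftrightarrow> smooth_curve UNIV A c \<and> (\<forall>s t. c (s + t) = c s \<otimes>\<^bsub>G\<^esub> c t)"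

lemma homcurve_zero: "homcurve c \<Longrightarrow> c 0 = \<one>\<^bsub>G\<^esub>"
proof -
  assume c: "homcurve c"
  then have "c (0 + 0) = c 0 \<otimes>\<^bsub>G\<^esub> c 0" unfolding homcurve_def by blast
  moreover have "c 0 \<in> carrier G" using c curve_pts unfolding homcurve_def by blast
  ultimately show ?thesis using l_cancel_one by simp
qed

text \<open>A homomorphism solves the left-invariant equation of any curve with the same initial
  velocity; hence \<open>c\<close> and \<open>d\<close> both solve the equation of
  \<open>c\<close>.\<close>

lemma homcurve_unique:
  assumes c: "homcurve c" and d: "homcurve d" and v: "velocity UNIV A c 0 = velocity UNIV A d 0"
  shows "c = d"
proof
  fix t
  have sc: "smooth_curve UNIV A c" and sd: "smooth_curve UNIV A d" using c d by (auto simp: homcurve_def)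
  have li: "left_invariant c UNIV b UNIV"
    if b: "homcurve b" and vb: "velocity UNIV A c 0 = velocity UNIV A b 0" for b
    unfolding left_invariant_def
  proof (intro conjI ballI)
    show sb: "smooth_curve UNIV A b" using b by (simp add: homcurve_def)
    fix t :: real
    have p: "smooth_curve UNIV A (\<lambda>_. b t)"
      using sb by (intro smooth_curve_const[OF man fatU]) (auto simp: smooth_curve_def)
    have "velocity UNIV A b t = velocity UNIV A (\<lambda>r. b (t + r)) 0" by (rule velocity_shift[symmetric])
    also have "\<dots> = velocity UNIV A (\<lambda>r. b t \<otimes>\<^bsub>G\<^esub> b r) 0" using b by (simp add: homcurve_def)
    also have "\<dots> = velocity UNIV A (\<lambda>r. b t \<otimes>\<^bsub>G\<^esub> c r) 0"
      by (rule velocity_mult_eq[OF fatU fatU _ _ p sb p sc]) (simp_all add: vb)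
    finally show "velocity UNIV A b t = velocity UNIV A (\<lambda>r. b t \<otimes>\<^bsub>G\<^esub> c r) 0" .
  qed
  show "c t = d t"
    by (rule left_invariant_unique[of UNIV c UNIV c d 0])
       (use li[OF c refl] li[OF d v] sc homcurve_zero[OF c] homcurve_zero[OF d] in auto)
qed

text \<open>The left-invariant equation is solved in a chart at the identity. Multiplicativity
  follows from uniqueness: \<open>c (s + t)\<close> and the product of \<open>c s\<close> and
  \<open>c t\<close> solve the same equation in \<open>t\<close> and agree at 0.\<close>

lemma local_homcurve:
  assumes a: "a \<in> tan_space A \<one>\<^bsub>G\<^esub>"
  obtains \<delta> c where "\<delta> > 0" "smooth_curve {-\<delta><..<\<delta>} A c" "c 0 = \<one>\<^bsub>G\<^esub>" "velocity UNIV A c 0 = a"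
    "\<And>s t. \<bar>s\<bar> < \<delta> \<Longrightarrow> \<bar>t\<bar> < \<delta> \<Longrightarrow> \<bar>s + t\<bar> < \<delta> \<Longrightarrow> c (s + t) = c s \<otimes>\<^bsub>G\<^esub> c t"
proof -
  obtain g where g: "g \<in> charts_at A \<one>\<^bsub>G\<^esub>" using one_pts pts_iff by metis
  then have gA: "g \<in> A" "\<one>\<^bsub>G\<^esub> \<in> fst g" by (auto simp: charts_at_iff)
  have fh: "fin_dim TYPE('h)" using man by (simp add: man_def)
  define y1 where "y1 = snd g \<one>\<^bsub>G\<^esub>"
  define D where "D = snd (prod_chart g g) ` {p \<in> fst (prod_chart g g). (\<lambda>(x, y). x \<otimes>\<^bsub>G\<^esub> y) p \<in> fst g}"
  define m where "m z = snd g (chart_inv g (fst z) \<otimes>\<^bsub>G\<^esub> chart_inv g (snd z))" for z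
  have gg: "prod_chart g g \<in> prod_atlas A A" using charts_at_prod[OF g g] by (simp add: charts_at_iff)
  have oD: "open D" unfolding D_def by (rule smooth_map_chart(1)[OF smooth_mult gg gA(1)])
  have D_iff: "(x, y) \<in> D \<longleftrightarrow> x \<in> snd g ` fst g \<and> y \<in> snd g ` fst g \<and> chart_inv g x \<otimes>\<^bsub>G\<^esub> chart_inv g y \<in> fst g" for x y
    unfolding D_def using chart_inv_left[OF man gA(1)] by (auto simp: image_iff) blast
  have sm: "smooth_on D m"
  proof -
    have "smooth_on D (\<lambda>x. snd g ((\<lambda>(x, y). x \<otimes>\<^bsub>G\<^esub> y) (chart_inv (prod_chart g g) x)))"
      unfolding D_def by (rule smooth_map_chart(2)[OF smooth_mult gg gA(1)])
    then show ?thesis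
      by (rule smooth_cong[THEN iffD1, rotated])
         (use D_iff in \<open>auto simp: m_def chart_inv_prod[OF man man gA(1) gA(1)]\<close>)
  qed
  have inv1: "chart_inv g y1 = \<one>\<^bsub>G\<^esub>" unfolding y1_def by (rule chart_inv_left[OF man gA])
  define U where "U = (\<lambda>y. (y, y1)) -` D"
  have oU: "open U" unfolding U_def by (intro open_vimage oD continuous_intros)
  have y1g: "y1 \<in> snd g ` fst g" using gA by (simp add: y1_def)
  have y1U: "y1 \<in> U" using gA y1g by (simp add: U_def D_iff inv1)
  \<comment> \<open>The left-invariant field of \<open>a\<close> in the chart: the derivative of the
    multiplication in its second argument, taken at the identity.\<close>
  define F where "F y = DD m (y, y1) (0, snd a g)" for y
  have sF: "smooth_on U F"
    unfolding F_def
    by (rule smooth_compose[OF fin_dim_prod[OF fh fh] smooth_DD[OF sm oD] smooth_Pair[OF smooth_ident smooth_const]])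
       (auto simp: U_def)
  obtain \<epsilon> y where \<epsilon>: "\<epsilon> > 0" and y: "y 0 = y1" "\<And>t. \<bar>t\<bar> < \<epsilon> \<Longrightarrow> y t \<in> U"
    "\<And>t. \<bar>t\<bar> < \<epsilon> \<Longrightarrow> (y has_vector_derivative F (y t)) (at t)" "smooth_on {-\<epsilon><..<\<epsilon>} y"
    using local_ode_solution[OF fh sF oU y1U] by metis
  define c where "c t = chart_inv g (y t)" for t
  let ?I = "{-\<epsilon><..<\<epsilon>}"
  have fI: "fat ?I" by (simp add: fat_open)
  have I: "open ?I" "0 \<in> ?I" using \<epsilon> by auto
  have yg: "y t \<in> snd g ` fst g" if "t \<in> ?I" for t
    using y(2)[of t] that by (auto simp: U_def D_iff)
  have cg: "c t \<in> fst g" "snd g (c t) = y t" if "t \<in> ?I" for t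
    unfolding c_def using chart_inv_mem[OF yg[OF that]] chart_inv_right[OF yg[OF that]] by auto
  have sc: "smooth_curve ?I A c"
  proof (rule smooth_curveI[OF man fI])
    have "smooth_on ?I (\<lambda>t. snd g (c t))" using y(4) by (rule smooth_cong[THEN iffD1, rotated]) (simp add: cg)
    then show "\<exists>d\<in>A. \<exists>V. open V \<and> t \<in> V \<and> (\<forall>s\<in>?I\<inter>V. c s \<in> fst d) \<and> smooth_on (?I \<inter> V) (\<lambda>s. snd d (c s))" for t
      using gA(1) cg(1) by (intro bexI[of _ g] exI[of _ UNIV]) auto
  qed
  have c0: "c 0 = \<one>\<^bsub>G\<^esub>" by (simp add: c_def y(1) inv1)
  have der: "((\<lambda>s. snd g (c s)) has_vector_derivative F (y t)) (at t)" if "t \<in> ?I" for t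
  proof (rule has_vector_derivative_transform_within_open[OF _ I(1) that])
    show "(y has_vector_derivative F (y t)) (at t)" using y(3) that by auto
  qed (simp add: cg)
  have mono: "m (y, y1) = y" if "y \<in> snd g ` fst g" for y
    using that chart_inv_left[OF man gA(1)] chart_carrier[OF gA(1)] by (auto simp: m_def inv1)
  have F1: "F y1 = snd a g"
  proof -
    have "((\<lambda>z. m (y1, z)) has_derivative (\<lambda>h. DD m (y1, y1) (0, h))) (at y1)"
    proof (rule has_derivative_compose[of "\<lambda>z. (y1, z)" "\<lambda>h. (0, h)" y1 UNIV m])
      show "((\<lambda>z. (y1, z)) has_derivative (\<lambda>h. (0, h))) (at y1)" by (auto intro!: derivative_eq_intros)
      show "(m has_derivative DD m (y1, y1)) (at (y1, y1))"
        using smooth_has_derivative[OF sm oD] y1U by (simp add: U_def)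
    qed
    moreover have "m (y1, z) = z" if "z \<in> snd g ` fst g" for z
      using that chart_inv_left[OF man gA(1)] chart_carrier[OF gA(1)] by (auto simp: m_def inv1)
    then have "DD (\<lambda>z. m (y1, z)) y1 = DD (\<lambda>z. z) y1"
      by (intro DD_cong[OF open_chart[OF man gA(1)] y1g])
    ultimately have "(\<lambda>h. DD m (y1, y1) (0, h)) = (\<lambda>h. h)"
      using DD_eq DD_eq[OF has_derivative_ident] by metis
    then show ?thesis unfolding F_def by metis
  qed
  have va: "velocity UNIV A c 0 = a"
  proof -
    have "snd (velocity ?I A c 0) g = snd a g"
      using velocity_coordI[OF man fI I(2), of g c "F y1"] der[OF I(2)] g F1 c0 at_within_open[OF I(2,1)]
      by (simp add: y(1))
    then have "velocity ?I A c 0 = a"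
      using tan_space_eqI[of "velocity ?I A c 0" A "\<one>\<^bsub>G\<^esub>" a g] velocity_in[OF man fI sc I(2)] a g by (simp add: c0)
    then show ?thesis using velocity_open[OF I] by metis
  qed
  \<comment> \<open>The chart solution satisfies the equation in its intrinsic form: both velocities
    have the coordinate \<open>F (y t)\<close>.\<close>
  have vel: "velocity UNIV A c t = velocity UNIV A (\<lambda>r. c t \<otimes>\<^bsub>G\<^esub> c r) 0" if t: "t \<in> ?I" for t
  proof -
    have pt: "c t \<in> pts A" using curve_pts[OF sc t] carrier by simp
    note sp = curve_mult[OF fI smooth_curve_const[OF man fI pt] sc]
    have gt: "g \<in> charts_at A (c t)" "g \<in> charts_at A (c t \<otimes>\<^bsub>G\<^esub> c 0)"
      using cg(1)[OF t] gA(1) pt by (auto simp: charts_at_iff c0 carrier)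
    have ytU: "(y t, y1) \<in> D" using y(2)[of t] t by (auto simp: U_def)
    have "((\<lambda>r. (y t, y r)) has_vector_derivative (0, F y1)) (at 0)"
      using has_vector_derivative_Pair[OF has_vector_derivative_const y(3)[of 0]] \<epsilon> by (simp add: y(1))
    then have "((\<lambda>r. m (y t, y r)) has_derivative (\<lambda>h. DD m (y t, y1) (h *\<^sub>R (0, F y1)))) (at 0)"
      unfolding has_vector_derivative_def
      by (rule has_derivative_compose) (use smooth_has_derivative[OF sm oD ytU] y(1) in simp)
    moreover have "DD m (y t, y1) (h *\<^sub>R (0, F y1)) = h *\<^sub>R F (y t)" for h
      using linear_cmul[OF linear_DD[OF sm oD ytU], of h "(0, snd a g)"] unfolding F1 F_def[of "y t"] .
    ultimately have "((\<lambda>r. m (y t, y r)) has_vector_derivative F (y t)) (at 0)"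
      by (simp only: has_vector_derivative_def)
    then have "((\<lambda>r. snd g (c t \<otimes>\<^bsub>G\<^esub> c r)) has_vector_derivative F (y t)) (at 0 within ?I)"
      using at_within_open[OF I(2,1)] by (simp add: m_def c_def)
    then have "snd (velocity ?I A (\<lambda>r. c t \<otimes>\<^bsub>G\<^esub> c r) 0) g = F (y t)"
      using velocity_coordI[OF man fI I(2), of g "\<lambda>r. c t \<otimes>\<^bsub>G\<^esub> c r"] gt by blast
    moreover have "snd (velocity ?I A c t) g = F (y t)"
      using velocity_coordI[OF man fI t, of g c "F (y t)"] der[OF t] gt at_within_open[OF t I(1)] by simp
    moreover have "c t \<otimes>\<^bsub>G\<^esub> c 0 = c t" using pt by (simp add: c0 carrier)
    ultimately have "velocity ?I A c t = velocity ?I A (\<lambda>r. c t \<otimes>\<^bsub>G\<^esub> c r) 0"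
      using tan_space_eqI[OF velocity_in[OF man fI sc t] _ gt(1)] velocity_in[OF man fI sp I(2)] by simp
    then show ?thesis using velocity_open[OF I(1) t] velocity_open[OF I] by metis
  qed
  \<comment> \<open>Halving keeps \<open>s + t\<close> inside the domain of
    \<open>c\<close>.\<close>
  define \<delta> where "\<delta> = \<epsilon> / 2"
  let ?J = "{-\<delta><..<\<delta>}"
  have \<delta>: "\<delta> > 0" "?J \<subseteq> ?I" using \<epsilon> by (auto simp: \<delta>_def)
  have fJ: "fat ?J" by (simp add: fat_open)
  have add: "c (s + t) = c s \<otimes>\<^bsub>G\<^esub> c t" if s: "s \<in> ?J" and t: "t \<in> ?J" for s t
  proof -
    have sI: "s \<in> ?I" and ps: "c s \<in> pts A" using s \<delta>(2) curve_pts[OF sc] carrier by auto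
    have sJ: "smooth_curve ?J A c" by (rule smooth_curve_shrink[OF man fI fJ \<delta>(2) sc])
    have shift: "s + t \<in> ?I" if "t \<in> ?J" for t using s that by (auto simp: \<delta>_def)
    have s1: "smooth_curve ?J A (\<lambda>t. c (s + t))"
      by (rule smooth_curve_reparam[OF man fI fJ sc smooth_add[OF smooth_const smooth_ident] shift])
    have l1: "left_invariant c ?I (\<lambda>t. c (s + t)) ?J"
      unfolding left_invariant_def
    proof (intro conjI ballI s1)
      fix t assume "t \<in> ?J"
      have "velocity UNIV A (\<lambda>t. c (s + t)) t = velocity UNIV A (\<lambda>r. c (s + (t + r))) 0" by (rule velocity_shift[symmetric])
      also have "\<dots> = velocity UNIV A c (s + t)" using velocity_shift[of A c "s + t"] by (simp add: add.assoc)
      finally show "velocity UNIV A (\<lambda>t. c (s + t)) t = velocity UNIV A (\<lambda>r. c (s + t) \<otimes>\<^bsub>G\<^esub> c r) 0"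
        using vel[OF shift[OF \<open>t \<in> ?J\<close>]] by simp
    qed
    note cs = smooth_curve_const[OF man fI ps]
    have l2: "left_invariant c ?I (\<lambda>t. c s \<otimes>\<^bsub>G\<^esub> c t) ?J"
      unfolding left_invariant_def
    proof (intro conjI ballI curve_mult[OF fJ smooth_curve_const[OF man fJ ps] sJ])
      fix t assume "t \<in> ?J"
      then have t: "t \<in> ?I" using \<delta> by blast
      have pt: "c t \<in> pts A" using curve_pts[OF sc t] carrier by simp
      note ct = curve_mult[OF fI smooth_curve_const[OF man fI pt] sc]
      have "velocity ?I A (\<lambda>t. c s \<otimes>\<^bsub>G\<^esub> c t) t = velocity ?I A (\<lambda>r. c s \<otimes>\<^bsub>G\<^esub> (c t \<otimes>\<^bsub>G\<^esub> c r)) 0"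
      proof (rule velocity_mult_eq[OF fI fI t I(2) cs sc cs ct])
        show "velocity ?I A (\<lambda>_. c s) t = velocity ?I A (\<lambda>_. c s) 0"
          using velocity_open[OF I(1) t] velocity_open[OF I] velocity_const[OF man ps] by metis
        show "velocity ?I A c t = velocity ?I A (\<lambda>r. c t \<otimes>\<^bsub>G\<^esub> c r) 0"
          using vel[OF t] velocity_open[OF I(1) t] velocity_open[OF I] by metis
      qed
      then have "velocity UNIV A (\<lambda>t. c s \<otimes>\<^bsub>G\<^esub> c t) t = velocity UNIV A (\<lambda>r. c s \<otimes>\<^bsub>G\<^esub> (c t \<otimes>\<^bsub>G\<^esub> c r)) 0"
        using velocity_open[OF I(1) t] velocity_open[OF I] by metis
      also have "\<dots> = velocity UNIV A (\<lambda>r. (c s \<otimes>\<^bsub>G\<^esub> c t) \<otimes>\<^bsub>G\<^esub> c r) 0"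
        using curve_pts[OF sc] ps pt carrier by (intro velocity_cong[OF I]) (simp add: m_assoc)
      finally show "velocity UNIV A (\<lambda>t. c s \<otimes>\<^bsub>G\<^esub> c t) t = velocity UNIV A (\<lambda>r. (c s \<otimes>\<^bsub>G\<^esub> c t) \<otimes>\<^bsub>G\<^esub> c r) 0" .
    qed
    show ?thesis
      by (rule left_invariant_unique[OF I sc c0 _ _ l1 l2, of 0]) (use \<delta> t ps carrier c0 in auto)
  qed
  show ?thesis
    by (rule that[OF \<delta>(1) smooth_curve_shrink[OF man fI fJ \<delta>(2) sc] c0 va]) (auto intro!: add)
qed

text \<open>The local homomorphism is extended by evaluating it at \<open>t / 2 ^ n\<close> and
  taking the power \<open>2 ^ n\<close>, with \<open>n\<close> so large that the argument lies in
  the domain. Doubling shows that the choice of \<open>n\<close> does not matter.\<close>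

lemma homcurve_exists:
  assumes a: "a \<in> tan_space A \<one>\<^bsub>G\<^esub>"
  obtains C where "homcurve C" "velocity UNIV A C 0 = a"
proof -
  obtain \<delta> c where \<delta>: "\<delta> > 0" and sc: "smooth_curve {-\<delta><..<\<delta>} A c" and c0: "c 0 = \<one>\<^bsub>G\<^esub>" "velocity UNIV A c 0 = a"
    and add: "\<And>s t. \<bar>s\<bar> < \<delta> \<Longrightarrow> \<bar>t\<bar> < \<delta> \<Longrightarrow> \<bar>s + t\<bar> < \<delta> \<Longrightarrow> c (s + t) = c s \<otimes>\<^bsub>G\<^esub> c t"
    using local_homcurve[OF a] by metis
  let ?I = "{-\<delta><..<\<delta>}"
  have fI: "fat ?I" by (simp add: fat_open)
  have cc: "c t \<in> carrier G" if "\<bar>t\<bar> < \<delta>" for t using curve_pts[OF sc, of t] that by (auto simp: abs_less_iff)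
  define C where "C t = (let n = LEAST n. \<bar>t\<bar> < 2 ^ n * \<delta> in c (t / 2 ^ n) [^]\<^bsub>G\<^esub> (2 ^ n :: nat))" for t
  have indep: "c (t / 2 ^ n) [^]\<^bsub>G\<^esub> (2 ^ n :: nat) = c (t / 2 ^ (n + k)) [^]\<^bsub>G\<^esub> (2 ^ (n + k) :: nat)"
    if "\<bar>t\<bar> < 2 ^ n * \<delta>" for t n k
  proof (induction k)
    case (Suc k)
    define x where "x = t / 2 ^ (n + Suc k)"
    have "(2::real) ^ n \<le> 2 ^ (n + k)" by (intro power_increasing) auto
    then have "\<bar>t\<bar> < 2 ^ (n + k) * \<delta>" using that \<delta> mult_right_mono[of "2 ^ n" "2 ^ (n + k)" \<delta>] by linarith
    then have x: "\<bar>x + x\<bar> < \<delta>" "x + x = t / 2 ^ (n + k)"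
      by (auto simp: x_def abs_divide divide_less_eq mult.commute field_simps)
    then have "\<bar>x\<bar> < \<delta>" by linarith
    then have "c (x + x) = c x [^]\<^bsub>G\<^esub> (2::nat)" using add[of x x] x cc by (simp add: numeral_2_eq_2)
    then have "c (t / 2 ^ (n + k)) [^]\<^bsub>G\<^esub> (2 ^ (n + k) :: nat) = c x [^]\<^bsub>G\<^esub> (2 * 2 ^ (n + k) :: nat)"
      using x(2) nat_pow_pow[OF cc[OF \<open>\<bar>x\<bar> < \<delta>\<close>], of 2] by metis
    then show ?case using Suc by (simp add: x_def)
  qed simp
  have C: "C t = c (t / 2 ^ n) [^]\<^bsub>G\<^esub> (2 ^ n :: nat)" if "\<bar>t\<bar> < 2 ^ n * \<delta>" for t n
  proof -
    let ?m = "LEAST n. \<bar>t\<bar> < 2 ^ n * \<delta>"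
    have "\<bar>t\<bar> < 2 ^ ?m * \<delta>" "?m \<le> n" using LeastI[of "\<lambda>n. \<bar>t\<bar> < 2 ^ n * \<delta>", OF that] Least_le[of "\<lambda>n. \<bar>t\<bar> < 2 ^ n * \<delta>", OF that] by auto
    then show ?thesis using indep[of t ?m "n - ?m"] by (simp add: C_def Let_def)
  qed
  have big: "\<exists>n. x < 2 ^ n * \<delta>" for x
  proof -
    obtain n where "x / \<delta> < 2 ^ n" using real_arch_pow[of 2 "x / \<delta>"] by auto
    then show ?thesis using \<delta> by (auto simp: divide_less_eq)
  qed
  have hom: "C (s + t) = C s \<otimes>\<^bsub>G\<^esub> C t" for s t
  proof -
    obtain n where n: "\<bar>s\<bar> + \<bar>t\<bar> < 2 ^ n * \<delta>" using big by blast
    define x y where "x = s / 2 ^ n" and "y = t / 2 ^ n"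
    have "\<bar>s + t\<bar> < 2 ^ n * \<delta>" "\<bar>s\<bar> < 2 ^ n * \<delta>" "\<bar>t\<bar> < 2 ^ n * \<delta>" using n by linarith+
    then have *: "\<bar>x + y\<bar> < \<delta>" "\<bar>x\<bar> < \<delta>" "\<bar>y\<bar> < \<delta>"
      by (auto simp: x_def y_def divide_less_eq mult.commute simp flip: add_divide_distrib)
    \<comment> \<open>\<open>c x\<close> and \<open>c y\<close> commute because their product in
      either order is \<open>c (x + y)\<close>; therefore the power of the product splits.\<close>
    then have xy: "c (x + y) = c x \<otimes>\<^bsub>G\<^esub> c y" "c x \<otimes>\<^bsub>G\<^esub> c y = c y \<otimes>\<^bsub>G\<^esub> c x"
      using add[of x y] add[of y x] by (auto simp: add.commute)
    have "C (s + t) = c (x + y) [^]\<^bsub>G\<^esub> (2 ^ n :: nat)"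
      using C[OF \<open>\<bar>s + t\<bar> < 2 ^ n * \<delta>\<close>] by (simp add: x_def y_def add_divide_distrib)
    also have "\<dots> = c x [^]\<^bsub>G\<^esub> (2 ^ n :: nat) \<otimes>\<^bsub>G\<^esub> c y [^]\<^bsub>G\<^esub> (2 ^ n :: nat)"
      using pow_mult_distrib[OF xy(2)] cc * xy by simp
    also have "\<dots> = C s \<otimes>\<^bsub>G\<^esub> C t"
      using C[OF \<open>\<bar>s\<bar> < 2 ^ n * \<delta>\<close>] C[OF \<open>\<bar>t\<bar> < 2 ^ n * \<delta>\<close>] by (simp add: x_def y_def)
    finally show ?thesis .
  qed
  have Cc: "C t = c t" if "t \<in> ?I" for t
  proof -
    have "\<bar>t\<bar> < \<delta>" using that by (auto simp: abs_less_iff)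
    then show ?thesis using C[of t 0] cc[of t] by simp
  qed
  have Cp: "C t \<in> pts A" for t
  proof -
    obtain n where n: "\<bar>t\<bar> < 2 ^ n * \<delta>" using big by blast
    then have "\<bar>t / 2 ^ n\<bar> < \<delta>" by (simp add: abs_divide divide_less_eq mult.commute)
    then show ?thesis using C[OF n] cc nat_pow_closed carrier by metis
  qed
  \<comment> \<open>Near \<open>t\<close> the curve is the left translate by \<open>C t\<close> of
    the smooth local one.\<close>
  have sC: "smooth_curve UNIV A C"
  proof (rule smooth_curve_locally[OF man fatU])
    fix t :: real
    let ?V = "{t-\<delta><..<t+\<delta>}"
    have fV: "fat ?V" by (simp add: fat_open)
    have "smooth_curve ?V A (\<lambda>s. c (s - t))"
      by (rule smooth_curve_reparam[OF man fI fV sc smooth_diff[OF smooth_ident smooth_const]]) auto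
    from curve_mult[OF fV smooth_curve_const[OF man fV Cp[of t]] this]
    have "smooth_curve ?V A (\<lambda>s. C t \<otimes>\<^bsub>G\<^esub> c (s - t))" .
    moreover have "C t \<otimes>\<^bsub>G\<^esub> c (s - t) = C s" if "s \<in> ?V" for s
      using hom[of t "s - t"] Cc[of "s - t"] that by auto
    ultimately have "smooth_curve ?V A C" using smooth_curve_cong[of ?V "\<lambda>s. C t \<otimes>\<^bsub>G\<^esub> c (s - t)" C A] by simp
    then show "\<exists>V. open V \<and> t \<in> V \<and> smooth_curve (UNIV \<inter> V) A C"
      using \<delta> by (intro exI[of _ ?V]) auto
  qed
  have "velocity UNIV A C 0 = a"
    using velocity_cong[of ?I 0 C c A] Cc \<delta> c0(2) by simp
  then show ?thesis using that[of C] hom sC by (simp add: homcurve_def)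
qed

end

section \<open>Open submanifolds and projections\<close>

context
  fixes A :: "('p, 'e::real_inner) atlas" and W :: "'p set"
  assumes A: "man A" and W: "openin (manifold_topology A) W"
begin

lemma restrict_chart_inv: "c \<in> A \<Longrightarrow> q \<in> fst c \<Longrightarrow> q \<in> W \<Longrightarrow> chart_inv (fst c \<inter> W, snd c) (snd c q) = q"
proof -
  assume c: "c \<in> A" "q \<in> fst c" "q \<in> W"
  have "inj_on (snd c) (fst c \<inter> W)" using inj_on_subset[OF chart_inj[OF A c(1)]] by blast
  then show ?thesis unfolding chart_inv_def using c by (simp add: inv_into_f_f)
qed

lemma open_restrict_chart: "c \<in> A \<Longrightarrow> open (snd c ` (fst c \<inter> W))"
  using W openin_manifold_topology[of A W] A by (simp add: man_def Int_commute)

lemma man_restrict: "man (restrict_atlas A W)"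
proof -
  have ov: "snd c ` (fst c \<inter> W \<inter> (fst d \<inter> W)) = snd c ` (fst c \<inter> W) \<inter> snd c ` (fst c \<inter> fst d)"
    if c: "c \<in> A" for c d :: "('p, 'e) chart"
    using inj_onD[OF chart_inj[OF A c]] by blast
  have "smooth_on (snd c ` (fst c \<inter> W \<inter> (fst d \<inter> W))) (snd d \<circ> chart_inv (fst c \<inter> W, snd c))"
    if c: "c \<in> A" "d \<in> A" for c d
  proof -
    have "smooth_on (snd c ` (fst c \<inter> W \<inter> (fst d \<inter> W))) (transition c d)"
      by (rule smooth_subset[OF smooth_transition[OF A c]]) auto
    then show ?thesis
      by (rule smooth_cong[THEN iffD1, rotated])
         (use c in \<open>auto simp: restrict_chart_inv chart_inv_left[OF A]\<close>)
  qed
  moreover have "open (snd c ` (fst c \<inter> W \<inter> (fst d \<inter> W)))" if "c \<in> A" "d \<in> A" for c d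
    unfolding ov[OF that(1)] using open_restrict_chart open_overlap[OF A] that by blast
  moreover have "inj_on (snd c) (fst c \<inter> W)" if "c \<in> A" for c
    using inj_on_subset[OF chart_inj[OF A that]] by blast
  ultimately show ?thesis
    using A open_restrict_chart unfolding man_def smooth_atlas_def restrict_atlas_def by simp
qed

lemma charts_at_restrict:
  "c \<in> charts_at A p \<Longrightarrow> p \<in> W \<Longrightarrow> (fst c \<inter> W, snd c) \<in> charts_at (restrict_atlas A W) p"
  by (auto simp: charts_at_iff restrict_atlas_def)

lemma pts_restrict: "pts (restrict_atlas A W) = W"
proof -
  have "W \<subseteq> pts A" using W openin_manifold_topology[of A W] A by (simp add: man_def)
  then show ?thesis unfolding pts_def restrict_atlas_def by auto
qed

lemma curve_restrict:
  assumes I: "fat I"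
  shows "smooth_curve I (restrict_atlas A W) \<gamma> \<longleftrightarrow> smooth_curve I A \<gamma> \<and> (\<forall>t\<in>I. \<gamma> t \<in> W)"
proof
  assume \<gamma>: "smooth_curve I (restrict_atlas A W) \<gamma>"
  then have \<gamma>W: "\<gamma> t \<in> W" if "t \<in> I" for t using that unfolding smooth_curve_def pts_restrict by blast
  have "smooth_curve I A \<gamma>"
  proof (rule smooth_curveI[OF A I])
    fix t assume t: "t \<in> I"
    have "W \<subseteq> pts A" using W openin_manifold_topology[of A W] A by (simp add: man_def)
    then obtain c where c: "c \<in> charts_at A (\<gamma> t)" using \<gamma>W[OF t] unfolding pts_iff[symmetric] by (metis pts_iff subsetD)
    obtain V where "open V" "t \<in> V" "\<And>s. s \<in> I \<inter> V \<Longrightarrow> \<gamma> s \<in> fst c \<inter> W" "smooth_on (I \<inter> V) (\<lambda>s. snd c (\<gamma> s))"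
      using smooth_curve_local[OF man_restrict I \<gamma> t charts_at_restrict[OF c \<gamma>W[OF t]]] by auto
    then show "\<exists>c\<in>A. \<exists>V. open V \<and> t \<in> V \<and> (\<forall>s\<in>I\<inter>V. \<gamma> s \<in> fst c) \<and> smooth_on (I \<inter> V) (\<lambda>s. snd c (\<gamma> s))"
      using c unfolding charts_at_iff by blast
  qed
  then show "smooth_curve I A \<gamma> \<and> (\<forall>t\<in>I. \<gamma> t \<in> W)" using \<gamma>W by blast
next
  assume "smooth_curve I A \<gamma> \<and> (\<forall>t\<in>I. \<gamma> t \<in> W)"
  then have \<gamma>: "smooth_curve I A \<gamma>" and \<gamma>W: "\<And>t. t \<in> I \<Longrightarrow> \<gamma> t \<in> W" by auto
  show "smooth_curve I (restrict_atlas A W) \<gamma>"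
  proof (rule smooth_curveI[OF man_restrict I])
    fix t assume t: "t \<in> I"
    obtain c where c: "c \<in> charts_at A (\<gamma> t)" using \<gamma> t unfolding smooth_curve_def pts_iff by blast
    obtain V where V: "open V" "t \<in> V" "\<And>s. s \<in> I \<inter> V \<Longrightarrow> \<gamma> s \<in> fst c" "smooth_on (I \<inter> V) (\<lambda>s. snd c (\<gamma> s))"
      using smooth_curve_local[OF A I \<gamma> t c] by metis
    have "(fst c \<inter> W, snd c) \<in> restrict_atlas A W" using charts_at_restrict[OF c \<gamma>W[OF t]] by (simp add: charts_at_iff)
    then show "\<exists>c\<in>restrict_atlas A W. \<exists>V. open V \<and> t \<in> V \<and> (\<forall>s\<in>I\<inter>V. \<gamma> s \<in> fst c) \<and> smooth_on (I \<inter> V) (\<lambda>s. snd c (\<gamma> s))"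
      using V \<gamma>W by (intro bexI[of _ "(fst c \<inter> W, snd c)"] exI[of _ V]) auto
  qed
qed

text \<open>A restricted atlas has other charts and therefore other tangent vectors, so the
  velocities themselves cannot be identified; their equality can be transferred.\<close>

lemma velocity_restrict_eq:
  assumes I: "fat I" "fat J" "t \<in> I" "s \<in> J"
    and \<gamma>: "smooth_curve I (restrict_atlas A W) \<gamma>" and \<delta>: "smooth_curve J (restrict_atlas A W) \<delta>"
  shows "velocity I (restrict_atlas A W) \<gamma> t = velocity J (restrict_atlas A W) \<delta> s
    \<longleftrightarrow> velocity I A \<gamma> t = velocity J A \<delta> s" (is "?l \<longleftrightarrow> ?r")
proof -
  have \<gamma>': "smooth_curve I A \<gamma>" "\<gamma> t \<in> W" using \<gamma> curve_restrict[OF I(1)] I by auto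
  have \<delta>': "smooth_curve J A \<delta>" "\<delta> s \<in> W" using \<delta> curve_restrict[OF I(2)] I by auto
  obtain c where c: "c \<in> charts_at A (\<gamma> t)" using \<gamma>'(1) I(3) unfolding smooth_curve_def pts_iff by blast
  let ?c = "(fst c \<inter> W, snd c)"
  note c' = charts_at_restrict[OF c \<gamma>'(2)]
  have p: "\<gamma> t = \<delta> s" if "?l \<or> ?r" using that by (auto simp: velocity_def)
  have 1: "snd (velocity I (restrict_atlas A W) \<gamma> t) ?c = snd (velocity I A \<gamma> t) c"
    using c c' by (simp add: velocity_def)
  have 2: "snd (velocity J (restrict_atlas A W) \<delta> s) ?c = snd (velocity J A \<delta> s) c" if "\<gamma> t = \<delta> s"
    using c c' that by (simp add: velocity_def)
  show ?thesis
  proof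
    assume ?l
    then show ?r
      using tan_space_eqI[OF velocity_in[OF A I(1) \<gamma>'(1) I(3)] _ c] velocity_in[OF A I(2) \<delta>'(1) I(4)] p 1 2 by metis
  next
    assume ?r
    then show ?l
      using tan_space_eqI[OF velocity_in[OF man_restrict I(1) \<gamma> I(3)] _ c'] velocity_in[OF man_restrict I(2) \<delta> I(4)] p 1 2
      by metis
  qed
qed

end

lemma smooth_map_snd:
  assumes A: "man A" and B: "man B"
  shows "smooth_map (prod_atlas A B) B snd"
proof (rule smooth_mapI[OF man_prod[OF A B] B])
  fix z assume z: "z \<in> pts (prod_atlas A B)"
  then have "fst z \<in> pts A" "snd z \<in> pts B" by (auto simp: pts_prod)
  then obtain c d where c: "c \<in> charts_at A (fst z)" and d: "d \<in> charts_at B (snd z)" using pts_iff by metis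
  have cd: "c \<in> A" "d \<in> B" "fst z \<in> fst c" "snd z \<in> fst d" using c d by (auto simp: charts_at_iff)
  let ?c = "prod_chart c d"
  have zc: "?c \<in> charts_at (prod_atlas A B) z" using charts_at_prod[OF c d] by simp
  then have cP: "?c \<in> prod_atlas A B" by (simp add: charts_at_iff)
  have im: "snd ?c ` fst ?c = snd c ` fst c \<times> snd d ` fst d" by (auto simp: map_prod_def image_iff)
  have inv: "snd (chart_inv ?c x) = chart_inv d (snd x)" if "x \<in> snd ?c ` fst ?c" for x
    using chart_inv_prod[OF A B cd(1,2), of "fst x" "snd x"] that unfolding im by auto
  have "smooth_on (snd ?c ` fst ?c) (\<lambda>x. snd x)" by (rule smooth_snd[OF smooth_ident])
  then have "smooth_on (snd ?c ` fst ?c) (\<lambda>x. snd d (snd (chart_inv ?c x)))"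
  proof (rule smooth_cong[THEN iffD1, rotated])
    fix x assume x: "x \<in> snd ?c ` fst ?c"
    then have "snd x \<in> snd d ` fst d" unfolding im by auto
    then show "snd x = snd d (snd (chart_inv ?c x))" using inv[OF x] chart_inv_right[of "snd x" d] by metis
  qed
  moreover have "snd (chart_inv ?c x) \<in> fst d" if x: "x \<in> snd ?c ` fst ?c" for x
  proof -
    have "snd x \<in> snd d ` fst d" using x unfolding im by auto
    then show ?thesis using inv[OF x] chart_inv_mem[of "snd x" d] by metis
  qed
  ultimately show "\<exists>c\<in>charts_at (prod_atlas A B) z. \<exists>e\<in>B. \<exists>V. open V \<and> snd c z \<in> V \<and> V \<subseteq> snd c ` fst c \<and>
      (\<forall>x\<in>V. snd (chart_inv c x) \<in> fst e) \<and> smooth_on V (\<lambda>x. snd e (snd (chart_inv c x)))"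
  proof (intro bexI[OF _ zc] bexI[OF _ cd(2)] exI[of _ "snd ?c ` fst ?c"] conjI ballI)
    show "snd ?c z \<in> snd ?c ` fst ?c" using zc unfolding charts_at_iff by (intro imageI) blast
  qed (use open_chart[OF man_prod[OF A B] cP] in blast)+
qed

text \<open>A straight segment in a chart, shortened so that it stays in \<open>W\<close>.\<close>

lemma curve_with_velocity:
  assumes A: "man A" and W: "openin (manifold_topology A) W" "p \<in> W" and Z: "Z \<in> tan_space A p"
  obtains \<epsilon> \<gamma> where "\<epsilon> > 0" "smooth_curve {-\<epsilon><..<\<epsilon>} A \<gamma>" "\<gamma> 0 = p" "velocity UNIV A \<gamma> 0 = Z"
    "\<And>t. t \<in> {-\<epsilon><..<\<epsilon>} \<Longrightarrow> \<gamma> t \<in> W"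
proof -
  have "W \<subseteq> pts A" using W openin_manifold_topology[of A W] A by (simp add: man_def)
  then obtain c where c: "c \<in> charts_at A p" using W(2) pts_iff by (metis subsetD)
  then have cA: "c \<in> A" "p \<in> fst c" by (auto simp: charts_at_iff)
  let ?V = "snd c ` (fst c \<inter> W)"
  define h where "h t = snd c p + t *\<^sub>R snd Z c" for t
  have "open (h -` ?V)"
    unfolding h_def by (intro open_vimage open_restrict_chart[OF A W(1) cA(1)] continuous_intros)
  moreover have "0 \<in> h -` ?V" using cA W(2) by (simp add: h_def)
  ultimately obtain \<epsilon> where \<epsilon>: "\<epsilon> > 0" "ball 0 \<epsilon> \<subseteq> h -` ?V" unfolding open_contains_ball by blast
  define \<gamma> where "\<gamma> t = chart_inv c (h t)" for t
  let ?I = "{-\<epsilon><..<\<epsilon>}"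
  have I: "open ?I" "fat ?I" "0 \<in> ?I" using \<epsilon>(1) by (auto intro: fat_open)
  have hV: "h t \<in> ?V" if "t \<in> ?I" for t
  proof -
    have "t \<in> ball 0 \<epsilon>" using that by (auto simp: dist_real_def abs_less_iff)
    then show ?thesis using \<epsilon>(2) by blast
  qed
  have \<gamma>: "\<gamma> t \<in> fst c" "\<gamma> t \<in> W" "snd c (\<gamma> t) = h t" if t: "t \<in> ?I" for t
  proof -
    obtain q where "q \<in> fst c" "q \<in> W" "h t = snd c q" using hV[OF t] by blast
    then show "\<gamma> t \<in> fst c" "\<gamma> t \<in> W" "snd c (\<gamma> t) = h t"
      using chart_inv_left[OF A cA(1)] by (auto simp: \<gamma>_def)
  qed
  have "smooth_on ?I h"
    unfolding h_def by (intro smooth_add smooth_scaleR smooth_const smooth_ident)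
  then have sh: "smooth_on ?I (\<lambda>t. snd c (\<gamma> t))"
    by (rule smooth_cong[THEN iffD1, rotated]) (simp add: \<gamma>)
  have sc: "smooth_curve ?I A \<gamma>"
    by (rule smooth_curveI[OF A I(2)]) (use sh \<gamma>(1) cA(1) in \<open>auto intro!: bexI[of _ c] exI[of _ UNIV]\<close>)
  have \<gamma>0: "\<gamma> 0 = p" using chart_inv_left[OF A cA] by (simp add: \<gamma>_def h_def)
  have "(h has_vector_derivative snd Z c) (at 0)"
    unfolding h_def by (auto intro!: derivative_eq_intros)
  then have "((\<lambda>t. snd c (\<gamma> t)) has_vector_derivative snd Z c) (at 0)"
    by (rule has_vector_derivative_transform_within_open[OF _ I(1,3)]) (simp add: \<gamma>)
  then have "snd (velocity ?I A \<gamma> 0) c = snd Z c"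
    using velocity_coordI[OF A I(2,3), of c \<gamma>] c \<gamma>0 at_within_open[OF I(3,1)] by simp
  then have "velocity ?I A \<gamma> 0 = Z"
    using tan_space_eqI[OF _ Z c] velocity_in[OF A I(2) sc I(3)] \<gamma>0 by metis
  then have "velocity UNIV A \<gamma> 0 = Z" using velocity_open[OF I(1,3)] by metis
  then show ?thesis using that[OF \<epsilon>(1) sc \<gamma>0 _ \<gamma>(2)] by blast
qed

section \<open>The principal bundle\<close>

locale chaplygin_system =
  fixes S :: "('q, 'e::real_inner, 'm, 'f::real_inner, 'g, 'h::real_inner) chaplygin"
  assumes pb: "principal_bundle S" and hd: "horizontal_distribution S"
begin

abbreviation "Q \<equiv> Qat S"
abbreviation "M \<equiv> Mat S"
abbreviation "G \<equiv> Gat S"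
abbreviation "\<pi> \<equiv> proj S"
abbreviation "e \<equiv> \<one>\<^bsub>grp S\<^esub>"

lemma manifolds: "manifold Q" "manifold M" "lie_group G (grp S)"
  using pb unfolding principal_bundle_def by blast+

sublocale L: lie_group_loc "Gat S" "grp S"
  by (unfold_locales) (rule manifolds(3))

lemma manQ: "man Q" and manM: "man M" and manG: "man G"
  using manifolds manifold_man L.man by auto

lemma fin_dims: "fin_dim TYPE('e)" "fin_dim TYPE('f)" "fin_dim TYPE('h)"
  using manQ manM manG by (auto simp: man_def)

lemma smooth_act: "smooth_map (prod_atlas Q G) Q (\<lambda>(q, g). act S q g)"
  and act_one: "q \<in> pts Q \<Longrightarrow> act S q e = q"
  and act_assoc: "q \<in> pts Q \<Longrightarrow> g \<in> pts G \<Longrightarrow> h \<in> pts G \<Longrightarrow> act S (act S q g) h = act S q (g \<otimes>\<^bsub>grp S\<^esub> h)"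
  and smooth_proj: "smooth_map Q M \<pi>" and proj_onto: "\<pi> ` pts Q = pts M"
  using pb unfolding principal_bundle_def by blast+

lemma act_in: "q \<in> pts Q \<Longrightarrow> g \<in> pts G \<Longrightarrow> act S q g \<in> pts Q"
  using smooth_act unfolding smooth_map_def pts_prod by auto

lemma proj_in: "q \<in> pts Q \<Longrightarrow> \<pi> q \<in> pts M"
  using proj_onto by blast

lemma openin_preimage:
  assumes "openin (manifold_topology M) U"
  shows "openin (manifold_topology Q) {q \<in> pts Q. \<pi> q \<in> U}"
proof -
  have sQ: "smooth_atlas Q" and sM: "smooth_atlas M" using manQ manM by (auto simp: man_def)
  have "open (snd c ` ({q \<in> pts Q. \<pi> q \<in> U} \<inter> fst c))" if c: "c \<in> Q" for c
  proof (subst open_subopen, intro ballI)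
    fix x assume "x \<in> snd c ` ({q \<in> pts Q. \<pi> q \<in> U} \<inter> fst c)"
    then obtain q where q: "q \<in> pts Q" "\<pi> q \<in> U" "q \<in> fst c" "x = snd c q" by blast
    have cq: "c \<in> charts_at Q q" using c q by (simp add: charts_at_iff)
    obtain d where d: "d \<in> charts_at M (\<pi> q)" using proj_in[OF q(1)] pts_iff by metis
    then have dM: "d \<in> M" "\<pi> q \<in> fst d" by (auto simp: charts_at_iff)
    obtain V where V: "open V" "snd c q \<in> V" "V \<subseteq> snd c ` fst c" "\<And>x. x \<in> V \<Longrightarrow> \<pi> (chart_inv c x) \<in> fst d"
      "smooth_on V (\<lambda>x. snd d (\<pi> (chart_inv c x)))"
      using smooth_map_local[OF manQ smooth_proj cq d] by metis
    have oU: "open (snd d ` (U \<inter> fst d))" using assms dM(1) openin_manifold_topology[OF sM] by blast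
    let ?T = "V \<inter> (\<lambda>x. snd d (\<pi> (chart_inv c x))) -` (snd d ` (U \<inter> fst d))"
    have "open ?T" by (rule continuous_open_preimage[OF smooth_continuous[OF V(5)] V(1) oU])
    moreover have "x \<in> ?T"
      using V(2) q dM chart_inv_left[OF manQ c q(3)] by auto
    moreover have "?T \<subseteq> snd c ` ({q \<in> pts Q. \<pi> q \<in> U} \<inter> fst c)"
    proof
      fix y assume y: "y \<in> ?T"
      then obtain m where m: "m \<in> U" "m \<in> fst d" "snd d (\<pi> (chart_inv c y)) = snd d m" by blast
      then have "\<pi> (chart_inv c y) = m" using inj_onD[OF chart_inj[OF manM dM(1)]] V(4) y by blast
      moreover have "chart_inv c y \<in> fst c" "snd c (chart_inv c y) = y"
        using chart_inv_mem[of y c] chart_inv_right[of y c] V(3) y by blast+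
      moreover from this have "chart_inv c y \<in> pts Q" using c unfolding pts_def by blast
      ultimately show "y \<in> snd c ` ({q \<in> pts Q. \<pi> q \<in> U} \<inter> fst c)"
        using m(1) by (intro image_eqI[of _ _ "chart_inv c y"]) auto
    qed
    ultimately show "\<exists>T. open T \<and> x \<in> T \<and> T \<subseteq> snd c ` ({q \<in> pts Q. \<pi> q \<in> U} \<inter> fst c)" by blast
  qed
  then show ?thesis unfolding openin_manifold_topology[OF sQ] by blast
qed

text \<open>\<open>k\<close> is the equivariant fibre coordinate and \<open>\<sigma>\<close> the
  inverse of \<open>(\<pi>, k)\<close>. Naming the inverse hides the \<open>inv_into\<close> over a
  restricted atlas.\<close>

definition trivialization :: "'m set \<Rightarrow> ('q \<Rightarrow> 'g) \<Rightarrow> ('m \<times> 'g \<Rightarrow> 'q) \<Rightarrow> bool" where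
  "trivialization U k \<sigma> \<longleftrightarrow> openin (manifold_topology M) U \<and>
     smooth_map (restrict_atlas Q {q \<in> pts Q. \<pi> q \<in> U}) (prod_atlas (restrict_atlas M U) G) (\<lambda>q. (\<pi> q, k q)) \<and>
     smooth_map (prod_atlas (restrict_atlas M U) G) (restrict_atlas Q {q \<in> pts Q. \<pi> q \<in> U}) \<sigma> \<and>
     (\<forall>q\<in>pts Q. \<pi> q \<in> U \<longrightarrow> k q \<in> pts G \<and> \<sigma> (\<pi> q, k q) = q \<and>
        (\<forall>g\<in>pts G. \<pi> (act S q g) = \<pi> q \<and> k (act S q g) = k q \<otimes>\<^bsub>grp S\<^esub> g)) \<and>
     (\<forall>x\<in>U. \<forall>g\<in>pts G. \<sigma> (x, g) \<in> pts Q \<and> \<pi> (\<sigma> (x, g)) = x \<and> k (\<sigma> (x, g)) = g)"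

lemma trivialization_exists:
  assumes "x \<in> pts M"
  obtains U k \<sigma> where "x \<in> U" "trivialization U k \<sigma>"
proof -
  obtain U k where U: "openin (manifold_topology M) U" "x \<in> U" and
    d: "diffeo (restrict_atlas Q {q \<in> pts Q. \<pi> q \<in> U}) (prod_atlas (restrict_atlas M U) G) (\<lambda>q. (\<pi> q, k q))"
    and k: "\<forall>q\<in>pts Q. \<forall>g\<in>pts G. \<pi> q \<in> U \<longrightarrow> \<pi> (act S q g) = \<pi> q \<and> k (act S q g) = k q \<otimes>\<^bsub>grp S\<^esub> g"
    using pb assms unfolding principal_bundle_def by blast
  let ?W = "{q \<in> pts Q. \<pi> q \<in> U}"
  let ?\<sigma> = "inv_into (pts (restrict_atlas Q ?W)) (\<lambda>q. (\<pi> q, k q))"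
  have pW: "pts (restrict_atlas Q ?W) = ?W" by (rule pts_restrict[OF manQ openin_preimage[OF U(1)]])
  have pU: "pts (prod_atlas (restrict_atlas M U) G) = U \<times> pts G"
    unfolding pts_prod pts_restrict[OF manM U(1)] ..
  have bij: "bij_betw (\<lambda>q. (\<pi> q, k q)) ?W (U \<times> pts G)"
    and sm: "smooth_map (restrict_atlas Q ?W) (prod_atlas (restrict_atlas M U) G) (\<lambda>q. (\<pi> q, k q))"
      "smooth_map (prod_atlas (restrict_atlas M U) G) (restrict_atlas Q ?W) ?\<sigma>"
    using d unfolding diffeo_def pW pU by auto
  have 1: "k q \<in> pts G" "?\<sigma> (\<pi> q, k q) = q" if "q \<in> ?W" for q
    using that bij bij_betw_inv_into_left[OF bij that] bij_betwE[OF bij] unfolding pW by auto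
  have 2: "?\<sigma> (y, g) \<in> ?W" "(\<lambda>q. (\<pi> q, k q)) (?\<sigma> (y, g)) = (y, g)" if "y \<in> U" "g \<in> pts G" for y g
    using bij_betwE[OF bij_betw_inv_into[OF bij]] bij_betw_inv_into_right[OF bij, of "(y, g)"] that unfolding pW by auto
  have "trivialization U k ?\<sigma>"
    unfolding trivialization_def using U(1) sm 1 2 k by auto
  then show ?thesis using that U(2) by blast
qed

lemma proj_act: "q \<in> pts Q \<Longrightarrow> g \<in> pts G \<Longrightarrow> \<pi> (act S q g) = \<pi> q"
proof -
  assume q: "q \<in> pts Q" and g: "g \<in> pts G"
  obtain U k \<sigma> where "\<pi> q \<in> U" "trivialization U k \<sigma>" using trivialization_exists[OF proj_in[OF q]] .
  then show ?thesis using q g unfolding trivialization_def by blast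
qed

subsection \<open>Exponential map and fundamental vector fields\<close>

lemma one_parameter_subgroup_iff:
  "one_parameter_subgroup S a c \<longleftrightarrow> L.homcurve c \<and> velocity UNIV G c 0 = a"
  by (auto simp: one_parameter_subgroup_def L.homcurve_def)

definition expcurve :: "('g, 'h) tvec \<Rightarrow> real \<Rightarrow> 'g" where
  "expcurve a = (THE c. one_parameter_subgroup S a c)"

lemma expcurve_eqI: "one_parameter_subgroup S a c \<Longrightarrow> expcurve a = c"
  unfolding expcurve_def using L.homcurve_unique by (intro the_equality) (auto simp: one_parameter_subgroup_iff)

lemma expcurve:
  assumes "a \<in> lie_alg S"
  shows "smooth_curve UNIV G (expcurve a)" "velocity UNIV G (expcurve a) 0 = a" "expcurve a 0 = e"
    "expcurve a t \<in> pts G" "lie_exp S (tscale t a) = expcurve a t"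
proof -
  obtain C where C: "L.homcurve C" "velocity UNIV G C 0 = a"
    using L.homcurve_exists assms unfolding lie_alg_def by metis
  then have eC: "expcurve a = C" by (intro expcurve_eqI) (simp add: one_parameter_subgroup_iff)
  show sm: "smooth_curve UNIV G (expcurve a)" using C by (simp add: eC L.homcurve_def)
  show "velocity UNIV G (expcurve a) 0 = a" "expcurve a 0 = e"
    using C L.homcurve_zero by (simp_all add: eC)
  show "expcurve a t \<in> pts G" using L.curve_pts[OF sm] L.carrier by simp
  \<comment> \<open>The curve \<open>C (t * s)\<close> in \<open>s\<close> is the one-parameter
    subgroup of \<open>tscale t a\<close>, and \<open>lie_exp\<close> evaluates it at 1.\<close>
  have "smooth_curve UNIV G (\<lambda>s. C (t * s))"
    by (rule smooth_curve_reparam[OF manG L.fatU L.fatU _ smooth_bounded_linear[OF bounded_linear_mult_right]])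
       (use sm in \<open>simp_all add: eC\<close>)
  then have "L.homcurve (\<lambda>s. C (t * s))"
    using C(1) by (simp add: L.homcurve_def ring_distribs)
  moreover have "velocity UNIV G (\<lambda>s. C (t * s)) 0 = tscale t a"
    using velocity_scale[OF manG, of C t] sm C(2) by (simp add: eC)
  ultimately have "expcurve (tscale t a) = (\<lambda>s. C (t * s))"
    by (intro expcurve_eqI) (simp add: one_parameter_subgroup_iff)
  then show "lie_exp S (tscale t a) = expcurve a t"
    unfolding lie_exp_def by (fold expcurve_def) (simp add: eC)
qed

lemma fundamental_eq:
  "a \<in> lie_alg S \<Longrightarrow> fundamental S a q = velocity UNIV Q (\<lambda>t. act S q (expcurve a t)) 0"
  by (simp add: fundamental_def expcurve)

lemma smooth_curve_act:
  "q \<in> pts Q \<Longrightarrow> fat I \<Longrightarrow> smooth_curve I G \<beta> \<Longrightarrow> smooth_curve I Q (\<lambda>t. act S q (\<beta> t))"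
  using smooth_curve_map2[OF manQ manG manQ _ smooth_act smooth_curve_const[OF manQ]] by blast

text \<open>In the definition of the fundamental field the exponential curve may be replaced by any
  curve in the group with the same velocity.\<close>

lemma velocity_act:
  assumes q: "q \<in> pts Q" and I: "open I" "0 \<in> I" and \<beta>: "smooth_curve I G \<beta>" and a: "a \<in> lie_alg S"
    and v: "velocity UNIV G \<beta> 0 = a"
  shows "velocity UNIV Q (\<lambda>t. act S q (\<beta> t)) 0 = fundamental S a q"
proof -
  have fI: "fat I" by (rule fat_open[OF I(1)])
  have "velocity I Q (\<lambda>t. act S q (\<beta> t)) 0 = velocity UNIV Q (\<lambda>t. act S q (expcurve a t)) 0"
  proof (rule velocity_map2_eq[OF manQ manG manQ fI L.fatU I(2) _ smooth_act smooth_curve_const[OF manQ fI q] \<beta>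
        smooth_curve_const[OF manQ L.fatU q] expcurve(1)[OF a]])
    show "velocity I Q (\<lambda>_. q) 0 = velocity UNIV Q (\<lambda>_. q) 0" by (rule velocity_open[OF I])
    show "velocity I G \<beta> 0 = velocity UNIV G (expcurve a) 0"
      using velocity_open[OF I, of G \<beta>] v expcurve(2)[OF a] by simp
  qed simp
  then show ?thesis using velocity_open[OF I] fundamental_eq[OF a] by metis
qed

lemma fundamental_in:
  assumes "a \<in> lie_alg S" "q \<in> pts Q"
  shows "fundamental S a q \<in> tan_space Q q"
  using velocity_in[OF manQ L.fatU smooth_curve_act[OF assms(2) L.fatU expcurve(1)[OF assms(1)]], of 0]
  by (simp add: fundamental_eq assms expcurve act_one)

definition g0 :: "('g, 'h) chart" where
  "g0 = (SOME c. c \<in> charts_at G e)"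

lemma g0: "g0 \<in> charts_at G e"
  unfolding g0_def using L.one_pts someI_ex[of "\<lambda>c. c \<in> charts_at G e"] pts_iff by metis

text \<open>Together with the chart \<open>g0\<close> this identifies the Lie algebra with the model
  space \<open>'h\<close>, so that quantities with values in the Lie algebra become ordinary
  vectors.\<close>

definition lv :: "'h \<Rightarrow> ('g, 'h) tvec" where
  "lv b = tvec G g0 e b"

lemma lv: "lv b \<in> lie_alg S" "snd (lv b) g0 = b" "a \<in> lie_alg S \<Longrightarrow> lv (snd a g0) = a"
  unfolding lv_def lie_alg_def using tvec_in[OF manG g0] tvec_coord[OF manG g0] tvec_collapse[OF manG _ g0] by auto

lemma lie_alg_eqI: "a \<in> lie_alg S \<Longrightarrow> b \<in> lie_alg S \<Longrightarrow> snd a g0 = snd b g0 \<Longrightarrow> a = b"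
  using lv(3) by metis

definition fcoord :: "('q, 'e) chart \<Rightarrow> 'e \<Rightarrow> 'h \<Rightarrow> 'e" where
  "fcoord c x b = snd (fundamental S (lv b) (chart_inv c x)) c"

text \<open>In charts the fundamental field is the partial derivative of the action in the group
  direction at the identity. This gives smoothness in the point and linearity in \<open>b\<close> at
  once.\<close>

lemma fcoord:
  assumes c: "c \<in> Q"
  shows "smooth_on (snd c ` fst c) (\<lambda>x. fcoord c x b)" and "x \<in> snd c ` fst c \<Longrightarrow> linear (fcoord c x)"
proof -
  have gG: "g0 \<in> G" "e \<in> fst g0" using g0 by (auto simp: charts_at_iff)
  let ?C = "prod_chart c g0"
  have CP: "?C \<in> prod_atlas Q G" using c gG by (auto simp: prod_atlas_eq)
  define D where "D = snd ?C ` {p \<in> fst ?C. (\<lambda>(q, g). act S q g) p \<in> fst c}"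
  define \<phi> where "\<phi> z = snd c ((\<lambda>(q, g). act S q g) (chart_inv ?C z))" for z
  have D: "open D" "smooth_on D \<phi>"
    unfolding D_def \<phi>_def using smooth_map_chart[OF smooth_act CP c] by auto
  let ?y = "snd g0 e"
  have mem: "(x, ?y) \<in> D" if x: "x \<in> snd c ` fst c" for x
  proof -
    obtain q where q: "q \<in> fst c" "x = snd c q" using x by blast
    then have "q \<in> pts Q" using c unfolding pts_def by blast
    then show ?thesis unfolding D_def using q gG act_one by (intro image_eqI[of _ _ "(q, e)"]) auto
  qed
  have eq: "fcoord c x b = DD \<phi> (x, ?y) (0, b)" if x: "x \<in> snd c ` fst c" for x b
  proof -
    obtain q where q: "q \<in> fst c" "x = snd c q" using x by blast
    have cq: "c \<in> charts_at Q q" using q c by (simp add: charts_at_iff)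
    then have qp: "q \<in> pts Q" using pts_iff by metis
    have inv: "chart_inv c x = q" using chart_inv_left[OF manQ c q(1)] q(2) by simp
    let ?a = "lv b"
    have a: "?a \<in> lie_alg S" by (rule lv)
    note sc = smooth_curve_const[OF manQ L.fatU qp] expcurve(1)[OF a]
    note sp = smooth_curve_Pair[OF manQ manG L.fatU sc]
    have ex0: "expcurve ?a 0 = e" by (rule expcurve(3)[OF a])
    have "fundamental S ?a q = tan_map (prod_atlas Q G) Q (\<lambda>(q, g). act S q g)
        (velocity UNIV (prod_atlas Q G) (\<lambda>t. (q, expcurve ?a t)) 0)"
      using smooth_curve_map(2)[OF man_prod[OF manQ manG] manQ L.fatU smooth_act sp, of 0]
      by (simp add: fundamental_eq[OF a])
    moreover have "snd (tan_map (prod_atlas Q G) Q (\<lambda>(q, g). act S q g)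
        (velocity UNIV (prod_atlas Q G) (\<lambda>t. (q, expcurve ?a t)) 0)) c
        = DD \<phi> (snd ?C (q, e)) (snd (velocity UNIV (prod_atlas Q G) (\<lambda>t. (q, expcurve ?a t)) 0) ?C)"
      unfolding \<phi>_def
      by (rule tan_map_coord[OF man_prod[OF manQ manG] manQ smooth_act _ charts_at_prod[OF cq g0]])
         (use velocity_in[OF man_prod[OF manQ manG] L.fatU sp, of 0] ex0 cq act_one[OF qp] in auto)
    moreover have "snd (velocity UNIV (prod_atlas Q G) (\<lambda>t. (q, expcurve ?a t)) 0) ?C = (0, b)"
      using velocity_Pair[OF manQ manG L.fatU sc, of 0 c g0] cq g0 ex0 expcurve(2)[OF a] lv(2)
        velocity_const[OF manQ qp] by simp
    ultimately show ?thesis using q(2) inv by (simp add: fcoord_def)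
  qed
  have "smooth_on (snd c ` fst c) (\<lambda>x. DD \<phi> (x, ?y) (0, b))"
    by (rule smooth_compose[OF fin_dim_prod[OF fin_dims(1,3)] smooth_DD[OF D(2,1)] smooth_Pair[OF smooth_ident smooth_const]])
       (use mem in auto)
  then show "smooth_on (snd c ` fst c) (\<lambda>x. fcoord c x b)"
    by (rule smooth_cong[THEN iffD1, rotated]) (simp add: eq)
  assume x: "x \<in> snd c ` fst c"
  have l: "linear (DD \<phi> (x, ?y))" by (rule linear_DD[OF D(2,1) mem[OF x]])
  show "linear (fcoord c x)"
  proof (rule linearI)
    show "fcoord c x (a + b) = fcoord c x a + fcoord c x b" for a b
      unfolding eq[OF x] using linear_add[OF l, of "(0, a)" "(0, b)"] by simp
    show "fcoord c x (r *\<^sub>R b) = r *\<^sub>R fcoord c x b" for r b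
      unfolding eq[OF x] using linear_cmul[OF l, of r "(0, b)"] by simp
  qed
qed

lemma fundamental_coord:
  assumes "a \<in> lie_alg S" "c \<in> charts_at Q q"
  shows "snd (fundamental S a q) c = fcoord c (snd c q) (snd a g0)"
  using assms chart_inv_left[OF manQ] by (simp add: fcoord_def lv charts_at_iff)

subsection \<open>The vertical bundle\<close>

lemma fundamental_vertical:
  assumes a: "a \<in> lie_alg S" and q: "q \<in> pts Q"
  shows "fundamental S a q \<in> vert S q"
proof -
  note sc = smooth_curve_act[OF q L.fatU expcurve(1)[OF a]]
  have "proj_push S (fundamental S a q) = velocity UNIV M (\<lambda>t. \<pi> (act S q (expcurve a t))) 0"
    using smooth_curve_map(2)[OF manQ manM L.fatU smooth_proj sc, of 0] by (simp add: fundamental_eq[OF a] proj_push_def)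
  also have "\<dots> = tzero (\<pi> q)"
    using velocity_const[OF manM proj_in[OF q]] proj_act[OF q expcurve(4)[OF a]] by simp
  finally show ?thesis using fundamental_in[OF a q] by (simp add: vert_def)
qed

lemma vertical_fundamental:
  assumes q: "q \<in> pts Q" and Z: "Z \<in> vert S q"
  obtains a where "a \<in> lie_alg S" "Z = fundamental S a q"
proof -
  have ZT: "Z \<in> tan_space Q q" and Z0: "proj_push S Z = tzero (\<pi> q)" using Z by (auto simp: vert_def)
  obtain U k \<sigma> where U: "\<pi> q \<in> U" and tr: "trivialization U k \<sigma>"
    using trivialization_exists[OF proj_in[OF q]] .
  note t = tr[unfolded trivialization_def]
  have oU: "openin (manifold_topology M) U" using t by blast
  let ?W = "{q \<in> pts Q. \<pi> q \<in> U}"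
  let ?R = "restrict_atlas Q ?W" and ?P = "restrict_atlas M U"
  note oW = openin_preimage[OF oU]
  note mR = man_restrict[OF manQ oW] and mP = man_restrict[OF manM oU]
  have \<sigma>: "smooth_map (prod_atlas ?P G) ?R (\<lambda>(x, g). \<sigma> (x, g))" using t by simp
  obtain \<epsilon> \<gamma> where \<epsilon>: "\<epsilon> > 0" and \<gamma>: "smooth_curve {-\<epsilon><..<\<epsilon>} Q \<gamma>" "\<gamma> 0 = q" "velocity UNIV Q \<gamma> 0 = Z"
    "\<And>t. t \<in> {-\<epsilon><..<\<epsilon>} \<Longrightarrow> \<gamma> t \<in> ?W"
    using curve_with_velocity[OF manQ oW _ ZT] q U by blast
  let ?I = "{-\<epsilon><..<\<epsilon>}"
  have I: "open ?I" "0 \<in> ?I" and fI: "fat ?I" using \<epsilon> by (auto intro: fat_open)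
  have \<gamma>R: "smooth_curve ?I ?R \<gamma>" using curve_restrict[OF manQ oW fI] \<gamma> by blast
  have "smooth_map ?R (prod_atlas ?P G) (\<lambda>q. (\<pi> q, k q))" using t by blast
  from smooth_map_compose[OF mR man_prod[OF mP manG] manG this smooth_map_snd[OF mP manG]]
  have sk: "smooth_map ?R G k" by simp
  have k\<gamma>: "smooth_curve ?I G (\<lambda>t. k (\<gamma> t))" by (rule smooth_curve_map(1)[OF mR manG fI sk \<gamma>R])
  have p\<gamma>: "smooth_curve ?I ?P (\<lambda>t. \<pi> (\<gamma> t))"
    using curve_restrict[OF manM oU fI] smooth_curve_map(1)[OF manQ manM fI smooth_proj \<gamma>(1)] \<gamma>(4) by blast
  have kq: "k q \<in> pts G" and pq: "\<pi> q \<in> pts ?P" using t q U pts_restrict[OF manM oU] by auto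
  have cq: "smooth_curve ?I ?P (\<lambda>_. \<pi> q)" by (rule smooth_curve_const[OF mP fI pq])
  \<comment> \<open>The comparison takes place in the restricted atlas of the base, because that is
    the domain of \<open>\<sigma>\<close>.\<close>
  have vp: "velocity ?I ?P (\<lambda>t. \<pi> (\<gamma> t)) 0 = velocity ?I ?P (\<lambda>_. \<pi> q) 0"
  proof -
    have "velocity ?I M (\<lambda>t. \<pi> (\<gamma> t)) 0 = tzero (\<pi> q)"
      using smooth_curve_map(2)[OF manQ manM fI smooth_proj \<gamma>(1) I(2)] Z0 \<gamma>(3) velocity_open[OF I, of Q \<gamma>]
      by (simp add: proj_push_def)
    then show ?thesis
      using velocity_restrict_eq[OF manM oU fI fI I(2) I(2) p\<gamma> cq] velocity_open[OF I]
        velocity_const[OF manM proj_in[OF q]] by metis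
  qed
  \<comment> \<open>By equivariance of \<open>k\<close>, the motion of the fibre coordinate is a
    right translation of \<open>q\<close> by \<open>\<beta> t\<close>.\<close>
  define \<beta> where "\<beta> t = inv\<^bsub>grp S\<^esub> (k q) \<otimes>\<^bsub>grp S\<^esub> k (\<gamma> t)" for t
  have ikq: "inv\<^bsub>grp S\<^esub> (k q) \<in> pts G" using kq by (simp flip: L.carrier)
  have \<beta>: "smooth_curve ?I G \<beta>"
    unfolding \<beta>_def by (rule L.curve_mult[OF fI smooth_curve_const[OF manG fI ikq] k\<gamma>])
  have kc: "k (\<gamma> t) \<in> carrier (grp S)" if "t \<in> ?I" for t using L.curve_pts[OF k\<gamma> that] .
  have \<beta>0: "\<beta> 0 = e" using \<gamma>(2) kq by (simp add: \<beta>_def flip: L.carrier)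
  have a: "velocity UNIV G \<beta> 0 \<in> lie_alg S"
    using velocity_in[OF manG fI \<beta> I(2)] velocity_open[OF I, of G \<beta>] \<beta>0 by (simp add: lie_alg_def)
  have act: "act S q (\<beta> t) = \<sigma> (\<pi> q, k (\<gamma> t))" if "t \<in> ?I" for t
  proof -
    have \<beta>t: "\<beta> t \<in> pts G" using L.curve_pts[OF \<beta> that] L.carrier by simp
    have "k (act S q (\<beta> t)) = k q \<otimes>\<^bsub>grp S\<^esub> \<beta> t" "\<pi> (act S q (\<beta> t)) = \<pi> q" using t q U \<beta>t by auto
    moreover have "k q \<otimes>\<^bsub>grp S\<^esub> \<beta> t = k (\<gamma> t)"
      using kq kc[OF that] ikq by (simp add: \<beta>_def flip: L.carrier L.m_assoc)
    moreover have "\<sigma> (\<pi> (act S q (\<beta> t)), k (act S q (\<beta> t))) = act S q (\<beta> t)"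
      using t act_in[OF q \<beta>t] U \<open>\<pi> (act S q (\<beta> t)) = \<pi> q\<close> by auto
    ultimately show ?thesis by simp
  qed
  have s1: "smooth_curve ?I ?R (\<lambda>t. \<sigma> (\<pi> (\<gamma> t), k (\<gamma> t)))" and s2: "smooth_curve ?I ?R (\<lambda>t. \<sigma> (\<pi> q, k (\<gamma> t)))"
    using smooth_curve_map2[OF mP manG mR fI \<sigma> p\<gamma> k\<gamma>] smooth_curve_map2[OF mP manG mR fI \<sigma> cq k\<gamma>] by auto
  have "velocity ?I ?R (\<lambda>t. \<sigma> (\<pi> (\<gamma> t), k (\<gamma> t))) 0 = velocity ?I ?R (\<lambda>t. \<sigma> (\<pi> q, k (\<gamma> t))) 0"
    by (rule velocity_map2_eq[OF mP manG mR fI fI I(2) I(2) \<sigma> p\<gamma> k\<gamma> cq k\<gamma> vp refl])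
  then have "velocity ?I Q (\<lambda>t. \<sigma> (\<pi> (\<gamma> t), k (\<gamma> t))) 0 = velocity ?I Q (\<lambda>t. \<sigma> (\<pi> q, k (\<gamma> t))) 0"
    using velocity_restrict_eq[OF manQ oW fI fI I(2) I(2) s1 s2] by blast
  then have "velocity UNIV Q (\<lambda>t. \<sigma> (\<pi> (\<gamma> t), k (\<gamma> t))) 0 = velocity UNIV Q (\<lambda>t. \<sigma> (\<pi> q, k (\<gamma> t))) 0"
    unfolding velocity_open[OF I] .
  moreover have "velocity UNIV Q (\<lambda>t. \<sigma> (\<pi> (\<gamma> t), k (\<gamma> t))) 0 = Z"
  proof -
    have "\<sigma> (\<pi> (\<gamma> s), k (\<gamma> s)) = \<gamma> s" if "s \<in> ?I" for s using t \<gamma>(4)[OF that] by blast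
    then show ?thesis using velocity_cong[OF I, of "\<lambda>t. \<sigma> (\<pi> (\<gamma> t), k (\<gamma> t))" \<gamma> Q] \<gamma>(3) by blast
  qed
  moreover have "velocity UNIV Q (\<lambda>t. \<sigma> (\<pi> q, k (\<gamma> t))) 0 = velocity UNIV Q (\<lambda>t. act S q (\<beta> t)) 0"
    by (rule velocity_cong[OF I]) (simp add: act)
  ultimately have "Z = fundamental S (velocity UNIV G \<beta> 0) q"
    using velocity_act[OF q I \<beta> a refl] by simp
  then show ?thesis using that a by blast
qed

text \<open>Equivariance of \<open>k\<close> recovers \<open>expcurve a\<close> from the orbit of
  \<open>q\<close>. If the orbit has zero velocity, so has the recovered curve.\<close>

lemma fundamental_eq_zero:
  assumes a: "a \<in> lie_alg S" and q: "q \<in> pts Q" and 0: "fundamental S a q = tzero q"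
  shows "a = tzero e"
proof -
  obtain U k \<sigma> where U: "\<pi> q \<in> U" and tr: "trivialization U k \<sigma>"
    using trivialization_exists[OF proj_in[OF q]] .
  note t = tr[unfolded trivialization_def]
  have oU: "openin (manifold_topology M) U" using t by blast
  let ?W = "{q \<in> pts Q. \<pi> q \<in> U}"
  let ?R = "restrict_atlas Q ?W" and ?P = "restrict_atlas M U"
  note oW = openin_preimage[OF oU]
  note mR = man_restrict[OF manQ oW] and mP = man_restrict[OF manM oU]
  have "smooth_map ?R (prod_atlas ?P G) (\<lambda>q. (\<pi> q, k q))" using t by blast
  from smooth_map_compose[OF mR man_prod[OF mP manG] manG this smooth_map_snd[OF mP manG]]
  have sk: "smooth_map ?R G k" by simp
  have kq: "k q \<in> pts G" and qW: "q \<in> ?W" "q \<in> pts ?R" using t q U pts_restrict[OF manQ oW] by auto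
  let ?\<gamma> = "\<lambda>t. act S q (expcurve a t)"
  have \<gamma>R: "smooth_curve UNIV ?R ?\<gamma>"
    using curve_restrict[OF manQ oW L.fatU] smooth_curve_act[OF q L.fatU expcurve(1)[OF a]]
      act_in[OF q expcurve(4)[OF a]] proj_act[OF q expcurve(4)[OF a]] U by auto
  have cR: "smooth_curve UNIV ?R (\<lambda>_. q)" by (rule smooth_curve_const[OF mR L.fatU qW(2)])
  have "velocity UNIV Q ?\<gamma> 0 = velocity UNIV Q (\<lambda>_. q) 0"
    using 0 velocity_const[OF manQ q] by (simp add: fundamental_eq[OF a])
  then have "velocity UNIV ?R ?\<gamma> 0 = velocity UNIV ?R (\<lambda>_. q) 0"
    using velocity_restrict_eq[OF manQ oW L.fatU L.fatU _ _ \<gamma>R cR, of 0 0] by simp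
  then have v: "velocity UNIV G (\<lambda>t. k (?\<gamma> t)) 0 = velocity UNIV G (\<lambda>_. k q) 0"
    using smooth_curve_map(2)[OF mR manG L.fatU sk \<gamma>R, of 0] smooth_curve_map(2)[OF mR manG L.fatU sk cR, of 0] by simp
  have ikq: "inv\<^bsub>grp S\<^esub> (k q) \<in> pts G" using kq by (simp flip: L.carrier)
  note ci = smooth_curve_const[OF manG L.fatU ikq]
  have "velocity UNIV G (\<lambda>t. inv\<^bsub>grp S\<^esub> (k q) \<otimes>\<^bsub>grp S\<^esub> k (?\<gamma> t)) 0 = velocity UNIV G (\<lambda>t. inv\<^bsub>grp S\<^esub> (k q) \<otimes>\<^bsub>grp S\<^esub> k q) 0"
    by (rule L.velocity_mult_eq[OF L.fatU L.fatU _ _ ci smooth_curve_map(1)[OF mR manG L.fatU sk \<gamma>R] ci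
        smooth_curve_map(1)[OF mR manG L.fatU sk cR] refl v]) simp_all
  moreover have "inv\<^bsub>grp S\<^esub> (k q) \<otimes>\<^bsub>grp S\<^esub> k (?\<gamma> t) = expcurve a t" for t
  proof -
    have "k (?\<gamma> t) = k q \<otimes>\<^bsub>grp S\<^esub> expcurve a t" using tr q U expcurve(4)[OF a] unfolding trivialization_def by blast
    then show ?thesis using kq expcurve(4)[OF a] ikq by (simp flip: L.carrier L.m_assoc)
  qed
  ultimately have "a = velocity UNIV G (\<lambda>t. inv\<^bsub>grp S\<^esub> (k q) \<otimes>\<^bsub>grp S\<^esub> k q) 0"
    using expcurve(2)[OF a] by simp
  also have "\<dots> = tzero e" using velocity_const[OF manG L.one_pts] kq by (simp flip: L.carrier)
  finally show ?thesis .
qed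

text \<open>A curve in the base is lifted through \<open>\<sigma>\<close> with the group component
  kept at \<open>k q\<close>.\<close>

lemma proj_push_onto:
  assumes q: "q \<in> pts Q" and X: "X \<in> tan_space M (\<pi> q)"
  obtains Z where "Z \<in> tan_space Q q" "proj_push S Z = X"
proof -
  obtain U k \<sigma> where U: "\<pi> q \<in> U" and tr: "trivialization U k \<sigma>"
    using trivialization_exists[OF proj_in[OF q]] .
  note t = tr[unfolded trivialization_def]
  have oU: "openin (manifold_topology M) U" using t by blast
  let ?W = "{q \<in> pts Q. \<pi> q \<in> U}"
  let ?R = "restrict_atlas Q ?W" and ?P = "restrict_atlas M U"
  note oW = openin_preimage[OF oU]
  note mR = man_restrict[OF manQ oW] and mP = man_restrict[OF manM oU]
  have \<sigma>: "smooth_map (prod_atlas ?P G) ?R (\<lambda>(x, g). \<sigma> (x, g))" using t by simp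
  have kq: "k q \<in> pts G" using t q U by auto
  obtain \<epsilon> \<alpha> where \<epsilon>: "\<epsilon> > 0" and \<alpha>: "smooth_curve {-\<epsilon><..<\<epsilon>} M \<alpha>" "\<alpha> 0 = \<pi> q" "velocity UNIV M \<alpha> 0 = X"
    "\<And>t. t \<in> {-\<epsilon><..<\<epsilon>} \<Longrightarrow> \<alpha> t \<in> U"
    using curve_with_velocity[OF manM oU U X] by metis
  let ?I = "{-\<epsilon><..<\<epsilon>}"
  have I: "open ?I" "0 \<in> ?I" and fI: "fat ?I" using \<epsilon> by (auto intro: fat_open)
  have \<alpha>P: "smooth_curve ?I ?P \<alpha>" using curve_restrict[OF manM oU fI] \<alpha> by blast
  let ?\<gamma> = "\<lambda>t. \<sigma> (\<alpha> t, k q)"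
  have "smooth_curve ?I ?R ?\<gamma>"
    using smooth_curve_map2[OF mP manG mR fI \<sigma> \<alpha>P smooth_curve_const[OF manG fI kq]] by simp
  then have \<gamma>: "smooth_curve ?I Q ?\<gamma>" using curve_restrict[OF manQ oW fI] by blast
  have \<gamma>0: "?\<gamma> 0 = q" using t q U \<alpha>(2) by auto
  have p\<gamma>: "\<pi> (?\<gamma> t) = \<alpha> t" if "t \<in> ?I" for t using tr \<alpha>(4)[OF that] kq unfolding trivialization_def by blast
  have "proj_push S (velocity ?I Q ?\<gamma> 0) = velocity ?I M (\<lambda>t. \<pi> (?\<gamma> t)) 0"
    using smooth_curve_map(2)[OF manQ manM fI smooth_proj \<gamma> I(2)] by (simp add: proj_push_def)
  also have "\<dots> = velocity UNIV M \<alpha> 0"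
    using velocity_open[OF I, of M "\<lambda>t. \<pi> (?\<gamma> t)"] velocity_cong[OF I, of "\<lambda>t. \<pi> (?\<gamma> t)" \<alpha> M] p\<gamma> by simp
  finally have "proj_push S (velocity ?I Q ?\<gamma> 0) = X" using \<alpha>(3) by simp
  moreover have "velocity ?I Q ?\<gamma> 0 \<in> tan_space Q q" using velocity_in[OF manQ fI \<gamma> I(2)] \<gamma>0 by simp
  ultimately show ?thesis using that by blast
qed

end

context chaplygin_system
begin

section \<open>The horizontal distribution\<close>

definition proj_dom :: "('q, 'e) chart \<Rightarrow> ('m, 'f) chart \<Rightarrow> 'e set" where
  "proj_dom c d = snd c ` {q \<in> fst c. \<pi> q \<in> fst d}"

definition pcoord :: "('q, 'e) chart \<Rightarrow> ('m, 'f) chart \<Rightarrow> 'e \<Rightarrow> 'f" where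
  "pcoord c d x = snd d (\<pi> (chart_inv c x))"

lemma pcoord:
  assumes "c \<in> Q" "d \<in> M"
  shows "open (proj_dom c d)" "smooth_on (proj_dom c d) (pcoord c d)" "proj_dom c d \<subseteq> snd c ` fst c"
  using smooth_map_chart[OF smooth_proj assms] by (auto simp: proj_dom_def pcoord_def[abs_def])

lemma proj_dom_mem: "c \<in> charts_at Q q \<Longrightarrow> d \<in> charts_at M (\<pi> q) \<Longrightarrow> snd c q \<in> proj_dom c d"
  by (auto simp: proj_dom_def charts_at_iff)

lemma chart_pts:
  assumes "c \<in> Q" "x \<in> snd c ` fst c"
  shows "chart_inv c x \<in> pts Q" "c \<in> charts_at Q (chart_inv c x)" "snd c (chart_inv c x) = x"
  using chart_inv_mem[OF assms(2)] chart_inv_right[OF assms(2)] assms(1) unfolding charts_at_iff pts_def by blast+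

lemma proj_dom_charts:
  assumes "c \<in> Q" "d \<in> M" "x \<in> proj_dom c d"
  shows "c \<in> charts_at Q (chart_inv c x)" "d \<in> charts_at M (\<pi> (chart_inv c x))" "chart_inv c x \<in> pts Q"
    "snd c (chart_inv c x) = x"
proof -
  obtain q where q: "q \<in> fst c" "\<pi> q \<in> fst d" "x = snd c q" using assms(3) unfolding proj_dom_def by blast
  then have "chart_inv c x = q" using chart_inv_left[OF manQ assms(1)] by simp
  then show "c \<in> charts_at Q (chart_inv c x)" "d \<in> charts_at M (\<pi> (chart_inv c x))" "chart_inv c x \<in> pts Q"
    "snd c (chart_inv c x) = x"
    using q assms unfolding charts_at_iff pts_def by auto
qed

lemma proj_push_coord:
  assumes "Z \<in> tan_space Q q" "c \<in> charts_at Q q" "d \<in> charts_at M (\<pi> q)"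
  shows "snd (proj_push S Z) d = DD (pcoord c d) (snd c q) (snd Z c)"
  unfolding proj_push_def pcoord_def[abs_def]
  by (rule tan_map_coord[OF manQ manM smooth_proj assms])

lemma proj_push_in: "Z \<in> tan_space Q q \<Longrightarrow> q \<in> pts Q \<Longrightarrow> proj_push S Z \<in> tan_space M (\<pi> q)"
  unfolding proj_push_def by (rule tan_map_in[OF manQ manM smooth_proj])

lemma linear_pcoord:
  "c \<in> charts_at Q q \<Longrightarrow> d \<in> charts_at M (\<pi> q) \<Longrightarrow> linear (DD (pcoord c d) (snd c q))"
  using linear_DD[OF pcoord(2,1) proj_dom_mem] by (simp add: charts_at_iff)

lemma proj_push_tdiff:
  assumes q: "q \<in> pts Q" and Z: "Z \<in> tan_space Q q" and W: "W \<in> tan_space Q q"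
  shows "proj_push S (tdiff Z W) = tdiff (proj_push S Z) (proj_push S W)"
proof -
  obtain c where c: "c \<in> charts_at Q q" using q pts_iff by metis
  obtain d where d: "d \<in> charts_at M (\<pi> q)" using proj_in[OF q] pts_iff by metis
  have ZW: "tdiff Z W \<in> tan_space Q q" by (rule tdiff_in[OF manQ Z W])
  show ?thesis
  proof (rule tan_space_eqI[OF proj_push_in[OF ZW q] tdiff_in[OF manM proj_push_in[OF Z q] proj_push_in[OF W q]] d])
    show "snd (proj_push S (tdiff Z W)) d = snd (tdiff (proj_push S Z) (proj_push S W)) d"
      using proj_push_coord[OF ZW c d] proj_push_coord[OF Z c d] proj_push_coord[OF W c d]
      by (simp add: linear_diff[OF linear_pcoord[OF c d]])
  qed
qed

lemma tdiff_self: "tdiff Z Z = tzero (fst Z)"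
  by (rule prod_eqI) (auto simp: fun_eq_iff)

lemma tadd_zero: "fst Z = p \<Longrightarrow> tadd Z (tzero p) = Z"
  by (rule prod_eqI) (auto simp: fun_eq_iff)

lemma tdiff_zero: "fst Z = p \<Longrightarrow> tdiff Z (tzero p) = Z"
  by (rule prod_eqI) (auto simp: fun_eq_iff)

section \<open>Horizontal spaces and the connection form\<close>

lemma hor_vert:
  assumes "q \<in> pts Q"
  shows "hor S q \<inter> vert S q = {tzero q}" "tan_space Q q = {tadd Y V | Y V. Y \<in> hor S q \<and> V \<in> vert S q}"
  using hd assms unfolding horizontal_distribution_def by blast+

lemma frame:
  assumes "q \<in> pts Q"
  obtains W k and X :: "nat \<Rightarrow> 'q \<Rightarrow> ('q, 'e) tvec" where "openin (manifold_topology Q) W" "q \<in> W"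
    "\<forall>i<k. vector_field_on Q W (X i)" "\<forall>p\<in>W. hor S p = {(p, \<lambda>c. \<Sum>i<k. r i *\<^sub>R snd (X i p) c) | r. True}"
    "\<forall>p\<in>W. \<forall>r. (\<forall>c. (\<Sum>i<k. r i *\<^sub>R snd (X i p) c) = 0) \<longrightarrow> (\<forall>i<k. r i = 0)"
proof -
  obtain W k and X :: "nat \<Rightarrow> 'q \<Rightarrow> ('q, 'e) tvec" where W: "openin (manifold_topology Q) W" "q \<in> W"
    "\<forall>i<k. vector_field_on Q W (X i)" and
    h: "\<forall>p\<in>W. hor S p = {(p, \<lambda>c. \<Sum>i<k. r i *\<^sub>R snd (X i p) c) | r. True} \<and>
          (\<forall>r. (\<forall>c. (\<Sum>i<k. r i *\<^sub>R snd (X i p) c) = 0) \<longrightarrow> (\<forall>i<k. r i = 0))"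
    using hd assms unfolding horizontal_distribution_def smooth_distribution_def by blast
  show ?thesis by (rule that[of W k X, OF W]) (use h in blast)+
qed

lemma hor_span:
  assumes q: "q \<in> pts Q"
  obtains k and X :: "nat \<Rightarrow> 'q \<Rightarrow> ('q, 'e) tvec"
  where "hor S q = {(q, \<lambda>c. \<Sum>i<k. r i *\<^sub>R snd (X i q) c) | r. True}"
proof -
  obtain W k and X :: "nat \<Rightarrow> 'q \<Rightarrow> ('q, 'e) tvec" where "q \<in> W"
    "\<forall>p\<in>W. hor S p = {(p, \<lambda>c. \<Sum>i<k. r i *\<^sub>R snd (X i p) c) | r. True}"
    by (rule frame[OF q])
  then show ?thesis using that by blast
qed

lemma hor_fst: "q \<in> pts Q \<Longrightarrow> Z \<in> hor S q \<Longrightarrow> fst Z = q"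
proof -
  assume q: "q \<in> pts Q" and Z: "Z \<in> hor S q"
  obtain k and X :: "nat \<Rightarrow> 'q \<Rightarrow> ('q, 'e) tvec" where h: "hor S q = {(q, \<lambda>c. \<Sum>i<k. r i *\<^sub>R snd (X i q) c) | r. True}"
    using hor_span[OF q] .
  show ?thesis using Z unfolding h by auto
qed

text \<open>The inclusion is read off from the direct sum by taking the vertical summand to be
  zero.\<close>

lemma hor_tan: "q \<in> pts Q \<Longrightarrow> Z \<in> hor S q \<Longrightarrow> Z \<in> tan_space Q q"
proof -
  assume q: "q \<in> pts Q" and Z: "Z \<in> hor S q"
  have "tzero q \<in> vert S q" using hor_vert(1)[OF q] by blast
  then have "tadd Z (tzero q) \<in> tan_space Q q" using hor_vert(2)[OF q] Z by blast
  then show ?thesis using tadd_zero[OF hor_fst[OF q Z]] by simp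
qed

lemma hor_tdiff:
  assumes q: "q \<in> pts Q" and Z: "Z \<in> hor S q" and Y: "Y \<in> hor S q"
  shows "tdiff Z Y \<in> hor S q"
proof -
  obtain k and X :: "nat \<Rightarrow> 'q \<Rightarrow> ('q, 'e) tvec" where h: "hor S q = {(q, \<lambda>c. \<Sum>i<k. r i *\<^sub>R snd (X i q) c) | r. True}"
    using hor_span[OF q] .
  obtain r s where "Z = (q, \<lambda>c. \<Sum>i<k. r i *\<^sub>R snd (X i q) c)" "Y = (q, \<lambda>c. \<Sum>i<k. s i *\<^sub>R snd (X i q) c)"
    using Z Y h by auto
  then have "tdiff Z Y = (q, \<lambda>c. \<Sum>i<k. (r i - s i) *\<^sub>R snd (X i q) c)"
    by (intro prod_eqI ext) (auto simp: scaleR_diff_left sum_subtractf)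
  then show ?thesis unfolding h by (intro CollectI exI[of _ "\<lambda>i. r i - s i"]) simp
qed

lemma lie_alg_tdiff: "a \<in> lie_alg S \<Longrightarrow> b \<in> lie_alg S \<Longrightarrow> tdiff a b \<in> lie_alg S"
  unfolding lie_alg_def by (rule tdiff_in[OF manG])

lemma lie_alg_tzero: "tzero e \<in> lie_alg S"
  unfolding lie_alg_def by (rule tzero_in[OF manG])

lemma linear_fcoord: "c \<in> charts_at Q q \<Longrightarrow> linear (fcoord c (snd c q))"
  using fcoord(2)[of c "snd c q"] by (simp add: charts_at_iff)

lemma fundamental_tdiff:
  assumes q: "q \<in> pts Q" and a: "a \<in> lie_alg S" "b \<in> lie_alg S"
  shows "fundamental S (tdiff a b) q = tdiff (fundamental S a q) (fundamental S b q)"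
proof -
  obtain c where c: "c \<in> charts_at Q q" using q pts_iff by metis
  show ?thesis
    by (rule tan_space_eqI[OF fundamental_in[OF lie_alg_tdiff[OF a] q]
          tdiff_in[OF manQ fundamental_in[OF a(1) q] fundamental_in[OF a(2) q]] c])
       (simp add: fundamental_coord[OF _ c] a lie_alg_tdiff linear_diff[OF linear_fcoord[OF c]])
qed

lemma fundamental_tzero: "q \<in> pts Q \<Longrightarrow> fundamental S (tzero e) q = tzero q"
proof -
  assume q: "q \<in> pts Q"
  have "fundamental S (tdiff (tzero e) (tzero e)) q = tzero q"
    using fundamental_tdiff[OF q lie_alg_tzero lie_alg_tzero] tdiff_self
      tan_space_fst[OF fundamental_in[OF lie_alg_tzero q]] by metis
  then show ?thesis by (simp add: tdiff_self)
qed

text \<open>Two candidates differ by an element whose fundamental vector is both horizontal and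
  vertical.\<close>

lemma omega_unique:
  assumes q: "q \<in> pts Q" and Z: "Z \<in> tan_space Q q" and a: "a \<in> lie_alg S" "b \<in> lie_alg S"
    and h: "tdiff Z (fundamental S a q) \<in> hor S q" "tdiff Z (fundamental S b q) \<in> hor S q"
  shows "a = b"
proof -
  let ?F = "fundamental S (tdiff a b) q"
  have "tdiff (tdiff Z (fundamental S b q)) (tdiff Z (fundamental S a q)) = ?F"
    using tan_space_fst[OF Z] tan_space_fst[OF fundamental_in[OF a(1) q]]
    unfolding fundamental_tdiff[OF q a] by (intro prod_eqI ext) auto
  then have "?F \<in> hor S q" using hor_tdiff[OF q h(2,1)] by simp
  then have "?F = tzero q"
    using fundamental_vertical[OF lie_alg_tdiff[OF a] q] hor_vert(1)[OF q] by blast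
  then have "tdiff a b = tzero e" by (rule fundamental_eq_zero[OF lie_alg_tdiff[OF a] q])
  then have "snd a g0 - snd b g0 = 0" using tcoord_simps(4)[of a b g0] by simp
  then show ?thesis using lie_alg_eqI[OF a] by simp
qed

lemma omega:
  assumes q: "q \<in> pts Q" and Z: "Z \<in> tan_space Q q"
  shows "omega S Z \<in> lie_alg S" "tdiff Z (fundamental S (omega S Z) q) \<in> hor S q"
proof -
  obtain Y V where Y: "Z = tadd Y V" "Y \<in> hor S q" "V \<in> vert S q" using hor_vert(2)[OF q] Z by blast
  obtain a where a: "a \<in> lie_alg S" "V = fundamental S a q" using vertical_fundamental[OF q Y(3)] .
  have "tdiff Z V = Y" unfolding Y(1) by (intro prod_eqI ext) auto
  then have "a \<in> lie_alg S \<and> tdiff Z (fundamental S a (fst Z)) \<in> hor S (fst Z)"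
    using a Y(2) tan_space_fst[OF Z] by simp
  then have "omega S Z \<in> lie_alg S \<and> tdiff Z (fundamental S (omega S Z) (fst Z)) \<in> hor S (fst Z)"
    unfolding omega_def by (rule theI) (use omega_unique[OF q Z] tan_space_fst[OF Z] a Y \<open>tdiff Z V = Y\<close> in auto)
  then show "omega S Z \<in> lie_alg S" "tdiff Z (fundamental S (omega S Z) q) \<in> hor S q"
    using tan_space_fst[OF Z] by auto
qed

lemma omega_eqI:
  "q \<in> pts Q \<Longrightarrow> Z \<in> tan_space Q q \<Longrightarrow> a \<in> lie_alg S \<Longrightarrow> tdiff Z (fundamental S a q) \<in> hor S q \<Longrightarrow> omega S Z = a"
  using omega_unique omega by blast

lemma omega_fundamental:
  assumes "q \<in> pts Q" "a \<in> lie_alg S" shows "omega S (fundamental S a q) = a"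
proof -
  have "tdiff (fundamental S a q) (fundamental S a q) \<in> hor S q"
    unfolding tdiff_self tan_space_fst[OF fundamental_in[OF assms(2,1)]] using hor_vert(1)[OF assms(1)] by blast
  then show ?thesis by (rule omega_eqI[OF assms(1) fundamental_in[OF assms(2,1)] assms(2)])
qed

lemma omega_zero_iff:
  assumes "q \<in> pts Q" "Z \<in> tan_space Q q" shows "omega S Z = tzero e \<longleftrightarrow> Z \<in> hor S q"
proof -
  have *: "tdiff Z (fundamental S (tzero e) q) = Z"
    using tdiff_zero[OF tan_space_fst[OF assms(2)]] fundamental_tzero[OF assms(1)] by simp
  show ?thesis using omega_eqI[OF assms lie_alg_tzero] omega(2)[OF assms] unfolding * by (metis *)
qed

section \<open>The connection form in coordinates\<close>

definition wcoord :: "('q, 'e) chart \<Rightarrow> 'e \<Rightarrow> 'e \<Rightarrow> 'h" where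
  "wcoord c x v = snd (omega S (tvec Q c (chart_inv c x) v)) g0"

lemma omega_coord:
  assumes "Z \<in> tan_space Q q" "c \<in> charts_at Q q"
  shows "snd (omega S Z) g0 = wcoord c (snd c q) (snd Z c)"
proof -
  have "chart_inv c (snd c q) = q" using chart_inv_left[OF manQ] assms(2) by (simp add: charts_at_iff)
  then show ?thesis using tvec_collapse[OF manQ assms] by (simp add: wcoord_def)
qed

lemma hor_iff_wcoord:
  assumes "Z \<in> tan_space Q q" "c \<in> charts_at Q q"
  shows "Z \<in> hor S q \<longleftrightarrow> wcoord c (snd c q) (snd Z c) = 0"
proof -
  have q: "q \<in> pts Q" using assms(2) pts_iff by metis
  have "omega S Z = tzero e \<longleftrightarrow> snd (omega S Z) g0 = 0"
    using lie_alg_eqI[OF omega(1)[OF q assms(1)] lie_alg_tzero] by auto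
  then show ?thesis using omega_zero_iff[OF q assms(1)] omega_coord[OF assms] by simp
qed

lemma wcoord_eqI:
  assumes c: "c \<in> Q" and x: "x \<in> snd c ` fst c"
    and h: "tvec Q c (chart_inv c x) (v - fcoord c x b) \<in> hor S (chart_inv c x)"
  shows "wcoord c x v = b"
proof -
  let ?q = "chart_inv c x"
  note q = chart_pts[OF c x]
  have Z: "tvec Q c ?q v \<in> tan_space Q ?q" by (rule tvec_in[OF manQ q(2)])
  have "tdiff (tvec Q c ?q v) (fundamental S (lv b) ?q) = tvec Q c ?q (v - fcoord c x b)"
    by (rule tan_space_eqI[OF tdiff_in[OF manQ Z fundamental_in[OF lv(1) q(1)]] tvec_in[OF manQ q(2)] q(2)])
       (simp add: tvec_coord[OF manQ q(2)] fundamental_coord[OF lv(1) q(2)] lv q(3))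
  then have "omega S (tvec Q c ?q v) = lv b" using omega_eqI[OF q(1) Z lv(1)] h by simp
  then show ?thesis by (simp add: wcoord_def lv)
qed

lemma wcoord_hor:
  assumes c: "c \<in> Q" and x: "x \<in> snd c ` fst c"
  shows "tvec Q c (chart_inv c x) (v - fcoord c x (wcoord c x v)) \<in> hor S (chart_inv c x)"
proof -
  let ?q = "chart_inv c x"
  note q = chart_pts[OF c x]
  have Z: "tvec Q c ?q v \<in> tan_space Q ?q" by (rule tvec_in[OF manQ q(2)])
  note o = omega[OF q(1) Z]
  have "tdiff (tvec Q c ?q v) (fundamental S (omega S (tvec Q c ?q v)) ?q) = tvec Q c ?q (v - fcoord c x (wcoord c x v))"
    by (rule tan_space_eqI[OF tdiff_in[OF manQ Z fundamental_in[OF o(1) q(1)]] tvec_in[OF manQ q(2)] q(2)])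
       (simp add: tvec_coord[OF manQ q(2)] fundamental_coord[OF o(1) q(2)] wcoord_def q(3))
  then show ?thesis using o(2) by simp
qed

text \<open>In the local frame at \<open>x\<close>, completed by the fundamental vectors,
  \<open>T x\<close> rebuilds a vector from its components at \<open>x0\<close>. Its inverse
  \<open>R x\<close> is a smooth family and satisfies
  \<open>wcoord c x0 (R x w) = wcoord c x w\<close>; at the fixed point \<open>x0\<close> the form
  is a single linear map.\<close>

lemma wcoord_local:
  assumes c: "c \<in> Q" and x0: "x0 \<in> snd c ` fst c"
  obtains V where "open V" "x0 \<in> V" "V \<subseteq> snd c ` fst c" "\<And>w. smooth_on V (\<lambda>x. wcoord c x w)"
    "\<And>x. x \<in> V \<Longrightarrow> linear (wcoord c x)"
proof -
  note q0 = chart_pts[OF c x0]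
  obtain W k and X :: "nat \<Rightarrow> 'q \<Rightarrow> ('q, 'e) tvec" where W: "openin (manifold_topology Q) W" "chart_inv c x0 \<in> W"
    and X: "\<forall>i<k. vector_field_on Q W (X i)"
    and h': "\<forall>p\<in>W. hor S p = {(p, \<lambda>c. \<Sum>i<k. r i *\<^sub>R snd (X i p) c) | r. True}"
    and ind': "\<forall>p\<in>W. \<forall>r. (\<forall>c. (\<Sum>i<k. r i *\<^sub>R snd (X i p) c) = 0) \<longrightarrow> (\<forall>i<k. r i = 0)"
    by (rule frame[OF q0(1)])
  note h = bspec[OF h']
  have ind: "r i = 0" if "p \<in> W" "\<And>c. (\<Sum>i<k. r i *\<^sub>R snd (X i p) c) = 0" "i < k" for p r i
    using ind' that by blast
  let ?V = "snd c ` (W \<inter> fst c)"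
  have oV: "open ?V"
    using open_restrict_chart[OF manQ W(1) c] by (simp add: Int_commute)
  have xV: "x0 \<in> ?V" using W(2) q0 by (intro image_eqI[of _ _ "chart_inv c x0"]) (auto simp: charts_at_iff)
  have VW: "chart_inv c x \<in> W" "x \<in> snd c ` fst c" if x: "x \<in> ?V" for x
    using x chart_inv_left[OF manQ c] by auto
  define Y where "Y i x = snd (X i (chart_inv c x)) c" for i x
  have sY: "smooth_on ?V (Y i)" if "i < k" for i
    unfolding Y_def[abs_def] by (rule vector_field_on_chart(2)[OF manQ W(1) X[rule_format, OF that] c])
  have YH: "tvec Q c (chart_inv c x) (\<Sum>i<k. r i *\<^sub>R Y i x) \<in> hor S (chart_inv c x)"
    "tvec Q c (chart_inv c x) (\<Sum>i<k. r i *\<^sub>R Y i x) = (chart_inv c x, \<lambda>c'. \<Sum>i<k. r i *\<^sub>R snd (X i (chart_inv c x)) c')"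
    if x: "x \<in> ?V" for x r
  proof -
    note q = chart_pts[OF c VW(2)[OF x]]
    have H: "(chart_inv c x, \<lambda>c'. \<Sum>i<k. r i *\<^sub>R snd (X i (chart_inv c x)) c') \<in> hor S (chart_inv c x)"
      unfolding h[OF VW(1)[OF x]] by (intro CollectI exI[of _ r]) simp
    show "tvec Q c (chart_inv c x) (\<Sum>i<k. r i *\<^sub>R Y i x) = (chart_inv c x, \<lambda>c'. \<Sum>i<k. r i *\<^sub>R snd (X i (chart_inv c x)) c')"
      by (rule tan_space_eqI[OF tvec_in[OF manQ q(2)] hor_tan[OF q(1) H] q(2)])
         (simp add: tvec_coord[OF manQ q(2)] Y_def)
    then show "tvec Q c (chart_inv c x) (\<Sum>i<k. r i *\<^sub>R Y i x) \<in> hor S (chart_inv c x)" using H by simp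
  qed
  have "\<exists>r. w - fcoord c x (wcoord c x w) = (\<Sum>i<k. r i *\<^sub>R Y i x)" if x: "x \<in> ?V" for x w
  proof -
    note q = chart_pts[OF c VW(2)[OF x]]
    obtain r where "tvec Q c (chart_inv c x) (w - fcoord c x (wcoord c x w))
        = (chart_inv c x, \<lambda>c'. \<Sum>i<k. r i *\<^sub>R snd (X i (chart_inv c x)) c')"
      using wcoord_hor[OF c VW(2)[OF x], of w] unfolding h[OF VW(1)[OF x]] by blast
    then have "snd (tvec Q c (chart_inv c x) (w - fcoord c x (wcoord c x w))) c = (\<Sum>i<k. r i *\<^sub>R Y i x)"
      by (simp add: Y_def)
    then show ?thesis by (auto simp: tvec_coord[OF manQ q(2)])
  qed
  then have "\<exists>r. x \<in> ?V \<longrightarrow> w - fcoord c x (wcoord c x w) = (\<Sum>i<k. r i *\<^sub>R Y i x)" for x w by blast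
  then obtain r where r: "\<And>x w. x \<in> ?V \<Longrightarrow> w - fcoord c x (wcoord c x w) = (\<Sum>i<k. r x w i *\<^sub>R Y i x)" by metis
  have dec: "w = (\<Sum>i<k. r x w i *\<^sub>R Y i x) + fcoord c x (wcoord c x w)" if "x \<in> ?V" for x w
    using r[OF that, of w] by (simp add: algebra_simps)
  \<comment> \<open>The vertical component is determined by the uniqueness of \<open>omega\<close>,
    the others by the independence of the frame.\<close>
  have uniq: "wcoord c x w = b" "i < k \<Longrightarrow> r x w i = s i"
    if x: "x \<in> ?V" and w: "w = (\<Sum>i<k. s i *\<^sub>R Y i x) + fcoord c x b" for x w s b i
  proof -
    show 1: "wcoord c x w = b"
      using YH(1)[OF x, of s] w by (intro wcoord_eqI[OF c VW(2)[OF x]]) simp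
    have z: "(\<Sum>i<k. (r x w i - s i) *\<^sub>R Y i x) = 0"
      using dec[OF x, of w] w 1 by (simp add: scaleR_diff_left sum_subtractf)
    \<comment> \<open>Independence of the frame is stated over all charts at once, so the vanishing
      in the chart \<open>c\<close> is first turned into the vanishing of a tangent vector.\<close>
    have "tvec Q c (chart_inv c x) 0 = tzero (chart_inv c x)"
      using tvec_zero[OF manQ chart_pts(2)[OF c VW(2)[OF x]]] .
    then have "(\<Sum>i<k. (r x w i - s i) *\<^sub>R snd (X i (chart_inv c x)) c') = 0" for c'
      using arg_cong[OF YH(2)[OF x, of "\<lambda>i. r x w i - s i"], of "\<lambda>Z. snd Z c'"] unfolding z by simp
    then show "r x w i = s i" if "i < k"
      using ind[OF VW(1)[OF x], where r = "\<lambda>i. r x w i - s i", OF _ that] by simp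
  qed
  have lin: "linear (wcoord c x)" "linear (\<lambda>w. r x w i)" if x: "x \<in> ?V" and i: "i < k" for x i
  proof -
    note lf = fcoord(2)[OF c VW(2)[OF x]]
    have a: "v + w = (\<Sum>i<k. (r x v i + r x w i) *\<^sub>R Y i x) + fcoord c x (wcoord c x v + wcoord c x w)" for v w
      using dec[OF x, of v] dec[OF x, of w]
      by (simp add: linear_add[OF lf] scaleR_add_left sum.distrib) (metis (no_types, lifting) add.assoc add.left_commute)
    have s: "t *\<^sub>R w = (\<Sum>i<k. (t * r x w i) *\<^sub>R Y i x) + fcoord c x (t *\<^sub>R wcoord c x w)" for t w
    proof -
      have "t *\<^sub>R w = t *\<^sub>R ((\<Sum>i<k. r x w i *\<^sub>R Y i x) + fcoord c x (wcoord c x w))" using dec[OF x, of w] by simp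
      then show ?thesis by (simp add: linear_cmul[OF lf] scaleR_add_right scaleR_sum_right)
    qed
    show "linear (wcoord c x)" by (rule linearI) (simp_all add: uniq(1)[OF x a] uniq(1)[OF x s])
    show "linear (\<lambda>w. r x w i)" by (rule linearI) (simp_all add: uniq(2)[OF x a i] uniq(2)[OF x s i])
  qed
  have linw: "linear (wcoord c x)" if x: "x \<in> ?V" for x
  \<comment> \<open>\<open>lin\<close> asks for an index below \<open>k\<close>, so a distribution
    of rank zero is treated separately.\<close>
  proof (cases "k = 0")
    case False
    then show ?thesis using lin(1)[OF x, of 0] by simp
  next
    case True
    note lf = fcoord(2)[OF c VW(2)[OF x]]
    have d: "w = fcoord c x (wcoord c x w)" for w using dec[OF x, of w] True by simp
    show ?thesis
    proof (rule linearI)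
      show "wcoord c x (v + w) = wcoord c x v + wcoord c x w" for v w
        using uniq(1)[OF x, of "v + w" "\<lambda>_. 0" "wcoord c x v + wcoord c x w"] True d[of v] d[of w]
        by (simp add: linear_add[OF lf])
      show "wcoord c x (t *\<^sub>R w) = t *\<^sub>R wcoord c x w" for t w
        using uniq(1)[OF x, of "t *\<^sub>R w" "\<lambda>_. 0" "t *\<^sub>R wcoord c x w"] True d[of w]
        by (simp add: linear_cmul[OF lf])
    qed
  qed
  define T where "T x w = (\<Sum>i<k. r x0 w i *\<^sub>R Y i x) + fcoord c x (wcoord c x0 w)" for x w
  define R where "R x w = (\<Sum>i<k. r x w i *\<^sub>R Y i x0) + fcoord c x0 (wcoord c x w)" for x w
  have R0: "wcoord c x0 (R x w) = wcoord c x w" "i < k \<Longrightarrow> r x0 (R x w) i = r x w i" for x w i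
    using uniq[OF xV, of "R x w" "r x w" "wcoord c x w"] by (simp_all add: R_def)
  have "smooth_on ?V (\<lambda>x. R x w)" for w
  proof (rule smooth_inverse_family[OF fin_dims(1) fin_dims(1) oV])
    show "smooth_on ?V (\<lambda>x. T x v)" for v
      unfolding T_def
      by (intro smooth_add smooth_sum smooth_scaleR smooth_const smooth_subset[OF fcoord(1)[OF c]])
         (use sY VW(2) in auto)
    show "linear (T x)" if x: "x \<in> ?V" for x
    proof (rule linearI)
      note lf = fcoord(2)[OF c VW(2)[OF x]]
      show "T x (v + w) = T x v + T x w" for v w
        by (simp add: T_def linear_add[OF linw[OF xV]] linear_add[OF lf] linear_add[OF lin(2)[OF xV]]
            scaleR_add_left sum.distrib)
      show "T x (t *\<^sub>R w) = t *\<^sub>R T x w" for t w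
        by (simp add: T_def linear_cmul[OF linw[OF xV]] linear_cmul[OF lf] linear_cmul[OF lin(2)[OF xV]]
            scaleR_add_right scaleR_sum_right)
    qed
    show "R x (T x v) = v" if x: "x \<in> ?V" for x v
      using uniq[OF x, of "T x v" "r x0 v" "wcoord c x0 v"] dec[OF xV, of v] by (simp add: T_def R_def)
    show "T x (R x w) = w" if x: "x \<in> ?V" for x w
      using dec[OF x, of w] by (simp add: T_def R0)
  qed
  then have "smooth_on ?V (\<lambda>x. wcoord c x0 (R x w))" for w
    by (rule smooth_compose_linear[OF fin_dim_bounded_linear[OF fin_dims(1) linw[OF xV]]])
  then have "smooth_on ?V (\<lambda>x. wcoord c x w)" for w by (simp add: R0)
  then show ?thesis using that[of ?V] oV xV VW(2) linw by blast
qed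

lemma wcoord:
  assumes c: "c \<in> Q"
  shows "smooth_on (snd c ` fst c) (\<lambda>x. wcoord c x w)" and "x \<in> snd c ` fst c \<Longrightarrow> linear (wcoord c x)"
proof -
  show "smooth_on (snd c ` fst c) (\<lambda>x. wcoord c x w)"
  proof (rule smooth_local[OF fat_open[OF open_chart[OF manQ c]]])
    fix x assume "x \<in> snd c ` fst c"
    from wcoord_local[OF c this] obtain V where "open V" "x \<in> V" "smooth_on V (\<lambda>x. wcoord c x w)" by metis
    then show "\<exists>V. open V \<and> x \<in> V \<and> smooth_on (snd c ` fst c \<inter> V) (\<lambda>x. wcoord c x w)"
      using smooth_subset[of V _ "snd c ` fst c \<inter> V"] by blast
  qed
  show "linear (wcoord c x)" if "x \<in> snd c ` fst c" using wcoord_local[OF c that] by metis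
qed

lemma wcoord_fcoord: "c \<in> Q \<Longrightarrow> x \<in> snd c ` fst c \<Longrightarrow> wcoord c x (fcoord c x b) = b"
  using omega_fundamental[OF chart_pts(1) lv(1)] omega_coord[OF fundamental_in[OF lv(1) chart_pts(1)] chart_pts(2)]
  by (simp add: fundamental_coord[OF lv(1) chart_pts(2)] chart_pts(3) lv)

subsection \<open>Horizontal lifts\<close>

text \<open>For existence the vertical part is removed from any vector over \<open>X\<close>; for
  uniqueness, the difference of two lifts is both horizontal and vertical.\<close>

lemma hlift:
  assumes q: "q \<in> pts Q" and X: "X \<in> tan_space M (\<pi> q)"
  shows "hlift S X q \<in> hor S q" "proj_push S (hlift S X q) = X"
proof -
  obtain Z where Z: "Z \<in> tan_space Q q" "proj_push S Z = X" using proj_push_onto[OF q X] .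
  let ?F = "fundamental S (omega S Z) q"
  have F: "?F \<in> tan_space Q q" "proj_push S ?F = tzero (\<pi> q)"
    using fundamental_vertical[OF omega(1)[OF q Z(1)] q] by (auto simp: vert_def)
  have Y: "tdiff Z ?F \<in> hor S q" by (rule omega(2)[OF q Z(1)])
  have "proj_push S (tdiff Z ?F) = X"
    using proj_push_tdiff[OF q Z(1) F(1)] F(2) Z(2) tdiff_zero[OF tan_space_fst[OF X]] by simp
  with Y have "hlift S X q \<in> hor S q \<and> proj_push S (hlift S X q) = X"
    unfolding hlift_def
  proof (intro theI[of "\<lambda>Z. Z \<in> hor S q \<and> proj_push S Z = X" "tdiff Z ?F"])
    fix Y' assume Y': "Y' \<in> hor S q \<and> proj_push S Y' = X"
    let ?D = "tdiff Y' (tdiff Z ?F)"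
    have D: "?D \<in> hor S q" using hor_tdiff[OF q] Y' Y by blast
    have "proj_push S ?D = tzero (\<pi> q)"
      using proj_push_tdiff[OF q hor_tan[OF q] hor_tan[OF q Y], of Y'] Y' \<open>proj_push S (tdiff Z ?F) = X\<close>
        tdiff_self[of X] tan_space_fst[OF X] by simp
    then have "?D = tzero q" using D hor_tan[OF q D] hor_vert(1)[OF q] unfolding vert_def by blast
    then have "snd Y' c = snd (tdiff Z ?F) c" for c using tcoord_simps(4)[of Y' "tdiff Z ?F" c] by simp
    moreover have "fst Y' = q" "fst (tdiff Z ?F) = q" using hor_fst[OF q] Y' Y by blast+
    ultimately show "Y' = tdiff Z ?F" by (intro prod_eqI ext) simp_all
  qed auto
  then show "hlift S X q \<in> hor S q" "proj_push S (hlift S X q) = X" by auto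
qed

lemma hlift_eqI:
  assumes q: "q \<in> pts Q" and Z: "Z \<in> hor S q"
  shows "hlift S (proj_push S Z) q = Z"
proof -
  have X: "proj_push S Z \<in> tan_space M (\<pi> q)" by (rule proj_push_in[OF hor_tan[OF q Z] q])
  let ?H = "hlift S (proj_push S Z) q"
  let ?D = "tdiff ?H Z"
  have D: "?D \<in> hor S q" by (rule hor_tdiff[OF q hlift(1)[OF q X] Z])
  have "proj_push S ?D = tzero (\<pi> q)"
    using proj_push_tdiff[OF q hor_tan[OF q hlift(1)[OF q X]] hor_tan[OF q Z]] hlift(2)[OF q X]
      tdiff_self[of "proj_push S Z"] tan_space_fst[OF X] by simp
  then have "?D = tzero q" using D hor_tan[OF q D] hor_vert(1)[OF q] unfolding vert_def by blast
  then have "snd ?H c = snd Z c" for c using tcoord_simps(4)[of ?H Z c] by simp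
  then show ?thesis using hor_fst[OF q Z] hor_fst[OF q hlift(1)[OF q X]] by (intro prod_eqI ext) auto
qed

definition hcoord :: "('q, 'e) chart \<Rightarrow> ('m, 'f) chart \<Rightarrow> 'e \<Rightarrow> 'f \<Rightarrow> 'e" where
  "hcoord c d x y = snd (hlift S (tvec M d (\<pi> (chart_inv c x)) y) (chart_inv c x)) c"

lemma hlift_coord:
  assumes "X \<in> tan_space M (\<pi> q)" "c \<in> charts_at Q q" "d \<in> charts_at M (\<pi> q)"
  shows "snd (hlift S X q) c = hcoord c d (snd c q) (snd X d)"
proof -
  have "chart_inv c (snd c q) = q" using chart_inv_left[OF manQ] assms(2) by (simp add: charts_at_iff)
  then show ?thesis using tvec_collapse[OF manM assms(1,3)] by (simp add: hcoord_def)
qed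

context
  fixes c :: "('q, 'e) chart" and d :: "('m, 'f) chart"
  assumes c: "c \<in> Q" and d: "d \<in> M"
begin

lemma proj_dom_img: "x \<in> proj_dom c d \<Longrightarrow> x \<in> snd c ` fst c"
  using pcoord(3)[OF c d] by blast

lemma pcoord_hcoord:
  assumes x: "x \<in> proj_dom c d"
  shows "DD (pcoord c d) x (hcoord c d x y) = y" "wcoord c x (hcoord c d x y) = 0"
proof -
  let ?q = "chart_inv c x"
  note q = proj_dom_charts[OF c d x]
  have X: "tvec M d (\<pi> ?q) y \<in> tan_space M (\<pi> ?q)" by (rule tvec_in[OF manM q(2)])
  note h = hlift[OF q(3) X]
  note ht = hor_tan[OF q(3) h(1)]
  have hc: "snd (hlift S (tvec M d (\<pi> ?q) y) ?q) c = hcoord c d x y" by (simp add: hcoord_def)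
  show "DD (pcoord c d) x (hcoord c d x y) = y"
    using proj_push_coord[OF ht q(1,2)] h(2) tvec_coord[OF manM q(2)] by (simp add: q(4) hc)
  show "wcoord c x (hcoord c d x y) = 0"
    using hor_iff_wcoord[OF ht q(1)] h(1) by (simp add: q(4) hc)
qed

lemma pcoord_fcoord:
  assumes x: "x \<in> proj_dom c d"
  shows "DD (pcoord c d) x (fcoord c x b) = 0"
proof -
  let ?q = "chart_inv c x"
  note q = proj_dom_charts[OF c d x]
  have "fundamental S (lv b) ?q \<in> tan_space Q ?q" "proj_push S (fundamental S (lv b) ?q) = tzero (\<pi> ?q)"
    using fundamental_vertical[OF lv(1) q(3)] by (auto simp: vert_def)
  then show ?thesis
    using proj_push_coord[OF _ q(1,2), of "fundamental S (lv b) ?q"] fundamental_coord[OF lv(1) q(1)] by (simp add: q(4) lv)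
qed

text \<open>The splitting of a vector into its horizontal and its vertical part, in
  coordinates.\<close>

lemma hcoord_pcoord:
  assumes x: "x \<in> proj_dom c d"
  shows "hcoord c d x (DD (pcoord c d) x v) + fcoord c x (wcoord c x v) = v"
proof -
  let ?q = "chart_inv c x"
  note q = proj_dom_charts[OF c d x]
  define u where "u = v - fcoord c x (wcoord c x v)"
  let ?Y = "tvec Q c ?q u"
  have Y: "?Y \<in> hor S ?q" unfolding u_def by (rule wcoord_hor[OF c proj_dom_img[OF x]])
  note YT = hor_tan[OF q(3) Y]
  have "hcoord c d x (snd (proj_push S ?Y) d) = u"
    using hlift_coord[OF proj_push_in[OF YT q(3)] q(1,2)] hlift_eqI[OF q(3) Y] tvec_coord[OF manQ q(1)] by (simp add: q(4))
  moreover have "snd (proj_push S ?Y) d = DD (pcoord c d) x v"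
    using proj_push_coord[OF YT q(1,2)] linear_diff[OF linear_pcoord[OF q(1,2)]] pcoord_fcoord[OF x]
    by (simp add: q(4) tvec_coord[OF manQ q(1)] u_def)
  ultimately show ?thesis by (simp add: u_def)
qed

text \<open>The differential of the projection together with the connection form is an invertible
  smooth family; its inverse combines \<open>hcoord\<close> and \<open>fcoord\<close>, so the
  smoothness of inverse families applies.\<close>

lemma hcoord:
  shows "smooth_on (proj_dom c d) (\<lambda>x. hcoord c d x y)" and "x \<in> proj_dom c d \<Longrightarrow> linear (hcoord c d x)"
proof -
  let ?N = "proj_dom c d"
  define T where "T x v = (DD (pcoord c d) x v, wcoord c x v)" for x v
  define R where "R x z = hcoord c d x (fst z) + fcoord c x (snd z)" for x z
  note pc = pcoord[OF c d]
  have lp: "linear (DD (pcoord c d) x)" if "x \<in> ?N" for x by (rule linear_DD[OF pc(2,1) that])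
  have lw: "linear (wcoord c x)" "linear (fcoord c x)" if "x \<in> ?N" for x
    using wcoord(2)[OF c proj_dom_img[OF that]] fcoord(2)[OF c proj_dom_img[OF that]] by auto
  have lT: "linear (T x)" if x: "x \<in> ?N" for x
    by (rule linearI) (simp_all add: T_def linear_add[OF lp[OF x]] linear_add[OF lw(1)[OF x]]
        linear_cmul[OF lp[OF x]] linear_cmul[OF lw(1)[OF x]])
  have RT: "R x (T x v) = v" if x: "x \<in> ?N" for x v
    using hcoord_pcoord[OF x] by (simp add: R_def T_def)
  have TR: "T x (R x z) = z" if x: "x \<in> ?N" for x z
    by (simp add: T_def R_def linear_add[OF lp[OF x]] linear_add[OF lw(1)[OF x]] pcoord_hcoord[OF x]
        pcoord_fcoord[OF x] wcoord_fcoord[OF c proj_dom_img[OF x]])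
  have "smooth_on ?N (\<lambda>x. R x z)" for z
  proof (rule smooth_inverse_family[OF fin_dims(1) fin_dim_prod[OF fin_dims(2,3)] pc(1) _ lT RT TR])
    show "smooth_on ?N (\<lambda>x. T x v)" for v
      unfolding T_def by (rule smooth_Pair[OF smooth_DD[OF pc(2,1)] smooth_subset[OF wcoord(1)[OF c] pc(3)]])
  qed
  then have "smooth_on ?N (\<lambda>x. R x (y, 0))" .
  then show "smooth_on ?N (\<lambda>x. hcoord c d x y)"
    by (rule smooth_cong[THEN iffD1, rotated]) (simp add: R_def linear_0[OF lw(2)])
  assume x: "x \<in> ?N"
  have Rh: "hcoord c d x y = R x (y, 0)" for y by (simp add: R_def linear_0[OF lw(2)[OF x]])
  have inj: "u = v" if "T x u = T x v" for u v using RT[OF x] that by metis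
  show "linear (hcoord c d x)"
  proof (rule linearI)
    show "hcoord c d x (a + b) = hcoord c d x a + hcoord c d x b" for a b
      unfolding Rh by (rule inj) (simp add: linear_add[OF lT[OF x]] TR[OF x])
    show "hcoord c d x (r *\<^sub>R a) = r *\<^sub>R hcoord c d x a" for r a
      unfolding Rh by (rule inj) (simp add: linear_cmul[OF lT[OF x]] TR[OF x])
  qed
qed

end

subsection \<open>Curvature and the map \<open>\<B>\<close> in coordinates\<close>

text \<open>In a chart, \<open>wform c x u v\<close> is minus the exterior derivative of the connection form \<open>\<omega>\<close>; the
  Cartan formula for it turns \<open>\<omega>\<close> of a bracket into this first-order expression.\<close>

definition wform :: "('q, 'e) chart \<Rightarrow> 'e \<Rightarrow> 'e \<Rightarrow> 'e \<Rightarrow> 'h" where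
  "wform c x u v = DD (\<lambda>y. wcoord c y u) x v - DD (\<lambda>y. wcoord c y v) x u"

text \<open>Fields on which the connection form is constant near \<open>q\<close>: horizontal lifts,
  with constant zero, and fundamental fields. For two such fields the terms of Cartan's formula that
  differentiate \<open>\<omega>(X)\<close> and \<open>\<omega>(Y)\<close> vanish.\<close>

definition wconst_at :: "('q \<Rightarrow> ('q, 'e) tvec) \<Rightarrow> 'q \<Rightarrow> ('q, 'e) chart \<Rightarrow> bool" where
  "wconst_at X q c \<longleftrightarrow> (\<exists>V \<beta>. open V \<and> snd c q \<in> V \<and> V \<subseteq> snd c ` fst c \<and>
     (\<forall>x\<in>V. X (chart_inv c x) \<in> tan_space Q (chart_inv c x)) \<and> smooth_on V (\<lambda>x. snd (X (chart_inv c x)) c) \<and>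
     (\<forall>x\<in>V. wcoord c x (snd (X (chart_inv c x)) c) = \<beta>))"

lemma wconst_field_at: "wconst_at X q c \<Longrightarrow> field_at Q X q c"
  unfolding wconst_at_def field_at_def by blast

lemma wconst_derivative:
  assumes c: "c \<in> charts_at Q q" and X: "wconst_at X q c"
  shows "DD (\<lambda>y. wcoord c y (snd (X q) c)) (snd c q) h
    + wcoord c (snd c q) (DD (\<lambda>x. snd (X (chart_inv c x)) c) (snd c q) h) = 0"
proof -
  obtain V \<beta> where V: "open V" "snd c q \<in> V" "V \<subseteq> snd c ` fst c" "smooth_on V (\<lambda>x. snd (X (chart_inv c x)) c)"
    "\<And>x. x \<in> V \<Longrightarrow> wcoord c x (snd (X (chart_inv c x)) c) = \<beta>"
    using X unfolding wconst_at_def by blast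
  have cQ: "c \<in> Q" "q \<in> fst c" using c by (auto simp: charts_at_iff)
  have inv: "chart_inv c (snd c q) = q" by (rule chart_inv_left[OF manQ cQ])
  let ?x = "snd c q" and ?f = "\<lambda>x. snd (X (chart_inv c x)) c"
  note sw = smooth_subset[OF wcoord(1)[OF cQ(1)] V(3)]
  have "((\<lambda>x. wcoord c x (?f x)) has_derivative
      (\<lambda>h. DD (\<lambda>y. wcoord c y (?f ?x)) ?x h + wcoord c ?x (DD ?f ?x h))) (at ?x within V)"
  proof (rule has_derivative_apply[OF fin_dims(1)])
    show "((\<lambda>x. wcoord c x v) has_derivative DD (\<lambda>y. wcoord c y v) ?x) (at ?x within V)" for v
      by (rule has_derivative_at_withinI[OF smooth_has_derivative[OF sw V(1,2)]])
    show "(?f has_derivative DD ?f ?x) (at ?x within V)"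
      by (rule has_derivative_at_withinI[OF smooth_has_derivative[OF V(4,1,2)]])
    show "linear (wcoord c x)" if "x \<in> V" for x using wcoord(2)[OF cQ(1)] V(3) that by blast
  qed (use V fat_open in auto)
  moreover have "((\<lambda>x. wcoord c x (?f x)) has_derivative (\<lambda>h. 0)) (at ?x within V)"
    by (rule has_derivative_transform[OF V(2) V(5) has_derivative_const])
  ultimately have "(\<lambda>h. DD (\<lambda>y. wcoord c y (?f ?x)) ?x h + wcoord c ?x (DD ?f ?x h)) = (\<lambda>h. 0)"
    by (rule fat_unique_derivative[OF fat_open[OF V(1)] V(2)])
  from fun_cong[OF this, of h] show ?thesis by (simp add: inv)
qed

text \<open>Because the connection form is constant on both fields, the derivatives of fields inside
  the bracket are traded for derivatives of the form, and only the values of the fields at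
  \<open>q\<close> remain.\<close>

lemma omega_bracket:
  assumes q: "q \<in> pts Q" and c: "c \<in> charts_at Q q"
    and X: "\<And>c. c \<in> charts_at Q q \<Longrightarrow> wconst_at X q c" and Y: "\<And>c. c \<in> charts_at Q q \<Longrightarrow> wconst_at Y q c"
  shows "lie_bracket Q X Y q \<in> tan_space Q q"
    and "snd (omega S (lie_bracket Q X Y q)) g0 = wform c (snd c q) (snd (X q) c) (snd (Y q) c)"
proof -
  show B: "lie_bracket Q X Y q \<in> tan_space Q q"
    by (rule lie_bracket_in[OF manQ q wconst_field_at[OF X] wconst_field_at[OF Y]])
  have cQ: "c \<in> Q" "q \<in> fst c" using c by (auto simp: charts_at_iff)
  have inv: "chart_inv c (snd c q) = q" by (rule chart_inv_left[OF manQ cQ])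
  have lw: "linear (wcoord c (snd c q))" by (rule wcoord(2)[OF cQ(1)]) (use cQ in blast)
  have "snd (omega S (lie_bracket Q X Y q)) g0 = wcoord c (snd c q) (snd (lie_bracket Q X Y q) c)"
    by (rule omega_coord[OF B c])
  also have "snd (lie_bracket Q X Y q) c = DD (\<lambda>x. snd (Y (chart_inv c x)) c) (snd c q) (snd (X q) c)
      - DD (\<lambda>x. snd (X (chart_inv c x)) c) (snd c q) (snd (Y q) c)"
    using c by (simp add: lie_bracket_def Let_def inv)
  finally show "snd (omega S (lie_bracket Q X Y q)) g0 = wform c (snd c q) (snd (X q) c) (snd (Y q) c)"
    using wconst_derivative[OF c X[OF c], of "snd (Y q) c"] wconst_derivative[OF c Y[OF c], of "snd (X q) c"]
    by (simp add: linear_diff[OF lw] wform_def add_eq_0_iff)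
qed

lemma wconst_fundamental:
  assumes a: "a \<in> lie_alg S" and c: "c \<in> charts_at Q q"
  shows "wconst_at (fundamental S a) q c"
proof -
  have cQ: "c \<in> Q" "q \<in> fst c" using c by (auto simp: charts_at_iff)
  let ?V = "snd c ` fst c"
  have co: "snd (fundamental S a (chart_inv c x)) c = fcoord c x (snd a g0)" if "x \<in> ?V" for x
    using fundamental_coord[OF a chart_pts(2)[OF cQ(1) that]] chart_pts(3)[OF cQ(1) that] by simp
  have "smooth_on ?V (\<lambda>x. snd (fundamental S a (chart_inv c x)) c)"
    using fcoord(1)[OF cQ(1), of "snd a g0"] by (rule smooth_cong[THEN iffD1, rotated]) (simp add: co)
  moreover have "wcoord c x (snd (fundamental S a (chart_inv c x)) c) = snd a g0" if "x \<in> ?V" for x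
    using wcoord_fcoord[OF cQ(1) that] co[OF that] by simp
  ultimately show ?thesis
    unfolding wconst_at_def using open_chart[OF manQ cQ(1)] cQ fundamental_in[OF a chart_pts(1)[OF cQ(1)]]
    by (intro exI[of _ ?V] exI[of _ "snd a g0"]) auto
qed

lemma wconst_hlift_field:
  assumes X: "vector_field M X" and c: "c \<in> charts_at Q q"
  shows "wconst_at (hlift_field S X) q c"
proof -
  have cQ: "c \<in> Q" "q \<in> fst c" using c by (auto simp: charts_at_iff)
  have q: "q \<in> pts Q" using c pts_iff by metis
  have inv: "chart_inv c (snd c q) = q" by (rule chart_inv_left[OF manQ cQ])
  obtain d where d: "d \<in> charts_at M (\<pi> q)" using proj_in[OF q] pts_iff by metis
  then have dM: "d \<in> M" by (simp add: charts_at_iff)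
  obtain U where U: "open U" "snd d (\<pi> q) \<in> U" "smooth_on U (\<lambda>x. snd (X (chart_inv d x)) d)"
    using vector_field_field_at[OF manM X d] unfolding field_at_def by blast
  note pc = pcoord[OF cQ(1) dM]
  let ?V = "proj_dom c d \<inter> pcoord c d -` U"
  have oV: "open ?V" by (rule continuous_open_preimage[OF smooth_continuous[OF pc(2)] pc(1) U(1)])
  have xV: "snd c q \<in> ?V" using proj_dom_mem[OF c d] U(2) by (simp add: pcoord_def inv)
  have Xin: "X p \<in> tan_space M p" if "p \<in> pts M" for p using X that unfolding vector_field_on_def by blast
  let ?Xd = "\<lambda>x. snd (X (chart_inv d (pcoord c d x))) d"
  have co: "hlift_field S X (chart_inv c x) \<in> hor S (chart_inv c x)"
    "snd (hlift_field S X (chart_inv c x)) c = hcoord c d x (?Xd x)" if x: "x \<in> ?V" for x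
  proof -
    have xN: "x \<in> proj_dom c d" using x by blast
    note qx = proj_dom_charts[OF cQ(1) dM xN]
    have "chart_inv d (pcoord c d x) = \<pi> (chart_inv c x)"
      unfolding pcoord_def using chart_inv_left[OF manM dM] qx(2) by (simp add: charts_at_iff)
    then show "snd (hlift_field S X (chart_inv c x)) c = hcoord c d x (?Xd x)"
      using hlift_coord[OF Xin[OF proj_in[OF qx(3)]] qx(1,2)] qx(4) by (simp add: hlift_field_def)
    show "hlift_field S X (chart_inv c x) \<in> hor S (chart_inv c x)"
      unfolding hlift_field_def by (rule hlift(1)[OF qx(3) Xin[OF proj_in[OF qx(3)]]])
  qed
  have "smooth_on ?V (\<lambda>x. hcoord c d x (?Xd x))"
  proof (rule smooth_apply[OF fin_dims(2)])
    show "smooth_on ?V (\<lambda>x. hcoord c d x y)" for y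
      by (rule smooth_subset[OF hcoord(1)[OF cQ(1) dM]]) blast
    show "linear (hcoord c d x)" if "x \<in> ?V" for x using hcoord(2)[OF cQ(1) dM] that by blast
    show "smooth_on ?V ?Xd"
      by (rule smooth_compose[OF fin_dims(2) U(3) smooth_subset[OF pc(2)]]) auto
  qed
  then have sm: "smooth_on ?V (\<lambda>x. snd (hlift_field S X (chart_inv c x)) c)"
    by (rule smooth_cong[THEN iffD1, rotated]) (simp add: co)
  have "hlift_field S X (chart_inv c x) \<in> tan_space Q (chart_inv c x)
      \<and> wcoord c x (snd (hlift_field S X (chart_inv c x)) c) = 0" if x: "x \<in> ?V" for x
  proof -
    have xN: "x \<in> proj_dom c d" using x by blast
    note qx = proj_dom_charts[OF cQ(1) dM xN]
    note ht = hor_tan[OF qx(3) co(1)[OF x]]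
    show ?thesis using ht hor_iff_wcoord[OF ht qx(1)] co(1)[OF x] qx(4) by simp
  qed
  then show ?thesis
    unfolding wconst_at_def using oV xV sm pc(3) by (intro exI[of _ ?V] exI[of _ 0]) auto
qed

text \<open>All extensions give the same value, since the bracket formula sees only the values at
  \<open>q\<close> and the lift of the bracket is horizontal and drops out. Extensions exist, so the
  definite description has exactly one solution.\<close>

lemma curvature_coord:
  assumes q: "q \<in> pts Q" and X: "X \<in> tan_space M (\<pi> q)" and Y: "Y \<in> tan_space M (\<pi> q)" and c: "c \<in> charts_at Q q"
  shows "curvature S q X Y \<in> lie_alg S"
    and "snd (curvature S q X Y) g0 = wform c (snd c q) (snd (hlift S X q) c) (snd (hlift S Y q) c)"
proof -
  let ?w = "wform c (snd c q) (snd (hlift S X q) c) (snd (hlift S Y q) c)"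
  have val: "omega S (tdiff (lie_bracket Q (hlift_field S X') (hlift_field S Y') q)
        (hlift_field S (lie_bracket M X' Y') q)) = lv ?w"
    if X': "vector_field M X'" "X' (\<pi> q) = X" and Y': "vector_field M Y'" "Y' (\<pi> q) = Y" for X' Y'
  proof -
    let ?B = "lie_bracket Q (hlift_field S X') (hlift_field S Y') q" and ?H = "hlift_field S (lie_bracket M X' Y') q"
    note b = omega_bracket[OF q c wconst_hlift_field[OF X'(1)] wconst_hlift_field[OF Y'(1)]]
    have "lie_bracket M X' Y' (\<pi> q) \<in> tan_space M (\<pi> q)"
      by (rule lie_bracket_in[OF manM proj_in[OF q] vector_field_field_at[OF manM X'(1)] vector_field_field_at[OF manM Y'(1)]])
    then have H: "?H \<in> hor S q" unfolding hlift_field_def by (rule hlift(1)[OF q])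
    note HT = hor_tan[OF q H]
    have lw: "linear (wcoord c (snd c q))" using wcoord(2) c by (simp add: charts_at_iff)
    have "snd (omega S (tdiff ?B ?H)) g0 = wcoord c (snd c q) (snd ?B c) - wcoord c (snd c q) (snd ?H c)"
      using omega_coord[OF tdiff_in[OF manQ b(1) HT] c] by (simp add: linear_diff[OF lw])
    also have "\<dots> = snd (omega S ?B) g0" using hor_iff_wcoord[OF HT c] H omega_coord[OF b(1) c] by simp
    also have "\<dots> = ?w" using b(2) X'(2) Y'(2) by (simp add: hlift_field_def)
    finally show ?thesis using lie_alg_eqI[OF omega(1)[OF q tdiff_in[OF manQ b(1) HT]] lv(1)] lv(2) by simp
  qed
  obtain X' where X': "vector_field M X'" "X' (\<pi> q) = X" using vector_field_extension[OF manifolds(2) proj_in[OF q] X] .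
  obtain Y' where Y': "vector_field M Y'" "Y' (\<pi> q) = Y" using vector_field_extension[OF manifolds(2) proj_in[OF q] Y] .
  have "curvature S q X Y = lv ?w"
    unfolding curvature_def
  proof (rule the_equality)
    show "\<forall>X' Y'. vector_field M X' \<and> vector_field M Y' \<and> X' (\<pi> q) = X \<and> Y' (\<pi> q) = Y \<longrightarrow>
     lv ?w = omega S (tdiff (lie_bracket Q (hlift_field S X') (hlift_field S Y') q) (hlift_field S (lie_bracket M X' Y') q))"
      using val by simp
    fix a assume a: "\<forall>X' Y'. vector_field M X' \<and> vector_field M Y' \<and> X' (\<pi> q) = X \<and> Y' (\<pi> q) = Y \<longrightarrow>
     a = omega S (tdiff (lie_bracket Q (hlift_field S X') (hlift_field S Y') q) (hlift_field S (lie_bracket M X' Y') q))"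
    show "a = lv ?w" using a[rule_format, of X' Y'] X' Y' val[OF X' Y'] by simp
  qed
  then show "curvature S q X Y \<in> lie_alg S" "snd (curvature S q X Y) g0 = ?w" using lv by auto
qed

lemma bmap_coord:
  assumes q: "q \<in> pts Q" and X: "X \<in> tan_space M (\<pi> q)" and a: "a \<in> lie_alg S" and c: "c \<in> charts_at Q q"
  shows "bmap S q X a \<in> lie_alg S"
    and "snd (bmap S q X a) g0 = wform c (snd c q) (snd (hlift S X q) c) (snd (fundamental S a q) c)"
proof -
  let ?w = "wform c (snd c q) (snd (hlift S X q) c) (snd (fundamental S a q) c)"
  have val: "omega S (lie_bracket Q (hlift_field S X') (fundamental S a) q) = lv ?w"
    if X': "vector_field M X'" "X' (\<pi> q) = X" for X'
  proof -
    note b = omega_bracket[OF q c wconst_hlift_field[OF X'(1)] wconst_fundamental[OF a]]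
    show ?thesis
      using lie_alg_eqI[OF omega(1)[OF q b(1)] lv(1)] lv(2) b(2) X'(2) by (simp add: hlift_field_def)
  qed
  obtain X' where X': "vector_field M X'" "X' (\<pi> q) = X" using vector_field_extension[OF manifolds(2) proj_in[OF q] X] .
  have "bmap S q X a = lv ?w"
    unfolding bmap_def
  proof (rule the_equality)
    show "\<forall>X'. vector_field M X' \<and> X' (\<pi> q) = X \<longrightarrow> lv ?w = omega S (lie_bracket Q (hlift_field S X') (fundamental S a) q)"
      using val by simp
    fix a' assume "\<forall>X'. vector_field M X' \<and> X' (\<pi> q) = X \<longrightarrow> a' = omega S (lie_bracket Q (hlift_field S X') (fundamental S a) q)"
    then show "a' = lv ?w" using X' val[OF X'] by auto
  qed
  then show "bmap S q X a \<in> lie_alg S" "snd (bmap S q X a) g0 = ?w" using lv by auto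
qed

end

context chaplygin_system
begin

section \<open>Derivatives of the Lagrangian in coordinates\<close>

lemma chart_inv_tan_coord:
  "Z \<in> tan_space Q q \<Longrightarrow> c \<in> charts_at Q q \<Longrightarrow> chart_inv (tan_chart Q c) (snd c q, snd Z c) = Z"
  using chart_inv_left[OF man_tan[OF manQ], of "tan_chart Q c" Z] charts_at_tanI[of c Q q Z] tan_space_fst[of Z Q q]
  by (simp add: charts_at_iff)

definition lcoord :: "(('q, 'e) tvec \<Rightarrow> real) \<Rightarrow> ('q, 'e) chart \<Rightarrow> 'e \<times> 'e \<Rightarrow> real" where
  "lcoord L c z = L (chart_inv (tan_chart Q c) z)"

lemma smooth_lcoord:
  assumes L: "smooth_lagrangian S L" and c: "c \<in> Q"
  shows "smooth_on ((snd c ` fst c) \<times> UNIV) (lcoord L c)" "open ((snd c ` fst c) \<times> (UNIV :: 'e set))"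
proof -
  let ?C = "tan_chart Q c"
  have "?C \<in> tan_atlas Q" "(UNIV, id) \<in> real_atlas" using c by (auto simp: tan_atlas_def real_atlas_def)
  from smooth_map_chart(2)[OF L[unfolded smooth_lagrangian_def] this]
  have "smooth_on (snd ?C ` fst ?C) (\<lambda>z. L (chart_inv ?C z))" by simp
  then show "smooth_on ((snd c ` fst c) \<times> UNIV) (lcoord L c)"
    unfolding tan_chart_image[OF manQ c] lcoord_def .
  show "open ((snd c ` fst c) \<times> (UNIV :: 'e set))" using open_chart[OF manQ c] by (simp add: open_Times)
qed

lemma lcoord_has_derivative:
  assumes L: "smooth_lagrangian S L" and c: "c \<in> charts_at Q q"
  shows "(lcoord L c has_derivative DD (lcoord L c) (snd c q, v)) (at (snd c q, v))"
  using c by (intro smooth_has_derivative[OF smooth_lcoord[OF L]]) (auto simp: charts_at_iff)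

lemma linear_lcoord:
  "smooth_lagrangian S L \<Longrightarrow> c \<in> charts_at Q q \<Longrightarrow> linear (DD (lcoord L c) (snd c q, v))"
  using lcoord_has_derivative has_derivative_linear by blast

lemma differential_lcoord:
  assumes L: "smooth_lagrangian S L" and Z: "Z \<in> tan_space Q q" and c: "c \<in> charts_at Q q"
    and W: "W \<in> tan_space (tan_atlas Q) Z"
  shows "differential (tan_atlas Q) L W = DD (lcoord L c) (snd c q, snd Z c) (snd W (tan_chart Q c))"
  using differential_coord[OF man_tan[OF manQ] W charts_at_tanI[OF c Z]] lcoord_has_derivative[OF L c]
    tan_space_fst[OF Z] by (simp add: lcoord_def[abs_def])

lemma FL_coord:
  assumes L: "smooth_lagrangian S L" and Z: "Z \<in> tan_space Q q" and c: "c \<in> charts_at Q q" and b: "b \<in> lie_alg S"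
  shows "FL S L Z b = DD (lcoord L c) (snd c q, snd Z c) (0, fcoord c (snd c q) (snd b g0))"
proof -
  have q: "q \<in> pts Q" using c pts_iff by metis
  have cQ: "c \<in> Q" using c by (simp add: charts_at_iff)
  let ?F = "fundamental S b q" and ?u = "(0, fcoord c (snd c q) (snd b g0))"
  note F = fundamental_in[OF b q]
  have "L (tadd Z (tscale t ?F)) = lcoord L c ((snd c q, snd Z c) + t *\<^sub>R ?u)" for t
    using chart_inv_tan_coord[OF tadd_in[OF manQ Z tscale_in[OF manQ F]] c] by (simp add: lcoord_def fundamental_coord[OF b c])
  moreover have "((\<lambda>t. lcoord L c ((snd c q, snd Z c) + t *\<^sub>R ?u)) has_real_derivative
     DD (lcoord L c) ((snd c q, snd Z c) + 0 *\<^sub>R ?u) ?u) (at 0)"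
    by (rule DERIV_along_line[OF smooth_lcoord[OF L cQ]]) (use c in \<open>auto simp: charts_at_iff\<close>)
  ultimately show ?thesis
    using tan_space_fst[OF Z] by (simp add: FL_def DERIV_imp_deriv)
qed

text \<open>Along the orbit of \<open>q\<close> under the one-parameter subgroup of
  \<open>b\<close>, the lift of a fixed base vector has the coordinates
  \<open>(x, hcoord c d x y)\<close>. The direction on the right is the derivative of this pair
  along the fundamental vector \<open>f\<close>.\<close>

lemma HL_coord:
  assumes L: "smooth_lagrangian S L" and Z: "Z \<in> hor S q" and c: "c \<in> charts_at Q q" and d: "d \<in> charts_at M (\<pi> q)"
    and b: "b \<in> lie_alg S" and f: "f = fcoord c (snd c q) (snd b g0)"
  shows "HL S L Z b = DD (lcoord L c) (snd c q, snd Z c)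
    (f, DD (\<lambda>x. hcoord c d x (snd (proj_push S Z) d)) (snd c q) f)"
proof -
  have q: "q \<in> pts Q" using c pts_iff by metis
  have cQ: "c \<in> Q" "d \<in> M" "\<pi> q \<in> fst d" using c d by (auto simp: charts_at_iff)
  note ZT = hor_tan[OF q Z]
  define P y x where "P = proj_push S Z" and "y = snd P d" and "x = snd c q"
  have PT: "P \<in> tan_space M (\<pi> q)" unfolding P_def by (rule proj_push_in[OF ZT q])
  define g where "g t = act S q (expcurve b t)" for t
  note sg = smooth_curve_act[OF q L.fatU expcurve(1)[OF b], folded g_def]
  have g0q: "g 0 = q" by (simp add: g_def expcurve(3)[OF b] act_one[OF q])
  have gp: "g t \<in> pts Q" "\<pi> (g t) = \<pi> q" for t
    unfolding g_def using act_in[OF q expcurve(4)[OF b]] proj_act[OF q expcurve(4)[OF b]] by auto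
  obtain V where V: "open V" "0 \<in> V" "\<And>s. s \<in> V \<Longrightarrow> g s \<in> fst c"
    using smooth_curve_local[OF manQ L.fatU sg, of 0 c] c g0q by auto
  have cg: "c \<in> charts_at Q (g s)" "d \<in> charts_at M (\<pi> (g s))" if "s \<in> V" for s
    using V(3)[OF that] cQ gp by (auto simp: charts_at_iff)
  let ?h = "\<lambda>z. (z, hcoord c d z y)"
  have eq: "L (hlift S P (g s)) = lcoord L c (?h (snd c (g s)))" if s: "s \<in> V" for s
  proof -
    have PT': "P \<in> tan_space M (\<pi> (g s))" using PT gp by simp
    show ?thesis
      using chart_inv_tan_coord[OF hor_tan[OF gp(1) hlift(1)[OF gp(1) PT']] cg(1)[OF s]]
        hlift_coord[OF PT' cg[OF s]] by (simp add: lcoord_def y_def)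
  qed
  note xN = proj_dom_mem[OF c d, folded x_def]
  have h: "(?h has_derivative (\<lambda>k. (k, DD (\<lambda>z. hcoord c d z y) x k))) (at x)"
    by (intro has_derivative_Pair has_derivative_ident smooth_has_derivative[OF hcoord(1)[OF cQ(1,2)] pcoord(1)[OF cQ(1,2)] xN])
  have v: "hcoord c d x y = snd Z c"
    using hlift_coord[OF PT c d] hlift_eqI[OF q Z] by (simp add: P_def y_def x_def)
  have "((\<lambda>s. snd c (g s)) has_vector_derivative f) (at 0)"
    using velocity_coord[OF manQ L.fatU sg, of 0 c] c g0q fundamental_eq[OF b, of q] fundamental_coord[OF b c] f
    by (simp add: g_def[abs_def])
  then have gd: "((\<lambda>s. snd c (g s)) has_derivative (\<lambda>t. t *\<^sub>R f)) (at 0)" by (simp add: has_vector_derivative_def)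
  have "(?h has_derivative (\<lambda>k. (k, DD (\<lambda>z. hcoord c d z y) x k))) (at (snd c (g 0)))" using h g0q by (simp add: x_def)
  from has_derivative_compose[OF gd this]
  have hd: "((\<lambda>s. ?h (snd c (g s))) has_derivative (\<lambda>t. (t *\<^sub>R f, DD (\<lambda>z. hcoord c d z y) x (t *\<^sub>R f)))) (at 0)" .
  have "(lcoord L c has_derivative DD (lcoord L c) (x, snd Z c)) (at (?h (snd c (g 0))))"
    using lcoord_has_derivative[OF L c, of "snd Z c"] v g0q by (simp add: x_def)
  from has_derivative_compose[OF hd this]
  have D: "((\<lambda>s. lcoord L c (?h (snd c (g s)))) has_derivative
      (\<lambda>t. DD (lcoord L c) (x, snd Z c) (t *\<^sub>R f, DD (\<lambda>z. hcoord c d z y) x (t *\<^sub>R f)))) (at 0)" .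
  have lin: "linear (DD (lcoord L c) (x, snd Z c))" unfolding x_def by (rule linear_lcoord[OF L c])
  have linh: "linear (DD (\<lambda>z. hcoord c d z y) x)" by (rule linear_DD[OF hcoord(1)[OF cQ(1,2)] pcoord(1)[OF cQ(1,2)] xN])
  have "DD (lcoord L c) (x, snd Z c) (t *\<^sub>R f, DD (\<lambda>z. hcoord c d z y) x (t *\<^sub>R f))
      = DD (lcoord L c) (x, snd Z c) (f, DD (\<lambda>z. hcoord c d z y) x f) * t" for t
    using linear_cmul[OF lin, of t "(f, DD (\<lambda>z. hcoord c d z y) x f)"] by (simp add: linear_cmul[OF linh])
  then have "((\<lambda>s. lcoord L c (?h (snd c (g s)))) has_real_derivative
      DD (lcoord L c) (x, snd Z c) (f, DD (\<lambda>z. hcoord c d z y) x f)) (at 0)"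
    using D unfolding has_field_derivative_def by presburger
  then have "((\<lambda>s. L (hlift S P (g s))) has_real_derivative
      DD (lcoord L c) (x, snd Z c) (f, DD (\<lambda>z. hcoord c d z y) x f)) (at 0)"
    by (rule has_field_derivative_transform_within_open[OF _ V(1,2)]) (simp add: eq)
  then have "deriv (\<lambda>s. L (hlift S P (g s))) 0 = DD (lcoord L c) (x, snd Z c) (f, DD (\<lambda>z. hcoord c d z y) x f)"
    by (rule DERIV_imp_deriv)
  then show ?thesis
    using tan_space_fst[OF ZT] by (simp add: HL_def g_def P_def y_def x_def expcurve(5)[OF b])
qed

text \<open>Both sides have the same projection because second derivatives of \<open>\<pi>\<close> commute.\<close>

lemma bracket_vertical:
  assumes c: "c \<in> Q" and d: "d \<in> M" and x: "x \<in> proj_dom c d"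
    and v: "v = hcoord c d x y" and f: "f = fcoord c x b"
  shows "DD (\<lambda>z. fcoord c z b) x v - DD (\<lambda>z. hcoord c d z y) x f = fcoord c x (wform c x v f)"
proof -
  let ?N = "proj_dom c d" and ?P = "pcoord c d"
  note pc = pcoord[OF c d]
  note img = proj_dom_img[OF c d]
  note sf = smooth_subset[OF fcoord(1)[OF c] pc(3)] and sw = smooth_subset[OF wcoord(1)[OF c] pc(3)]
  note sh = hcoord(1)[OF c d]
  have lw: "linear (wcoord c z)" if "z \<in> ?N" for z using wcoord(2)[OF c img[OF that]] .
  have lP: "linear (DD ?P z)" if "z \<in> ?N" for z by (rule linear_DD[OF pc(2,1) that])
  \<comment> \<open>In coordinates \<open>?u\<close> is the bracket of the horizontal field with
    constant base coordinate \<open>y\<close> and the fundamental field of \<open>b\<close>.\<close>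
  let ?u = "DD (\<lambda>z. fcoord c z b) x v - DD (\<lambda>z. hcoord c d z y) x f"
  have "DD (\<lambda>z. DD ?P z f) x v + DD ?P x (DD (\<lambda>z. fcoord c z b) x v) = 0"
    using DD_apply_zero[where T = "DD ?P" and u = "\<lambda>z. fcoord c z b" and k = 0 and h = v,
      OF fin_dims(1) pc(1) smooth_DD[OF pc(2,1)] lP sf x] pcoord_fcoord[OF c d] f by simp
  moreover have "DD (\<lambda>z. DD ?P z v) x f + DD ?P x (DD (\<lambda>z. hcoord c d z y) x f) = 0"
    using DD_apply_zero[where T = "DD ?P" and u = "\<lambda>z. hcoord c d z y" and k = y and h = f,
      OF fin_dims(1) pc(1) smooth_DD[OF pc(2,1)] lP sh x] pcoord_hcoord(1)[OF c d] v by simp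
  moreover have "DD (\<lambda>z. DD ?P z f) x v = DD (\<lambda>z. DD ?P z v) x f" by (rule DD_symmetric[OF pc(2,1) x])
  ultimately have P0: "DD ?P x ?u = 0" by (simp add: linear_diff[OF lP[OF x]] add_eq_0_iff)
  have "DD (\<lambda>z. wcoord c z f) x v + wcoord c x (DD (\<lambda>z. fcoord c z b) x v) = 0"
    using DD_apply_zero[where T = "wcoord c" and u = "\<lambda>z. fcoord c z b" and k = b and h = v,
      OF fin_dims(1) pc(1) sw lw sf x] wcoord_fcoord[OF c img] f by simp
  moreover have "DD (\<lambda>z. wcoord c z v) x f + wcoord c x (DD (\<lambda>z. hcoord c d z y) x f) = 0"
    using DD_apply_zero[where T = "wcoord c" and u = "\<lambda>z. hcoord c d z y" and k = 0 and h = f,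
      OF fin_dims(1) pc(1) sw lw sh x] pcoord_hcoord(2)[OF c d] v by simp
  ultimately have "wcoord c x ?u = wform c x v f" by (simp add: linear_diff[OF lw[OF x]] add_eq_0_iff wform_def)
  then show ?thesis
    using hcoord_pcoord[OF c d x, of ?u] P0 linear_0[OF hcoord(2)[OF c d x]] by simp
qed

text \<open>One term is a derivative applied to the vector, the other the derivative of a family
  that is linear in the vector.\<close>

lemma linear_wform:
  assumes c: "c \<in> Q" and x: "x \<in> snd c ` fst c"
  shows "linear (wform c x v)"
proof -
  note o = open_chart[OF manQ c]
  have 1: "linear (DD (\<lambda>y. wcoord c y v) x)" by (rule linear_DD[OF wcoord(1)[OF c] o x])
  have 2: "linear (\<lambda>u. DD (\<lambda>y. wcoord c y u) x v)" by (rule linear_DD_family[OF o wcoord(1)[OF c] wcoord(2)[OF c] x])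
  show ?thesis
    by (rule linearI) (simp_all add: wform_def linear_add[OF 1] linear_add[OF 2] linear_cmul[OF 1] linear_cmul[OF 2]
        scaleR_diff_right)
qed

text \<open>The connection form as a function on the tangent bundle. Over the chart the horizontal
  bundle is its zero set, so its differential linearizes the constraint.\<close>

definition wjoint :: "('q, 'e) chart \<Rightarrow> 'e \<times> 'e \<Rightarrow> 'h" where
  "wjoint c z = wcoord c (fst z) (snd z)"

lemma wjoint:
  assumes c: "c \<in> Q"
  shows "smooth_on ((snd c ` fst c) \<times> UNIV) (wjoint c)"
    and "x \<in> snd c ` fst c \<Longrightarrow> (wjoint c has_derivative (\<lambda>(h, k). DD (\<lambda>y. wcoord c y v) x h + wcoord c x k)) (at (x, v))"
proof -
  note o = open_chart[OF manQ c]
  have oS: "open ((snd c ` fst c) \<times> (UNIV :: 'e set))" using o by (simp add: open_Times)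
  have s1: "smooth_on ((snd c ` fst c) \<times> UNIV) (\<lambda>z::'e \<times> 'e. wcoord c (fst z) w)" for w
    by (rule smooth_compose[OF fin_dims(1) wcoord(1)[OF c] smooth_fst[OF smooth_ident]]) auto
  have l: "linear (wcoord c (fst z))" if "z \<in> (snd c ` fst c) \<times> (UNIV :: 'e set)" for z
    using that wcoord(2)[OF c] by auto
  show "smooth_on ((snd c ` fst c) \<times> UNIV) (wjoint c)"
    unfolding wjoint_def by (rule smooth_apply[OF fin_dims(1) s1 l smooth_snd[OF smooth_ident]])
  assume x: "x \<in> snd c ` fst c"
  have z: "(x, v) \<in> (snd c ` fst c) \<times> (UNIV :: 'e set)" using x by simp
  have 1: "((\<lambda>z. wcoord c (fst z) w) has_derivative (\<lambda>h. DD (\<lambda>y. wcoord c y w) x (fst h))) (at (x, v) within (snd c ` fst c) \<times> UNIV)" for w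
  proof (rule has_derivative_at_withinI)
    have "((\<lambda>y. wcoord c y w) has_derivative DD (\<lambda>y. wcoord c y w) x) (at (fst (x, v)))"
      using smooth_has_derivative[OF wcoord(1)[OF c] o x] by simp
    from has_derivative_compose[OF has_derivative_fst[OF has_derivative_ident] this]
    show "((\<lambda>z. wcoord c (fst z) w) has_derivative (\<lambda>h. DD (\<lambda>y. wcoord c y w) x (fst h))) (at (x, v))" .
  qed
  have "((\<lambda>z. wcoord c (fst z) (snd z)) has_derivative (\<lambda>h. DD (\<lambda>y. wcoord c y (snd (x, v))) x (fst h) + wcoord c (fst (x, v)) (snd h)))
      (at (x, v) within (snd c ` fst c) \<times> UNIV)"
    by (rule has_derivative_apply[OF fin_dims(1) 1 l has_derivative_snd[OF has_derivative_ident] z fat_open[OF oS]])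
  then show "(wjoint c has_derivative (\<lambda>(h, k). DD (\<lambda>y. wcoord c y v) x h + wcoord c x k)) (at (x, v))"
    using at_within_open[OF z oS] by (simp add: wjoint_def[abs_def] case_prod_unfold)
qed

subsection \<open>Vectors tangent to the horizontal bundle\<close>

text \<open>A curve in the horizontal bundle annihilates \<open>wjoint\<close>, which gives one
  direction on differentiating. Conversely, a straight line in a direction of the kernel is
  corrected by its vertical part, which vanishes to first order.\<close>

lemma sub_tan_horizontal:
  assumes Z: "Z \<in> hor S q" and c: "c \<in> charts_at Q q" and W: "W \<in> tan_space (tan_atlas Q) Z"
    and hk: "snd W (tan_chart Q c) = (h, k)"
  shows "W \<in> sub_tan_space (tan_atlas Q) (horizontal_bundle S) Z \<longleftrightarrow>
    DD (\<lambda>y. wcoord c y (snd Z c)) (snd c q) h + wcoord c (snd c q) k = 0" (is "?l \<longleftrightarrow> ?r")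
proof -
  have q: "q \<in> pts Q" using c pts_iff by metis
  have cQ: "c \<in> Q" "q \<in> fst c" using c by (auto simp: charts_at_iff)
  note ZT = hor_tan[OF q Z]
  define x v where "x = snd c q" and "v = snd Z c"
  let ?C = "tan_chart Q c" and ?T = "tan_atlas Q"
  note mT = man_tan[OF manQ]
  have xi: "x \<in> snd c ` fst c" using cQ by (simp add: x_def)
  have CZ: "?C \<in> charts_at ?T Z" by (rule charts_at_tanI[OF c ZT])
  have sC: "snd ?C Z = (x, v)" using tan_space_fst[OF ZT] by (simp add: x_def v_def)
  note wd = wjoint(2)[OF cQ(1) xi, of v]
  show ?thesis
  proof
    assume ?l
    then obtain \<gamma> \<epsilon> where \<epsilon>: "\<epsilon> > 0" and \<gamma>: "smooth_curve {-\<epsilon><..<\<epsilon>} ?T \<gamma>" "\<forall>s\<in>{-\<epsilon><..<\<epsilon>}. \<gamma> s \<in> horizontal_bundle S"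
      "\<gamma> 0 = Z" "W = velocity {-\<epsilon><..<\<epsilon>} ?T \<gamma> 0"
      unfolding sub_tan_space_def by blast
    let ?I = "{-\<epsilon><..<\<epsilon>}"
    have I: "open ?I" "fat ?I" "0 \<in> ?I" using \<epsilon> by (auto intro: fat_open)
    have CZ': "?C \<in> charts_at ?T (\<gamma> 0)" using CZ \<gamma>(3) by simp
    obtain V where V: "open V" "0 \<in> V" "\<And>s. s \<in> ?I \<inter> V \<Longrightarrow> \<gamma> s \<in> fst ?C"
      using smooth_curve_local[OF mT I(2) \<gamma>(1) I(3) CZ'] by metis
    have "((\<lambda>s. snd ?C (\<gamma> s)) has_derivative (\<lambda>t. t *\<^sub>R (h, k))) (at 0)"
      using velocity_coord[OF mT I(2) \<gamma>(1) I(3) CZ'] \<gamma>(4) hk at_within_open[OF I(3,1)]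
      by (simp add: has_vector_derivative_def)
    moreover have "(wjoint c has_derivative (\<lambda>(h, k). DD (\<lambda>y. wcoord c y v) x h + wcoord c x k)) (at (snd ?C (\<gamma> 0)))"
      using wd sC \<gamma>(3) by simp
    ultimately have "((\<lambda>s. wjoint c (snd ?C (\<gamma> s))) has_derivative
        (\<lambda>t. (\<lambda>(h, k). DD (\<lambda>y. wcoord c y v) x h + wcoord c x k) (t *\<^sub>R (h, k)))) (at 0)"
      by (rule has_derivative_compose)
    moreover have "((\<lambda>s. wjoint c (snd ?C (\<gamma> s))) has_derivative (\<lambda>t. 0)) (at 0)"
    proof (rule has_derivative_transform_within_open[OF has_derivative_const[of 0] open_Int[OF I(1) V(1)]])
      show "0 \<in> ?I \<inter> V" using I V by blast
      fix s assume s: "s \<in> ?I \<inter> V"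
      obtain q' where q': "q' \<in> pts Q" "\<gamma> s \<in> hor S q'" using \<gamma>(2) s unfolding horizontal_bundle_def by blast
      have f: "fst (\<gamma> s) = q'" by (rule hor_fst[OF q'])
      have "c \<in> charts_at Q q'" using V(3)[OF s] f cQ(1) by (simp add: tan_chart_domain charts_at_iff)
      then show "0 = wjoint c (snd ?C (\<gamma> s))"
        using hor_iff_wcoord[OF hor_tan[OF q']] q'(2) f by (simp add: wjoint_def)
    qed
    ultimately have "(\<lambda>t. (\<lambda>(h, k). DD (\<lambda>y. wcoord c y v) x h + wcoord c x k) (t *\<^sub>R (h, k))) = (\<lambda>t. 0)"
      by (rule has_derivative_unique)
    from fun_cong[OF this, of 1] show ?r by (simp add: x_def v_def)
  next
    assume r: ?r
    define p where "p s = x + s *\<^sub>R h" for s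
    \<comment> \<open>\<open>\<kappa>\<close> is the connection form along the straight line;
      subtracting the corresponding fundamental vector makes \<open>u s\<close> horizontal.\<close>
    define \<kappa> where "\<kappa> s = wcoord c (p s) (v + s *\<^sub>R k)" for s
    define u where "u s = (v + s *\<^sub>R k) - fcoord c (p s) (\<kappa> s)" for s
    have "open (p -` (snd c ` fst c))"
      unfolding p_def by (intro open_vimage open_chart[OF manQ cQ(1)] continuous_intros)
    moreover have "0 \<in> p -` (snd c ` fst c)" using xi by (simp add: p_def)
    ultimately obtain \<epsilon> where \<epsilon>: "\<epsilon> > 0" "ball 0 \<epsilon> \<subseteq> p -` (snd c ` fst c)" unfolding open_contains_ball by blast
    let ?I = "{-\<epsilon><..<\<epsilon>}"
    have I: "open ?I" "fat ?I" "0 \<in> ?I" using \<epsilon> by (auto intro: fat_open)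
    have pi: "p s \<in> snd c ` fst c" if "s \<in> ?I" for s
    proof -
      have "s \<in> ball 0 \<epsilon>" using that by (auto simp: dist_real_def abs_less_iff)
      then show ?thesis using \<epsilon>(2) by blast
    qed
    define \<gamma> where "\<gamma> s = tvec Q c (chart_inv c (p s)) (u s)" for s
    have \<gamma>c: "snd ?C (\<gamma> s) = (p s, u s)" "\<gamma> s \<in> fst ?C" "\<gamma> s \<in> horizontal_bundle S" if s: "s \<in> ?I" for s
    proof -
      note qs = chart_pts[OF cQ(1) pi[OF s]]
      show "snd ?C (\<gamma> s) = (p s, u s)" using qs tvec_coord[OF manQ qs(2)] by (simp add: \<gamma>_def)
      show "\<gamma> s \<in> fst ?C" unfolding \<gamma>_def by (rule tvec_in_tan_chart[OF manQ cQ(1) chart_inv_mem[OF pi[OF s]]])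
      show "\<gamma> s \<in> horizontal_bundle S"
        unfolding \<gamma>_def u_def \<kappa>_def horizontal_bundle_def using wcoord_hor[OF cQ(1) pi[OF s]] qs(1) by blast
    qed
    have sp: "smooth_on ?I p" unfolding p_def by (intro smooth_add smooth_scaleR smooth_const smooth_ident)
    have sv: "smooth_on ?I (\<lambda>s. v + s *\<^sub>R k)" by (intro smooth_add smooth_scaleR smooth_const smooth_ident)
    have s\<kappa>: "smooth_on ?I \<kappa>"
      unfolding \<kappa>_def
      by (rule smooth_apply[OF fin_dims(1) smooth_compose[OF fin_dims(1) wcoord(1)[OF cQ(1)] sp] wcoord(2)[OF cQ(1)] sv])
         (use pi in auto)
    have "smooth_on ?I (\<lambda>s. fcoord c (p s) (\<kappa> s))"
      by (rule smooth_apply[OF fin_dims(3) smooth_compose[OF fin_dims(1) fcoord(1)[OF cQ(1)] sp] fcoord(2)[OF cQ(1)] s\<kappa>])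
         (use pi in auto)
    then have su: "smooth_on ?I u" unfolding u_def by (intro smooth_diff sv)
    have s\<gamma>: "smooth_curve ?I ?T \<gamma>"
    proof (rule smooth_curveI[OF mT I(2)])
      have "smooth_on ?I (\<lambda>s. snd ?C (\<gamma> s))"
        using smooth_Pair[OF sp su] by (rule smooth_cong[THEN iffD1, rotated]) (simp only: \<gamma>c)
      then show "\<exists>d\<in>?T. \<exists>V. open V \<and> t \<in> V \<and> (\<forall>s\<in>?I\<inter>V. \<gamma> s \<in> fst d) \<and> smooth_on (?I \<inter> V) (\<lambda>s. snd d (\<gamma> s))" for t
        using CZ \<gamma>c(2) unfolding charts_at_iff by (intro bexI[of _ ?C] exI[of _ UNIV]) auto
    qed
    have \<kappa>0: "\<kappa> 0 = 0" using hor_iff_wcoord[OF ZT c] Z by (simp add: \<kappa>_def p_def x_def v_def)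
    have u0: "u 0 = v" using linear_0[OF fcoord(2)[OF cQ(1) xi]] by (simp add: u_def \<kappa>0 p_def)
    have \<gamma>0: "\<gamma> 0 = Z"
      using chart_inv_left[OF manQ cQ] tvec_collapse[OF manQ ZT c] by (simp add: \<gamma>_def u0 p_def x_def v_def)
    have pd: "(p has_vector_derivative h) (at 0)" unfolding p_def by (auto intro!: derivative_eq_intros)
    have "((\<lambda>s. (p s, v + s *\<^sub>R k)) has_vector_derivative (h, k)) (at 0)"
      by (intro has_vector_derivative_Pair pd) (auto intro!: derivative_eq_intros)
    then have "((\<lambda>s. (p s, v + s *\<^sub>R k)) has_derivative (\<lambda>t. t *\<^sub>R (h, k))) (at 0)" by (simp add: has_vector_derivative_def)
    moreover have "(wjoint c has_derivative (\<lambda>(h, k). DD (\<lambda>y. wcoord c y v) x h + wcoord c x k)) (at (p 0, v + 0 *\<^sub>R k))"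
      using wd by (simp add: p_def)
    ultimately have "((\<lambda>s. wjoint c (p s, v + s *\<^sub>R k)) has_derivative
        (\<lambda>t. (\<lambda>(h, k). DD (\<lambda>y. wcoord c y v) x h + wcoord c x k) (t *\<^sub>R (h, k)))) (at 0)"
      by (rule has_derivative_compose)
    moreover have "(\<lambda>(h, k). DD (\<lambda>y. wcoord c y v) x h + wcoord c x k) (t *\<^sub>R (h, k)) = 0" for t
      using has_derivative_linear[OF wd] linear_cmul[of _ t "(h, k)"] r by (fastforce simp: x_def v_def)
    \<comment> \<open>Since \<open>\<kappa>\<close> and its derivative vanish at 0, the correction
      does not affect the velocity.\<close>
    ultimately have \<kappa>d: "(\<kappa> has_derivative (\<lambda>t. 0)) (at 0)" by (simp add: \<kappa>_def[abs_def] wjoint_def)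
    have lin: "linear (fcoord c (p s))" if "s \<in> ?I" for s using fcoord(2)[OF cQ(1) pi[OF that]] .
    have sf: "smooth_on ?I (\<lambda>s. fcoord c (p s) b)" for b
      by (rule smooth_compose[OF fin_dims(1) fcoord(1)[OF cQ(1)] sp]) (use pi in auto)
    have "((\<lambda>s. fcoord c (p s) (\<kappa> s)) has_derivative
        (\<lambda>t. DD (\<lambda>s. fcoord c (p s) (\<kappa> 0)) 0 t + fcoord c (p 0) 0)) (at 0 within ?I)"
      by (rule has_derivative_apply[OF fin_dims(3) has_derivative_at_withinI[OF smooth_has_derivative[OF sf I(1,3)]] lin
          has_derivative_at_withinI[OF \<kappa>d] I(3,2)])
    moreover have "DD (\<lambda>s. fcoord c (p s) (\<kappa> 0)) 0 = (\<lambda>t. 0)"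
      using DD_cong[OF I(1,3), of "\<lambda>s. fcoord c (p s) (\<kappa> 0)" "\<lambda>_. 0"] linear_0[OF lin] DD_eq[OF has_derivative_const]
      by (simp add: \<kappa>0)
    ultimately have "((\<lambda>s. fcoord c (p s) (\<kappa> s)) has_vector_derivative 0) (at 0)"
      using linear_0[OF lin[OF I(3)]] at_within_open[OF I(3,1)] by (simp add: has_vector_derivative_def)
    moreover have "((\<lambda>s. v + s *\<^sub>R k) has_vector_derivative k) (at 0)" by (auto intro!: derivative_eq_intros)
    ultimately have "(u has_vector_derivative k - 0) (at 0)"
      unfolding u_def by (intro has_vector_derivative_diff)
    then have "((\<lambda>s. (p s, u s)) has_vector_derivative (h, k)) (at 0)"
      using has_vector_derivative_Pair[OF pd] by simp
    then have "((\<lambda>s. snd ?C (\<gamma> s)) has_vector_derivative (h, k)) (at 0)"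
      by (rule has_vector_derivative_transform_within_open[OF _ I(1,3)]) (simp only: \<gamma>c)
    then have "snd (velocity ?I ?T \<gamma> 0) ?C = (h, k)"
      using velocity_coordI[OF mT I(2,3), of ?C \<gamma> "(h, k)"] CZ \<gamma>0 at_within_open[OF I(3,1)] by simp
    then have "velocity ?I ?T \<gamma> 0 = W"
      using tan_space_eqI[OF _ W CZ] velocity_in[OF mT I(2) s\<gamma> I(3)] \<gamma>0 hk by simp
    then show ?l unfolding sub_tan_space_def using \<epsilon>(1) s\<gamma> \<gamma>0 \<gamma>c(3) by blast
  qed
qed

end

section \<open>Sections along a horizontal path\<close>

lemma smooth_DD_along:
  fixes f :: "'a::real_inner \<Rightarrow> 'b::real_normed_vector"
  assumes fd: "fin_dim TYPE('a)" and f: "smooth_on U f" "open U"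
    and z: "smooth_on J z" "\<And>s. s \<in> J \<Longrightarrow> z s \<in> U" and w: "smooth_on J w"
  shows "smooth_on J (\<lambda>s. DD f (z s) (w s))"
proof (rule smooth_apply[OF fd])
  show "smooth_on J (\<lambda>s. DD f (z s) v)" for v
    by (rule smooth_compose[OF fd smooth_DD[OF f] z(1)]) (use z(2) in blast)
  show "linear (DD f (z s))" if "s \<in> J" for s by (rule linear_DD[OF f z(2)[OF that]])
qed (rule w)

locale chaplygin_path = chaplygin_system S
  for S :: "('q, 'e::real_inner, 'm, 'f::real_inner, 'g, 'h::real_inner) chaplygin" +
  fixes t0 t1 :: real and X :: "real \<Rightarrow> ('q, 'e) tvec"
  assumes t01: "t0 < t1" and hp: "horizontal_path S t0 t1 X"
begin

abbreviation "I \<equiv> {t0..t1}"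
abbreviation "q t \<equiv> fst (X t)"

lemma fI: "fat I" by (rule fat_atLeastAtMost[OF t01])

lemma sq: "smooth_curve I Q (\<lambda>t. q t)"
  and X_vel: "t \<in> I \<Longrightarrow> velocity I Q (\<lambda>t. q t) t = X t"
  and X_hor: "t \<in> I \<Longrightarrow> X t \<in> hor S (q t)"
  using hp unfolding horizontal_path_def by (blast, metis, blast)

lemma qp: "t \<in> I \<Longrightarrow> q t \<in> pts Q"
  using sq unfolding smooth_curve_def by blast

lemma XT: "t \<in> I \<Longrightarrow> X t \<in> tan_space Q (q t)"
  by (rule hor_tan[OF qp X_hor])

lemma chart_at_q: "t \<in> I \<Longrightarrow> \<exists>c. c \<in> charts_at Q (q t)"
  using qp pts_iff by metis

lemma path_local:
  assumes t: "t \<in> I" and c: "c \<in> charts_at Q (q t)"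
  obtains V where "open V" "t \<in> V" "\<And>s. s \<in> I \<inter> V \<Longrightarrow> c \<in> charts_at Q (q s)"
    "smooth_on (I \<inter> V) (\<lambda>s. snd c (q s))" "smooth_on (I \<inter> V) (\<lambda>s. snd (X s) c)"
proof -
  obtain V where V: "open V" "t \<in> V" "\<And>s. s \<in> I \<inter> V \<Longrightarrow> q s \<in> fst c" "smooth_on (I \<inter> V) (\<lambda>s. snd c (q s))"
    using smooth_curve_local[OF manQ fI sq t c] by metis
  have c': "c \<in> charts_at Q (q s)" if "s \<in> I \<inter> V" for s using V(3)[OF that] c by (simp add: charts_at_iff)
  have "smooth_on (I \<inter> V) (\<lambda>s. vector_derivative (\<lambda>s. snd c (q s)) (at s within I))"
    by (rule smooth_vector_derivative[OF manQ fI V(1,4)])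
  then have "smooth_on (I \<inter> V) (\<lambda>s. snd (X s) c)"
  proof (rule smooth_cong[THEN iffD1, rotated])
    fix s assume s: "s \<in> I \<inter> V"
    then have "((\<lambda>s. snd c (q s)) has_vector_derivative snd (X s) c) (at s within I)"
      using velocity_coord[OF manQ fI sq _ c'[OF s]] X_vel by auto
    then show "vector_derivative (\<lambda>s. snd c (q s)) (at s within I) = snd (X s) c"
      using has_vector_derivative_eq[OF manQ fI] s by blast
  qed
  then show ?thesis using that V c' by blast
qed

lemma q_derivative:
  "t \<in> I \<Longrightarrow> c \<in> charts_at Q (q t) \<Longrightarrow> ((\<lambda>s. snd c (q s)) has_vector_derivative snd (X t) c) (at t within I)"
  using velocity_coord[OF manQ fI sq] X_vel by metis

text \<open>Vector fields along the path. There is no end-point condition, so that vertical fields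
  with constant coefficient, as used in \<open>HLm_eq\<close>, belong to the class.\<close>

definition sec :: "(real \<Rightarrow> ('q, 'e) tvec) \<Rightarrow> bool" where
  "sec \<xi> \<longleftrightarrow> smooth_curve I (tan_atlas Q) \<xi> \<and> (\<forall>t\<in>I. \<xi> t \<in> tan_space Q (q t))"

lemma sec_in: "sec \<xi> \<Longrightarrow> t \<in> I \<Longrightarrow> \<xi> t \<in> tan_space Q (q t)"
  by (simp add: sec_def)

lemma sec_chartI:
  assumes T: "\<And>t. t \<in> I \<Longrightarrow> \<xi> t \<in> tan_space Q (q t)"
    and loc: "\<And>t. t \<in> I \<Longrightarrow> \<exists>c V. c \<in> charts_at Q (q t) \<and> open V \<and> t \<in> V \<and> smooth_on (I \<inter> V) (\<lambda>s. snd (\<xi> s) c)"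
  shows "sec \<xi>"
  unfolding sec_def
proof (intro conjI ballI T)
  show "smooth_curve I (tan_atlas Q) \<xi>"
  proof (rule smooth_curveI[OF man_tan[OF manQ] fI])
    fix t assume t: "t \<in> I"
    obtain c U where c: "c \<in> charts_at Q (q t)" and U: "open U" "t \<in> U" "smooth_on (I \<inter> U) (\<lambda>s. snd (\<xi> s) c)"
      using loc[OF t] by blast
    obtain V where V: "open V" "t \<in> V" "\<And>s. s \<in> I \<inter> V \<Longrightarrow> c \<in> charts_at Q (q s)"
      "smooth_on (I \<inter> V) (\<lambda>s. snd c (q s))"
      using path_local[OF t c] by metis
    let ?C = "tan_chart Q c"
    have f: "fst (\<xi> s) = q s" if "s \<in> I" for s by (rule tan_space_fst[OF T[OF that]])
    have "smooth_on (I \<inter> (V \<inter> U)) (\<lambda>s. (snd c (q s), snd (\<xi> s) c))"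
      by (rule smooth_Pair[OF smooth_subset[OF V(4)] smooth_subset[OF U(3)]]) auto
    then have "smooth_on (I \<inter> (V \<inter> U)) (\<lambda>s. snd ?C (\<xi> s))"
      by (rule smooth_cong[THEN iffD1, rotated]) (simp add: f)
    moreover have "\<xi> s \<in> fst ?C" if "s \<in> I \<inter> (V \<inter> U)" for s
      using V(3)[of s] T[of s] f[of s] that by (simp add: tan_chart_domain charts_at_iff)
    moreover have "?C \<in> tan_atlas Q" using c by (simp add: tan_atlas_def charts_at_iff)
    ultimately show "\<exists>c\<in>tan_atlas Q. \<exists>V. open V \<and> t \<in> V \<and> (\<forall>s\<in>I\<inter>V. \<xi> s \<in> fst c) \<and> smooth_on (I \<inter> V) (\<lambda>s. snd c (\<xi> s))"
      using V(1,2) U(1,2) by (intro bexI[of _ ?C] exI[of _ "V \<inter> U"]) auto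
  qed
qed

lemma secI:
  assumes T: "\<And>t. t \<in> I \<Longrightarrow> \<xi> t \<in> tan_space Q (q t)"
    and loc: "\<And>t c V. t \<in> I \<Longrightarrow> c \<in> charts_at Q (q t) \<Longrightarrow> open V \<Longrightarrow> t \<in> V \<Longrightarrow> (\<And>s. s \<in> I \<inter> V \<Longrightarrow> c \<in> charts_at Q (q s)) \<Longrightarrow>
      smooth_on (I \<inter> V) (\<lambda>s. snd c (q s)) \<Longrightarrow> smooth_on (I \<inter> V) (\<lambda>s. snd (X s) c) \<Longrightarrow>
      \<exists>V. open V \<and> t \<in> V \<and> smooth_on (I \<inter> V) (\<lambda>s. snd (\<xi> s) c)"
  shows "sec \<xi>"
proof (rule sec_chartI[OF T])
  fix t assume t: "t \<in> I"
  obtain c where c: "c \<in> charts_at Q (q t)" using chart_at_q[OF t] by blast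
  obtain V where V: "open V" "t \<in> V" "\<And>s. s \<in> I \<inter> V \<Longrightarrow> c \<in> charts_at Q (q s)"
    "smooth_on (I \<inter> V) (\<lambda>s. snd c (q s))" "smooth_on (I \<inter> V) (\<lambda>s. snd (X s) c)"
    using path_local[OF t c] by metis
  from loc[OF t c V] c
  show "\<exists>c V. c \<in> charts_at Q (q t) \<and> open V \<and> t \<in> V \<and> smooth_on (I \<inter> V) (\<lambda>s. snd (\<xi> s) c)" by blast
qed

lemma sec_local:
  assumes \<xi>: "sec \<xi>" and t: "t \<in> I" and c: "c \<in> charts_at Q (q t)"
  obtains V where "open V" "t \<in> V" "\<And>s. s \<in> I \<inter> V \<Longrightarrow> c \<in> charts_at Q (q s)"
    "smooth_on (I \<inter> V) (\<lambda>s. snd c (q s))" "smooth_on (I \<inter> V) (\<lambda>s. snd (X s) c)" "smooth_on (I \<inter> V) (\<lambda>s. snd (\<xi> s) c)"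
proof -
  obtain V where V: "open V" "t \<in> V" "\<And>s. s \<in> I \<inter> V \<Longrightarrow> c \<in> charts_at Q (q s)"
    "smooth_on (I \<inter> V) (\<lambda>s. snd c (q s))" "smooth_on (I \<inter> V) (\<lambda>s. snd (X s) c)"
    using path_local[OF t c] by metis
  have s: "smooth_curve I (tan_atlas Q) \<xi>" using \<xi> by (simp add: sec_def)
  obtain U where U: "open U" "t \<in> U" "smooth_on (I \<inter> U) (\<lambda>s. snd (tan_chart Q c) (\<xi> s))"
    using smooth_curve_local[OF man_tan[OF manQ] fI s t charts_at_tanI[OF c sec_in[OF \<xi> t]]] by metis
  have "smooth_on (I \<inter> U) (\<lambda>s. snd (snd (tan_chart Q c) (\<xi> s)))" by (rule smooth_snd[OF U(3)])
  then have U3: "smooth_on (I \<inter> U) (\<lambda>s. snd (\<xi> s) c)" by simp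
  show ?thesis
  proof (rule that[of "V \<inter> U"])
    show "smooth_on (I \<inter> (V \<inter> U)) (\<lambda>s. snd c (q s))" by (rule smooth_subset[OF V(4)]) blast
    show "smooth_on (I \<inter> (V \<inter> U)) (\<lambda>s. snd (X s) c)" by (rule smooth_subset[OF V(5)]) blast
    show "smooth_on (I \<inter> (V \<inter> U)) (\<lambda>s. snd (\<xi> s) c)" by (rule smooth_subset[OF U3]) blast
  qed (use V U in auto)
qed

lemma smooth_on_I:
  assumes "\<And>t. t \<in> I \<Longrightarrow> \<exists>V. open V \<and> t \<in> V \<and> smooth_on (I \<inter> V) f"
  shows "smooth_on I f"
  by (rule smooth_local[OF fI assms])

definition sdot :: "(real \<Rightarrow> ('q, 'e) tvec) \<Rightarrow> ('q, 'e) chart \<Rightarrow> real \<Rightarrow> 'e" where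
  "sdot \<xi> c t = vector_derivative (\<lambda>s. snd (\<xi> s) c) (at t within I)"

lemma sdot:
  assumes "sec \<xi>" "t \<in> I" "c \<in> charts_at Q (q t)"
  shows "((\<lambda>s. snd (\<xi> s) c) has_vector_derivative sdot \<xi> c t) (at t within I)"
proof -
  obtain V where "open V" "t \<in> V" "smooth_on (I \<inter> V) (\<lambda>s. snd (\<xi> s) c)" using sec_local[OF assms] by metis
  then show ?thesis unfolding sdot_def using smooth_has_vector_derivative[OF manQ fI] assms(2) by blast
qed

lemma sdot_eqI:
  "t \<in> I \<Longrightarrow> ((\<lambda>s. snd (\<xi> s) c) has_vector_derivative w) (at t within I) \<Longrightarrow> sdot \<xi> c t = w"
  unfolding sdot_def by (rule has_vector_derivative_eq[OF manQ fI])

lemma sec_tadd: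
  assumes "sec \<xi>" "sec \<zeta>" shows "sec (\<lambda>s. tadd (\<xi> s) (\<zeta> s))"
proof (rule secI)
  show "tadd (\<xi> t) (\<zeta> t) \<in> tan_space Q (q t)" if "t \<in> I" for t
    using tadd_in[OF manQ sec_in[OF assms(1) that] sec_in[OF assms(2) that]] .
  fix t c assume t: "t \<in> I" "c \<in> charts_at Q (q t)"
  obtain V where V: "open V" "t \<in> V" "smooth_on (I \<inter> V) (\<lambda>s. snd (\<xi> s) c)" using sec_local[OF assms(1) t] by metis
  obtain U where U: "open U" "t \<in> U" "smooth_on (I \<inter> U) (\<lambda>s. snd (\<zeta> s) c)" using sec_local[OF assms(2) t] by metis
  have "smooth_on (I \<inter> (V \<inter> U)) (\<lambda>s. snd (\<xi> s) c + snd (\<zeta> s) c)"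
    by (rule smooth_add[OF smooth_subset[OF V(3)] smooth_subset[OF U(3)]]) auto
  then show "\<exists>V. open V \<and> t \<in> V \<and> smooth_on (I \<inter> V) (\<lambda>s. snd (tadd (\<xi> s) (\<zeta> s)) c)"
    using V U by (intro exI[of _ "V \<inter> U"]) (simp add: open_Int)
qed

lemma sec_tdiff:
  assumes "sec \<xi>" "sec \<zeta>" shows "sec (\<lambda>s. tdiff (\<xi> s) (\<zeta> s))"
proof (rule secI)
  show "tdiff (\<xi> t) (\<zeta> t) \<in> tan_space Q (q t)" if "t \<in> I" for t
    using tdiff_in[OF manQ sec_in[OF assms(1) that] sec_in[OF assms(2) that]] .
  fix t c assume t: "t \<in> I" "c \<in> charts_at Q (q t)"
  obtain V where V: "open V" "t \<in> V" "smooth_on (I \<inter> V) (\<lambda>s. snd (\<xi> s) c)" using sec_local[OF assms(1) t] by metis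
  obtain U where U: "open U" "t \<in> U" "smooth_on (I \<inter> U) (\<lambda>s. snd (\<zeta> s) c)" using sec_local[OF assms(2) t] by metis
  have "smooth_on (I \<inter> (V \<inter> U)) (\<lambda>s. snd (\<xi> s) c - snd (\<zeta> s) c)"
    by (rule smooth_diff[OF smooth_subset[OF V(3)] smooth_subset[OF U(3)]]) auto
  then show "\<exists>V. open V \<and> t \<in> V \<and> smooth_on (I \<inter> V) (\<lambda>s. snd (tdiff (\<xi> s) (\<zeta> s)) c)"
    using V U by (intro exI[of _ "V \<inter> U"]) (simp add: open_Int)
qed

text \<open>The tangent lift of \<open>\<xi>\<close> has base point \<open>\<xi> t\<close> and base
  component \<open>X t\<close>. The flip exchanges the two, so the variation sits over
  \<open>X t\<close> and moves the path in the direction \<open>\<xi> t\<close>.\<close>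

lemma variation_coord:
  assumes \<xi>: "sec \<xi>" and t: "t \<in> I" and c: "c \<in> charts_at Q (q t)"
  shows "variation S t0 t1 \<xi> t \<in> tan_space (tan_atlas Q) (X t)"
    and "snd (variation S t0 t1 \<xi> t) (tan_chart Q c) = (snd (\<xi> t) c, sdot \<xi> c t)"
proof -
  let ?C = "tan_chart Q c" and ?T = "tan_atlas Q"
  note mT = man_tan[OF manQ]
  have s\<xi>: "smooth_curve I ?T \<xi>" using \<xi> by (simp add: sec_def)
  note \<xi>t = sec_in[OF \<xi> t]
  note C = charts_at_tanI[OF c \<xi>t]
  have f: "fst (\<xi> s) = q s" if "s \<in> I" for s by (rule tan_space_fst[OF sec_in[OF \<xi> that]])
  have "((\<lambda>s. (snd c (q s), snd (\<xi> s) c)) has_vector_derivative (snd (X t) c, sdot \<xi> c t)) (at t within I)"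
    by (rule has_vector_derivative_Pair[OF q_derivative[OF t c] sdot[OF \<xi> t c]])
  then have "((\<lambda>s. snd ?C (\<xi> s)) has_vector_derivative (snd (X t) c, sdot \<xi> c t)) (at t within I)"
    by (rule has_vector_derivative_transform[OF t, rotated]) (simp add: f)
  then have "snd (velocity I ?T \<xi> t) ?C = (snd (X t) c, sdot \<xi> c t)"
    by (rule velocity_coordI[where ?\<gamma> = \<xi>, OF mT fI t C])
  from canonical_flip_coord[OF manQ \<xi>t velocity_in[OF mT fI s\<xi> t] c this]
  show "variation S t0 t1 \<xi> t \<in> tan_space (tan_atlas Q) (X t)"
    "snd (variation S t0 t1 \<xi> t) (tan_chart Q c) = (snd (\<xi> t) c, sdot \<xi> c t)"
    unfolding variation_def tvec_collapse[OF manQ XT[OF t] c] by auto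
qed

subsection \<open>Vertical and horizontal parts\<close>

text \<open>The vertical part of a section, read as a curve in the model space of the Lie algebra;
  \<open>vsec\<close> leads back.\<close>

definition beta :: "(real \<Rightarrow> ('q, 'e) tvec) \<Rightarrow> real \<Rightarrow> 'h" where
  "beta \<xi> s = snd (omega S (\<xi> s)) g0"

definition vsec :: "(real \<Rightarrow> 'h) \<Rightarrow> real \<Rightarrow> ('q, 'e) tvec" where
  "vsec \<beta> s = fundamental S (lv (\<beta> s)) (q s)"

definition hpart :: "(real \<Rightarrow> ('q, 'e) tvec) \<Rightarrow> real \<Rightarrow> ('q, 'e) tvec" where
  "hpart \<xi> s = tdiff (\<xi> s) (vsec (beta \<xi>) s)"

lemma beta_coord:
  "sec \<xi> \<Longrightarrow> s \<in> I \<Longrightarrow> c \<in> charts_at Q (q s) \<Longrightarrow> beta \<xi> s = wcoord c (snd c (q s)) (snd (\<xi> s) c)"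
  unfolding beta_def by (rule omega_coord[OF sec_in])

lemma smooth_beta:
  assumes \<xi>: "sec \<xi>" shows "smooth_on I (beta \<xi>)"
proof (rule smooth_on_I)
  fix t assume t: "t \<in> I"
  obtain c where c: "c \<in> charts_at Q (q t)" using chart_at_q[OF t] by blast
  then have cQ: "c \<in> Q" by (simp add: charts_at_iff)
  obtain V where V: "open V" "t \<in> V" "\<And>s. s \<in> I \<inter> V \<Longrightarrow> c \<in> charts_at Q (q s)"
    "smooth_on (I \<inter> V) (\<lambda>s. snd c (q s))" "smooth_on (I \<inter> V) (\<lambda>s. snd (\<xi> s) c)"
    using sec_local[OF \<xi> t c] by metis
  have xi: "snd c (q s) \<in> snd c ` fst c" if "s \<in> I \<inter> V" for s using V(3)[OF that] by (auto simp: charts_at_iff)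
  have "smooth_on (I \<inter> V) (\<lambda>s. wcoord c (snd c (q s)) (snd (\<xi> s) c))"
    by (rule smooth_apply[OF fin_dims(1) smooth_compose[OF fin_dims(1) wcoord(1)[OF cQ] V(4)] wcoord(2)[OF cQ] V(5)])
       (use xi in blast)+
  then have "smooth_on (I \<inter> V) (beta \<xi>)"
    by (rule smooth_cong[THEN iffD1, rotated]) (subst beta_coord[OF \<xi> _ V(3)], auto)
  then show "\<exists>V. open V \<and> t \<in> V \<and> smooth_on (I \<inter> V) (beta \<xi>)" using V by blast
qed

lemma vsec_coord: "c \<in> charts_at Q (q s) \<Longrightarrow> snd (vsec \<beta> s) c = fcoord c (snd c (q s)) (\<beta> s)"
  unfolding vsec_def using fundamental_coord[OF lv(1)] by (simp add: lv)

lemma sec_vsec: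
  assumes \<beta>: "smooth_on I \<beta>" shows "sec (vsec \<beta>)"
proof (rule secI)
  show "vsec \<beta> t \<in> tan_space Q (q t)" if "t \<in> I" for t
    unfolding vsec_def by (rule fundamental_in[OF lv(1) qp[OF that]])
  fix t c V assume t: "t \<in> I" "c \<in> charts_at Q (q t)" and V: "open V" "t \<in> V" "\<And>s. s \<in> I \<inter> V \<Longrightarrow> c \<in> charts_at Q (q s)"
    "smooth_on (I \<inter> V) (\<lambda>s. snd c (q s))"
  have cQ: "c \<in> Q" using t by (simp add: charts_at_iff)
  have xi: "snd c (q s) \<in> snd c ` fst c" if "s \<in> I \<inter> V" for s using V(3)[OF that] by (auto simp: charts_at_iff)
  have "smooth_on (I \<inter> V) (\<lambda>s. fcoord c (snd c (q s)) (\<beta> s))"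
    by (rule smooth_apply[OF fin_dims(3) smooth_compose[OF fin_dims(1) fcoord(1)[OF cQ] V(4)] fcoord(2)[OF cQ]
        smooth_subset[OF \<beta>]]) (use xi in blast)+
  then have "smooth_on (I \<inter> V) (\<lambda>s. snd (vsec \<beta> s) c)"
    by (rule smooth_cong[THEN iffD1, rotated]) (simp add: vsec_coord V(3))
  then show "\<exists>V. open V \<and> t \<in> V \<and> smooth_on (I \<inter> V) (\<lambda>s. snd (vsec \<beta> s) c)" using V by blast
qed

lemma beta_vsec: "s \<in> I \<Longrightarrow> beta (vsec \<beta>) s = \<beta> s"
  unfolding beta_def vsec_def using omega_fundamental[OF qp lv(1)] by (simp add: lv)

lemma hpart:
  assumes \<xi>: "sec \<xi>"
  shows "sec (hpart \<xi>)" "t \<in> I \<Longrightarrow> hpart \<xi> t \<in> hor S (q t)" "t \<in> I \<Longrightarrow> tadd (hpart \<xi> t) (vsec (beta \<xi>) t) = \<xi> t"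
proof -
  show "sec (hpart \<xi>)"
    unfolding hpart_def[abs_def] by (rule sec_tdiff[OF \<xi> sec_vsec[OF smooth_beta[OF \<xi>]]])
  show "hpart \<xi> t \<in> hor S (q t)" if t: "t \<in> I"
    using omega[OF qp[OF t] sec_in[OF \<xi> t]] lv(3) by (simp add: hpart_def vsec_def beta_def)
  show "tadd (hpart \<xi> t) (vsec (beta \<xi>) t) = \<xi> t" if "t \<in> I"
    by (rule prod_eqI) (auto simp: hpart_def tadd_def tdiff_def tscale_def)
qed

lemma beta_hor: "sec \<xi> \<Longrightarrow> t \<in> I \<Longrightarrow> \<xi> t \<in> hor S (q t) \<Longrightarrow> beta \<xi> t = 0"
  unfolding beta_def using omega_zero_iff[OF qp sec_in, THEN iffD2] by simp

definition bdot :: "(real \<Rightarrow> 'h) \<Rightarrow> real \<Rightarrow> 'h" where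
  "bdot \<beta> t = vector_derivative \<beta> (at t within I)"

lemma bdot:
  assumes "smooth_on I \<beta>" "t \<in> I"
  shows "(\<beta> has_vector_derivative bdot \<beta> t) (at t within I)" "smooth_on I (bdot \<beta>)"
  unfolding bdot_def
  using smooth_has_vector_derivative[OF manQ fI, of UNIV t \<beta>] smooth_vector_derivative[OF manQ fI, of UNIV \<beta>] assms by auto

lemma bdot_eqI: "t \<in> I \<Longrightarrow> (\<beta> has_vector_derivative w) (at t within I) \<Longrightarrow> bdot \<beta> t = w"
  unfolding bdot_def by (rule has_vector_derivative_eq[OF manQ fI])

text \<open>This and \<open>Rm\<close> are the two tensors along the path with \<open>X t\<close> in
  the first slot, their values read through \<open>g0\<close>.\<close>

definition Bm :: "real \<Rightarrow> 'h \<Rightarrow> 'h" where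
  "Bm t b = snd (bmap S (q t) (proj_push S (X t)) (lv b)) g0"

definition Rm :: "real \<Rightarrow> ('q, 'e) tvec \<Rightarrow> 'h" where
  "Rm t Y = snd (curvature S (q t) (proj_push S (X t)) (proj_push S Y)) g0"

context
  fixes t c
  assumes t: "t \<in> I" and c: "c \<in> charts_at Q (q t)"
begin

lemma Bm_coord: "Bm t b = wform c (snd c (q t)) (snd (X t) c) (fcoord c (snd c (q t)) b)"
  unfolding Bm_def
  using bmap_coord(2)[OF qp[OF t] proj_push_in[OF XT[OF t] qp[OF t]] lv(1) c] hlift_eqI[OF qp[OF t] X_hor[OF t]]
    fundamental_coord[OF lv(1) c] by (simp add: lv)

lemma Rm_coord:
  assumes Y: "Y \<in> hor S (q t)"
  shows "Rm t Y = wform c (snd c (q t)) (snd (X t) c) (snd Y c)"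
  unfolding Rm_def
  using curvature_coord(2)[OF qp[OF t] proj_push_in[OF XT[OF t] qp[OF t]]
      proj_push_in[OF hor_tan[OF qp[OF t] Y] qp[OF t]] c]
    hlift_eqI[OF qp[OF t] X_hor[OF t]] hlift_eqI[OF qp[OF t] Y] by simp

text \<open>The derivative of \<open>beta \<xi>\<close> along the path is the left side with
  \<open>X\<close> and \<open>\<xi>\<close> exchanged in its first term. The difference is
  \<open>wform\<close> on \<open>X\<close> and \<open>\<xi>\<close>, and linearity splits it along
  the vertical and horizontal parts of \<open>\<xi>\<close>.\<close>

lemma delta_omega:
  assumes \<xi>: "sec \<xi>"
  shows "DD (\<lambda>y. wcoord c y (snd (X t) c)) (snd c (q t)) (snd (\<xi> t) c) + wcoord c (snd c (q t)) (sdot \<xi> c t)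
    = bdot (beta \<xi>) t + Bm t (beta \<xi> t) + Rm t (hpart \<xi> t)"
proof -
  have cQ: "c \<in> Q" "q t \<in> fst c" using c by (auto simp: charts_at_iff)
  let ?x = "snd c (q t)" and ?v = "snd (X t) c" and ?\<eta> = "snd (\<xi> t) c"
  have xi: "?x \<in> snd c ` fst c" using cQ by blast
  obtain V where V: "open V" "t \<in> V" "\<And>s. s \<in> I \<inter> V \<Longrightarrow> c \<in> charts_at Q (q s)"
    using path_local[OF t c] by metis
  have "((\<lambda>s. (snd c (q s), snd (\<xi> s) c)) has_derivative (\<lambda>r. r *\<^sub>R (?v, sdot \<xi> c t))) (at t within I)"
    using has_vector_derivative_Pair[OF q_derivative[OF t c] sdot[OF \<xi> t c]] by (simp add: has_vector_derivative_def)
  from has_derivative_compose[OF this wjoint(2)[OF cQ(1) xi]]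
  have D: "((\<lambda>s. wjoint c (snd c (q s), snd (\<xi> s) c)) has_derivative
      (\<lambda>r. (\<lambda>(h, k). DD (\<lambda>y. wcoord c y ?\<eta>) ?x h + wcoord c ?x k) (r *\<^sub>R (?v, sdot \<xi> c t)))) (at t within I)" .
  have lin: "(\<lambda>(h, k). DD (\<lambda>y. wcoord c y ?\<eta>) ?x h + wcoord c ?x k) (r *\<^sub>R (?v, sdot \<xi> c t))
      = r *\<^sub>R (DD (\<lambda>y. wcoord c y ?\<eta>) ?x ?v + wcoord c ?x (sdot \<xi> c t))" for r
    using linear_cmul[OF has_derivative_linear[OF wjoint(2)[OF cQ(1) xi, of ?\<eta>]], of r "(?v, sdot \<xi> c t)"] by simp
  have "((\<lambda>s. wjoint c (snd c (q s), snd (\<xi> s) c)) has_vector_derivative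
      DD (\<lambda>y. wcoord c y ?\<eta>) ?x ?v + wcoord c ?x (sdot \<xi> c t)) (at t within I \<inter> V)"
    using D unfolding has_vector_derivative_def has_derivative_at_within_Int_open[OF V(2,1)] lin .
  then have "(beta \<xi> has_vector_derivative DD (\<lambda>y. wcoord c y ?\<eta>) ?x ?v + wcoord c ?x (sdot \<xi> c t)) (at t within I \<inter> V)"
  proof (rule has_vector_derivative_transform[rotated 2])
    show "t \<in> I \<inter> V" using t V by blast
    show "beta \<xi> s = wjoint c (snd c (q s), snd (\<xi> s) c)" if "s \<in> I \<inter> V" for s
      using beta_coord[OF \<xi> _ V(3)[OF that]] that by (simp add: wjoint_def)
  qed
  then have "(beta \<xi> has_vector_derivative DD (\<lambda>y. wcoord c y ?\<eta>) ?x ?v + wcoord c ?x (sdot \<xi> c t)) (at t within I)"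
    unfolding has_vector_derivative_def has_derivative_at_within_Int_open[OF V(2,1)] .
  then have b: "bdot (beta \<xi>) t = DD (\<lambda>y. wcoord c y ?\<eta>) ?x ?v + wcoord c ?x (sdot \<xi> c t)"
    by (rule bdot_eqI[OF t])
  have "?\<eta> = snd (hpart \<xi> t) c + fcoord c ?x (beta \<xi> t)"
    using arg_cong[OF hpart(3)[OF \<xi> t], of "\<lambda>Z. snd Z c"] vsec_coord[OF c] by simp
  then have "wform c ?x ?v ?\<eta> = Rm t (hpart \<xi> t) + Bm t (beta \<xi> t)"
    using linear_add[OF linear_wform[OF cQ(1) xi]] Bm_coord Rm_coord[OF hpart(2)[OF \<xi> t]] by simp
  then show ?thesis unfolding b by (simp add: wform_def algebra_simps)
qed

end

lemma variation_tangent_iff: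
  assumes \<xi>: "sec \<xi>" and t: "t \<in> I"
  shows "variation S t0 t1 \<xi> t \<in> sub_tan_space (tan_atlas Q) (horizontal_bundle S) (X t) \<longleftrightarrow>
    bdot (beta \<xi>) t + Bm t (beta \<xi> t) + Rm t (hpart \<xi> t) = 0"
proof -
  obtain c where c: "c \<in> charts_at Q (q t)" using chart_at_q[OF t] by blast
  show ?thesis
    using sub_tan_horizontal[OF X_hor[OF t] c variation_coord[OF \<xi> t c]] delta_omega[OF t c \<xi>] by simp
qed

definition av :: "(('q, 'e) tvec \<Rightarrow> real) \<Rightarrow> (real \<Rightarrow> ('q, 'e) tvec) \<Rightarrow> real \<Rightarrow> real" where
  "av L \<xi> t = differential (tan_atlas Q) L (variation S t0 t1 \<xi> t)"

text \<open>\<open>m\<close> stands for the multiplier at one fixed time. Its composite with the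
  connection form is \<open>m\<close> after \<open>wjoint\<close> in coordinates, so
  \<open>delta_omega\<close> gives its derivative along a variation.\<close>

lemma differential_omega:
  assumes \<xi>: "sec \<xi>" and t: "t \<in> I" and m: "linear m" and L: "smooth_lagrangian S L"
  shows "differential (tan_atlas Q) (\<lambda>Z. L Z - m (snd (omega S Z) g0)) (variation S t0 t1 \<xi> t)
    = av L \<xi> t - m (bdot (beta \<xi>) t + Bm t (beta \<xi> t) + Rm t (hpart \<xi> t))"
proof -
  obtain c where c: "c \<in> charts_at Q (q t)" using chart_at_q[OF t] by blast
  have cQ: "c \<in> Q" "q t \<in> fst c" using c by (auto simp: charts_at_iff)
  let ?x = "snd c (q t)" and ?v = "snd (X t) c" and ?C = "tan_chart Q c"
  have xi: "?x \<in> snd c ` fst c" using cQ by blast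
  note va = variation_coord[OF \<xi> t c]
  note C = charts_at_tanI[OF c XT[OF t]]
  let ?D = "\<lambda>z. DD (lcoord L c) (?x, ?v) z - m ((\<lambda>(h, k). DD (\<lambda>y. wcoord c y ?v) ?x h + wcoord c ?x k) z)"
  have bm: "bounded_linear m" by (rule fin_dim_bounded_linear[OF fin_dims(3) m])
  have "((\<lambda>z. lcoord L c z - m (wjoint c z)) has_derivative ?D) (at (?x, ?v))"
    by (intro has_derivative_diff lcoord_has_derivative[OF L c] bounded_linear.has_derivative[OF bm] wjoint(2)[OF cQ(1) xi])
  then have "((\<lambda>z. L (chart_inv ?C z) - m (snd (omega S (chart_inv ?C z)) g0)) has_derivative ?D) (at (?x, ?v))"
  proof (rule has_derivative_transform_within_open[OF _ smooth_lcoord(2)[OF L cQ(1)]])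
    show "(?x, ?v) \<in> (snd c ` fst c) \<times> UNIV" using xi by simp
    fix z assume z: "z \<in> (snd c ` fst c) \<times> (UNIV :: 'e set)"
    then have "chart_inv ?C z = tvec Q c (chart_inv c (fst z)) (snd z)"
      using chart_inv_tan_chart[OF manQ cQ(1), of "fst z" "snd z"] by auto
    then show "lcoord L c z - m (wjoint c z) = L (chart_inv ?C z) - m (snd (omega S (chart_inv ?C z)) g0)"
      by (simp add: lcoord_def wjoint_def wcoord_def)
  qed
  then have "((\<lambda>z. L (chart_inv ?C z) - m (snd (omega S (chart_inv ?C z)) g0)) has_derivative ?D) (at (snd ?C (X t)))"
    by simp
  from differential_coord[OF man_tan[OF manQ] va(1) C this]
  have "differential (tan_atlas Q) (\<lambda>Z. L Z - m (snd (omega S Z) g0)) (variation S t0 t1 \<xi> t) = ?D (snd (\<xi> t) c, sdot \<xi> c t)"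
    by (simp only: va(2))
  then show ?thesis
    using differential_lcoord[OF L XT[OF t] c va(1)] delta_omega[OF t c \<xi>] by (simp add: av_def va(2))
qed

end

locale chaplygin_lagrangian = chaplygin_path S t0 t1 X
  for S :: "('q, 'e::real_inner, 'm, 'f::real_inner, 'g, 'h::real_inner) chaplygin" and t0 t1 X +
  fixes L :: "('q, 'e) tvec \<Rightarrow> real"
  assumes L: "smooth_lagrangian S L"
begin

definition FLm :: "real \<Rightarrow> 'h \<Rightarrow> real" where "FLm t b = FL S L (X t) (lv b)"
definition HLm :: "real \<Rightarrow> 'h \<Rightarrow> real" where "HLm t b = HL S L (X t) (lv b)"

lemma av_coord:
  assumes "sec \<xi>" "t \<in> I" "c \<in> charts_at Q (q t)"
  shows "av L \<xi> t = DD (lcoord L c) (snd c (q t), snd (X t) c) (snd (\<xi> t) c, sdot \<xi> c t)"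
  using differential_lcoord[OF L XT[OF assms(2)] assms(3)] variation_coord[OF assms] by (simp add: av_def)

lemma FLm_coord:
  "t \<in> I \<Longrightarrow> c \<in> charts_at Q (q t) \<Longrightarrow>
    FLm t b = DD (lcoord L c) (snd c (q t), snd (X t) c) (0, fcoord c (snd c (q t)) b)"
  unfolding FLm_def using FL_coord[OF L XT _ lv(1)] by (simp add: lv)

lemma av_vsec:
  assumes \<beta>: "smooth_on I \<beta>" and t: "t \<in> I"
  shows "av L (vsec \<beta>) t = HLm t (\<beta> t) + FLm t (bdot \<beta> t + Bm t (\<beta> t))"
proof -
  obtain c where c: "c \<in> charts_at Q (q t)" using chart_at_q[OF t] by blast
  obtain d where d: "d \<in> charts_at M (\<pi> (q t))" using proj_in[OF qp[OF t]] pts_iff by metis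
  have cQ: "c \<in> Q" "q t \<in> fst c" "d \<in> M" using c d by (auto simp: charts_at_iff)
  let ?x = "snd c (q t)" and ?v = "snd (X t) c"
  define f y where "f = fcoord c ?x (\<beta> t)" and "y = snd (proj_push S (X t)) d"
  have xi: "?x \<in> snd c ` fst c" using cQ by blast
  note xN = proj_dom_mem[OF c d]
  note o = open_chart[OF manQ cQ(1)]
  note s = sec_vsec[OF \<beta>]
  obtain V where V: "open V" "t \<in> V" "\<And>s. s \<in> I \<inter> V \<Longrightarrow> c \<in> charts_at Q (q s)"
    using path_local[OF t c] by metis
  have vy: "?v = hcoord c d ?x y"
    using hlift_coord[OF proj_push_in[OF XT[OF t] qp[OF t]] c d] hlift_eqI[OF qp[OF t] X_hor[OF t]] by (simp add: y_def)
  have qd: "((\<lambda>s. snd c (q s)) has_derivative (\<lambda>r. r *\<^sub>R ?v)) (at t within I \<inter> V)"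
    using q_derivative[OF t c] unfolding has_vector_derivative_def has_derivative_at_within_Int_open[OF V(2,1)] .
  have bd: "(\<beta> has_derivative (\<lambda>r. r *\<^sub>R bdot \<beta> t)) (at t within I \<inter> V)"
    using bdot(1)[OF \<beta> t] unfolding has_vector_derivative_def has_derivative_at_within_Int_open[OF V(2,1)] .
  have T: "((\<lambda>s. fcoord c (snd c (q s)) b) has_derivative (\<lambda>r. DD (\<lambda>z. fcoord c z b) ?x (r *\<^sub>R ?v))) (at t within I \<inter> V)" for b
    by (rule has_derivative_compose[OF qd smooth_has_derivative[OF fcoord(1)[OF cQ(1)] o xi]])
  have l: "linear (fcoord c (snd c (q s)))" if "s \<in> I \<inter> V" for s using linear_fcoord[OF V(3)[OF that]] .
  have tV: "t \<in> I \<inter> V" using t V by blast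
  have "((\<lambda>s. fcoord c (snd c (q s)) (\<beta> s)) has_derivative
      (\<lambda>r. DD (\<lambda>z. fcoord c z (\<beta> t)) ?x (r *\<^sub>R ?v) + fcoord c ?x (r *\<^sub>R bdot \<beta> t))) (at t within I \<inter> V)"
    by (rule has_derivative_apply[OF fin_dims(3) T l bd tV fat_Int_open[OF fI V(1)]])
  moreover have "DD (\<lambda>z. fcoord c z (\<beta> t)) ?x (r *\<^sub>R ?v) + fcoord c ?x (r *\<^sub>R bdot \<beta> t)
      = r *\<^sub>R (DD (\<lambda>z. fcoord c z (\<beta> t)) ?x ?v + fcoord c ?x (bdot \<beta> t))" for r
    by (simp add: linear_cmul[OF linear_DD[OF fcoord(1)[OF cQ(1)] o xi]] linear_cmul[OF linear_fcoord[OF c]] scaleR_add_right)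
  ultimately have "((\<lambda>s. fcoord c (snd c (q s)) (\<beta> s)) has_vector_derivative
      DD (\<lambda>z. fcoord c z (\<beta> t)) ?x ?v + fcoord c ?x (bdot \<beta> t)) (at t within I \<inter> V)"
    by (simp only: has_vector_derivative_def)
  then have "((\<lambda>s. snd (vsec \<beta> s) c) has_vector_derivative
      DD (\<lambda>z. fcoord c z (\<beta> t)) ?x ?v + fcoord c ?x (bdot \<beta> t)) (at t within I \<inter> V)"
    by (rule has_vector_derivative_transform[OF tV, rotated]) (rule vsec_coord[OF V(3)])
  then have "((\<lambda>s. snd (vsec \<beta> s) c) has_vector_derivative
      DD (\<lambda>z. fcoord c z (\<beta> t)) ?x ?v + fcoord c ?x (bdot \<beta> t)) (at t within I)"
    unfolding has_vector_derivative_def has_derivative_at_within_Int_open[OF V(2,1)] .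
  then have sd: "sdot (vsec \<beta>) c t = DD (\<lambda>z. fcoord c z (\<beta> t)) ?x ?v + fcoord c ?x (bdot \<beta> t)"
    by (rule sdot_eqI[OF t])
  \<comment> \<open>The derivative of the fundamental field along \<open>X\<close> is exchanged for
    that of the horizontal lift along the fundamental field; the price is the vertical vector of
    \<open>Bm\<close>.\<close>
  have "DD (\<lambda>z. fcoord c z (\<beta> t)) ?x ?v = DD (\<lambda>z. hcoord c d z y) ?x f + fcoord c ?x (Bm t (\<beta> t))"
    using bracket_vertical[OF cQ(1,3) xN vy f_def] Bm_coord[OF t c] by (simp add: f_def algebra_simps)
  \<comment> \<open>The first summand is the direction that defines \<open>HL\<close>; the second
    has no base component and defines \<open>FL\<close>.\<close>
  then have e: "(snd (vsec \<beta> t) c, sdot (vsec \<beta>) c t)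
      = (f, DD (\<lambda>z. hcoord c d z y) ?x f) + (0, fcoord c ?x (bdot \<beta> t + Bm t (\<beta> t)))"
    using vsec_coord[OF c, of \<beta>] by (simp add: sd f_def linear_add[OF linear_fcoord[OF c]])
  have "av L (vsec \<beta>) t = DD (lcoord L c) (?x, ?v) (f, DD (\<lambda>z. hcoord c d z y) ?x f)
      + DD (lcoord L c) (?x, ?v) (0, fcoord c ?x (bdot \<beta> t + Bm t (\<beta> t)))"
    unfolding av_coord[OF s t c] e by (rule linear_add[OF linear_lcoord[OF L c]])
  moreover have "HLm t (\<beta> t) = DD (lcoord L c) (?x, ?v) (f, DD (\<lambda>z. hcoord c d z y) ?x f)"
    unfolding HLm_def y_def by (rule HL_coord[OF L X_hor[OF t] c d lv(1)]) (simp add: f_def lv)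
  ultimately show ?thesis using FLm_coord[OF t c] by simp
qed

lemma av_tadd:
  assumes \<xi>: "sec \<xi>" and \<zeta>: "sec \<zeta>" and t: "t \<in> I"
  shows "av L (\<lambda>s. tadd (\<xi> s) (\<zeta> s)) t = av L \<xi> t + av L \<zeta> t"
proof -
  obtain c where c: "c \<in> charts_at Q (q t)" using chart_at_q[OF t] by blast
  have "((\<lambda>s. snd (tadd (\<xi> s) (\<zeta> s)) c) has_vector_derivative sdot \<xi> c t + sdot \<zeta> c t) (at t within I)"
    using has_vector_derivative_add[OF sdot[OF \<xi> t c] sdot[OF \<zeta> t c]] by simp
  then have "sdot (\<lambda>s. tadd (\<xi> s) (\<zeta> s)) c t = sdot \<xi> c t + sdot \<zeta> c t" by (rule sdot_eqI[OF t])
  then show ?thesis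
    unfolding av_coord[OF sec_tadd[OF \<xi> \<zeta>] t c] av_coord[OF \<xi> t c] av_coord[OF \<zeta> t c]
    using linear_add[OF linear_lcoord[OF L c], of "snd (X t) c" "(snd (\<xi> t) c, sdot \<xi> c t)" "(snd (\<zeta> t) c, sdot \<zeta> c t)"] by simp
qed

text \<open>The decomposition of \<open>\<xi>\<close> into its parts holds on \<open>I\<close> only,
  while \<open>av\<close> receives the whole function; as all derivatives are taken within
  \<open>I\<close>, the values outside do not enter.\<close>

lemma av_cong:
  assumes \<xi>: "sec \<xi>" and \<zeta>: "sec \<zeta>" and t: "t \<in> I" and eq: "\<And>s. s \<in> I \<Longrightarrow> \<xi> s = \<zeta> s"
  shows "av L \<xi> t = av L \<zeta> t"
proof -
  obtain c where c: "c \<in> charts_at Q (q t)" using chart_at_q[OF t] by blast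
  have "((\<lambda>s. snd (\<xi> s) c) has_vector_derivative sdot \<zeta> c t) (at t within I)"
    by (rule has_vector_derivative_transform[OF t _ sdot[OF \<zeta> t c]]) (simp add: eq)
  then have "sdot \<xi> c t = sdot \<zeta> c t" by (rule sdot_eqI[OF t])
  then show ?thesis by (simp add: av_coord[OF \<xi> t c] av_coord[OF \<zeta> t c] eq[OF t])
qed

lemma av_decomposition:
  assumes \<xi>: "sec \<xi>" and t: "t \<in> I"
  shows "av L \<xi> t = av L (hpart \<xi>) t + (HLm t (beta \<xi> t) + FLm t (bdot (beta \<xi>) t + Bm t (beta \<xi> t)))"
  using av_cong[OF \<xi> sec_tadd[OF hpart(1)[OF \<xi>] sec_vsec[OF smooth_beta[OF \<xi>]]] t hpart(3)[OF \<xi>, symmetric]]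
    av_tadd[OF hpart(1)[OF \<xi>] sec_vsec[OF smooth_beta[OF \<xi>]] t] av_vsec[OF smooth_beta[OF \<xi>] t] by simp

subsection \<open>Smoothness along the path\<close>

lemma smooth_av:
  assumes \<xi>: "sec \<xi>" shows "smooth_on I (av L \<xi>)"
proof (rule smooth_on_I)
  fix t assume t: "t \<in> I"
  obtain c where c: "c \<in> charts_at Q (q t)" using chart_at_q[OF t] by blast
  then have cQ: "c \<in> Q" by (simp add: charts_at_iff)
  obtain V where V: "open V" "t \<in> V" "\<And>s. s \<in> I \<inter> V \<Longrightarrow> c \<in> charts_at Q (q s)"
    "smooth_on (I \<inter> V) (\<lambda>s. snd c (q s))" "smooth_on (I \<inter> V) (\<lambda>s. snd (X s) c)" "smooth_on (I \<inter> V) (\<lambda>s. snd (\<xi> s) c)"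
    using sec_local[OF \<xi> t c] by metis
  have "smooth_on (I \<inter> V) (sdot \<xi> c)"
    unfolding sdot_def by (rule smooth_vector_derivative[OF manQ fI V(1,6)])
  then have "smooth_on (I \<inter> V) (\<lambda>s. DD (lcoord L c) (snd c (q s), snd (X s) c) (snd (\<xi> s) c, sdot \<xi> c s))"
    by (intro smooth_DD_along[OF fin_dim_prod[OF fin_dims(1) fin_dims(1)] smooth_lcoord[OF L cQ]] smooth_Pair V)
       (use V(3) in \<open>auto simp: charts_at_iff\<close>)
  then have "smooth_on (I \<inter> V) (av L \<xi>)"
    by (rule smooth_cong[THEN iffD1, rotated]) (subst av_coord[OF \<xi> _ V(3)], auto)
  then show "\<exists>V. open V \<and> t \<in> V \<and> smooth_on (I \<inter> V) (av L \<xi>)" using V by blast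
qed

lemma smooth_FLm: "smooth_on I (\<lambda>t. FLm t b)"
proof (rule smooth_on_I)
  fix t assume t: "t \<in> I"
  obtain c where c: "c \<in> charts_at Q (q t)" using chart_at_q[OF t] by blast
  then have cQ: "c \<in> Q" by (simp add: charts_at_iff)
  obtain V where V: "open V" "t \<in> V" "\<And>s. s \<in> I \<inter> V \<Longrightarrow> c \<in> charts_at Q (q s)"
    "smooth_on (I \<inter> V) (\<lambda>s. snd c (q s))" "smooth_on (I \<inter> V) (\<lambda>s. snd (X s) c)"
    using path_local[OF t c] by metis
  have xi: "snd c (q s) \<in> snd c ` fst c" if "s \<in> I \<inter> V" for s using V(3)[OF that] by (auto simp: charts_at_iff)
  have "smooth_on (I \<inter> V) (\<lambda>s. fcoord c (snd c (q s)) b)"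
    by (rule smooth_compose[OF fin_dims(1) fcoord(1)[OF cQ] V(4)]) (use xi in blast)
  then have "smooth_on (I \<inter> V) (\<lambda>s. DD (lcoord L c) (snd c (q s), snd (X s) c) (0, fcoord c (snd c (q s)) b))"
    by (intro smooth_DD_along[OF fin_dim_prod[OF fin_dims(1) fin_dims(1)] smooth_lcoord[OF L cQ]] smooth_Pair V smooth_const)
       (use xi in auto)
  then have "smooth_on (I \<inter> V) (\<lambda>t. FLm t b)"
    by (rule smooth_cong[THEN iffD1, rotated]) (subst FLm_coord[OF _ V(3)], auto)
  then show "\<exists>V. open V \<and> t \<in> V \<and> smooth_on (I \<inter> V) (\<lambda>t. FLm t b)" using V by blast
qed

lemma smooth_wform:
  assumes c: "c \<in> Q" and x: "smooth_on J x" "\<And>s. s \<in> J \<Longrightarrow> x s \<in> snd c ` fst c"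
    and v: "smooth_on J v" and u: "smooth_on J u"
  shows "smooth_on J (\<lambda>s. wform c (x s) (v s) (u s))"
proof -
  note o = open_chart[OF manQ c]
  have 1: "smooth_on J (\<lambda>s. DD (\<lambda>y. wcoord c y (a s)) (x s) (b s))" if a: "smooth_on J a" and b: "smooth_on J b" for a b
  proof (rule smooth_apply[where T = "\<lambda>s a. DD (\<lambda>y. wcoord c y a) (x s) (b s)", OF fin_dims(1) _ _ a])
    show "smooth_on J (\<lambda>s. DD (\<lambda>y. wcoord c y w) (x s) (b s))" for w
      by (rule smooth_DD_along[OF fin_dims(1) wcoord(1)[OF c] o x b])
    show "linear (\<lambda>a. DD (\<lambda>y. wcoord c y a) (x s) (b s))" if "s \<in> J" for s
      by (rule linear_DD_family[OF o wcoord(1)[OF c] wcoord(2)[OF c] x(2)[OF that]])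
  qed
  show ?thesis unfolding wform_def by (rule smooth_diff[OF 1[OF v u] 1[OF u v]])
qed

lemma smooth_Bm: "smooth_on I (\<lambda>t. Bm t b)"
proof (rule smooth_on_I)
  fix t assume t: "t \<in> I"
  obtain c where c: "c \<in> charts_at Q (q t)" using chart_at_q[OF t] by blast
  then have cQ: "c \<in> Q" by (simp add: charts_at_iff)
  obtain V where V: "open V" "t \<in> V" "\<And>s. s \<in> I \<inter> V \<Longrightarrow> c \<in> charts_at Q (q s)"
    "smooth_on (I \<inter> V) (\<lambda>s. snd c (q s))" "smooth_on (I \<inter> V) (\<lambda>s. snd (X s) c)"
    using path_local[OF t c] by metis
  have xi: "snd c (q s) \<in> snd c ` fst c" if "s \<in> I \<inter> V" for s using V(3)[OF that] by (auto simp: charts_at_iff)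
  have "smooth_on (I \<inter> V) (\<lambda>s. fcoord c (snd c (q s)) b)"
    by (rule smooth_compose[OF fin_dims(1) fcoord(1)[OF cQ] V(4)]) (use xi in blast)
  from smooth_wform[OF cQ V(4) xi V(5) this]
  have "smooth_on (I \<inter> V) (\<lambda>s. wform c (snd c (q s)) (snd (X s) c) (fcoord c (snd c (q s)) b))" .
  then have "smooth_on (I \<inter> V) (\<lambda>t. Bm t b)"
    by (rule smooth_cong[THEN iffD1, rotated]) (subst Bm_coord[OF _ V(3)], auto)
  then show "\<exists>V. open V \<and> t \<in> V \<and> smooth_on (I \<inter> V) (\<lambda>t. Bm t b)" using V by blast
qed

lemma smooth_Rm:
  assumes Y: "sec Y" "\<And>t. t \<in> I \<Longrightarrow> Y t \<in> hor S (q t)"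
  shows "smooth_on I (\<lambda>t. Rm t (Y t))"
proof (rule smooth_on_I)
  fix t assume t: "t \<in> I"
  obtain c where c: "c \<in> charts_at Q (q t)" using chart_at_q[OF t] by blast
  then have cQ: "c \<in> Q" by (simp add: charts_at_iff)
  obtain V where V: "open V" "t \<in> V" "\<And>s. s \<in> I \<inter> V \<Longrightarrow> c \<in> charts_at Q (q s)"
    "smooth_on (I \<inter> V) (\<lambda>s. snd c (q s))" "smooth_on (I \<inter> V) (\<lambda>s. snd (X s) c)" "smooth_on (I \<inter> V) (\<lambda>s. snd (Y s) c)"
    using sec_local[OF Y(1) t c] by metis
  have xi: "snd c (q s) \<in> snd c ` fst c" if "s \<in> I \<inter> V" for s using V(3)[OF that] by (auto simp: charts_at_iff)
  from smooth_wform[OF cQ V(4) xi V(5,6)]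
  have "smooth_on (I \<inter> V) (\<lambda>s. wform c (snd c (q s)) (snd (X s) c) (snd (Y s) c))" .
  then have "smooth_on (I \<inter> V) (\<lambda>t. Rm t (Y t))"
    by (rule smooth_cong[THEN iffD1, rotated]) (subst Rm_coord[OF _ V(3) Y(2)], auto)
  then show "\<exists>V. open V \<and> t \<in> V \<and> smooth_on (I \<inter> V) (\<lambda>t. Rm t (Y t))" using V by blast
qed

lemma linear_FLm: "t \<in> I \<Longrightarrow> linear (FLm t)"
proof -
  assume t: "t \<in> I"
  obtain c where c: "c \<in> charts_at Q (q t)" using chart_at_q[OF t] by blast
  let ?D = "DD (lcoord L c) (snd c (q t), snd (X t) c)"
  have l: "linear ?D" by (rule linear_lcoord[OF L c])
  show ?thesis
  proof (rule linearI)
    show "FLm t (a + b) = FLm t a + FLm t b" for a b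
      unfolding FLm_coord[OF t c]
      using linear_add[OF l, of "(0, fcoord c (snd c (q t)) a)" "(0, fcoord c (snd c (q t)) b)"]
      by (simp add: linear_add[OF linear_fcoord[OF c]])
    show "FLm t (r *\<^sub>R a) = r *\<^sub>R FLm t a" for r a
      unfolding FLm_coord[OF t c]
      using linear_cmul[OF l, of r "(0, fcoord c (snd c (q t)) a)"]
      by (simp add: linear_cmul[OF linear_fcoord[OF c]])
  qed
qed

lemma linear_Bm: "t \<in> I \<Longrightarrow> linear (Bm t)"
proof -
  assume t: "t \<in> I"
  obtain c where c: "c \<in> charts_at Q (q t)" using chart_at_q[OF t] by blast
  have l: "linear (wform c (snd c (q t)) (snd (X t) c))" by (rule linear_wform) (use c in \<open>auto simp: charts_at_iff\<close>)
  show ?thesis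
    by (rule linearI) (simp_all add: Bm_coord[OF t c] linear_add[OF linear_fcoord[OF c]] linear_add[OF l]
        linear_cmul[OF linear_fcoord[OF c]] linear_cmul[OF l])
qed

lemma bdot_const: "t \<in> I \<Longrightarrow> bdot (\<lambda>_. b) t = 0"
  by (rule bdot_eqI) auto

text \<open>A constant vertical field expresses \<open>HL\<close> by a variation and
  \<open>FL\<close>. Smoothness of \<open>HL\<close> along the path then follows from that of the
  other two.\<close>

lemma HLm_eq: "t \<in> I \<Longrightarrow> HLm t b = av L (vsec (\<lambda>_. b)) t - FLm t (Bm t b)"
  using av_vsec[OF smooth_const] bdot_const by simp

lemma smooth_HLm: "smooth_on I (\<lambda>t. HLm t b)"
proof -
  have "smooth_on I (\<lambda>t. av L (vsec (\<lambda>_. b)) t - FLm t (Bm t b))"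
    by (rule smooth_diff[OF smooth_av[OF sec_vsec[OF smooth_const]]
        smooth_apply[OF fin_dims(3) smooth_FLm linear_FLm smooth_Bm]])
  then show ?thesis by (rule smooth_cong[THEN iffD1, rotated]) (rule HLm_eq[symmetric])
qed

lemma linear_HLm: "t \<in> I \<Longrightarrow> linear (HLm t)"
proof -
  assume t: "t \<in> I"
  obtain c where c: "c \<in> charts_at Q (q t)" using chart_at_q[OF t] by blast
  obtain d where d: "d \<in> charts_at M (\<pi> (q t))" using proj_in[OF qp[OF t]] pts_iff by metis
  have cQ: "c \<in> Q" "d \<in> M" using c d by (auto simp: charts_at_iff)
  let ?x = "snd c (q t)"
  define h where "h = DD (\<lambda>x. hcoord c d x (snd (proj_push S (X t)) d)) ?x"
  have lh: "linear h"
    unfolding h_def by (rule linear_DD[OF hcoord(1)[OF cQ] pcoord(1)[OF cQ] proj_dom_mem[OF c d]])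
  have l: "linear (DD (lcoord L c) (?x, snd (X t) c))" by (rule linear_lcoord[OF L c])
  have eq: "HLm t b = DD (lcoord L c) (?x, snd (X t) c) (fcoord c ?x b, h (fcoord c ?x b))" for b
    unfolding HLm_def h_def by (rule HL_coord[OF L X_hor[OF t] c d lv(1)]) (simp add: lv)
  show ?thesis
  proof (rule linearI)
    show "HLm t (a + b) = HLm t a + HLm t b" for a b
      unfolding eq using linear_add[OF l, of "(fcoord c ?x a, h (fcoord c ?x a))" "(fcoord c ?x b, h (fcoord c ?x b))"]
      by (simp add: linear_add[OF linear_fcoord[OF c]] linear_add[OF lh])
    show "HLm t (r *\<^sub>R a) = r *\<^sub>R HLm t a" for r a
      unfolding eq using linear_cmul[OF l, of r "(fcoord c ?x a, h (fcoord c ?x a))"]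
      by (simp add: linear_cmul[OF linear_fcoord[OF c]] linear_cmul[OF lh])
  qed
qed

end

section \<open>The fundamental lemma of the calculus of variations\<close>

definition bump :: "real \<Rightarrow> real \<Rightarrow> real \<Rightarrow> real" where
  "bump a b t = flat (t - a) * flat (b - t)"

lemma smooth_bump: "smooth_on S (bump a b)"
  unfolding bump_def
  by (intro smooth_mult smooth_compose[OF fin_dim_real smooth_flat[of UNIV]] smooth_diff smooth_ident smooth_const) auto

lemma bump_nonneg: "bump a b t \<ge> 0"
  by (simp add: bump_def flat_nonneg)

lemma bump_pos: "a < t \<Longrightarrow> t < b \<Longrightarrow> bump a b t > 0"
  by (simp add: bump_def flat_pos)

lemma bump_zero: "t \<le> a \<or> b \<le> t \<Longrightarrow> bump a b t = 0"
  by (auto simp: bump_def flat_def)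

text \<open>The tests are bumps supported in the open interval and inside \<open>V\<close>. They
  therefore also serve for sections that live in one chart and vanish at the end-points. An
  end-point \<open>t\<close> is reached because supports can be placed arbitrarily close to
  it.\<close>

lemma calculus_of_variations:
  fixes g :: "real \<Rightarrow> real"
  assumes t01: "t0 < t1" and V: "open V" "t \<in> V" and t: "t \<in> {t0..t1}" and g: "continuous_on ({t0..t1} \<inter> V) g"
    and int: "\<And>a b. t0 < a \<Longrightarrow> a < b \<Longrightarrow> b < t1 \<Longrightarrow> {a..b} \<subseteq> V \<Longrightarrow> integral {t0..t1} (\<lambda>s. bump a b s * g s) = 0"
  shows "g t = 0"
proof (rule ccontr)
  assume nz: "g t \<noteq> 0"
  have tV: "t \<in> {t0..t1} \<inter> V" using t V by blast
  obtain r where r: "r > 0" "ball t r \<subseteq> V" using V open_contains_ball by metis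
  have "\<exists>\<delta>>0. \<forall>s\<in>{t0..t1} \<inter> V. dist s t < \<delta> \<longrightarrow> dist (g s) (g t) < \<bar>g t\<bar>"
    using g[unfolded continuous_on_iff, rule_format, OF tV, of "\<bar>g t\<bar>"] nz by simp
  then obtain \<delta> where \<delta>: "\<delta> > 0" "\<And>s. s \<in> {t0..t1} \<inter> V \<Longrightarrow> dist s t < \<delta> \<Longrightarrow> dist (g s) (g t) < \<bar>g t\<bar>" by blast
  define \<epsilon> where "\<epsilon> = min r \<delta>"
  have \<epsilon>: "\<epsilon> > 0" "\<epsilon> \<le> r" "\<epsilon> \<le> \<delta>" using r \<delta> by (auto simp: \<epsilon>_def)
  \<comment> \<open>The part of the interval within \<open>\<epsilon>\<close> of \<open>t\<close>.
    The bump occupies its middle third, which avoids the end-points even if \<open>t\<close> is one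
    of them.\<close>
  define lo hi where "lo = max t0 (t - \<epsilon>)" and "hi = min t1 (t + \<epsilon>)"
  have lh: "lo < hi" using t \<epsilon> t01 by (auto simp: lo_def hi_def)
  define a b where "a = lo + (hi - lo) / 3" and "b = hi - (hi - lo) / 3"
  have ab: "lo < a" "a < b" "b < hi" using lh by (auto simp: a_def b_def field_simps)
  have I: "t0 < a" "b < t1" using ab by (auto simp: lo_def hi_def)
  have near: "dist s t < \<epsilon>" if "s \<in> {a..b}" for s using that ab by (auto simp: dist_real_def lo_def hi_def)
  have abV: "{a..b} \<subseteq> V"
  proof
    fix s assume "s \<in> {a..b}"
    then have "s \<in> ball t r" using near[of s] \<epsilon>(2) by (simp add: dist_commute)
    then show "s \<in> V" using r(2) by blast
  qed
  have abI: "{a..b} \<subseteq> {t0..t1}" using I by auto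
  \<comment> \<open>On the support \<open>g\<close> keeps the sign of \<open>g t\<close>, so a
    vanishing integral forces a nonnegative continuous integrand to be zero.\<close>
  have sgn: "sgn (g t) * g s > 0" if s: "s \<in> {a..b}" for s
  proof -
    have "dist (g s) (g t) < \<bar>g t\<bar>" using s abV abI near[OF s] \<epsilon>(3) by (intro \<delta>(2)) auto
    then show ?thesis using nz by (auto simp: dist_real_def sgn_if abs_if split: if_splits)
  qed
  let ?f = "\<lambda>s. bump a b s * g s"
  have "continuous_on {a..b} ?f"
  proof (rule continuous_on_mult)
    show "continuous_on {a..b} (bump a b)" by (rule smooth_continuous[OF smooth_bump])
    show "continuous_on {a..b} g" by (rule continuous_on_subset[OF g]) (use abV abI in blast)
  qed
  then have c: "continuous_on {a..b} (\<lambda>s. sgn (g t) * ?f s)" by (rule continuous_on_mult[OF continuous_on_const])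
  have "(?f has_integral integral {a..b} ?f) {a..b}"
    using integrable_continuous_real[OF \<open>continuous_on {a..b} ?f\<close>] by (rule integrable_integral)
  then have "(?f has_integral integral {a..b} ?f) {t0..t1}"
    by (rule has_integral_on_superset[OF _ _ abI]) (auto simp: bump_zero)
  then have "integral {a..b} ?f = 0"
    using int[OF I(1) ab(2) I(2) abV] by (simp add: integral_unique)
  then have "integral {a..b} (\<lambda>s. sgn (g t) * ?f s) = 0" by simp
  moreover have "0 \<le> sgn (g t) * ?f s" if "s \<in> {a..b}" for s
  proof -
    have "0 \<le> bump a b s * (sgn (g t) * g s)" using sgn[OF that] bump_nonneg[of a b s] by simp
    then show ?thesis by (simp add: mult_ac)
  qed
  ultimately have "\<forall>s\<in>{a..b}. sgn (g t) * ?f s = 0"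
    using integral_eq_0_iff[OF c ab(2)] by blast
  moreover define s where "s = (a + b) / 2"
  moreover have "s \<in> {a..b}" "a < s" "s < b" using ab by (auto simp: s_def)
  ultimately have "bump a b s * (sgn (g t) * g s) = 0" by (metis mult.left_commute)
  moreover have "bump a b s > 0" by (rule bump_pos[OF \<open>a < s\<close> \<open>s < b\<close>])
  ultimately show False using sgn[OF \<open>s \<in> {a..b}\<close>] by (metis less_irrefl mult_eq_0_iff)
qed

text \<open>Agreement on the points of the manifold is enough. For the multiplier term this matters,
  since \<open>omega\<close> is unspecified on elements of the raw type that are not tangent
  vectors.\<close>

lemma differential_cong:
  assumes A: "man A" and W: "W \<in> tan_space A p" "p \<in> pts A" and fg: "\<And>p. p \<in> pts A \<Longrightarrow> f p = g p"
  shows "differential A f W = differential A g W"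
proof -
  obtain c where "c \<in> charts_at A p" using W(2) pts_iff by metis
  then have c: "(SOME c. c \<in> charts_at A p) \<in> charts_at A p" by (rule some_chart)
  let ?c = "SOME c. c \<in> charts_at A p"
  have cA: "?c \<in> A" "p \<in> fst ?c" using c by (auto simp: charts_at_iff)
  have "(f \<circ> chart_inv ?c) x = (g \<circ> chart_inv ?c) x" if "x \<in> snd ?c ` fst ?c" for x
  proof -
    have "chart_inv ?c x \<in> pts A" using chart_inv_mem[OF that] cA(1) unfolding pts_def by blast
    then show ?thesis using fg by simp
  qed
  then have "DD (f \<circ> chart_inv ?c) (snd ?c p) = DD (g \<circ> chart_inv ?c) (snd ?c p)"
    using cA by (intro DD_cong[OF open_chart[OF A cA(1)]]) auto
  then show ?thesis using tan_space_fst[OF W(1)] by (simp add: differential_def Let_def)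
qed

section \<open>The extremals of a Chaplygin system\<close>

context chaplygin_system
begin

lemma lv_linear: "lv (a + b) = tadd (lv a) (lv b)" "lv (r *\<^sub>R a) = tscale r (lv a)" "lv 0 = tzero e"
proof -
  have la: "tadd (lv a) (lv b) \<in> lie_alg S" "tscale r (lv a) \<in> lie_alg S"
    using lv(1) tadd_in[OF manG] tscale_in[OF manG] by (auto simp: lie_alg_def)
  show "lv (a + b) = tadd (lv a) (lv b)" by (rule lie_alg_eqI[OF lv(1) la(1)]) (simp add: lv)
  show "lv (r *\<^sub>R a) = tscale r (lv a)" by (rule lie_alg_eqI[OF lv(1) la(2)]) (simp add: lv)
  show "lv 0 = tzero e" by (rule lie_alg_eqI[OF lv(1) lie_alg_tzero]) (simp add: lv)
qed

end

context chaplygin_path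
begin

lemma ends: "t0 \<in> I" "t1 \<in> I" using t01 by auto

lemma generator_iff: "generator S t0 t1 X \<xi> \<longleftrightarrow> sec \<xi> \<and> \<xi> t0 = tzero (q t0) \<and> \<xi> t1 = tzero (q t1)"
  by (auto simp: generator_def sec_def)

lemma tzero_hor: "t \<in> I \<Longrightarrow> tzero (q t) \<in> hor S (q t)"
  using hor_vert(1)[OF qp] by blast

lemma beta_tzero: "t \<in> I \<Longrightarrow> \<xi> t = tzero (q t) \<Longrightarrow> beta \<xi> t = 0"
  unfolding beta_def using omega_zero_iff[OF qp hor_tan[OF qp tzero_hor]] tzero_hor by simp

lemma vsec_zero: "t \<in> I \<Longrightarrow> \<beta> t = 0 \<Longrightarrow> vsec \<beta> t = tzero (q t)"
  unfolding vsec_def by (simp add: lv_linear fundamental_tzero[OF qp])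

lemma hpart_zero: "sec \<xi> \<Longrightarrow> t \<in> I \<Longrightarrow> beta \<xi> t = 0 \<Longrightarrow> hpart \<xi> t = \<xi> t"
  unfolding hpart_def using tdiff_zero[OF tan_space_fst[OF sec_in]] vsec_zero by simp

lemma generator_beta: "generator S t0 t1 X \<xi> \<Longrightarrow> beta \<xi> t0 = 0 \<and> beta \<xi> t1 = 0"
  unfolding generator_iff using beta_tzero ends by blast

lemma generator_hpart: "generator S t0 t1 X \<xi> \<Longrightarrow> generator S t0 t1 X (hpart \<xi>)"
  using hpart(1) hpart_zero[OF _ ends(1)] hpart_zero[OF _ ends(2)] generator_beta unfolding generator_iff by metis

lemma generator_vsec:
  "smooth_on I \<beta> \<Longrightarrow> \<beta> t0 = 0 \<Longrightarrow> \<beta> t1 = 0 \<Longrightarrow> generator S t0 t1 X (vsec \<beta>)"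
  unfolding generator_iff using sec_vsec vsec_zero ends by blast

lemma bdot_cong:
  assumes "smooth_on I \<beta>" "t \<in> I" "\<And>s. s \<in> I \<Longrightarrow> \<alpha> s = \<beta> s"
  shows "bdot \<alpha> t = bdot \<beta> t"
  by (rule bdot_eqI[OF assms(2)], rule has_vector_derivative_transform[OF assms(2) _ bdot(1)[OF assms(1,2)]]) (rule assms(3))

text \<open>The inverse of the decomposition: the horizontal part and the curve in the Lie algebra
  can be prescribed independently.\<close>

lemma sec_add_vsec:
  assumes Y: "sec Y" "\<And>t. t \<in> I \<Longrightarrow> Y t \<in> hor S (q t)" and \<beta>: "smooth_on I \<beta>"
  defines "\<xi> \<equiv> \<lambda>s. tadd (Y s) (vsec \<beta> s)"
  shows "sec \<xi>" "t \<in> I \<Longrightarrow> beta \<xi> t = \<beta> t" "t \<in> I \<Longrightarrow> hpart \<xi> t = Y t" "t \<in> I \<Longrightarrow> bdot (beta \<xi>) t = bdot \<beta> t"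
proof -
  show \<xi>: "sec \<xi>" unfolding \<xi>_def by (rule sec_tadd[OF Y(1) sec_vsec[OF \<beta>]])
  show b: "beta \<xi> t = \<beta> t" if t: "t \<in> I" for t
  proof -
    have "tdiff (\<xi> t) (fundamental S (lv (\<beta> t)) (q t)) = Y t"
      unfolding \<xi>_def vsec_def by (intro prod_eqI ext) auto
    then have "omega S (\<xi> t) = lv (\<beta> t)"
      using omega_eqI[OF qp[OF t] sec_in[OF \<xi> t] lv(1)] Y(2)[OF t] by simp
    then show ?thesis by (simp add: beta_def lv)
  qed
  show "hpart \<xi> t = Y t" if "t \<in> I"
  proof -
    have "vsec (beta \<xi>) t = vsec \<beta> t" using b[OF that] by (simp add: vsec_def)
    then show ?thesis unfolding hpart_def by (simp add: \<xi>_def) (intro prod_eqI ext, auto)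
  qed
  show "bdot (beta \<xi>) t = bdot \<beta> t" if "t \<in> I" by (rule bdot_cong[OF \<beta> that b])
qed

lemma fibre_derivative_lv:
  assumes \<beta>: "smooth_on I \<beta>" and b: "\<And>s. s \<in> I \<Longrightarrow> b s = lv (\<beta> s)" and t: "t \<in> I"
  shows "fibre_derivative I b t = lv (bdot \<beta> t)"
proof (rule prod_eqI)
  have fe: "fst (lv x) = e" for x by (simp add: lv_def)
  show "fst (fibre_derivative I b t) = fst (lv (bdot \<beta> t))" using b[OF t] fe by (simp add: fibre_derivative_def)
  show "snd (fibre_derivative I b t) = snd (lv (bdot \<beta> t))"
  proof
    fix k
    \<comment> \<open>The coordinate of \<open>lv x\<close> in any chart \<open>k\<close> is linear
      in \<open>x\<close>, also when \<open>k\<close> is not a chart at the identity and the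
      coordinate is the padding 0.\<close>
    define T where "T x = snd (lv x) k" for x
    have "linear T" by (rule linearI) (simp_all add: T_def lv_linear)
    then have "bounded_linear T" by (rule fin_dim_bounded_linear[OF fin_dims(3)])
    then have "((\<lambda>s. T (\<beta> s)) has_vector_derivative T (bdot \<beta> t)) (at t within I)"
      by (rule bounded_linear.has_vector_derivative[OF _ bdot(1)[OF \<beta> t]])
    then have "((\<lambda>s. snd (b s) k) has_vector_derivative T (bdot \<beta> t)) (at t within I)"
      by (rule has_vector_derivative_transform[OF t, rotated]) (simp add: b T_def)
    then have "vector_derivative (\<lambda>s. snd (b s) k) (at t within I) = T (bdot \<beta> t)"
      by (rule has_vector_derivative_eq[OF manQ fI t])
    then show "snd (fibre_derivative I b t) k = snd (lv (bdot \<beta> t)) k" by (simp add: fibre_derivative_def T_def)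
  qed
qed

lemma lie_curve:
  assumes \<beta>: "smooth_on I \<beta>"
  shows "smooth_curve I (tan_atlas G) (\<lambda>s. lv (\<beta> s))"
proof (rule smooth_curveI[OF man_tan[OF manG] fI])
  let ?C = "tan_chart G g0"
  have g: "g0 \<in> G" "e \<in> fst g0" using g0 by (auto simp: charts_at_iff)
  have C: "?C \<in> tan_atlas G" using g by (simp add: tan_atlas_def)
  have "smooth_on I (\<lambda>s. (snd g0 e, \<beta> s))" by (rule smooth_Pair[OF smooth_const \<beta>])
  then have "smooth_on I (\<lambda>s. snd ?C (lv (\<beta> s)))"
    by (rule smooth_cong[THEN iffD1, rotated]) (simp add: lv, simp add: lv_def)
  moreover have "lv x \<in> fst ?C" for x unfolding lv_def by (rule tvec_in_tan_chart[OF manG g])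
  ultimately show "\<exists>c\<in>tan_atlas G. \<exists>V. open V \<and> t \<in> V \<and> (\<forall>s\<in>I\<inter>V. lv (\<beta> s) \<in> fst c) \<and> smooth_on (I \<inter> V) (\<lambda>s. snd c (lv (\<beta> s)))" for t
    using C by (intro bexI[of _ ?C] exI[of _ UNIV]) auto
qed

lemma lie_curve_coord:
  assumes b: "smooth_curve I (tan_atlas G) b" "\<And>t. t \<in> I \<Longrightarrow> b t \<in> lie_alg S"
  shows "smooth_on I (\<lambda>s. snd (b s) g0)"
proof -
  let ?C = "tan_chart G g0"
  have C: "?C \<in> tan_atlas G" using g0 by (simp add: tan_atlas_def charts_at_iff)
  have "b t \<in> fst ?C" if "t \<in> I" for t
    using charts_at_tanI[OF g0, of "b t"] b(2)[OF that] by (simp add: lie_alg_def charts_at_iff)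
  then have "{t \<in> I. b t \<in> fst ?C} = I" by blast
  moreover have "smooth_on {t \<in> I. b t \<in> fst ?C} (snd ?C \<circ> b)" using b(1) C unfolding smooth_curve_def by blast
  ultimately have "smooth_on I (\<lambda>s. snd ?C (b s))" by (simp add: comp_def)
  from smooth_snd[OF this] show ?thesis by simp
qed

lemma lv_Bm: "t \<in> I \<Longrightarrow> b \<in> lie_alg S \<Longrightarrow> bmap S (q t) (proj_push S (X t)) b = lv (Bm t (snd b g0))"
  using bmap_coord(1)[OF qp proj_push_in[OF XT qp]] lv(3) chart_at_q unfolding Bm_def by metis

lemma lv_Rm: "t \<in> I \<Longrightarrow> Y \<in> hor S (q t) \<Longrightarrow> curvature S (q t) (proj_push S (X t)) (proj_push S Y) = lv (Rm t Y)"
  using curvature_coord(1)[OF qp proj_push_in[OF XT qp] proj_push_in[OF hor_tan[OF qp] qp]] lv(3) chart_at_q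
  unfolding Rm_def by metis

lemma constraint_iff:
  assumes \<beta>: "smooth_on I \<beta>" and b: "\<And>s. s \<in> I \<Longrightarrow> b s = lv (\<beta> s)" and t: "t \<in> I" and Y: "Y \<in> hor S (q t)"
  shows "tadd (tadd (fibre_derivative I b t) (bmap S (q t) (proj_push S (X t)) (b t)))
      (curvature S (q t) (proj_push S (X t)) (proj_push S Y)) = tzero e
    \<longleftrightarrow> bdot \<beta> t + Bm t (\<beta> t) + Rm t Y = 0"
proof -
  have f: "fibre_derivative I b t = lv (bdot \<beta> t)" by (rule fibre_derivative_lv[OF \<beta> _ t]) (rule b)
  have "tadd (tadd (fibre_derivative I b t) (bmap S (q t) (proj_push S (X t)) (b t)))
      (curvature S (q t) (proj_push S (X t)) (proj_push S Y)) = lv (bdot \<beta> t + Bm t (\<beta> t) + Rm t Y)"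
    unfolding f lv_Rm[OF t Y] using lv_Bm[OF t lv(1), of "\<beta> t"] b[OF t]
    by (simp add: lv lv_linear)
  moreover have "lv x = tzero e \<longleftrightarrow> x = 0" for x
  proof
    assume "lv x = tzero e"
    then have "snd (lv x) g0 = snd (lv 0) g0" using lv_linear(3) by simp
    then show "x = 0" by (simp add: lv)
  qed (simp add: lv_linear)
  ultimately show ?thesis by simp
qed

end

context chaplygin_lagrangian
begin

text \<open>The density that the vertical part \<open>\<beta>\<close> of a generator contributes to
  the variation of the action.\<close>

definition vpart :: "(real \<Rightarrow> 'h) \<Rightarrow> real \<Rightarrow> real" where
  "vpart \<beta> t = HLm t (\<beta> t) + FLm t (bdot \<beta> t + Bm t (\<beta> t))"

lemma action_eq: "action_variation S t0 t1 (\<lambda>_. L) \<xi> = integral I (av L \<xi>)"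
  by (simp add: action_variation_def av_def[abs_def])

lemma smooth_FLm_apply: "smooth_on I u \<Longrightarrow> smooth_on I (\<lambda>t. FLm t (u t))"
  by (rule smooth_apply[OF fin_dims(3) smooth_FLm linear_FLm])

lemma smooth_HLm_apply: "smooth_on I u \<Longrightarrow> smooth_on I (\<lambda>t. HLm t (u t))"
  by (rule smooth_apply[OF fin_dims(3) smooth_HLm linear_HLm])

lemma smooth_Bm_apply: "smooth_on I u \<Longrightarrow> smooth_on I (\<lambda>t. Bm t (u t))"
  by (rule smooth_apply[OF fin_dims(3) smooth_Bm linear_Bm])

lemma integrable: "smooth_on I f \<Longrightarrow> f integrable_on I" for f :: "real \<Rightarrow> real"
  by (rule integrable_continuous_real[OF smooth_continuous])

lemma smooth_vpart: "smooth_on I \<beta> \<Longrightarrow> smooth_on I (vpart \<beta>)"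
  unfolding vpart_def
  by (intro smooth_add[OF smooth_HLm_apply smooth_FLm_apply[OF smooth_add[OF bdot(2) smooth_Bm_apply]]]) (use ends in auto)

lemma action_decomposition:
  assumes "sec \<xi>"
  shows "integral I (av L \<xi>) = integral I (av L (hpart \<xi>)) + integral I (vpart (beta \<xi>))"
proof -
  have "integral I (av L \<xi>) = integral I (\<lambda>t. av L (hpart \<xi>) t + vpart (beta \<xi>) t)"
    by (rule Henstock_Kurzweil_Integration.integral_cong) (simp add: av_decomposition[OF assms] vpart_def)
  also have "\<dots> = integral I (av L (hpart \<xi>)) + integral I (vpart (beta \<xi>))"
    by (rule Henstock_Kurzweil_Integration.integral_add[OF integrable[OF smooth_av[OF hpart(1)[OF assms]]]
        integrable[OF smooth_vpart[OF smooth_beta[OF assms]]]])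
  finally show ?thesis .
qed

lemma nonholonomic_action:
  assumes N: "nonholonomic_extremal S t0 t1 (\<lambda>_. L) X" and \<xi>: "generator S t0 t1 X \<xi>"
  shows "action_variation S t0 t1 (\<lambda>_. L) \<xi> = integral I (vpart (beta \<xi>))"
proof -
  have s: "sec \<xi>" using \<xi> by (simp add: generator_iff)
  have "integral I (av L (hpart \<xi>)) = 0"
    using N generator_hpart[OF \<xi>] hpart(2)[OF s] unfolding nonholonomic_extremal_def action_eq by blast
  then show ?thesis using action_decomposition[OF s] by (simp add: action_eq)
qed

section \<open>The vertical Euler-Lagrange equation: statement (a)\<close>

definition Fdot :: "real \<Rightarrow> 'h \<Rightarrow> real" where
  "Fdot t b = vector_derivative (\<lambda>s. FLm s b) (at t within I)"

text \<open>The left side of the equation in (a), read in the model space.\<close>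

definition euler :: "real \<Rightarrow> 'h \<Rightarrow> real" where
  "euler t b = HLm t b - Fdot t b + FLm t (Bm t b)"

lemma Fdot: "t \<in> I \<Longrightarrow> ((\<lambda>s. FLm s b) has_vector_derivative Fdot t b) (at t within I)"
  unfolding Fdot_def using smooth_has_vector_derivative[OF manQ fI, of UNIV t "\<lambda>s. FLm s b"] smooth_FLm by simp

lemma linear_Fdot: assumes t: "t \<in> I" shows "linear (Fdot t)"
proof (rule linearI)
  show "Fdot t (a + b) = Fdot t a + Fdot t b" for a b
    unfolding Fdot_def[of t "a + b"]
    by (rule has_vector_derivative_eq[OF manQ fI t], rule has_vector_derivative_transform[OF t _
        has_vector_derivative_add[OF Fdot[OF t] Fdot[OF t]]]) (simp add: linear_add[OF linear_FLm])
  show "Fdot t (r *\<^sub>R a) = r *\<^sub>R Fdot t a" for r a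
  proof -
    have "((\<lambda>s. r *\<^sub>R FLm s a) has_vector_derivative r *\<^sub>R Fdot t a) (at t within I)"
      by (rule bounded_linear.has_vector_derivative[OF bounded_linear_scaleR_right Fdot[OF t]])
    then have "((\<lambda>s. FLm s (r *\<^sub>R a)) has_vector_derivative r *\<^sub>R Fdot t a) (at t within I)"
      by (rule has_vector_derivative_transform[OF t, rotated]) (simp add: linear_cmul[OF linear_FLm])
    then show ?thesis unfolding Fdot_def[of t "r *\<^sub>R a"] by (rule has_vector_derivative_eq[OF manQ fI t])
  qed
qed

lemma linear_euler: "t \<in> I \<Longrightarrow> linear (euler t)"
  by (rule linearI) (simp_all add: euler_def linear_add[OF linear_HLm] linear_add[OF linear_FLm] linear_add[OF linear_Bm]
      linear_add[OF linear_Fdot] linear_cmul[OF linear_HLm] linear_cmul[OF linear_FLm] linear_cmul[OF linear_Bm]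
      linear_cmul[OF linear_Fdot] algebra_simps)

lemma smooth_euler: "smooth_on I (\<lambda>t. euler t b)"
proof -
  have "smooth_on I (\<lambda>t. Fdot t b)"
    unfolding Fdot_def using smooth_vector_derivative[OF manQ fI, of UNIV "\<lambda>s. FLm s b"] smooth_FLm by simp
  then show ?thesis
    unfolding euler_def by (intro smooth_add[OF smooth_diff[OF smooth_HLm]] smooth_FLm_apply smooth_Bm)
qed

lemma integration_by_parts:
  assumes \<beta>: "smooth_on I \<beta>" "\<beta> t0 = 0" "\<beta> t1 = 0"
  shows "integral I (vpart \<beta>) = integral I (\<lambda>t. euler t (\<beta> t))"
proof -
  have D: "((\<lambda>s. FLm s (\<beta> s)) has_vector_derivative Fdot t (\<beta> t) + FLm t (bdot \<beta> t)) (at t within I)" if t: "t \<in> I" for t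
  proof -
    have "((\<lambda>s. FLm s (\<beta> s)) has_derivative (\<lambda>h. h *\<^sub>R Fdot t (\<beta> t) + FLm t (h *\<^sub>R bdot \<beta> t))) (at t within I)"
      by (rule has_derivative_apply[OF fin_dims(3) Fdot[OF t, unfolded has_vector_derivative_def] linear_FLm
          bdot(1)[OF \<beta>(1) t, unfolded has_vector_derivative_def] t fI])
    then show ?thesis
      unfolding has_vector_derivative_def by (simp add: linear_cmul[OF linear_FLm[OF t]] distrib_left)
  qed
  \<comment> \<open>The boundary terms vanish because \<open>FLm\<close> is applied to zero vectors
    there.\<close>
  have "((\<lambda>t. Fdot t (\<beta> t) + FLm t (bdot \<beta> t)) has_integral FLm t1 (\<beta> t1) - FLm t0 (\<beta> t0)) I"
    by (rule fundamental_theorem_of_calculus[OF less_imp_le[OF t01] D])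
  then have 0: "((\<lambda>t. Fdot t (\<beta> t) + FLm t (bdot \<beta> t)) has_integral 0) I"
    using linear_0[OF linear_FLm] \<beta> ends by simp
  have "(vpart \<beta> has_integral integral I (vpart \<beta>)) I"
    by (rule integrable_integral[OF integrable[OF smooth_vpart[OF \<beta>(1)]]])
  from has_integral_diff[OF this 0]
  have "((\<lambda>t. vpart \<beta> t - (Fdot t (\<beta> t) + FLm t (bdot \<beta> t))) has_integral integral I (vpart \<beta>)) I" by simp
  moreover have "vpart \<beta> t - (Fdot t (\<beta> t) + FLm t (bdot \<beta> t)) = euler t (\<beta> t)" if "t \<in> I" for t
    by (simp add: vpart_def euler_def linear_add[OF linear_FLm[OF that]])
  ultimately have "((\<lambda>t. euler t (\<beta> t)) has_integral integral I (vpart \<beta>)) I"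
    by (rule has_integral_eq[rotated])
  then show ?thesis by (simp add: integral_unique)
qed

lemma unconstrained_iff:
  assumes N: "nonholonomic_extremal S t0 t1 (\<lambda>_. L) X"
  shows "unconstrained_extremal S t0 t1 (\<lambda>_. L) X \<longleftrightarrow> (\<forall>t\<in>I. \<forall>b\<in>lie_alg S.
     (HL S L (X t) b - vector_derivative (\<lambda>s. FL S L (X s) b) (at t within I))
     + FL S L (X t) (bmap S (q t) (proj_push S (X t)) b) = 0)"
proof -
  have e: "(HL S L (X t) b - vector_derivative (\<lambda>s. FL S L (X s) b) (at t within I))
     + FL S L (X t) (bmap S (q t) (proj_push S (X t)) b) = euler t (snd b g0)" if t: "t \<in> I" and b: "b \<in> lie_alg S" for t b
    using lv_Bm[OF t b] lv(3)[OF b] by (simp add: euler_def Fdot_def HLm_def FLm_def)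
  have "unconstrained_extremal S t0 t1 (\<lambda>_. L) X \<longleftrightarrow> (\<forall>t\<in>I. \<forall>b. euler t b = 0)"
  proof
    assume U: "unconstrained_extremal S t0 t1 (\<lambda>_. L) X"
    show "\<forall>t\<in>I. \<forall>b. euler t b = 0"
    proof (intro ballI allI)
      fix t b assume t: "t \<in> I"
      show "euler t b = 0"
      proof (rule calculus_of_variations[OF t01 open_UNIV UNIV_I t])
        show "continuous_on (I \<inter> UNIV) (\<lambda>t. euler t b)" using smooth_continuous[OF smooth_euler] by simp
        fix a a' :: real assume a: "t0 < a" "a < a'" "a' < t1"
        \<comment> \<open>A bump times a fixed vector yields a vertical generator with vanishing
          end-points; by linearity it isolates \<open>euler s b\<close>.\<close>
        let ?\<beta> = "\<lambda>s. bump a a' s *\<^sub>R b"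
        have \<beta>: "smooth_on I ?\<beta>" "?\<beta> t0 = 0" "?\<beta> t1 = 0"
          using a by (auto simp: bump_zero intro: smooth_scaleR smooth_bump smooth_const)
        note g = generator_vsec[OF \<beta>]
        have s\<beta>: "beta (vsec ?\<beta>) s = ?\<beta> s" if "s \<in> I" for s by (rule beta_vsec[OF that])
        have "integral I (vpart (beta (vsec ?\<beta>))) = 0"
          using U g nonholonomic_action[OF N g] unfolding unconstrained_extremal_def by simp
        \<comment> \<open>\<open>beta (vsec ?\<beta>)\<close> is known to agree with
          \<open>?\<beta>\<close> on \<open>I\<close> only, so integration by parts is applied to
          the former.\<close>
        moreover have "integral I (vpart (beta (vsec ?\<beta>))) = integral I (\<lambda>t. euler t (beta (vsec ?\<beta>) t))"
          by (rule integration_by_parts) (use smooth_beta g s\<beta> \<beta> ends in \<open>auto simp: generator_iff\<close>)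
        moreover have "integral I (\<lambda>t. euler t (beta (vsec ?\<beta>) t)) = integral I (\<lambda>t. bump a a' t * euler t b)"
          by (rule Henstock_Kurzweil_Integration.integral_cong) (simp add: s\<beta> linear_cmul[OF linear_euler])
        ultimately show "integral I (\<lambda>s. bump a a' s * euler s b) = 0" by simp
      qed
    qed
  next
    assume E: "\<forall>t\<in>I. \<forall>b. euler t b = 0"
    have "action_variation S t0 t1 (\<lambda>_. L) \<xi> = 0" if g: "generator S t0 t1 X \<xi>" for \<xi>
    proof -
      have s: "sec \<xi>" using g by (simp add: generator_iff)
      have "integral I (\<lambda>t. euler t (beta \<xi> t)) = integral I (\<lambda>t. 0)"
        by (rule Henstock_Kurzweil_Integration.integral_cong) (use E in simp)
      then show ?thesis
        using nonholonomic_action[OF N g] integration_by_parts[OF smooth_beta[OF s]] generator_beta[OF g] by simp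
    qed
    then show "unconstrained_extremal S t0 t1 (\<lambda>_. L) X"
      using hp unfolding unconstrained_extremal_def by blast
  qed
  also have "\<dots> \<longleftrightarrow> (\<forall>t\<in>I. \<forall>b\<in>lie_alg S. euler t (snd b g0) = 0)" using lv(1,2) by metis
  finally show ?thesis using e by simp
qed

section \<open>Constrained variations: statement (b)\<close>

lemma constrained_integral:
  assumes \<beta>: "smooth_on I \<beta>" and Y: "sec Y" "\<And>t. t \<in> I \<Longrightarrow> Y t \<in> hor S (q t)"
    and c: "\<And>t. t \<in> I \<Longrightarrow> bdot \<beta> t + Bm t (\<beta> t) + Rm t (Y t) = 0"
  shows "integral I (vpart \<beta>) = integral I (\<lambda>t. HLm t (\<beta> t)) - integral I (\<lambda>t. FLm t (Rm t (Y t)))"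
proof -
  have "vpart \<beta> t = HLm t (\<beta> t) - FLm t (Rm t (Y t))" if "t \<in> I" for t
  proof -
    have "bdot \<beta> t + Bm t (\<beta> t) = - Rm t (Y t)" using c[OF that] by (simp add: eq_neg_iff_add_eq_0)
    then show ?thesis by (simp add: vpart_def linear_neg[OF linear_FLm[OF that]])
  qed
  then have "integral I (vpart \<beta>) = integral I (\<lambda>t. HLm t (\<beta> t) - FLm t (Rm t (Y t)))"
    by (intro Henstock_Kurzweil_Integration.integral_cong)
  also have "\<dots> = integral I (\<lambda>t. HLm t (\<beta> t)) - integral I (\<lambda>t. FLm t (Rm t (Y t)))"
    by (rule Henstock_Kurzweil_Integration.integral_diff[OF integrable[OF smooth_HLm_apply[OF \<beta>]]
        integrable[OF smooth_FLm_apply[OF smooth_Rm[OF Y]]]])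
  finally show ?thesis .
qed

text \<open>Generators of vakonomic variations correspond to the pairs \<open>(Y, b)\<close>: a pair
  gives \<open>Y\<close> plus the fundamental vectors of \<open>b\<close>, a generator gives its two
  parts. The relation imposed on the pair is the tangency condition for the variation.\<close>

lemma vakonomic_iff:
  assumes N: "nonholonomic_extremal S t0 t1 (\<lambda>_. L) X"
  shows "vakonomic_extremal S t0 t1 (\<lambda>_. L) X \<longleftrightarrow>
    (\<forall>Y b. smooth_curve I (tan_atlas Q) Y \<and> (\<forall>t\<in>I. Y t \<in> hor S (q t)) \<and>
       Y t0 = tzero (q t0) \<and> Y t1 = tzero (q t1) \<and>
       smooth_curve I (tan_atlas G) b \<and> (\<forall>t\<in>I. b t \<in> lie_alg S) \<and> b t0 = tzero e \<and> b t1 = tzero e \<and>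
       (\<forall>t\<in>I. tadd (tadd (fibre_derivative I b t) (bmap S (q t) (proj_push S (X t)) (b t)))
          (curvature S (q t) (proj_push S (X t)) (proj_push S (Y t))) = tzero e)
     \<longrightarrow> integral I (\<lambda>t. HL S L (X t) (b t))
       = integral I (\<lambda>t. FL S L (X t) (curvature S (q t) (proj_push S (X t)) (proj_push S (Y t)))))"
    (is "?l \<longleftrightarrow> (\<forall>Y b. ?P Y b \<longrightarrow> ?H b = ?F Y)")
proof -
  have FY: "?F Y = integral I (\<lambda>t. FLm t (Rm t (Y t)))" if "\<And>t. t \<in> I \<Longrightarrow> Y t \<in> hor S (q t)" for Y
    by (rule Henstock_Kurzweil_Integration.integral_cong) (simp add: FLm_def lv_Rm that)
  have Hb: "?H b = integral I (\<lambda>t. HLm t (\<beta> t))" if "\<And>t. t \<in> I \<Longrightarrow> b t = lv (\<beta> t)" for b \<beta>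
    by (rule Henstock_Kurzweil_Integration.integral_cong) (simp add: HLm_def that)
  show ?thesis
  proof
    assume V: ?l
    show "\<forall>Y b. ?P Y b \<longrightarrow> ?H b = ?F Y"
    proof (intro allI impI)
      fix Y b assume P: "?P Y b"
      define \<beta> where "\<beta> s = snd (b s) g0" for s
      have Yh: "\<And>t. t \<in> I \<Longrightarrow> Y t \<in> hor S (q t)" and bl: "\<And>t. t \<in> I \<Longrightarrow> b t \<in> lie_alg S" using P by blast+
      have Y: "sec Y" using P hor_tan[OF qp] unfolding sec_def by blast
      have \<beta>: "smooth_on I \<beta>" unfolding \<beta>_def by (rule lie_curve_coord) (use P in blast)+
      have b: "b t = lv (\<beta> t)" if "t \<in> I" for t using lv(3)[OF bl[OF that]] by (simp add: \<beta>_def)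
      have \<beta>0: "\<beta> t0 = 0" "\<beta> t1 = 0" using P by (simp_all add: \<beta>_def)
      let ?\<xi> = "\<lambda>s. tadd (Y s) (vsec \<beta> s)"
      have a: "sec ?\<xi>" by (rule sec_add_vsec(1)[OF Y _ \<beta>]) (rule Yh)
      have a': "beta ?\<xi> t = \<beta> t" "hpart ?\<xi> t = Y t" "bdot (beta ?\<xi>) t = bdot \<beta> t" if "t \<in> I" for t
        by (rule sec_add_vsec(2-4)[OF Y _ \<beta> that]; rule Yh; assumption)+
      have c: "bdot \<beta> t + Bm t (\<beta> t) + Rm t (Y t) = 0" if "t \<in> I" for t
        using constraint_iff[OF \<beta> b that Yh[OF that]] P that by blast
      have g: "generator S t0 t1 X ?\<xi>"
        unfolding generator_iff using a P vsec_zero[where \<beta>=\<beta>, OF ends(1) \<beta>0(1)] vsec_zero[where \<beta>=\<beta>, OF ends(2) \<beta>0(2)]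
        by (simp add: tadd_zero)
      have "variation S t0 t1 ?\<xi> t \<in> sub_tan_space (tan_atlas Q) (horizontal_bundle S) (X t)" if t: "t \<in> I" for t
        unfolding variation_tangent_iff[OF a t] using c[OF t] a'[OF t] by simp
      then have "action_variation S t0 t1 (\<lambda>_. L) ?\<xi> = 0" using V g unfolding vakonomic_extremal_def by blast
      then have "integral I (vpart (beta ?\<xi>)) = 0" using nonholonomic_action[OF N g] by simp
      moreover have "integral I (vpart (beta ?\<xi>)) = integral I (vpart \<beta>)"
        by (rule Henstock_Kurzweil_Integration.integral_cong) (simp add: vpart_def a')
      ultimately show "?H b = ?F Y"
        using constrained_integral[OF \<beta> Y Yh c] FY[OF Yh] Hb[OF b] by simp
    qed
  next
    assume A: "\<forall>Y b. ?P Y b \<longrightarrow> ?H b = ?F Y"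
    have "action_variation S t0 t1 (\<lambda>_. L) \<xi> = 0"
      if g: "generator S t0 t1 X \<xi>"
        and tan: "\<forall>t\<in>I. variation S t0 t1 \<xi> t \<in> sub_tan_space (tan_atlas Q) (horizontal_bundle S) (X t)" for \<xi>
    proof -
      have s: "sec \<xi>" using g by (simp add: generator_iff)
      define \<beta> Y b where "\<beta> = beta \<xi>" and "Y = hpart \<xi>" and "b t = lv (beta \<xi> t)" for t
      have \<beta>: "smooth_on I \<beta>" unfolding \<beta>_def by (rule smooth_beta[OF s])
      have Y: "sec Y" "\<And>t. t \<in> I \<Longrightarrow> Y t \<in> hor S (q t)" unfolding Y_def using hpart[OF s] by auto
      have b: "b t = lv (\<beta> t)" for t by (simp add: b_def \<beta>_def)
      have c: "bdot \<beta> t + Bm t (\<beta> t) + Rm t (Y t) = 0" if "t \<in> I" for t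
        using tan variation_tangent_iff[OF s that] that unfolding \<beta>_def Y_def by blast
      have gY: "Y t0 = tzero (q t0)" "Y t1 = tzero (q t1)"
        using generator_hpart[OF g] by (auto simp: Y_def generator_iff)
      have "?P Y b"
      proof (intro conjI ballI)
        show "smooth_curve I (tan_atlas Q) Y" using Y(1) by (simp add: sec_def)
        show "smooth_curve I (tan_atlas G) b" using lie_curve[OF \<beta>] by (simp add: b[abs_def])
        show "b t0 = tzero e" "b t1 = tzero e" using generator_beta[OF g] by (simp_all add: b \<beta>_def lv_linear)
        show "tadd (tadd (fibre_derivative I b t) (bmap S (q t) (proj_push S (X t)) (b t)))
          (curvature S (q t) (proj_push S (X t)) (proj_push S (Y t))) = tzero e" if "t \<in> I" for t
          using constraint_iff[OF \<beta> b that Y(2)[OF that]] c[OF that] by blast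
      qed (use Y gY lv(1) in \<open>simp_all add: b\<close>)
      then have "?H b = ?F Y" using A by blast
      then have "integral I (vpart \<beta>) = 0" using constrained_integral[OF \<beta> Y c] FY[OF Y(2)] Hb[OF b] by simp
      then show ?thesis using nonholonomic_action[OF N g] by (simp add: \<beta>_def)
    qed
    then show ?l using hp unfolding vakonomic_extremal_def by blast
  qed
qed

section \<open>Horizontal test sections and multipliers: statement (c)\<close>

definition hbump where
  "hbump c d V a b y s =
    (if s \<in> V then tvec Q c (q s) (bump a b s *\<^sub>R hcoord c d (snd c (q s)) y) else tzero (q s))"

text \<open>In (a) the test functions take values in one fixed Lie algebra; here they must lie in
  the moving spaces \<open>hor S (q t)\<close>. The test section is the lift of a constant
  coordinate vector \<open>y\<close> of the base, cut off inside one pair of charts and continued by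
  zero.\<close>

lemma localized_horizontal_section:
  fixes y
  assumes c: "c \<in> Q" and d: "d \<in> M" and V: "\<forall>s\<in>I \<inter> V. q s \<in> fst c \<and> \<pi> (q s) \<in> fst d"
    and sV: "open V" "smooth_on (I \<inter> V) (\<lambda>s. snd c (q s))" and ab: "t0 < a" "b < t1" "{a..b} \<subseteq> V"
  defines "Y \<equiv> hbump c d V a b y"
  shows "generator S t0 t1 X Y" "t \<in> I \<Longrightarrow> Y t \<in> hor S (q t)"
    "t \<in> I \<inter> V \<Longrightarrow> snd (Y t) c = bump a b t *\<^sub>R hcoord c d (snd c (q t)) y"
proof -
  have cs: "c \<in> charts_at Q (q s)" "snd c (q s) \<in> proj_dom c d" if "s \<in> I \<inter> V" for s
    using bspec[OF V that] c d by (auto simp: charts_at_iff proj_dom_def)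
  show co: "snd (Y t) c = bump a b t *\<^sub>R hcoord c d (snd c (q t)) y" if "t \<in> I \<inter> V" for t
    using that tvec_coord[OF manQ cs(1)[OF that]] by (simp add: Y_def hbump_def)
  have YT: "Y t \<in> tan_space Q (q t)" if t: "t \<in> I" for t
  proof (cases "t \<in> V")
    case True
    then show ?thesis using tvec_in[OF manQ cs(1)] t by (simp add: Y_def hbump_def)
  next
    case False
    then show ?thesis using tzero_in[OF manQ] by (simp add: Y_def hbump_def)
  qed
  show "Y t \<in> hor S (q t)" if t: "t \<in> I" for t
  proof (cases "t \<in> V")
    case True
    then have tV: "t \<in> I \<inter> V" using t by blast
    have "wcoord c (snd c (q t)) (snd (Y t) c) = 0"
      unfolding co[OF tV] using linear_cmul[OF wcoord(2)[OF c]] pcoord_hcoord(2)[OF c d cs(2)[OF tV]]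
        proj_dom_img[OF c d cs(2)[OF tV]] by simp
    then show ?thesis using hor_iff_wcoord[OF YT[OF t] cs(1)[OF tV]] by blast
  next
    case False
    then show ?thesis using tzero_hor[OF t] by (simp add: Y_def hbump_def)
  qed
  have zero: "Y t = tzero (q t)" if "t \<in> I" "t \<notin> {a<..<b}" for t
    using that bump_zero[of t a b] tvec_zero[OF manQ cs(1)] by (auto simp: Y_def hbump_def not_less)
  have "sec Y"
  proof (rule sec_chartI[OF YT])
    fix t assume t: "t \<in> I"
    show "\<exists>c V. c \<in> charts_at Q (q t) \<and> open V \<and> t \<in> V \<and> smooth_on (I \<inter> V) (\<lambda>s. snd (Y s) c)"
    proof (cases "t \<in> V")
      case True
      have "smooth_on (I \<inter> V) (\<lambda>s. hcoord c d (snd c (q s)) y)"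
        by (rule smooth_compose[OF fin_dims(1) hcoord(1)[OF c d] sV(2)]) (use cs(2) in blast)
      then have "smooth_on (I \<inter> V) (\<lambda>s. bump a b s *\<^sub>R hcoord c d (snd c (q s)) y)"
        by (rule smooth_scaleR[OF smooth_bump])
      then have "smooth_on (I \<inter> V) (\<lambda>s. snd (Y s) c)" by (rule smooth_cong[THEN iffD1, rotated]) (simp only: co)
      then show ?thesis using cs(1) t True sV(1) by blast
    next
      case False
      obtain k where k: "k \<in> charts_at Q (q t)" using chart_at_q[OF t] by blast
      have "smooth_on (I \<inter> - {a..b}) (\<lambda>s. 0 :: 'e)" by (rule smooth_const)
      then have "smooth_on (I \<inter> - {a..b}) (\<lambda>s. snd (Y s) k)"
        by (rule smooth_cong[THEN iffD1, rotated]) (use zero in auto)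
      moreover have "open (- {a..b})" "t \<in> - {a..b}" using False ab(3) by auto
      ultimately show ?thesis using k by blast
    qed
  qed
  then show "generator S t0 t1 X Y"
    unfolding generator_iff using zero[OF ends(1)] zero[OF ends(2)] ab by auto
qed

lemma multiplier_iff:
  assumes \<mu>: "smooth_dual_curve S I \<mu>"
    and U: "unconstrained_extremal S t0 t1 (\<lambda>t Z. L Z - \<mu> t (omega S Z)) X"
  shows "nonholonomic_extremal S t0 t1 (\<lambda>_. L) X \<longleftrightarrow>
    (\<forall>t\<in>I. \<forall>Y\<in>tan_space M (\<pi> (q t)). \<mu> t (curvature S (q t) (proj_push S (X t)) Y) = 0)"
proof -
  define m where "m t b = \<mu> t (lv b)" for t b
  have lm: "linear (m t)" if "t \<in> I" for t
    by (rule linearI) (use \<mu> that lv(1) in \<open>auto simp: m_def lv_linear smooth_dual_curve_def\<close>)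
  have sm: "smooth_on I (\<lambda>t. m t b)" for b using \<mu> lv(1) by (simp add: m_def smooth_dual_curve_def)
  \<comment> \<open>\<open>beta\<close> vanishes for a horizontal section, so that only the
    curvature survives in the differential of the multiplier term.\<close>
  have av: "integral I (av L Y) = integral I (\<lambda>t. m t (Rm t (Y t)))"
    if g: "generator S t0 t1 X Y" and h: "\<And>t. t \<in> I \<Longrightarrow> Y t \<in> hor S (q t)" for Y
  proof -
    have s: "sec Y" using g by (simp add: generator_iff)
    have b0: "beta Y t = 0" if "t \<in> I" for t by (rule beta_hor[OF s that h[OF that]])
    have d: "differential (tan_atlas Q) (\<lambda>Z. L Z - \<mu> t (omega S Z)) (variation S t0 t1 Y t)
        = av L Y t - m t (Rm t (Y t))" if t: "t \<in> I" for t
    proof -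
      obtain c where c: "c \<in> charts_at Q (q t)" using chart_at_q[OF t] by blast
      have p: "X t \<in> pts (tan_atlas Q)" using XT[OF t] qp[OF t] by (simp add: pts_tan)
      \<comment> \<open>\<open>\<mu> t\<close> is compared with its coordinate form
        \<open>m t\<close> on the tangent bundle, where \<open>omega\<close> takes its values in the
        Lie algebra.\<close>
      have "differential (tan_atlas Q) (\<lambda>Z. L Z - \<mu> t (omega S Z)) (variation S t0 t1 Y t)
        = differential (tan_atlas Q) (\<lambda>Z. L Z - m t (snd (omega S Z) g0)) (variation S t0 t1 Y t)"
      proof (rule differential_cong[OF man_tan[OF manQ] variation_coord(1)[OF s t c] p])
        fix Z assume "Z \<in> pts (tan_atlas Q)"
        then have "omega S Z \<in> lie_alg S" using omega(1)[of "fst Z" Z] by (simp add: pts_tan)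
        then show "L Z - \<mu> t (omega S Z) = L Z - m t (snd (omega S Z) g0)" by (simp add: m_def lv)
      qed
      also have "\<dots> = av L Y t - m t (bdot (beta Y) t + Bm t (beta Y t) + Rm t (hpart Y t))"
        by (rule differential_omega[OF s t lm[OF t] L])
      also have "bdot (beta Y) t = 0" using bdot_cong[OF smooth_const[of I 0] t, of "beta Y"] b0 bdot_const[OF t] by simp
      finally show ?thesis
        using b0[OF t] linear_0[OF linear_Bm[OF t]] hpart_zero[OF s t b0[OF t]] by simp
    qed
    have "0 = action_variation S t0 t1 (\<lambda>t Z. L Z - \<mu> t (omega S Z)) Y"
      using U g unfolding unconstrained_extremal_def by simp
    also have "\<dots> = integral I (\<lambda>t. av L Y t - m t (Rm t (Y t)))"
      unfolding action_variation_def by (rule Henstock_Kurzweil_Integration.integral_cong) (rule d)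
    also have "\<dots> = integral I (av L Y) - integral I (\<lambda>t. m t (Rm t (Y t)))"
      by (rule Henstock_Kurzweil_Integration.integral_diff[OF integrable[OF smooth_av[OF s]]
          integrable[OF smooth_apply[OF fin_dims(3) sm lm smooth_Rm[OF s h]]]])
    finally show ?thesis by simp
  qed
  show ?thesis
  proof
    assume N: "nonholonomic_extremal S t0 t1 (\<lambda>_. L) X"
    show "\<forall>t\<in>I. \<forall>Y\<in>tan_space M (\<pi> (q t)). \<mu> t (curvature S (q t) (proj_push S (X t)) Y) = 0"
    proof (intro ballI)
      fix t Y assume t: "t \<in> I" and Y: "Y \<in> tan_space M (\<pi> (q t))"
      obtain c where c: "c \<in> charts_at Q (q t)" using chart_at_q[OF t] by blast
      obtain d where d: "d \<in> charts_at M (\<pi> (q t))" using proj_in[OF qp[OF t]] pts_iff by metis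
      have cQ: "c \<in> Q" "d \<in> M" using c d by (auto simp: charts_at_iff)
      obtain V' where V': "open V'" "t \<in> V'" "\<And>s. s \<in> I \<inter> V' \<Longrightarrow> c \<in> charts_at Q (q s)"
        "smooth_on (I \<inter> V') (\<lambda>s. snd c (q s))" "smooth_on (I \<inter> V') (\<lambda>s. snd (X s) c)"
        using path_local[OF t c] by metis
      \<comment> \<open>\<open>V'\<close> is shrunk so that the path also stays over the chart
        \<open>d\<close> of the base.\<close>
      have "openin (top_of_set (I \<inter> V')) ((I \<inter> V') \<inter> (\<lambda>s. snd c (q s)) -` proj_dom c d)"
        by (rule continuous_openin_preimage_gen[OF smooth_continuous[OF V'(4)] pcoord(1)[OF cQ]])
      then obtain W where W: "open W" "(I \<inter> V') \<inter> (\<lambda>s. snd c (q s)) -` proj_dom c d = (I \<inter> V') \<inter> W"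
        unfolding openin_open by blast
      define V where "V = V' \<inter> W"
      have V: "open V" "t \<in> V" "smooth_on (I \<inter> V) (\<lambda>s. snd c (q s))" "smooth_on (I \<inter> V) (\<lambda>s. snd (X s) c)"
      proof -
        show "open V" using V'(1) W(1) by (simp add: V_def open_Int)
        have "t \<in> (I \<inter> V') \<inter> (\<lambda>s. snd c (q s)) -` proj_dom c d" using V'(2) t proj_dom_mem[OF c d] by simp
        then show "t \<in> V" unfolding W(2) by (simp add: V_def)
        show "smooth_on (I \<inter> V) (\<lambda>s. snd c (q s))" by (rule smooth_subset[OF V'(4)]) (auto simp: V_def)
        show "smooth_on (I \<inter> V) (\<lambda>s. snd (X s) c)" by (rule smooth_subset[OF V'(5)]) (auto simp: V_def)
      qed
      have cs: "c \<in> charts_at Q (q s)" "snd c (q s) \<in> proj_dom c d" if "s \<in> I \<inter> V" for s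
      proof -
        show "c \<in> charts_at Q (q s)" using V'(3)[of s] that by (simp add: V_def)
        have "s \<in> (I \<inter> V') \<inter> W" using that by (simp add: V_def)
        then show "snd c (q s) \<in> proj_dom c d" unfolding W(2)[symmetric] by simp
      qed
      have dom: "\<forall>s\<in>I \<inter> V. q s \<in> fst c \<and> \<pi> (q s) \<in> fst d"
      proof
        fix s assume that: "s \<in> I \<inter> V"
        have "q s \<in> fst c" using cs(1)[OF that] by (simp add: charts_at_iff)
        moreover have "d \<in> charts_at M (\<pi> (chart_inv c (snd c (q s))))"
          by (rule proj_dom_charts(2)[OF cQ cs(2)[OF that]])
        ultimately show "q s \<in> fst c \<and> \<pi> (q s) \<in> fst d" using chart_inv_left[OF manQ cQ(1)] by (simp add: charts_at_iff)
      qed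
      let ?H = "hlift S Y (q t)"
      \<comment> \<open>\<open>g\<close> continues the curvature term from \<open>t\<close> to
        nearby times by keeping the coordinate \<open>y\<close> of the base vector constant. It is
        meaningful on \<open>V\<close> only, which is why the fundamental lemma is used in its local
        form.\<close>
      define y g where "y = snd Y d" and
        "g s = m s (wform c (snd c (q s)) (snd (X s) c) (hcoord c d (snd c (q s)) y))" for s
      note H = hlift[OF qp[OF t] Y]
      have lw: "linear (wform c (snd c (q s)) (snd (X s) c))" if "s \<in> I \<inter> V" for s
        by (rule linear_wform[OF cQ(1) proj_dom_img[OF cQ cs(2)[OF that]]])
      have "smooth_on (I \<inter> V) (\<lambda>s. hcoord c d (snd c (q s)) y)"
        by (rule smooth_compose[OF fin_dims(1) hcoord(1)[OF cQ] V(3)]) (use cs(2) in blast)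
      from smooth_wform[OF cQ(1) V(3) proj_dom_img[OF cQ cs(2)] V(4) this]
      have "smooth_on (I \<inter> V) (\<lambda>s. wform c (snd c (q s)) (snd (X s) c) (hcoord c d (snd c (q s)) y))" .
      then have "smooth_on (I \<inter> V) g"
        unfolding g_def by (intro smooth_apply[OF fin_dims(3) smooth_subset[OF sm] lm]) auto
      then have cg: "continuous_on (I \<inter> V) g" by (rule smooth_continuous)
      have "g t = 0"
      proof (rule calculus_of_variations[OF t01 V(1,2) t cg])
        fix a b assume ab: "t0 < a" "a < b" "b < t1" "{a..b} \<subseteq> V"
        define Z where "Z = hbump c d V a b y"
        note Zs = localized_horizontal_section[OF cQ dom V(1,3) ab(1,3,4), where y=y, folded Z_def]
        have zh: "\<forall>s\<in>I. Z s \<in> hor S (q s)" by (intro ballI Zs(2))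
        have "action_variation S t0 t1 (\<lambda>_. L) Z = 0"
          by (rule N[unfolded nonholonomic_extremal_def, THEN conjunct2, rule_format]) (use Zs(1) zh in simp)
        moreover have "integral I (av L Z) = integral I (\<lambda>s. m s (Rm s (Z s)))"
          by (rule av[OF Zs(1)]) (rule bspec[OF zh])
        ultimately have "integral I (\<lambda>s. m s (Rm s (Z s))) = 0" unfolding action_eq by simp
        moreover have "m s (Rm s (Z s)) = bump a b s * g s" if s: "s \<in> I" for s
        proof (cases "s \<in> V")
          case True
          then have sV: "s \<in> I \<inter> V" using s by blast
          show ?thesis
            unfolding Rm_coord[OF s cs(1)[OF sV] Zs(2)[OF s]] Zs(3)[OF sV] g_def
            by (simp add: linear_cmul[OF lw[OF sV]] linear_cmul[OF lm[OF s]])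
        next
          case False
          then have "Z s = tzero (q s)" by (simp add: Z_def hbump_def)
          obtain k where k: "k \<in> charts_at Q (q s)" using chart_at_q[OF s] by blast
          have "linear (wform k (snd k (q s)) (snd (X s) k))"
            by (rule linear_wform) (use k in \<open>auto simp: charts_at_iff\<close>)
          \<comment> \<open>Outside \<open>V\<close> the test section and the bump are both zero, so
            the value of \<open>g\<close> there does not enter.\<close>
          then have "Rm s (Z s) = 0"
            using Rm_coord[OF s k Zs(2)[OF s]] \<open>Z s = tzero (q s)\<close> linear_0 by simp
          moreover have "bump a b s = 0" using False ab(4) by (intro bump_zero) (metis atLeastAtMost_iff linear subsetD)
          ultimately show ?thesis using linear_0[OF lm[OF s]] by simp
        qed
        then have "integral I (\<lambda>s. m s (Rm s (Z s))) = integral I (\<lambda>s. bump a b s * g s)"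
          by (rule Henstock_Kurzweil_Integration.integral_cong)
        ultimately show "integral I (\<lambda>s. bump a b s * g s) = 0" by simp
      qed
      moreover have "\<mu> t (curvature S (q t) (proj_push S (X t)) Y) = m t (Rm t ?H)"
        using lv_Rm[OF t H(1)] H(2) by (simp add: m_def)
      moreover have "m t (Rm t ?H) = g t"
        unfolding g_def y_def using Rm_coord[OF t c H(1)] hlift_coord[OF Y c d] by simp
      ultimately show "\<mu> t (curvature S (q t) (proj_push S (X t)) Y) = 0" by simp
    qed
  next
    assume 0: "\<forall>t\<in>I. \<forall>Y\<in>tan_space M (\<pi> (q t)). \<mu> t (curvature S (q t) (proj_push S (X t)) Y) = 0"
    have "action_variation S t0 t1 (\<lambda>_. L) Y = 0"
      if g: "generator S t0 t1 X Y" and h: "\<forall>t\<in>I. Y t \<in> hor S (q t)" for Y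
    proof -
      have "m t (Rm t (Y t)) = 0" if t: "t \<in> I" for t
        using bspec[OF bspec[OF 0 t] proj_push_in[OF hor_tan[OF qp[OF t]] qp[OF t]], of "Y t"] bspec[OF h t] lv_Rm[OF t, of "Y t"]
        by (simp add: m_def)
      then have "integral I (\<lambda>t. m t (Rm t (Y t))) = integral I (\<lambda>t. 0)"
        by (rule Henstock_Kurzweil_Integration.integral_cong)
      then show ?thesis using av[OF g] h by (simp add: action_eq)
    qed
    then show "nonholonomic_extremal S t0 t1 (\<lambda>_. L) X"
      using hp unfolding nonholonomic_extremal_def by blast
  qed
qed

end

theorem theorem4p8:
  fixes S :: "('q, 'e::real_inner, 'm, 'f::real_inner, 'g, 'h::real_inner) chaplygin"
    and L :: "('q, 'e) tvec \<Rightarrow> real"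
    and t0 t1 :: real
  assumes "t0 < t1"
    and "principal_bundle S"
    and "horizontal_distribution S"
    and "smooth_lagrangian S L"
  shows
    "(\<forall>X. nonholonomic_extremal S t0 t1 (\<lambda>_. L) X \<longrightarrow>
        (unconstrained_extremal S t0 t1 (\<lambda>_. L) X \<longleftrightarrow>
          (\<forall>t\<in>{t0..t1}. \<forall>b\<in>lie_alg S.
             (HL S L (X t) b - vector_derivative (\<lambda>s. FL S L (X s) b) (at t within {t0..t1}))
             + FL S L (X t) (bmap S (fst (X t)) (proj_push S (X t)) b) = 0)))
     \<and>
     (\<forall>X. nonholonomic_extremal S t0 t1 (\<lambda>_. L) X \<longrightarrow>
        (vakonomic_extremal S t0 t1 (\<lambda>_. L) X \<longleftrightarrow>
          (\<forall>Y b. smooth_curve {t0..t1} (tan_atlas (Qat S)) Y \<and>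
             (\<forall>t\<in>{t0..t1}. Y t \<in> hor S (fst (X t))) \<and>
             Y t0 = tzero (fst (X t0)) \<and> Y t1 = tzero (fst (X t1)) \<and>
             smooth_curve {t0..t1} (tan_atlas (Gat S)) b \<and>
             (\<forall>t\<in>{t0..t1}. b t \<in> lie_alg S) \<and>
             b t0 = tzero \<one>\<^bsub>grp S\<^esub> \<and> b t1 = tzero \<one>\<^bsub>grp S\<^esub> \<and>
             (\<forall>t\<in>{t0..t1}.
                tadd (tadd (fibre_derivative {t0..t1} b t)
                           (bmap S (fst (X t)) (proj_push S (X t)) (b t)))
                     (curvature S (fst (X t)) (proj_push S (X t)) (proj_push S (Y t)))
                = tzero \<one>\<^bsub>grp S\<^esub>)
             \<longrightarrow>
             integral {t0..t1} (\<lambda>t. HL S L (X t) (b t))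
             = integral {t0..t1} (\<lambda>t. FL S L (X t)
                 (curvature S (fst (X t)) (proj_push S (X t)) (proj_push S (Y t)))))))
     \<and>
     (\<forall>X \<mu>. vakonomic_extremal S t0 t1 (\<lambda>_. L) X \<and> smooth_dual_curve S {t0..t1} \<mu> \<and>
        unconstrained_extremal S t0 t1 (\<lambda>t Z. L Z - \<mu> t (omega S Z)) X \<longrightarrow>
        (nonholonomic_extremal S t0 t1 (\<lambda>_. L) X \<longleftrightarrow>
          (\<forall>t\<in>{t0..t1}. \<forall>Y\<in>tan_space (Mat S) (proj S (fst (X t))).
             \<mu> t (curvature S (fst (X t)) (proj_push S (X t)) Y) = 0)))"
proof -
  \<comment> \<open>Each kind of extremal is by definition a horizontal path, which is all that the
    locale asks of \<open>X\<close>.\<close>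
  have loc: "chaplygin_lagrangian S t0 t1 X L" if "horizontal_path S t0 t1 X" for X
    using assms that by unfold_locales
  show ?thesis
  proof (intro conjI allI impI)
    fix X assume N: "nonholonomic_extremal S t0 t1 (\<lambda>_. L) X"
    then have "horizontal_path S t0 t1 X" by (simp add: nonholonomic_extremal_def)
    then interpret chaplygin_lagrangian S t0 t1 X L by (rule loc)
    show "unconstrained_extremal S t0 t1 (\<lambda>_. L) X \<longleftrightarrow>
          (\<forall>t\<in>{t0..t1}. \<forall>b\<in>lie_alg S.
             (HL S L (X t) b - vector_derivative (\<lambda>s. FL S L (X s) b) (at t within {t0..t1}))
             + FL S L (X t) (bmap S (fst (X t)) (proj_push S (X t)) b) = 0)"
      by (rule unconstrained_iff[OF N])
  next
    fix X assume N: "nonholonomic_extremal S t0 t1 (\<lambda>_. L) X"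
    then have "horizontal_path S t0 t1 X" by (simp add: nonholonomic_extremal_def)
    then interpret chaplygin_lagrangian S t0 t1 X L by (rule loc)
    show "vakonomic_extremal S t0 t1 (\<lambda>_. L) X \<longleftrightarrow>
          (\<forall>Y b. smooth_curve {t0..t1} (tan_atlas (Qat S)) Y \<and>
             (\<forall>t\<in>{t0..t1}. Y t \<in> hor S (fst (X t))) \<and>
             Y t0 = tzero (fst (X t0)) \<and> Y t1 = tzero (fst (X t1)) \<and>
             smooth_curve {t0..t1} (tan_atlas (Gat S)) b \<and>
             (\<forall>t\<in>{t0..t1}. b t \<in> lie_alg S) \<and>
             b t0 = tzero \<one>\<^bsub>grp S\<^esub> \<and> b t1 = tzero \<one>\<^bsub>grp S\<^esub> \<and>
             (\<forall>t\<in>{t0..t1}.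
                tadd (tadd (fibre_derivative {t0..t1} b t)
                           (bmap S (fst (X t)) (proj_push S (X t)) (b t)))
                     (curvature S (fst (X t)) (proj_push S (X t)) (proj_push S (Y t)))
                = tzero \<one>\<^bsub>grp S\<^esub>)
             \<longrightarrow>
             integral {t0..t1} (\<lambda>t. HL S L (X t) (b t))
             = integral {t0..t1} (\<lambda>t. FL S L (X t)
                 (curvature S (fst (X t)) (proj_push S (X t)) (proj_push S (Y t)))))"
      by (rule vakonomic_iff[OF N])
  next
    fix X \<mu> assume A: "vakonomic_extremal S t0 t1 (\<lambda>_. L) X \<and> smooth_dual_curve S {t0..t1} \<mu> \<and>
        unconstrained_extremal S t0 t1 (\<lambda>t Z. L Z - \<mu> t (omega S Z)) X"
    then have "horizontal_path S t0 t1 X" by (simp add: vakonomic_extremal_def)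
    then interpret chaplygin_lagrangian S t0 t1 X L by (rule loc)
    show "nonholonomic_extremal S t0 t1 (\<lambda>_. L) X \<longleftrightarrow>
          (\<forall>t\<in>{t0..t1}. \<forall>Y\<in>tan_space (Mat S) (proj S (fst (X t))).
             \<mu> t (curvature S (fst (X t)) (proj_push S (X t)) Y) = 0)"
      by (rule multiplier_iff) (use A in blast)+
  qed
qed

end
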